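(* Let $F$ be a field of characteristic $2$, regarded as a trivial $\mathrm{Sp}_{2g}(\mathbb{Z})[2]$-module. If $g\ge3$ is odd, the composition factors of $H_1(\mathrm{Sp}_{2g}(\mathbb{Z})[2];F)$ as an $\mathrm{Sp}_{2g}(\mathbb{F}_2)$-module are $H_1(\Sigma_g;F)$, $F$, $\ker(\delta_2)$ with multiplicities $1,1,1$ respectively. If $g\ge3$ is even, the composition factors are $H_1(\Sigma_g;F)$, $F$, $\ker(\delta_2)/\langle\omega\rangle$ with multiplicities $1,2,1$ respectively.
   Context: $\mathrm{Sp}_{2g}(\mathbb{Z})[2]$ is the kernel of the reduction map $\mathrm{Sp}_{2g}(\mathbb{Z})\to\mathrm{Sp}_{2g}(\mathbb{F}_2)$; conjugation by $\mathrm{Sp}_{2g}(\mathbb{Z})$ induces an action of $\mathrm{Sp}_{2g}(\mathbb{F}_2)$ on $H_1(\mathrm{Sp}_{2g}(\mathbb{Z})[2];F)$. For $R=\mathbb{Z}$ or $\mathbb{F}_2$, $\mathrm{Sp}_{2g}(R)$ is identified with the isometry group of the intersection form on $H_1(\Sigma_g;R)$, $\Sigma_g$ the closed oriented genus $g$ surface; $\mathrm{Sp}_{2g}(\mathbb{F}_2)$ acts on $V=H_1(\Sigma_g;F)=H_1(\Sigma_g;\mathbb{F}_2)\otimes F$. $F$ as a composition factor is the trivial module. With $Q$ the intersection form on $V$, $\delta_2:\bigwedge^2V\to F$ is $v\wedge w\mapsto Q(v,w)$, and $\omega=\sum_{i=1}^gX_{2i-1}\wedge X_{2i}\in\bigwedge^2V$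 for a symplectic basis $\{X_i\}_{i=1}^{2g}$ with $Q(X_{2i-1},X_{2j})=\delta_{ij}$ and $Q(X_{2i},X_{2j})=Q(X_{2i-1},X_{2j-1})=0$. *)

theory Defs
  imports
    "HOL-Algebra.AbelCoset"
    "Jordan_Normal_Form.VS_Connect"
    "HOL-Library.Poly_Mapping"
    "HOL-Library.Z2"
begin

section \<open>Modules with a linear group action\<close>

text \<open>
  Scalars are a field type \<open>'f\<close>, seen as the ring record \<open>class_ring\<close>. A \<open>gmodule\<close> adds to a
  module record the action of a group with elements of type \<open>'g\<close>. The ring fields \<open>mult\<close> and
  \<open>one\<close> of a module record are irrelevant.
\<close>

record ('f, 'v, 'g) gmodule = "('f, 'v) module" +
  act :: "'g \<Rightarrow> 'v \<Rightarrow> 'v"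

definition with_act :: "('f, 'v) module \<Rightarrow> ('g \<Rightarrow> 'v \<Rightarrow> 'v) \<Rightarrow> ('f, 'v, 'g) gmodule" where
  "with_act M \<rho> = \<lparr>carrier = carrier M, mult = mult M, one = one M, zero = zero M,
     add = add M, smult = module.smult M, act = \<rho>\<rparr>"

definition is_gmodule :: "'g monoid \<Rightarrow> ('f::field, 'v, 'g) gmodule \<Rightarrow> bool" where
  "is_gmodule G M \<longleftrightarrow>
     Module.module class_ring M \<and>
     (\<forall>s\<in>carrier G. \<forall>x\<in>carrier M. act M s x \<in> carrier M) \<and>
     (\<forall>s\<in>carrier G. \<forall>x\<in>carrier M. \<forall>y\<in>carrier M.
        act M s (x \<oplus>\<^bsub>M\<^esub> y) = act M s x \<oplus>\<^bsub>M\<^esub> act M s y) \<and>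
     (\<forall>s\<in>carrier G. \<forall>r. \<forall>x\<in>carrier M. act M s (r \<odot>\<^bsub>M\<^esub> x) = r \<odot>\<^bsub>M\<^esub> act M s x) \<and>
     (\<forall>x\<in>carrier M. act M \<one>\<^bsub>G\<^esub> x = x) \<and>
     (\<forall>s\<in>carrier G. \<forall>t\<in>carrier G. \<forall>x\<in>carrier M.
        act M (s \<otimes>\<^bsub>G\<^esub> t) x = act M s (act M t x))"

definition gsubmodule :: "'g monoid \<Rightarrow> ('f::field, 'v, 'g) gmodule \<Rightarrow> 'v set \<Rightarrow> bool" where
  "gsubmodule G M W \<longleftrightarrow>
     Module.submodule W class_ring M \<and> (\<forall>s\<in>carrier G. \<forall>x\<in>W. act M s x \<in> W)"

text \<open>
  A map \<open>f\<close> into \<open>M\<close> induces a map on cosets by taking \<open>X\<close> to the union of the cosets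
  \<open>W + f x\<close> with \<open>x \<in> X\<close>. When the induced map is well defined, all these cosets coincide.
\<close>

definition coset_map ::
  "('f, 'v, 'm) module_scheme \<Rightarrow> 'v set \<Rightarrow> ('u \<Rightarrow> 'v) \<Rightarrow> 'u set \<Rightarrow> 'v set" where
  "coset_map M W f X = (\<Union>x\<in>X. W +>\<^bsub>M\<^esub> f x)"

definition quot_module :: "('f, 'v, 'm) module_scheme \<Rightarrow> 'v set \<Rightarrow> ('f, 'v set) module" where
  "quot_module M W = \<lparr>carrier = a_rcosets\<^bsub>M\<^esub> W, mult = undefined, one = undefined,
     zero = W, add = (<+>\<^bsub>M\<^esub>), smult = (\<lambda>r. coset_map M W (\<lambda>x. r \<odot>\<^bsub>M\<^esub> x))\<rparr>"

definition gquot :: "('f, 'v, 'g) gmodule \<Rightarrow> 'v set \<Rightarrow> ('f, 'v set, 'g) gmodule" where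
  "gquot M W = with_act (quot_module M W) (\<lambda>s. coset_map M W (act M s))"

definition giso ::
  "'g monoid \<Rightarrow> ('f, 'v, 'g) gmodule \<Rightarrow> ('f, 'w, 'g) gmodule \<Rightarrow> bool" where
  "giso G M N \<longleftrightarrow> (\<exists>\<phi>. bij_betw \<phi> (carrier M) (carrier N) \<and>
     (\<forall>x\<in>carrier M. \<forall>y\<in>carrier M. \<phi> (x \<oplus>\<^bsub>M\<^esub> y) = \<phi> x \<oplus>\<^bsub>N\<^esub> \<phi> y) \<and>
     (\<forall>r. \<forall>x\<in>carrier M. \<phi> (r \<odot>\<^bsub>M\<^esub> x) = r \<odot>\<^bsub>N\<^esub> \<phi> x) \<and>
     (\<forall>s\<in>carrier G. \<forall>x\<in>carrier M. \<phi> (act M s x) = act N s (\<phi> x)))"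

definition gsimple :: "'g monoid \<Rightarrow> ('f::field, 'v, 'g) gmodule \<Rightarrow> bool" where
  "gsimple G M \<longleftrightarrow> is_gmodule G M \<and> carrier M \<noteq> {\<zero>\<^bsub>M\<^esub>} \<and>
     (\<forall>W. gsubmodule G M W \<longrightarrow> W = {\<zero>\<^bsub>M\<^esub>} \<or> W = carrier M)"

definition series_factor ::
  "('f, 'v, 'g) gmodule \<Rightarrow> 'v set list \<Rightarrow> nat \<Rightarrow> ('f, 'v set, 'g) gmodule" where
  "series_factor M Ws i = gquot (M\<lparr>carrier := Ws ! Suc i\<rparr>) (Ws ! i)"

definition composition_series ::
  "'g monoid \<Rightarrow> ('f::field, 'v, 'g) gmodule \<Rightarrow> 'v set list \<Rightarrow> bool" where
  "composition_series G M Ws \<longleftrightarrow>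
     is_gmodule G M \<and> Ws \<noteq> [] \<and> hd Ws = {\<zero>\<^bsub>M\<^esub>} \<and> last Ws = carrier M \<and>
     (\<forall>W\<in>set Ws. gsubmodule G M W) \<and>
     (\<forall>i. Suc i < length Ws \<longrightarrow>
        Ws ! i \<subseteq> Ws ! Suc i \<and> gsimple G (series_factor M Ws i))"

definition composition_factor ::
  "'g monoid \<Rightarrow> ('f::field, 'v, 'g) gmodule \<Rightarrow> ('f, 'v set, 'g) gmodule \<Rightarrow> bool" where
  "composition_factor G M S \<longleftrightarrow>
     (\<exists>Ws i. composition_series G M Ws \<and> Suc i < length Ws \<and> S = series_factor M Ws i)"

text \<open>
  The multiplicity of \<open>S\<close> in \<open>M\<close> is \<open>m\<close>: there is a composition series, and each one has
  exactly \<open>m\<close> factors isomorphic to \<open>S\<close>.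
\<close>

definition has_multiplicity ::
  "'g monoid \<Rightarrow> ('f::field, 'v, 'g) gmodule \<Rightarrow> ('f, 'w, 'g) gmodule \<Rightarrow> nat \<Rightarrow> bool" where
  "has_multiplicity G M S m \<longleftrightarrow>
     (\<exists>Ws. composition_series G M Ws) \<and>
     (\<forall>Ws. composition_series G M Ws \<longrightarrow>
        card {i. Suc i < length Ws \<and> giso G (series_factor M Ws i) S} = m)"


section \<open>Free modules and the exterior square\<close>

definition scale_pm :: "'f::field \<Rightarrow> ('b \<Rightarrow>\<^sub>0 'f) \<Rightarrow> ('b \<Rightarrow>\<^sub>0 'f)" where
  "scale_pm r = Poly_Mapping.map (\<lambda>a. r * a)"

definition free_module :: "'b set \<Rightarrow> ('f::field, 'b \<Rightarrow>\<^sub>0 'f) module" where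
  "free_module B = \<lparr>carrier = {c. Poly_Mapping.keys c \<subseteq> B}, mult = undefined, one = undefined,
     zero = 0, add = (+), smult = scale_pm\<rparr>"

abbreviation gen :: "'b \<Rightarrow> ('b \<Rightarrow>\<^sub>0 'f::field)" where
  "gen b \<equiv> Poly_Mapping.single b 1"

definition lin_ext :: "('b \<Rightarrow> ('c \<Rightarrow>\<^sub>0 'f)) \<Rightarrow> ('b \<Rightarrow>\<^sub>0 'f::field) \<Rightarrow> ('c \<Rightarrow>\<^sub>0 'f)" where
  "lin_ext f c = (\<Sum>b\<in>Poly_Mapping.keys c. scale_pm (Poly_Mapping.lookup c b) (f b))"

text \<open>
  The exterior square is the free module on all pairs of elements of \<open>M\<close> modulo bilinearity and
  \<open>x \<and> x = 0\<close>; the latter is not implied by antisymmetry in characteristic 2.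
\<close>

definition ext_relators :: "('f::field, 'v, 'g) gmodule \<Rightarrow> ('v \<times> 'v \<Rightarrow>\<^sub>0 'f) set" where
  "ext_relators M =
     {gen (x \<oplus>\<^bsub>M\<^esub> y, z) - gen (x, z) - gen (y, z) | x y z.
        x \<in> carrier M \<and> y \<in> carrier M \<and> z \<in> carrier M} \<union>
     {gen (x, y \<oplus>\<^bsub>M\<^esub> z) - gen (x, y) - gen (x, z) | x y z.
        x \<in> carrier M \<and> y \<in> carrier M \<and> z \<in> carrier M} \<union>
     {gen (r \<odot>\<^bsub>M\<^esub> x, y) - scale_pm r (gen (x, y)) | r x y. x \<in> carrier M \<and> y \<in> carrier M} \<union>
     {gen (x, r \<odot>\<^bsub>M\<^esub> y) - scale_pm r (gen (x, y)) | r x y. x \<in> carrier M \<and> y \<in> carrier M} \<union>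
     {gen (x, x) | x. x \<in> carrier M}"

definition ext_null :: "('f::field, 'v, 'g) gmodule \<Rightarrow> ('v \<times> 'v \<Rightarrow>\<^sub>0 'f) set" where
  "ext_null M = LinearCombinations.module.span class_ring
     (free_module (carrier M \<times> carrier M)) (ext_relators M)"

definition ext_square ::
  "('f::field, 'v, 'g) gmodule \<Rightarrow> ('f, ('v \<times> 'v \<Rightarrow>\<^sub>0 'f) set, 'g) gmodule" where
  "ext_square M =
     (let P = free_module (carrier M \<times> carrier M) in
      with_act (quot_module P (ext_null M))
        (\<lambda>s. coset_map P (ext_null M) (lin_ext (\<lambda>(x, y). gen (act M s x, act M s y)))))"

definition wedge ::
  "('f::field, 'v, 'g) gmodule \<Rightarrow> 'v \<Rightarrow> 'v \<Rightarrow> ('v \<times> 'v \<Rightarrow>\<^sub>0 'f) set" where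
  "wedge M x y = ext_null M +>\<^bsub>free_module (carrier M \<times> carrier M)\<^esub> gen (x, y)"


section \<open>Group homology with trivial coefficients\<close>

text \<open>
  Homology of the bar complex with coefficients in the trivial module \<open>'f\<close>: the degree \<open>n\<close>
  chains are free on the lists \<open>[x\<^sub>1|\<dots>|x\<^sub>n]\<close> of group elements, and
  \<open>\<partial>[x\<^sub>1|\<dots>|x\<^sub>n]\<close> is the alternating sum of \<open>[x\<^sub>2|\<dots>|x\<^sub>n]\<close>, the
  \<open>[\<dots>|x\<^sub>i x\<^sub>i\<^sub>+\<^sub>1|\<dots>]\<close>, and \<open>[x\<^sub>1|\<dots>|x\<^sub>n\<^sub>-\<^sub>1]\<close>.
\<close>

definition bar_chains :: "'a monoid \<Rightarrow> nat \<Rightarrow> ('f::field, 'a list \<Rightarrow>\<^sub>0 'f) module" where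
  "bar_chains G n = free_module {xs. length xs = n \<and> set xs \<subseteq> carrier G}"

definition bar_face :: "'a monoid \<Rightarrow> nat \<Rightarrow> 'a list \<Rightarrow> 'a list" where
  "bar_face G i xs =
     (if i = 0 then tl xs
      else if i = length xs then butlast xs
      else take (i - 1) xs @ [xs ! (i - 1) \<otimes>\<^bsub>G\<^esub> xs ! i] @ drop (Suc i) xs)"

definition bar_boundary ::
  "'a monoid \<Rightarrow> nat \<Rightarrow> ('a list \<Rightarrow>\<^sub>0 'f::field) \<Rightarrow> ('a list \<Rightarrow>\<^sub>0 'f)" where
  "bar_boundary G n =
     (if n = 0 then (\<lambda>_. 0)
      else lin_ext (\<lambda>xs. \<Sum>i\<le>n. Poly_Mapping.single (bar_face G i xs) ((-1) ^ i)))"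

definition bar_cycles :: "'a monoid \<Rightarrow> nat \<Rightarrow> ('a list \<Rightarrow>\<^sub>0 'f::field) set" where
  "bar_cycles G n = {c \<in> carrier (bar_chains G n). bar_boundary G n c = 0}"

definition bar_boundaries :: "'a monoid \<Rightarrow> nat \<Rightarrow> ('a list \<Rightarrow>\<^sub>0 'f::field) set" where
  "bar_boundaries G n = bar_boundary G (Suc n) ` carrier (bar_chains G (Suc n))"

definition group_homology ::
  "'a monoid \<Rightarrow> nat \<Rightarrow> ('f::field, ('a list \<Rightarrow>\<^sub>0 'f) set) module" where
  "group_homology G n =
     quot_module ((bar_chains G n)\<lparr>carrier := bar_cycles G n\<rparr>) (bar_boundaries G n)"

definition homology_map ::
  "'b monoid \<Rightarrow> nat \<Rightarrow> ('a \<Rightarrow> 'b) \<Rightarrow>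
     ('a list \<Rightarrow>\<^sub>0 'f::field) set \<Rightarrow> ('b list \<Rightarrow>\<^sub>0 'f) set" where
  "homology_map H n \<phi> =
     coset_map (bar_chains H n) (bar_boundaries H n) (lin_ext (\<lambda>xs. gen (map \<phi> xs)))"


section \<open>Symplectic groups and the modules in the theorem\<close>

text \<open>
  \<open>H\<^sub>1(\<Sigma>\<^sub>g;R)\<close> is \<open>R\<^sup>2\<^sup>g\<close> with a symplectic basis as standard basis. Indices start at 0, so
  \<open>X\<^sub>2\<^sub>i\<^sub>-\<^sub>1\<close> and \<open>X\<^sub>2\<^sub>i\<close> for \<open>1 \<le> i \<le> g\<close> are the unit vectors number \<open>2 * j\<close> and \<open>2 * j + 1\<close>,
  where \<open>j = i - 1\<close>.
\<close>

definition intersection_form :: "nat \<Rightarrow> 'r::comm_ring_1 vec \<Rightarrow> 'r vec \<Rightarrow> 'r" where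
  "intersection_form g v w =
     (\<Sum>j<g. v $ (2 * j) * w $ (2 * j + 1) - v $ (2 * j + 1) * w $ (2 * j))"

definition Sp :: "nat \<Rightarrow> 'r::comm_ring_1 mat monoid" where
  "Sp g = \<lparr>carrier = {A \<in> carrier_mat (2 * g) (2 * g).
       \<forall>v\<in>carrier_vec (2 * g). \<forall>w\<in>carrier_vec (2 * g).
         intersection_form g (A *\<^sub>v v) (A *\<^sub>v w) = intersection_form g v w},
     mult = (*), one = 1\<^sub>m (2 * g)\<rparr>"

abbreviation mod2 :: "int mat \<Rightarrow> bit mat" where
  "mod2 \<equiv> map_mat of_int"

definition Sp_level2 :: "nat \<Rightarrow> int mat monoid" where
  "Sp_level2 g = (Sp g)\<lparr>carrier := kernel (Sp g) (Sp g) mod2\<rparr>"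

text \<open>
  An element \<open>s\<close> of the symplectic group over the field with two elements acts on homology as
  conjugation by any integral symplectic lift \<open>A\<close> of \<open>s\<close>. All lifts give the same coset, which
  is therefore their union.
\<close>

definition H1_Sp_level2 ::
  "'f::field itself \<Rightarrow> nat \<Rightarrow> ('f, (int mat list \<Rightarrow>\<^sub>0 'f) set, bit mat) gmodule" where
  "H1_Sp_level2 ty g = with_act (group_homology (Sp_level2 g) 1)
     (\<lambda>s X. \<Union>A\<in>{A \<in> carrier (Sp g). mod2 A = s}.
        homology_map (Sp_level2 g) 1 (\<lambda>B. A \<otimes>\<^bsub>Sp g\<^esub> B \<otimes>\<^bsub>Sp g\<^esub> inv\<^bsub>Sp g\<^esub> A) X)"

definition H1_surface :: "'f::field itself \<Rightarrow> nat \<Rightarrow> ('f, 'f vec, bit mat) gmodule" where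
  "H1_surface ty g = with_act (module_vec ty (2 * g)) (\<lambda>s v. map_mat of_bit s *\<^sub>v v)"

definition trivial_gmodule :: "'f::field itself \<Rightarrow> ('f, 'f, 'g) gmodule" where
  "trivial_gmodule ty = \<lparr>carrier = UNIV, mult = undefined, one = undefined, zero = 0,
     add = (+), smult = (*), act = (\<lambda>_ x. x)\<rparr>"

text \<open>
  \<open>delta2\<close> is induced by the linear map that sends the pair \<open>(v, w)\<close> to the intersection number
  of \<open>v\<close> and \<open>w\<close>. That map is constant on each element of the exterior square.
\<close>

definition delta2 :: "nat \<Rightarrow> ('f::field vec \<times> 'f vec \<Rightarrow>\<^sub>0 'f) set \<Rightarrow> 'f" where
  "delta2 g X = the_elem ((\<lambda>c. \<Sum>(v, w)\<in>Poly_Mapping.keys c.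
     Poly_Mapping.lookup c (v, w) * intersection_form g v w) ` X)"

definition ker_delta2 ::
  "'f::field itself \<Rightarrow> nat \<Rightarrow> ('f, ('f vec \<times> 'f vec \<Rightarrow>\<^sub>0 'f) set, bit mat) gmodule" where
  "ker_delta2 ty g = (ext_square (H1_surface ty g))
     \<lparr>carrier := {X \<in> carrier (ext_square (H1_surface ty g)). delta2 g X = 0}\<rparr>"

definition omega :: "'f::field itself \<Rightarrow> nat \<Rightarrow> ('f vec \<times> 'f vec \<Rightarrow>\<^sub>0 'f) set" where
  "omega ty g = (\<Oplus>\<^bsub>ext_square (H1_surface ty g)\<^esub>j\<in>{..<g}.
     wedge (H1_surface ty g) (unit_vec (2 * g) (2 * j)) (unit_vec (2 * g) (2 * j + 1)))"

definition ker_delta2_mod_omega ::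
  "'f::field itself \<Rightarrow> nat \<Rightarrow> ('f, ('f vec \<times> 'f vec \<Rightarrow>\<^sub>0 'f) set set, bit mat) gmodule" where
  "ker_delta2_mod_omega ty g = gquot (ker_delta2 ty g)
     (LinearCombinations.module.span class_ring (ext_square (H1_surface ty g)) {omega ty g})"

end

(* Everything is compared with the module S of symmetric 2g x 2g matrices over F, on which a
   matrix s acts by X |-> s X s^T.

   Sending 1 + 2C to CJ modulo 2, with J the matrix of the intersection form, is a homomorphism
   from the level 2 group onto the symmetric matrices over the field with two elements. The level
   2 group is generated by root elements 1 + 2k(E_pq + E_qp)J and sign changes, and modulo
   commutators a generator is determined by its image, so H_1 is isomorphic to S. The action is
   well defined on Sp_2g(F_2) because the reduction map is onto, by generation by transvections.

   The alternating matrices form a submodule A of S isomorphic to the exterior square of V via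
   x /\ y |-> x y^T + y x^T. Under this isomorphism delta_2 becomes the sum of the entries
   (2j, 2j+1), and omega becomes J. Taking the diagonal identifies S / A with V, because the
   entries of s are their own squares. If K denotes the kernel of delta_2 in A, then A / K is
   trivial, and J lies in K exactly if g is even. A submodule of A that is not contained in the
   line through J contains K: transvections produce from any other element some x /\ y in K,
   and then all of these. Hence 0 < K < A < S or 0 < <J> < K < A < S is a composition series, and
   by the Jordan-Hoelder theorem it remains to see that V, the trivial module and the middle
   factor are not isomorphic. For a transvection t, the image of t - 1 on them has dimension 1,
   0, and at least 2. *)
theory Submission
  imports Defs
begin

section \<open>Quotients of modules with a group action\<close>

text \<open>The field \<open>'f\<close> may be larger than the field with two elements, while the
  acting group stays the symplectic group over two elements. So the only transvections at hand are
  those along vectors with entries 0 and 1 (\<open>bin_vecs\<close>), and simplicity over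
  \<open>'f\<close> must be proved with these alone. Scalars that occur on the way are divided out
  inside the submodule, and multiples of a binary vector are recognised by pairing with binary test
  vectors. H_1 and the exterior square are both a free module modulo relations, and one device
  computes both: a linear map to matrices that kills the relations, together with a linear section
  to which every generator is congruent. For H_1 the group elements with this congruence form a
  subgroup, so the check reduces to generators; this is the form in which generation of the level 2
  group is proved. The modules to be compared have different types. For this reason an isomorphism
  of a factor A / B with N is expressed by a map on A whose fibres are the cosets of B
  (\<open>gepi\<close>), and Jordan-Hoelder is proved relative to an arbitrary N.\<close>

lemma submodule_iff:
  assumes "Module.module class_ring (M :: ('f::field, 'v, 'm) module_scheme)"
  shows "Module.submodule W class_ring M \<longleftrightarrow>
    W \<subseteq> carrier M \<and> \<zero>\<^bsub>M\<^esub> \<in> W \<and> (\<forall>x\<in>W. \<forall>y\<in>W. x \<oplus>\<^bsub>M\<^esub> y \<in> W) \<and> (\<forall>r. \<forall>x\<in>W. r \<odot>\<^bsub>M\<^esub> x \<in> W)"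
    (is "?L \<longleftrightarrow> ?R")
proof -
  interpret M: Module.module class_ring M by fact
  show ?thesis
  proof
    assume L: ?L
    then interpret S: Module.submodule W class_ring M .
    show ?R
      using M.submoduleE[OF L] S.one_closed S.subset by auto
  next
    assume R: ?R
    show ?L
    proof (rule M.submoduleI)
      fix a assume a: "a \<in> W"
      then have c: "a \<in> carrier M" using R by auto
      \<comment> \<open>Negatives come from the scalar -1, so closure under scalars covers
        them.\<close>
      have "(-1) \<odot>\<^bsub>M\<^esub> a \<oplus>\<^bsub>M\<^esub> a = \<zero>\<^bsub>M\<^esub>"
        using M.smult_l_distr[of "-1" 1 a] M.smult_l_null[OF c] M.smult_one[OF c] c by simp
      then have "\<ominus>\<^bsub>M\<^esub> a = (-1) \<odot>\<^bsub>M\<^esub> a"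
        using M.minus_equality c by simp
      then show "\<ominus>\<^bsub>M\<^esub> a \<in> W" using R a by auto
    qed (use R in auto)
  qed
qed

text \<open>Spans are built on the notion \<open>LinearCombinations.submodule\<close>, equivariant
  submodules on \<open>Module.submodule\<close>. Both unfold to the same closure conditions, which
  gives the universal property of the span for the second notion.\<close>

lemma span_props:
  fixes M :: "('f::field, 'v, 'm) module_scheme"
  assumes m: "Module.module class_ring M" and S: "S \<subseteq> carrier M"
  shows "Module.submodule (LinearCombinations.module.span class_ring M S) class_ring M"
    and "S \<subseteq> LinearCombinations.module.span class_ring M S"
    and "\<And>N. Module.submodule N class_ring M \<Longrightarrow> S \<subseteq> N \<Longrightarrow>
           LinearCombinations.module.span class_ring M S \<subseteq> N"
proof -
  interpret M: Module.module class_ring M by fact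
  have *: "LinearCombinations.submodule class_ring N M \<longleftrightarrow> Module.submodule N class_ring M" for N
    unfolding submodule_iff[OF m] LinearCombinations.submodule_def using m by auto
  show "Module.submodule (M.span S) class_ring M"
    using M.span_is_submodule[OF S] * by blast
  show "S \<subseteq> M.span S" using M.in_own_span[OF S] .
  show "M.span S \<subseteq> N" if "Module.submodule N class_ring M" "S \<subseteq> N" for N
    using M.span_is_subset[OF that(2)] * that(1) by blast
qed

locale quotient_module = Module.module class_ring M
  for M :: "('f::field, 'v, 'm) module_scheme" (structure) +
  fixes W
  assumes W: "Module.submodule W class_ring M"
begin

lemma W_sub: "W \<subseteq> carrier M" and W_zero: "\<zero> \<in> W"
  and W_add: "x \<in> W \<Longrightarrow> y \<in> W \<Longrightarrow> x \<oplus> y \<in> W"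
  and W_smult: "x \<in> W \<Longrightarrow> r \<odot> x \<in> W"
  using W submodule_iff[OF module_axioms] by auto

lemma abelian_subgroup_W: "abelian_subgroup W M"
  by (intro abelian_subgroupI3 additive_subgroup.intro abelian_group_axioms submodule.axioms(1)[OF W])

lemma carrier_quot: "carrier (quot_module M W) = (\<lambda>x. W +> x) ` carrier M"
  by (auto simp: quot_module_def A_RCOSETS_def')

lemma zero_quot: "\<zero>\<^bsub>quot_module M W\<^esub> = W +> \<zero>"
  using W_sub by (simp add: quot_module_def a_coset_add_zero)

lemma coset_eqI:
  assumes "x \<in> carrier M" "w \<in> W"
  shows "W +> (w \<oplus> x) = W +> x"
proof -
  have "W +> w = W"
    using assms(2) W_sub by (intro a_coset_join2 submodule.axioms(1)[OF W]) auto
  then show ?thesis using a_coset_add_assoc[of W w x] assms W_sub by auto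
qed

lemma coset_memE: "z \<in> W +> x \<Longrightarrow> (\<And>w. w \<in> W \<Longrightarrow> z = w \<oplus> x \<Longrightarrow> P) \<Longrightarrow> P"
  by (auto simp: a_r_coset_def')

lemma coset_self: "x \<in> carrier M \<Longrightarrow> x \<in> W +> x"
  using W_zero by (force simp: a_r_coset_def')

lemma coset_eq_iff:
  assumes "x \<in> carrier M" "y \<in> carrier M"
  shows "W +> x = W +> y \<longleftrightarrow> x \<ominus> y \<in> W"
proof
  assume "W +> x = W +> y"
  then obtain w where w: "w \<in> W" "x = w \<oplus> y" using coset_self[OF assms(1)] by (metis coset_memE)
  then have "w \<in> carrier M" using W_sub by auto
  then show "x \<ominus> y \<in> W" using w assms by (simp add: minus_eq a_assoc r_neg)
next
  assume "x \<ominus> y \<in> W"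
  from coset_eqI[OF assms(2) this] show "W +> x = W +> y"
    using assms by (simp add: minus_eq a_assoc l_neg)
qed

lemma add_quot:
  assumes "x \<in> carrier M" "y \<in> carrier M"
  shows "(W +> x) \<oplus>\<^bsub>quot_module M W\<^esub> (W +> y) = W +> (x \<oplus> y)"
proof -
  interpret W: abelian_subgroup W M by (rule abelian_subgroup_W)
  show ?thesis using assms by (simp add: quot_module_def W.a_rcos_sum)
qed

text \<open>Two elements of W + x differ by an element of W, which f sends into U; so all the cosets
  in the union \<open>coset_map\<close> coincide. Scalars, group elements and induced maps on
  homology are all evaluated through this.\<close>

lemma coset_map_coset:
  fixes N :: "('f::field, 'u, 'n) module_scheme"
  assumes N: "quotient_module N U"
    and f: "f \<in> carrier M \<rightarrow> carrier N"
    and add: "\<And>x y. x \<in> carrier M \<Longrightarrow> y \<in> carrier M \<Longrightarrow> f (x \<oplus> y) = f x \<oplus>\<^bsub>N\<^esub> f y"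
    and WU: "f ` W \<subseteq> U" and x: "x \<in> carrier M"
  shows "coset_map N U f (W +> x) = U +>\<^bsub>N\<^esub> f x"
proof -
  interpret N: quotient_module N U by fact
  have "U +>\<^bsub>N\<^esub> f z = U +>\<^bsub>N\<^esub> f x" if z: "z \<in> W +> x" for z
  proof -
    from z obtain w where w: "w \<in> W" "z = w \<oplus> x" by (rule coset_memE)
    then have "w \<in> carrier M" using W_sub by auto
    then have "f z = f w \<oplus>\<^bsub>N\<^esub> f x" using add x w by simp
    moreover have "f x \<in> carrier N" "f w \<in> U" using f x WU w by auto
    ultimately show ?thesis using N.coset_eqI[of "f x" "f w"] by simp
  qed
  then have "coset_map N U f (W +> x) = (\<Union>z\<in>W +> x. U +>\<^bsub>N\<^esub> f x)"
    unfolding coset_map_def by (intro SUP_cong refl)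
  then show ?thesis using coset_self[OF x] by auto
qed

lemma smult_quot:
  assumes "x \<in> carrier M"
  shows "r \<odot>\<^bsub>quot_module M W\<^esub> (W +> x) = W +> (r \<odot> x)"
proof -
  have "coset_map M W (\<lambda>x. r \<odot> x) (W +> x) = W +> (r \<odot> x)"
    by (rule coset_map_coset) (use assms W_smult in \<open>auto simp: smult_r_distr quotient_module_axioms\<close>)
  then show ?thesis by (simp add: quot_module_def)
qed

end

lemma quotient_moduleI:
  "Module.module class_ring M \<Longrightarrow> Module.submodule W class_ring M \<Longrightarrow> quotient_module M W"
  by (simp add: quotient_module_def quotient_module_axioms_def)

section \<open>Modules with a linear group action, and maps that induce isomorphisms of
  subquotients\<close>

lemma is_gmoduleD:
  assumes "is_gmodule G M"
  shows "Module.module class_ring M"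
    "\<And>s x. s \<in> carrier G \<Longrightarrow> x \<in> carrier M \<Longrightarrow> act M s x \<in> carrier M"
    "\<And>s x y. s \<in> carrier G \<Longrightarrow> x \<in> carrier M \<Longrightarrow> y \<in> carrier M \<Longrightarrow>
        act M s (x \<oplus>\<^bsub>M\<^esub> y) = act M s x \<oplus>\<^bsub>M\<^esub> act M s y"
    "\<And>s r x. s \<in> carrier G \<Longrightarrow> x \<in> carrier M \<Longrightarrow> act M s (r \<odot>\<^bsub>M\<^esub> x) = r \<odot>\<^bsub>M\<^esub> act M s x"
    "\<And>x. x \<in> carrier M \<Longrightarrow> act M \<one>\<^bsub>G\<^esub> x = x"
    "\<And>s t x. s \<in> carrier G \<Longrightarrow> t \<in> carrier G \<Longrightarrow> x \<in> carrier M \<Longrightarrow>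
        act M (s \<otimes>\<^bsub>G\<^esub> t) x = act M s (act M t x)"
  using assms by (auto simp: is_gmodule_def)

lemma gsubmodule_iff:
  assumes "is_gmodule G M"
  shows "gsubmodule G M W \<longleftrightarrow> W \<subseteq> carrier M \<and> \<zero>\<^bsub>M\<^esub> \<in> W \<and> (\<forall>x\<in>W. \<forall>y\<in>W. x \<oplus>\<^bsub>M\<^esub> y \<in> W) \<and>
    (\<forall>r. \<forall>x\<in>W. r \<odot>\<^bsub>M\<^esub> x \<in> W) \<and> (\<forall>s\<in>carrier G. \<forall>x\<in>W. act M s x \<in> W)"
  using submodule_iff[OF is_gmoduleD(1)[OF assms]] by (auto simp: gsubmodule_def)

lemma gsubmodule_minus:
  assumes "is_gmodule G M" "gsubmodule G M W" "x \<in> W" "y \<in> W"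
  shows "x \<ominus>\<^bsub>M\<^esub> y \<in> W"
proof -
  interpret M: Module.module class_ring M using is_gmoduleD(1)[OF assms(1)] .
  from assms(2) have "Module.submodule W class_ring M" by (simp add: gsubmodule_def)
  from M.submoduleE(3,5)[OF this] assms(3,4) show ?thesis by (simp add: M.minus_eq)
qed

text \<open>\<open>ghom_on G M A N f\<close>: the map \<open>f\<close> is linear and equivariant on the submodule \<open>A\<close> of \<open>M\<close>.
  \<open>gepi G M A B N f\<close>: moreover it induces an isomorphism from \<open>A / B\<close> to \<open>N\<close>.\<close>

definition ghom_on ::
  "'g monoid \<Rightarrow> ('f, 'v, 'g) gmodule \<Rightarrow> 'v set \<Rightarrow> ('f, 'w, 'g) gmodule \<Rightarrow> ('v \<Rightarrow> 'w) \<Rightarrow> bool" where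
  "ghom_on G M A N f \<longleftrightarrow>
     (\<forall>x\<in>A. \<forall>y\<in>A. f (x \<oplus>\<^bsub>M\<^esub> y) = f x \<oplus>\<^bsub>N\<^esub> f y) \<and>
     (\<forall>r. \<forall>x\<in>A. f (r \<odot>\<^bsub>M\<^esub> x) = r \<odot>\<^bsub>N\<^esub> f x) \<and>
     (\<forall>s\<in>carrier G. \<forall>x\<in>A. f (act M s x) = act N s (f x))"

definition gepi ::
  "'g monoid \<Rightarrow> ('f, 'v, 'g) gmodule \<Rightarrow> 'v set \<Rightarrow> 'v set \<Rightarrow> ('f, 'w, 'g) gmodule \<Rightarrow>
     ('v \<Rightarrow> 'w) \<Rightarrow> bool" where
  "gepi G M A B N f \<longleftrightarrow> ghom_on G M A N f \<and> f ` A = carrier N \<and>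
     (\<forall>x\<in>A. \<forall>y\<in>A. f x = f y \<longleftrightarrow> x \<ominus>\<^bsub>M\<^esub> y \<in> B)"

lemma ghom_onD:
  assumes "ghom_on G M A N f"
  shows "\<And>x y. x \<in> A \<Longrightarrow> y \<in> A \<Longrightarrow> f (x \<oplus>\<^bsub>M\<^esub> y) = f x \<oplus>\<^bsub>N\<^esub> f y"
    "\<And>r x. x \<in> A \<Longrightarrow> f (r \<odot>\<^bsub>M\<^esub> x) = r \<odot>\<^bsub>N\<^esub> f x"
    "\<And>s x. s \<in> carrier G \<Longrightarrow> x \<in> A \<Longrightarrow> f (act M s x) = act N s (f x)"
  using assms by (auto simp: ghom_on_def)

lemma giso_iff_ghom:
  "giso G M N \<longleftrightarrow> (\<exists>f. bij_betw f (carrier M) (carrier N) \<and> ghom_on G M (carrier M) N f)"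
  by (auto simp: giso_def ghom_on_def)

text \<open>The axioms of a module are equations, apart from closure and the existence of negatives, so
  they pass to any image under a map that respects the operations.\<close>

lemma is_gmodule_image:
  fixes M :: "('f::field, 'v, 'g) gmodule" and N :: "('f, 'w, 'g) gmodule"
  assumes G: "monoid G" and M: "is_gmodule G M"
    and h: "ghom_on G M (carrier M) N f" and im: "f ` carrier M = carrier N"
    and z: "f \<zero>\<^bsub>M\<^esub> = \<zero>\<^bsub>N\<^esub>"
  shows "is_gmodule G N"
proof -
  interpret G: monoid G by fact
  interpret M: Module.module class_ring M using is_gmoduleD(1)[OF M] .
  note a = is_gmoduleD[OF M] and hh = ghom_onD[OF h]
  have ex: "\<exists>u\<in>carrier M. x = f u" if "x \<in> carrier N" for x using that im by auto
  have mem: "f u \<in> carrier N" if "u \<in> carrier M" for u using that im by auto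
  have add: "f x \<oplus>\<^bsub>N\<^esub> f y = f (x \<oplus>\<^bsub>M\<^esub> y)" if "x \<in> carrier M" "y \<in> carrier M" for x y
    using hh(1) that by simp
  have sm: "r \<odot>\<^bsub>N\<^esub> f x = f (r \<odot>\<^bsub>M\<^esub> x)" if "x \<in> carrier M" for r x
    using hh(2) that by simp
  have ac: "act N s (f x) = f (act M s x)" if "x \<in> carrier M" "s \<in> carrier G" for s x
    using hh(3) that by simp
  have ab: "abelian_group N"
  proof (rule abelian_groupI)
    fix x assume x: "x \<in> carrier N"
    then obtain u where u: "u \<in> carrier M" "x = f u" using ex by blast
    then have "f (\<ominus>\<^bsub>M\<^esub> u) \<oplus>\<^bsub>N\<^esub> x = \<zero>\<^bsub>N\<^esub>" using add z by (simp add: M.l_neg)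
    then show "\<exists>y\<in>carrier N. y \<oplus>\<^bsub>N\<^esub> x = \<zero>\<^bsub>N\<^esub>" using u mem by blast
  next
    show "\<zero>\<^bsub>N\<^esub> \<in> carrier N" using mem[of "\<zero>\<^bsub>M\<^esub>"] z by simp
    fix x y assume x: "x \<in> carrier N" and y: "y \<in> carrier N"
    then obtain u v where u: "u \<in> carrier M" "x = f u" and v: "v \<in> carrier M" "y = f v"
      using ex by blast
    show "x \<oplus>\<^bsub>N\<^esub> y \<in> carrier N" "x \<oplus>\<^bsub>N\<^esub> y = y \<oplus>\<^bsub>N\<^esub> x"
      using u v by (auto simp: add mem M.a_comm)
    show "\<zero>\<^bsub>N\<^esub> \<oplus>\<^bsub>N\<^esub> x = x" using u add[of "\<zero>\<^bsub>M\<^esub>" u] z by simp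
    fix t assume "t \<in> carrier N"
    then obtain w where w: "w \<in> carrier M" "t = f w" using ex by blast
    show "x \<oplus>\<^bsub>N\<^esub> y \<oplus>\<^bsub>N\<^esub> t = x \<oplus>\<^bsub>N\<^esub> (y \<oplus>\<^bsub>N\<^esub> t)" using u v w by (simp add: add M.a_assoc)
  qed
  have m0: "Module.module class_ring N"
  proof (rule moduleI)
    show "cring (class_ring :: 'f ring)" using is_gmoduleD(1)[OF M] by (simp add: Module.module_def)
    show "abelian_group N" by (rule ab)
  next
    fix a x assume "x \<in> carrier N"
    then obtain u where u: "u \<in> carrier M" "x = f u" using ex by blast
    then show "a \<odot>\<^bsub>N\<^esub> x \<in> carrier N" by (simp add: sm mem)
    show "\<one>\<^bsub>class_ring\<^esub> \<odot>\<^bsub>N\<^esub> x = x" using u sm[of u 1] M.smult_one[of u] by simp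
    fix b
    show "(a \<oplus>\<^bsub>class_ring\<^esub> b) \<odot>\<^bsub>N\<^esub> x = a \<odot>\<^bsub>N\<^esub> x \<oplus>\<^bsub>N\<^esub> b \<odot>\<^bsub>N\<^esub> x"
      using u M.smult_l_distr[of a b u] by (simp add: sm add)
    show "(a \<otimes>\<^bsub>class_ring\<^esub> b) \<odot>\<^bsub>N\<^esub> x = a \<odot>\<^bsub>N\<^esub> (b \<odot>\<^bsub>N\<^esub> x)"
      using u M.smult_assoc1[of a b u] by (simp add: sm)
  next
    fix a x y assume "x \<in> carrier N" "y \<in> carrier N"
    then obtain u v where u: "u \<in> carrier M" "x = f u" and v: "v \<in> carrier M" "y = f v"
      using ex by blast
    then show "a \<odot>\<^bsub>N\<^esub> (x \<oplus>\<^bsub>N\<^esub> y) = a \<odot>\<^bsub>N\<^esub> x \<oplus>\<^bsub>N\<^esub> a \<odot>\<^bsub>N\<^esub> y"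
      using M.smult_r_distr[of a u v] by (simp add: sm add)
  qed
  have m1: "act N s x \<in> carrier N" if "s \<in> carrier G" "x \<in> carrier N" for s x
    using ex[OF that(2)] that(1) by (auto simp: ac mem a)
  have m2: "act N s (x \<oplus>\<^bsub>N\<^esub> y) = act N s x \<oplus>\<^bsub>N\<^esub> act N s y"
    if "s \<in> carrier G" "x \<in> carrier N" "y \<in> carrier N" for s x y
    using ex[OF that(2)] ex[OF that(3)] that(1) by (auto simp: ac add a)
  have m3: "act N s (r \<odot>\<^bsub>N\<^esub> x) = r \<odot>\<^bsub>N\<^esub> act N s x" if "s \<in> carrier G" "x \<in> carrier N" for r s x
    using ex[OF that(2)] that(1) by (auto simp: ac sm a)
  have m4: "act N \<one>\<^bsub>G\<^esub> x = x" if "x \<in> carrier N" for x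
    using ex[OF that] by (auto simp: ac a)
  have m5: "act N (s \<otimes>\<^bsub>G\<^esub> t) x = act N s (act N t x)"
    if st: "s \<in> carrier G" "t \<in> carrier G" "x \<in> carrier N" for s t x
  proof -
    obtain u where u: "u \<in> carrier M" "x = f u" using ex[OF st(3)] by blast
    have "act N (s \<otimes>\<^bsub>G\<^esub> t) x = f (act M s (act M t u))"
      unfolding u(2) ac[OF u(1) G.m_closed[OF st(1,2)]] a(6)[OF st(1,2) u(1)] ..
    also have "\<dots> = act N s (act N t x)"
      unfolding u(2) ac[OF u(1) st(2)] ac[OF a(2)[OF st(2) u(1)] st(1)] ..
    finally show ?thesis .
  qed
  show ?thesis unfolding is_gmodule_def
    by (intro conjI ballI allI; (rule m0 | rule m1 m2 m3 m4 m5; assumption))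
qed

lemma is_gmodule_restrict:
  assumes M: "is_gmodule G M" and A: "gsubmodule G M A"
  shows "is_gmodule G (M\<lparr>carrier := A\<rparr>)"
proof -
  from A have s: "Module.submodule A class_ring M" by (simp add: gsubmodule_def)
  have "Module.module class_ring (M\<lparr>carrier := A\<rparr>)"
    using submodule.submodule_is_module[OF s is_gmoduleD(1)[OF M]] .
  with A is_gmoduleD[OF M] show ?thesis
    unfolding is_gmodule_def by (auto simp: gsubmodule_iff[OF M] subset_iff)
qed

lemma gsubmodule_restrict:
  assumes M: "is_gmodule G M" and A: "gsubmodule G M A"
  shows "gsubmodule G (M\<lparr>carrier := A\<rparr>) B \<longleftrightarrow> gsubmodule G M B \<and> B \<subseteq> A"
  using A unfolding gsubmodule_iff[OF M] gsubmodule_iff[OF is_gmodule_restrict[OF M A]] by auto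

text \<open>Negatives are defined relative to the carrier; the negative found in A is also one in M,
  and negatives in M are unique.\<close>

lemma minus_restrict:
  assumes M: "is_gmodule G M" and A: "gsubmodule G M A" and xy: "x \<in> A" "y \<in> A"
  shows "x \<ominus>\<^bsub>M\<lparr>carrier := A\<rparr>\<^esub> y = x \<ominus>\<^bsub>M\<^esub> y"
proof -
  interpret M: Module.module class_ring M using is_gmoduleD(1)[OF M] .
  interpret A: Module.module class_ring "M\<lparr>carrier := A\<rparr>"
    using is_gmoduleD(1)[OF is_gmodule_restrict[OF M A]] .
  have sub: "A \<subseteq> carrier M" using A by (simp add: gsubmodule_iff[OF M])
  have n: "\<ominus>\<^bsub>M\<lparr>carrier := A\<rparr>\<^esub> y \<in> A" using A.a_inv_closed xy by simp
  have e: "y \<oplus>\<^bsub>M\<^esub> (\<ominus>\<^bsub>M\<lparr>carrier := A\<rparr>\<^esub> y) = \<zero>\<^bsub>M\<^esub>" using A.r_neg[of y] xy by simp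
  have "\<ominus>\<^bsub>M\<^esub> y = \<ominus>\<^bsub>M\<lparr>carrier := A\<rparr>\<^esub> y"
    by (rule M.minus_equality) (use e n xy sub M.a_comm in \<open>auto simp: subset_iff\<close>)
  then show ?thesis by (simp add: a_minus_def)
qed

section \<open>Quotients by equivariant submodules\<close>

lemma gquot_simps:
  "carrier (gquot M W) = carrier (quot_module M W)" "add (gquot M W) = add (quot_module M W)"
  "zero (gquot M W) = zero (quot_module M W)" "module.smult (gquot M W) = module.smult (quot_module M W)"
  "act (gquot M W) s = coset_map M W (act M s)"
  by (simp_all add: gquot_def with_act_def)

lemma gquot_epi:
  assumes M: "is_gmodule G M" and W: "gsubmodule G M W"
  shows "gepi G M (carrier M) W (gquot M W) (\<lambda>x. W +>\<^bsub>M\<^esub> x)"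
proof -
  interpret Q: quotient_module M W
    using is_gmoduleD(1)[OF M] W by (intro quotient_moduleI) (simp_all add: gsubmodule_def)
  have "coset_map M W (act M s) (W +>\<^bsub>M\<^esub> x) = W +>\<^bsub>M\<^esub> act M s x"
    if "s \<in> carrier G" "x \<in> carrier M" for s x
    by (rule Q.coset_map_coset)
      (use that W is_gmoduleD[OF M] in \<open>auto simp: Q.quotient_module_axioms gsubmodule_iff[OF M]\<close>)
  then show ?thesis
    unfolding gepi_def ghom_on_def gquot_simps Q.carrier_quot
    by (auto simp: Q.add_quot Q.smult_quot Q.coset_eq_iff)
qed

lemma zero_gquot:
  assumes "is_gmodule G M" "gsubmodule G M W"
  shows "\<zero>\<^bsub>gquot M W\<^esub> = W +>\<^bsub>M\<^esub> \<zero>\<^bsub>M\<^esub>"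
proof -
  interpret Q: quotient_module M W
    using is_gmoduleD(1)[OF assms(1)] assms(2) by (intro quotient_moduleI) (simp_all add: gsubmodule_def)
  show ?thesis by (simp add: gquot_simps Q.zero_quot)
qed

lemma is_gmodule_gquot:
  assumes "monoid G" "is_gmodule G M" "gsubmodule G M W"
  shows "is_gmodule G (gquot M W)"
  using gquot_epi[OF assms(2,3)] zero_gquot[OF assms(2,3)]
  by (intro is_gmodule_image[OF assms(1,2)]) (auto simp: gepi_def)

text \<open>The homomorphism theorem. Through it the factors of a series are later compared by maps
  on representatives instead of cosets.\<close>

lemma giso_gquot_iff:
  assumes M: "is_gmodule G M" and W: "gsubmodule G M W"
  shows "giso G (gquot M W) N \<longleftrightarrow> (\<exists>f. gepi G M (carrier M) W N f)"
proof
  note q = gquot_epi[OF M W]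
  let ?q = "\<lambda>x. W +>\<^bsub>M\<^esub> x"
  have im: "?q ` carrier M = carrier (gquot M W)" using q by (simp add: gepi_def)
  have qh: "ghom_on G M (carrier M) (gquot M W) ?q" using q by (simp add: gepi_def)
  interpret Q: quotient_module M W
    using is_gmoduleD(1)[OF M] W by (intro quotient_moduleI) (simp_all add: gsubmodule_def)
  {
    assume "giso G (gquot M W) N"
    then obtain p where p: "bij_betw p (carrier (gquot M W)) (carrier N)"
      "ghom_on G (gquot M W) (carrier (gquot M W)) N p" unfolding giso_iff_ghom by blast
    have mem: "?q x \<in> carrier (gquot M W)" if "x \<in> carrier M" for x using im that by auto
    have "gepi G M (carrier M) W N (\<lambda>x. p (?q x))"
      unfolding gepi_def
    proof (intro conjI ballI)
      show "ghom_on G M (carrier M) N (\<lambda>x. p (?q x))"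
        unfolding ghom_on_def using ghom_onD[OF qh] ghom_onD[OF p(2)] mem by simp
      show "(\<lambda>x. p (?q x)) ` carrier M = carrier N"
        using im p(1) by (simp add: bij_betw_def image_image[symmetric, of p ?q])
      fix x y assume xy: "x \<in> carrier M" "y \<in> carrier M"
      show "p (?q x) = p (?q y) \<longleftrightarrow> x \<ominus>\<^bsub>M\<^esub> y \<in> W"
        using p(1) mem[OF xy(1)] mem[OF xy(2)] Q.coset_eq_iff[OF xy]
        by (auto simp: bij_betw_def inj_on_eq_iff)
    qed
    then show "\<exists>f. gepi G M (carrier M) W N f" by blast
  next
    assume "\<exists>f. gepi G M (carrier M) W N f"
    then obtain f where f: "ghom_on G M (carrier M) N f" "f ` carrier M = carrier N"
      "\<And>x y. x \<in> carrier M \<Longrightarrow> y \<in> carrier M \<Longrightarrow> f x = f y \<longleftrightarrow> x \<ominus>\<^bsub>M\<^esub> y \<in> W"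
      unfolding gepi_def by blast
    \<comment> \<open>Evaluates f on some representative of the coset; the fibres of f are the
      cosets of W, so the choice has no influence.\<close>
    define p where "p = (\<lambda>X. f (SOME x. x \<in> carrier M \<and> ?q x = X))"
    have pq: "p (?q x) = f x" if x: "x \<in> carrier M" for x
    proof -
      have "\<exists>y. y \<in> carrier M \<and> ?q y = ?q x" using x by blast
      then have "(SOME y. y \<in> carrier M \<and> ?q y = ?q x) \<in> carrier M \<and>
         ?q (SOME y. y \<in> carrier M \<and> ?q y = ?q x) = ?q x" by (rule someI_ex)
      then show ?thesis unfolding p_def using f(3) x Q.coset_eq_iff by blast
    qed
    have "bij_betw p (?q ` carrier M) (carrier N)"
      unfolding bij_betw_def
    proof
      show "inj_on p (?q ` carrier M)"
      proof (rule inj_onI)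
        fix X Y assume "X \<in> ?q ` carrier M" "Y \<in> ?q ` carrier M" and e: "p X = p Y"
        then obtain x y where xy: "x \<in> carrier M" "y \<in> carrier M" "X = ?q x" "Y = ?q y" by blast
        with e have "f x = f y" using pq by simp
        then show "X = Y" using f(3) Q.coset_eq_iff xy by blast
      qed
      show "p ` ?q ` carrier M = carrier N" using pq f(2) by (force simp: image_image)
    qed
    moreover have "ghom_on G (gquot M W) (?q ` carrier M) N p"
      unfolding ghom_on_def
    proof (intro conjI ballI allI)
      fix X Y assume "X \<in> ?q ` carrier M" "Y \<in> ?q ` carrier M"
      then show "p (X \<oplus>\<^bsub>gquot M W\<^esub> Y) = p X \<oplus>\<^bsub>N\<^esub> p Y"
        using ghom_onD(1)[OF qh, symmetric] ghom_onD(1)[OF f(1)] pq by auto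
    next
      fix r X assume "X \<in> ?q ` carrier M"
      then show "p (r \<odot>\<^bsub>gquot M W\<^esub> X) = r \<odot>\<^bsub>N\<^esub> p X"
        using ghom_onD(2)[OF qh, symmetric] ghom_onD(2)[OF f(1)] pq by auto
    next
      fix s X assume "s \<in> carrier G" "X \<in> ?q ` carrier M"
      then show "p (act (gquot M W) s X) = act N s (p X)"
        using ghom_onD(3)[OF qh, symmetric] ghom_onD(3)[OF f(1)] pq is_gmoduleD(2)[OF M] by auto
    qed
    ultimately show "giso G (gquot M W) N" unfolding giso_iff_ghom im[symmetric] by blast
  }
qed

lemma gsimpleD:
  assumes "gsimple G M"
  shows "is_gmodule G M" "carrier M \<noteq> {\<zero>\<^bsub>M\<^esub>}"
    "\<And>W. gsubmodule G M W \<Longrightarrow> W = {\<zero>\<^bsub>M\<^esub>} \<or> W = carrier M"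
  using assms by (simp_all add: gsimple_def)

text \<open>The correspondence of submodules of the quotient with submodules of M above W:
  \<open>up\<close> takes preimages, \<open>down\<close> takes images, and \<open>lift_mem\<close>
  shows that no submodule above W grows when it passes to the quotient and back.\<close>

lemma gsimple_gquot_iff:
  assumes G: "monoid G" and M: "is_gmodule G M" and W: "gsubmodule G M W"
  shows "gsimple G (gquot M W) \<longleftrightarrow>
    W \<noteq> carrier M \<and> (\<forall>U. gsubmodule G M U \<and> W \<subseteq> U \<longrightarrow> U = W \<or> U = carrier M)"
proof -
  let ?Q = "gquot M W" and ?q = "\<lambda>x. W +>\<^bsub>M\<^esub> x"
  note q = gquot_epi[OF M W]
  have im: "?q ` carrier M = carrier ?Q" using q by (simp add: gepi_def)
  have qh: "ghom_on G M (carrier M) ?Q ?q" using q by (simp add: gepi_def)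
  note qq = ghom_onD[OF qh]
  interpret Q: quotient_module M W
    using is_gmoduleD(1)[OF M] W by (intro quotient_moduleI) (simp_all add: gsubmodule_def)
  note gQ = is_gmodule_gquot[OF G M W]
  interpret QQ: Module.module class_ring ?Q using is_gmoduleD(1)[OF gQ] .
  have z: "\<zero>\<^bsub>?Q\<^esub> = ?q \<zero>\<^bsub>M\<^esub>" using zero_gquot[OF M W] .
  have inW: "?q x = \<zero>\<^bsub>?Q\<^esub> \<longleftrightarrow> x \<in> W" if "x \<in> carrier M" for x
    using Q.coset_eq_iff[of x "\<zero>\<^bsub>M\<^esub>"] that Q.add.inv_one unfolding z a_minus_def
    by (simp add: a_inv_def)
  have up: "gsubmodule G M {x \<in> carrier M. ?q x \<in> X}" if X: "gsubmodule G ?Q X" for X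
    using X qq is_gmoduleD(2)[OF M] z unfolding gsubmodule_iff[OF M] gsubmodule_iff[OF gQ] by auto
  have down: "gsubmodule G ?Q (?q ` U)" if U: "gsubmodule G M U" for U
  proof -
    have c: "U \<subseteq> carrier M" using U by (simp add: gsubmodule_iff[OF M])
    have d0: "\<zero>\<^bsub>?Q\<^esub> \<in> ?q ` U" using U z by (auto simp: gsubmodule_iff[OF M])
    have d1: "x \<oplus>\<^bsub>?Q\<^esub> y \<in> ?q ` U" if "x \<in> ?q ` U" "y \<in> ?q ` U" for x y
      using that c qq(1)[symmetric] U by (auto simp: gsubmodule_iff[OF M] subset_iff)
    have d2: "r \<odot>\<^bsub>?Q\<^esub> x \<in> ?q ` U" if "x \<in> ?q ` U" for x r
      using that c qq(2)[symmetric] U by (auto simp: gsubmodule_iff[OF M] subset_iff)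
    have d3: "act ?Q s x \<in> ?q ` U" if "x \<in> ?q ` U" "s \<in> carrier G" for x s
      using that c qq(3)[symmetric] U by (auto simp: gsubmodule_iff[OF M] subset_iff)
    have d4: "?q ` U \<subseteq> carrier ?Q" unfolding im[symmetric] using c by blast
    show ?thesis unfolding gsubmodule_iff[OF gQ]
      by (intro conjI ballI allI; (rule d4 d0 | rule d1 d2 d3; assumption))
  qed
  have nz: "carrier ?Q \<noteq> {\<zero>\<^bsub>?Q\<^esub>} \<longleftrightarrow> W \<noteq> carrier M"
  proof -
    have "carrier ?Q = {\<zero>\<^bsub>?Q\<^esub>} \<longleftrightarrow> (\<forall>x\<in>carrier M. ?q x = \<zero>\<^bsub>?Q\<^esub>)"
    proof
      assume "carrier ?Q = {\<zero>\<^bsub>?Q\<^esub>}"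
      then show "\<forall>x\<in>carrier M. ?q x = \<zero>\<^bsub>?Q\<^esub>" using im by blast
    next
      assume "\<forall>x\<in>carrier M. ?q x = \<zero>\<^bsub>?Q\<^esub>"
      then have "carrier ?Q \<subseteq> {\<zero>\<^bsub>?Q\<^esub>}" unfolding im[symmetric] by blast
      then show "carrier ?Q = {\<zero>\<^bsub>?Q\<^esub>}" using QQ.zero_closed by blast
    qed
    also have "\<dots> \<longleftrightarrow> W = carrier M" using inW Q.W_sub by blast
    finally show ?thesis by blast
  qed
  have lift_mem: "x \<in> U" if U: "gsubmodule G M U" "W \<subseteq> U" and x: "x \<in> carrier M" "?q x \<in> ?q ` U" for U x
  proof -
    obtain y where y: "y \<in> U" "?q x = ?q y" using x by auto
    then have yc: "y \<in> carrier M" using U by (auto simp: gsubmodule_iff[OF M])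
    have "x \<ominus>\<^bsub>M\<^esub> y \<in> W" using Q.coset_eq_iff[OF x(1) yc] y(2) by simp
    then have "x \<ominus>\<^bsub>M\<^esub> y \<in> U" using U(2) by blast
    then have "(x \<ominus>\<^bsub>M\<^esub> y) \<oplus>\<^bsub>M\<^esub> y \<in> U" using U y by (simp add: gsubmodule_iff[OF M])
    then show "x \<in> U" using x yc by (simp add: Q.minus_eq Q.a_assoc Q.l_neg)
  qed
  show ?thesis
  proof
    assume s: "gsimple G ?Q"
    show "W \<noteq> carrier M \<and> (\<forall>U. gsubmodule G M U \<and> W \<subseteq> U \<longrightarrow> U = W \<or> U = carrier M)"
    proof (intro conjI allI impI)
      show "W \<noteq> carrier M" using gsimpleD(2)[OF s] nz by simp
      fix U assume U: "gsubmodule G M U \<and> W \<subseteq> U"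
      have c: "U \<subseteq> carrier M" using U by (simp add: gsubmodule_iff[OF M])
      have "gsubmodule G ?Q (?q ` U)" using down U by blast
      then have "?q ` U = {\<zero>\<^bsub>?Q\<^esub>} \<or> ?q ` U = carrier ?Q" by (rule gsimpleD(3)[OF s])
      then show "U = W \<or> U = carrier M"
      proof
        assume e: "?q ` U = {\<zero>\<^bsub>?Q\<^esub>}"
        have "U \<subseteq> W"
        proof
          fix x assume x: "x \<in> U"
          then have "?q x = \<zero>\<^bsub>?Q\<^esub>" using e by blast
          then show "x \<in> W" using inW[of x] c x by blast
        qed
        then show ?thesis using U by blast
      next
        assume e: "?q ` U = carrier ?Q"
        have "carrier M \<subseteq> U"
        proof
          fix x assume x: "x \<in> carrier M"
          then have "?q x \<in> ?q ` U" unfolding e im[symmetric] by (rule imageI)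
          then show "x \<in> U" using lift_mem[of U x] U x by blast
        qed
        then show ?thesis using c by auto
      qed
    qed
  next
    assume r: "W \<noteq> carrier M \<and> (\<forall>U. gsubmodule G M U \<and> W \<subseteq> U \<longrightarrow> U = W \<or> U = carrier M)"
    show "gsimple G ?Q" unfolding gsimple_def
    proof (intro conjI allI impI)
      show "is_gmodule G ?Q" by (rule gQ)
      show "carrier ?Q \<noteq> {\<zero>\<^bsub>?Q\<^esub>}" using nz r by blast
      fix X assume X: "gsubmodule G ?Q X"
      let ?U = "{x \<in> carrier M. ?q x \<in> X}"
      have Xz: "\<zero>\<^bsub>?Q\<^esub> \<in> X" and Xc: "X \<subseteq> ?q ` carrier M"
        using X unfolding gsubmodule_iff[OF gQ] im by blast+
      have "?q x = \<zero>\<^bsub>?Q\<^esub>" if "x \<in> W" for x using that inW Q.W_sub by blast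
      then have "W \<subseteq> ?U" using Xz Q.W_sub by auto
      then have "?U = W \<or> ?U = carrier M" using up[OF X] r[THEN conjunct2, rule_format, of ?U] by simp
      then show "X = {\<zero>\<^bsub>?Q\<^esub>} \<or> X = carrier ?Q"
      proof
        assume e: "?U = W"
        have "x = \<zero>\<^bsub>?Q\<^esub>" if x: "x \<in> X" for x
        proof -
          obtain u where u: "u \<in> carrier M" "x = ?q u" using Xc x by blast
          then have "u \<in> W" using e x by blast
          then show ?thesis using inW u by simp
        qed
        then show ?thesis using Xz by blast
      next
        assume "?U = carrier M"
        then have "?q ` carrier M \<subseteq> X" by blast
        then show ?thesis using Xc im by blast
      qed
    qed
  qed
qed

section \<open>The Jordan-Hoelder theorem\<close>

lemma gepi_restrict:
  assumes M: "is_gmodule G M" and A: "gsubmodule G M A"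
  shows "gepi G (M\<lparr>carrier := A\<rparr>) A B N f \<longleftrightarrow> gepi G M A B N f"
  using minus_restrict[OF M A] by (simp add: gepi_def ghom_on_def)

lemma giso_factor_iff:
  assumes "is_gmodule G M" "gsubmodule G M A" "gsubmodule G M B" "B \<subseteq> A"
  shows "giso G (gquot (M\<lparr>carrier := A\<rparr>) B) N \<longleftrightarrow> (\<exists>f. gepi G M A B N f)"
proof -
  have "gepi G (M\<lparr>carrier := A\<rparr>) A B N = gepi G M A B N"
    by (intro ext gepi_restrict assms)
  then show ?thesis
    using giso_gquot_iff[OF is_gmodule_restrict[OF assms(1,2)], of B N]
      gsubmodule_restrict[OF assms(1,2)] assms(3,4) by simp
qed

text \<open>The covering relation in the lattice of equivariant submodules. It expresses that A / B
  is simple without forming the quotient (\<open>gsimple_factor_iff\<close>).\<close>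

definition gcover ::
  "'g monoid \<Rightarrow> ('f::field, 'v, 'g) gmodule \<Rightarrow> 'v set \<Rightarrow> 'v set \<Rightarrow> bool" where
  "gcover G M B A \<longleftrightarrow> gsubmodule G M A \<and> gsubmodule G M B \<and> B \<subset> A \<and>
     (\<forall>U. gsubmodule G M U \<longrightarrow> B \<subseteq> U \<longrightarrow> U \<subseteq> A \<longrightarrow> U = B \<or> U = A)"

lemma gcoverD:
  assumes "gcover G M B A"
  shows "gsubmodule G M A" "gsubmodule G M B" "B \<subseteq> A" "B \<noteq> A"
    "\<And>U. gsubmodule G M U \<Longrightarrow> B \<subseteq> U \<Longrightarrow> U \<subseteq> A \<Longrightarrow> U = B \<or> U = A"
  using assms by (simp_all add: gcover_def psubset_eq)

lemma gsimple_factor_iff: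
  assumes "monoid G" "is_gmodule G M" "gsubmodule G M A" "gsubmodule G M B" "B \<subseteq> A"
  shows "gsimple G (gquot (M\<lparr>carrier := A\<rparr>) B) \<longleftrightarrow> gcover G M B A"
  using gsimple_gquot_iff[OF assms(1) is_gmodule_restrict[OF assms(2,3)], of B]
    gsubmodule_restrict[OF assms(2,3)] assms by (auto simp: gcover_def)

lemma gsubmodule_inter:
  assumes "is_gmodule G M" "gsubmodule G M A" "gsubmodule G M B"
  shows "gsubmodule G M (A \<inter> B)"
  using assms(2,3) unfolding gsubmodule_iff[OF assms(1)] by auto

definition gsum :: "('f, 'v, 'm) module_scheme \<Rightarrow> 'v set \<Rightarrow> 'v set \<Rightarrow> 'v set" where
  "gsum M A B = {b \<oplus>\<^bsub>M\<^esub> a | a b. a \<in> A \<and> b \<in> B}"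

lemma gsum_props:
  assumes M: "is_gmodule G M" and A: "gsubmodule G M A" and B: "gsubmodule G M B"
  shows "gsubmodule G M (gsum M A B)" "A \<subseteq> gsum M A B" "B \<subseteq> gsum M A B"
    "\<And>C. gsubmodule G M C \<Longrightarrow> A \<subseteq> C \<Longrightarrow> B \<subseteq> C \<Longrightarrow> gsum M A B \<subseteq> C"
proof -
  interpret M: Module.module class_ring M using is_gmoduleD(1)[OF M] .
  note a = A[unfolded gsubmodule_iff[OF M]] and b = B[unfolded gsubmodule_iff[OF M]]
  have ac: "x \<in> carrier M" if "x \<in> A" for x using a that by auto
  have bc: "x \<in> carrier M" if "x \<in> B" for x using b that by auto
  have I: "y \<oplus>\<^bsub>M\<^esub> x \<in> gsum M A B" if "x \<in> A" "y \<in> B" for x y using that by (auto simp: gsum_def)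
  have E: "\<exists>x\<in>A. \<exists>y\<in>B. z = y \<oplus>\<^bsub>M\<^esub> x" if "z \<in> gsum M A B" for z using that by (auto simp: gsum_def)
  show sA: "A \<subseteq> gsum M A B"
  proof
    fix x assume "x \<in> A"
    then show "x \<in> gsum M A B" using I[of x "\<zero>\<^bsub>M\<^esub>"] b ac by simp
  qed
  show sB: "B \<subseteq> gsum M A B"
  proof
    fix x assume "x \<in> B"
    then show "x \<in> gsum M A B" using I[of "\<zero>\<^bsub>M\<^esub>" x] a bc by simp
  qed
  show "gsum M A B \<subseteq> C" if C: "gsubmodule G M C" "A \<subseteq> C" "B \<subseteq> C" for C
  proof
    fix z assume "z \<in> gsum M A B"
    then obtain x y where "x \<in> A" "y \<in> B" "z = y \<oplus>\<^bsub>M\<^esub> x" using E by meson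
    then show "z \<in> C" using C(2,3) C(1)[unfolded gsubmodule_iff[OF M]] by (simp add: subset_iff)
  qed
  show "gsubmodule G M (gsum M A B)"
    unfolding gsubmodule_iff[OF M]
  proof (intro conjI ballI allI)
    show "gsum M A B \<subseteq> carrier M" using ac bc by (auto simp: gsum_def)
    show "\<zero>\<^bsub>M\<^esub> \<in> gsum M A B" using sA a by blast
    fix z z' assume "z \<in> gsum M A B" "z' \<in> gsum M A B"
    then obtain x y x' y' where xy: "x \<in> A" "y \<in> B" "z = y \<oplus>\<^bsub>M\<^esub> x" "x' \<in> A" "y' \<in> B" "z' = y' \<oplus>\<^bsub>M\<^esub> x'"
      using E by meson
    then have "z \<oplus>\<^bsub>M\<^esub> z' = (y \<oplus>\<^bsub>M\<^esub> y') \<oplus>\<^bsub>M\<^esub> (x \<oplus>\<^bsub>M\<^esub> x')" using ac bc by (simp add: M.a_ac)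
    then show "z \<oplus>\<^bsub>M\<^esub> z' \<in> gsum M A B" using I[of "x \<oplus>\<^bsub>M\<^esub> x'" "y \<oplus>\<^bsub>M\<^esub> y'"] a b xy by simp
  next
    fix r z assume "z \<in> gsum M A B"
    then obtain x y where xy: "x \<in> A" "y \<in> B" "z = y \<oplus>\<^bsub>M\<^esub> x" using E by meson
    then have "r \<odot>\<^bsub>M\<^esub> z = r \<odot>\<^bsub>M\<^esub> y \<oplus>\<^bsub>M\<^esub> r \<odot>\<^bsub>M\<^esub> x" using ac bc M.smult_r_distr by simp
    then show "r \<odot>\<^bsub>M\<^esub> z \<in> gsum M A B" using I[of "r \<odot>\<^bsub>M\<^esub> x" "r \<odot>\<^bsub>M\<^esub> y"] a b xy by simp
  next
    fix s z assume s: "s \<in> carrier G" and "z \<in> gsum M A B"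
    then obtain x y where xy: "x \<in> A" "y \<in> B" "z = y \<oplus>\<^bsub>M\<^esub> x" using E by meson
    then have "act M s z = act M s y \<oplus>\<^bsub>M\<^esub> act M s x" using ac bc is_gmoduleD(3)[OF M s] by simp
    then show "act M s z \<in> gsum M A B" using I[of "act M s x" "act M s y"] a b xy s by simp
  qed
qed

lemma minus_mem_iff:
  assumes M: "is_gmodule G M" and "gsubmodule G M B" "x \<in> carrier M" "y \<in> carrier M"
  shows "x \<ominus>\<^bsub>M\<^esub> y \<in> B \<longleftrightarrow> (\<exists>b\<in>B. x = b \<oplus>\<^bsub>M\<^esub> y)"
proof -
  interpret M: Module.module class_ring M using is_gmoduleD(1)[OF M] .
  have B: "B \<subseteq> carrier M" using assms(2) by (simp add: gsubmodule_iff[OF M])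
  have "x = (x \<ominus>\<^bsub>M\<^esub> y) \<oplus>\<^bsub>M\<^esub> y" using assms by (simp add: M.minus_eq M.a_assoc M.l_neg)
  moreover have "(b \<oplus>\<^bsub>M\<^esub> y) \<ominus>\<^bsub>M\<^esub> y = b" if "b \<in> B" for b
    using that B assms by (simp add: M.minus_eq M.a_assoc M.r_neg subset_iff)
  ultimately show ?thesis by metis
qed

text \<open>The butterfly lemma: both factors are identified with a factor of \<open>U\<^sub>1 \<inter> W\<^sub>1\<close>.\<close>

lemma butterfly:
  fixes M :: "('f::field, 'v, 'g) gmodule" and N :: "('f, 'w, 'g) gmodule"
  assumes M: "is_gmodule G M" and U: "gcover G M U0 U1" and W: "gcover G M W0 W1"
    and in1: "U1 \<inter> W0 \<subseteq> U0" and nin1: "\<not> U1 \<inter> W1 \<subseteq> U0"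
  shows "W1 \<inter> U0 \<subseteq> W0" "\<not> W1 \<inter> U1 \<subseteq> W0"
    "(\<exists>f. gepi G M U1 U0 N f) \<Longrightarrow> (\<exists>f. gepi G M W1 W0 N f)"
proof -
  interpret M: Module.module class_ring M using is_gmoduleD(1)[OF M] .
  define X where "X = U1 \<inter> W1"
  have sm: "gsubmodule G M U0" "gsubmodule G M U1" "gsubmodule G M W0" "gsubmodule G M W1"
    and sub: "U0 \<subseteq> U1" "W0 \<subseteq> W1"
    using gcoverD(1-3)[OF U] gcoverD(1-3)[OF W] by simp_all
  have X: "gsubmodule G M X" unfolding X_def by (rule gsubmodule_inter[OF M sm(2,4)])
  have c: "U1 \<subseteq> carrier M" "W1 \<subseteq> carrier M" "X \<subseteq> carrier M" "W0 \<subseteq> carrier M" "U0 \<subseteq> carrier M"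
    using sm X by (auto simp: gsubmodule_iff[OF M])
  show nin2: "\<not> W1 \<inter> U1 \<subseteq> W0" using in1 nin1 by blast
  \<comment> \<open>The modular law in the form used below: a summand lies in U1 as soon as the sum
    and the other summand do.\<close>
  have dec: "w \<in> U1" if "w \<oplus>\<^bsub>M\<^esub> x \<in> U1" "x \<in> U1" "w \<in> carrier M" for w x
  proof -
    have "(w \<oplus>\<^bsub>M\<^esub> x) \<ominus>\<^bsub>M\<^esub> x \<in> U1" using gsubmodule_minus[OF M sm(2)] that by blast
    then show ?thesis using that c by (simp add: M.minus_eq M.a_assoc M.r_neg subset_iff)
  qed
  \<comment> \<open>The sum of W0 and the intersection of W1 with U0 lies between W0 and W1. Were it
    W1, the W0-part of any element common to U1 and W1 would lie in U1, hence in U0 by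
    \<open>in1\<close>, against \<open>nin1\<close>.\<close>
  show in2: "W1 \<inter> U0 \<subseteq> W0"
  proof -
    note i = gsubmodule_inter[OF M sm(4,1)]
    note s = gsum_props[OF M i sm(3)]
    have "gsum M (W1 \<inter> U0) W0 \<subseteq> W1" using s(4)[OF sm(4)] sub by blast
    then have "gsum M (W1 \<inter> U0) W0 = W0 \<or> gsum M (W1 \<inter> U0) W0 = W1"
      by (rule gcoverD(5)[OF W s(1,3)])
    then show ?thesis
    proof
      assume "gsum M (W1 \<inter> U0) W0 = W0"
      then show ?thesis using s(2) by simp
    next
      assume e: "gsum M (W1 \<inter> U0) W0 = W1"
      have "U1 \<inter> W1 \<subseteq> U0"
      proof
        fix x assume x: "x \<in> U1 \<inter> W1"
        then have "x \<in> gsum M (W1 \<inter> U0) W0" using e by simp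
        then obtain u w where uw: "u \<in> W1 \<inter> U0" "w \<in> W0" "x = w \<oplus>\<^bsub>M\<^esub> u" by (auto simp: gsum_def)
        then have "w \<in> U1" using dec[of w u] x sub c by auto
        then have "w \<in> U0" using uw in1 by auto
        then show "x \<in> U0" using uw sm(1) by (simp add: gsubmodule_iff[OF M])
      qed
      then show ?thesis using nin1 by blast
    qed
  qed
  have XW: "gsum M X W0 = W1"
  proof -
    note s = gsum_props[OF M X sm(3)]
    have "gsum M X W0 \<subseteq> W1" using s(4)[OF sm(4)] sub by (simp add: X_def)
    then have "gsum M X W0 = W0 \<or> gsum M X W0 = W1" by (rule gcoverD(5)[OF W s(1,3)])
    moreover have "gsum M X W0 \<noteq> W0" using s(2) nin2 unfolding X_def by blast
    ultimately show ?thesis by blast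
  qed
  have XU: "gsum M X U0 = U1"
  proof -
    note s = gsum_props[OF M X sm(1)]
    have "gsum M X U0 \<subseteq> U1" using s(4)[OF sm(2)] sub by (simp add: X_def)
    then have "gsum M X U0 = U0 \<or> gsum M X U0 = U1" by (rule gcoverD(5)[OF U s(1,3)])
    moreover have "gsum M X U0 \<noteq> U0" using s(2) nin1 unfolding X_def by blast
    ultimately show ?thesis by blast
  qed
  show "\<exists>f. gepi G M W1 W0 N f" if "\<exists>f. gepi G M U1 U0 N f"
  proof -
    from that obtain f where f: "gepi G M U1 U0 N f" by blast
    have fh: "ghom_on G M U1 N f" and fim: "f ` U1 = carrier N" using f by (simp_all add: gepi_def)
    have fk: "f x = f y \<longleftrightarrow> (\<exists>b\<in>U0. x = b \<oplus>\<^bsub>M\<^esub> y)" if "x \<in> U1" "y \<in> U1" for x y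
      using f that minus_mem_iff[OF M sm(1), of x y] c by (auto simp: gepi_def)
    \<comment> \<open>Every y in W1 is w + x with w in W0 and x in X by \<open>XW\<close>; f is
      applied to the part in X. Another choice of x changes it by an element of W0 and U1, so of U0,
      where f sees no difference (\<open>same\<close>).\<close>
    define p where "p y = f (SOME x. x \<in> X \<and> (\<exists>w\<in>W0. y = w \<oplus>\<^bsub>M\<^esub> x))" for y
    have same: "f x = f x'" if "x \<in> X" "x' \<in> X" "w \<in> W0" "w' \<in> W0" "w \<oplus>\<^bsub>M\<^esub> x = w' \<oplus>\<^bsub>M\<^esub> x'" for x x' w w'
    proof -
      have cc: "x \<in> carrier M" "x' \<in> carrier M" "w \<in> carrier M" "w' \<in> carrier M" using that c by auto
      have W0m: "w' \<ominus>\<^bsub>M\<^esub> w \<in> W0" using gsubmodule_minus[OF M sm(3)] that by blast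
      have e: "x = (w' \<ominus>\<^bsub>M\<^esub> w) \<oplus>\<^bsub>M\<^esub> x'"
      proof -
        have "(w' \<ominus>\<^bsub>M\<^esub> w) \<oplus>\<^bsub>M\<^esub> x' = (\<ominus>\<^bsub>M\<^esub> w) \<oplus>\<^bsub>M\<^esub> (w' \<oplus>\<^bsub>M\<^esub> x')"
          using cc by (simp add: M.minus_eq M.a_ac)
        also have "\<dots> = x" using cc that(5)[symmetric] by (simp add: M.a_assoc[symmetric] M.l_neg)
        finally show ?thesis by simp
      qed
      have "w' \<ominus>\<^bsub>M\<^esub> w \<in> U1" using dec[of "w' \<ominus>\<^bsub>M\<^esub> w" x'] e that cc by (simp add: X_def)
      then have "w' \<ominus>\<^bsub>M\<^esub> w \<in> U0" using W0m in1 by blast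
      then show ?thesis using fk[of x x'] e that by (auto simp: X_def)
    qed
    have p: "p (w \<oplus>\<^bsub>M\<^esub> x) = f x" if "x \<in> X" "w \<in> W0" for x w
    proof -
      let ?P = "\<lambda>z. z \<in> X \<and> (\<exists>v\<in>W0. w \<oplus>\<^bsub>M\<^esub> x = v \<oplus>\<^bsub>M\<^esub> z)"
      have "?P x" using that by blast
      then have "?P (SOME z. ?P z)" by (rule someI)
      then obtain v where "(SOME z. ?P z) \<in> X" "v \<in> W0" "w \<oplus>\<^bsub>M\<^esub> x = v \<oplus>\<^bsub>M\<^esub> (SOME z. ?P z)" by blast
      from same[OF that(1) this(1) that(2) this(2,3)] show ?thesis by (simp add: p_def)
    qed
    have dW: "\<exists>x\<in>X. \<exists>w\<in>W0. y = w \<oplus>\<^bsub>M\<^esub> x" if "y \<in> W1" for y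
      using that unfolding XW[symmetric] by (auto simp: gsum_def)
    have XU1: "x \<in> U1" and Xc: "x \<in> carrier M" if "x \<in> X" for x using that c by (auto simp: X_def)
    have wc: "w \<in> carrier M" if "w \<in> W0" for w using that c by auto
    note x = X[unfolded gsubmodule_iff[OF M]] and w0 = sm(3)[unfolded gsubmodule_iff[OF M]]
    have ph: "ghom_on G M W1 N p" unfolding ghom_on_def
    proof (intro conjI ballI allI)
      fix y y' assume "y \<in> W1" "y' \<in> W1"
      then obtain x1 w1 x2 w2 where d: "x1 \<in> X" "w1 \<in> W0" "y = w1 \<oplus>\<^bsub>M\<^esub> x1" "x2 \<in> X" "w2 \<in> W0" "y' = w2 \<oplus>\<^bsub>M\<^esub> x2"
        using dW by meson
      then have "y \<oplus>\<^bsub>M\<^esub> y' = (w1 \<oplus>\<^bsub>M\<^esub> w2) \<oplus>\<^bsub>M\<^esub> (x1 \<oplus>\<^bsub>M\<^esub> x2)" using Xc wc by (simp add: M.a_ac)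
      then show "p (y \<oplus>\<^bsub>M\<^esub> y') = p y \<oplus>\<^bsub>N\<^esub> p y'"
        using d x w0 p ghom_onD(1)[OF fh] XU1 by simp
    next
      fix r y assume "y \<in> W1"
      then obtain x1 w1 where d: "x1 \<in> X" "w1 \<in> W0" "y = w1 \<oplus>\<^bsub>M\<^esub> x1" using dW by meson
      then have "r \<odot>\<^bsub>M\<^esub> y = r \<odot>\<^bsub>M\<^esub> w1 \<oplus>\<^bsub>M\<^esub> r \<odot>\<^bsub>M\<^esub> x1" using Xc wc M.smult_r_distr by simp
      then show "p (r \<odot>\<^bsub>M\<^esub> y) = r \<odot>\<^bsub>N\<^esub> p y"
        using d x w0 p ghom_onD(2)[OF fh] XU1 by simp
    next
      fix s y assume s: "s \<in> carrier G" and "y \<in> W1"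
      then obtain x1 w1 where d: "x1 \<in> X" "w1 \<in> W0" "y = w1 \<oplus>\<^bsub>M\<^esub> x1" using dW by meson
      then have "act M s y = act M s w1 \<oplus>\<^bsub>M\<^esub> act M s x1" using Xc wc is_gmoduleD(3)[OF M s] by simp
      then show "p (act M s y) = act N s (p y)"
        using d x w0 p ghom_onD(3)[OF fh s] XU1 s by simp
    qed
    have zW: "\<zero>\<^bsub>M\<^esub> \<in> W0" using w0 by simp
    have pX: "p z = f z" if "z \<in> X" for z using p[OF that zW] Xc[OF that] by simp
    have pim: "p ` W1 = carrier N"
    proof
      show "p ` W1 \<subseteq> carrier N" using dW p fim XU1 by fastforce
      show "carrier N \<subseteq> p ` W1"
      proof
        fix n assume "n \<in> carrier N"
        then obtain u where u: "u \<in> U1" "n = f u" using fim by blast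
        then have "u \<in> gsum M X U0" using XU by simp
        then obtain z b where z: "z \<in> X" "b \<in> U0" "u = b \<oplus>\<^bsub>M\<^esub> z" by (auto simp: gsum_def)
        then have "f u = f z" using fk[of u z] u XU1 by blast
        then have "n = p z" using pX z u by simp
        moreover have "z \<in> W1" using z by (simp add: X_def)
        ultimately show "n \<in> p ` W1" by blast
      qed
    qed
    have "p y = p y' \<longleftrightarrow> y \<ominus>\<^bsub>M\<^esub> y' \<in> W0" if yy: "y \<in> W1" "y' \<in> W1" for y y'
    proof -
      obtain x1 w1 where d1: "x1 \<in> X" "w1 \<in> W0" "y = w1 \<oplus>\<^bsub>M\<^esub> x1" using dW[OF yy(1)] by meson
      obtain x2 w2 where d2: "x2 \<in> X" "w2 \<in> W0" "y' = w2 \<oplus>\<^bsub>M\<^esub> x2" using dW[OF yy(2)] by meson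
      have cc: "x1 \<in> carrier M" "x2 \<in> carrier M" "w1 \<in> carrier M" "w2 \<in> carrier M"
        using d1 d2 Xc wc by auto
      have "p y = p y' \<longleftrightarrow> f x1 = f x2" using p d1 d2 by simp
      also have "\<dots> \<longleftrightarrow> x1 \<ominus>\<^bsub>M\<^esub> x2 \<in> U0" using f d1 d2 XU1 by (simp add: gepi_def)
      \<comment> \<open>On X the two kernels agree: by \<open>in1\<close> and \<open>in2\<close> the
        submodules U0 and W0 cut out the same part of X.\<close>
      also have "\<dots> \<longleftrightarrow> x1 \<ominus>\<^bsub>M\<^esub> x2 \<in> W0"
      proof -
        have "x1 \<ominus>\<^bsub>M\<^esub> x2 \<in> X" using gsubmodule_minus[OF M X] d1 d2 by blast
        then show ?thesis using in1 in2 unfolding X_def by blast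
      qed
      also have "\<dots> \<longleftrightarrow> y \<ominus>\<^bsub>M\<^esub> y' \<in> W0"
      proof -
        have e: "y \<ominus>\<^bsub>M\<^esub> y' = (w1 \<ominus>\<^bsub>M\<^esub> w2) \<oplus>\<^bsub>M\<^esub> (x1 \<ominus>\<^bsub>M\<^esub> x2)"
          using cc d1 d2 by (simp add: M.minus_eq M.minus_add M.a_ac)
        have ww: "w1 \<ominus>\<^bsub>M\<^esub> w2 \<in> W0" using gsubmodule_minus[OF M sm(3)] d1 d2 by blast
        have e2: "x1 \<ominus>\<^bsub>M\<^esub> x2 = (y \<ominus>\<^bsub>M\<^esub> y') \<ominus>\<^bsub>M\<^esub> (w1 \<ominus>\<^bsub>M\<^esub> w2)"
        proof -
          have k: "(a \<oplus>\<^bsub>M\<^esub> b) \<ominus>\<^bsub>M\<^esub> a = b" if "a \<in> carrier M" "b \<in> carrier M" for a b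
          proof -
            have "(a \<oplus>\<^bsub>M\<^esub> b) \<ominus>\<^bsub>M\<^esub> a = b \<oplus>\<^bsub>M\<^esub> (a \<oplus>\<^bsub>M\<^esub> (\<ominus>\<^bsub>M\<^esub> a))"
              using that by (simp add: M.minus_eq M.a_ac)
            then show ?thesis using that by (simp add: M.r_neg)
          qed
          show ?thesis unfolding e using k[of "w1 \<ominus>\<^bsub>M\<^esub> w2" "x1 \<ominus>\<^bsub>M\<^esub> x2"] cc by simp
        qed
        show ?thesis
        proof
          assume "x1 \<ominus>\<^bsub>M\<^esub> x2 \<in> W0"
          then show "y \<ominus>\<^bsub>M\<^esub> y' \<in> W0" unfolding e using ww w0 by simp
        next
          assume "y \<ominus>\<^bsub>M\<^esub> y' \<in> W0"
          then show "x1 \<ominus>\<^bsub>M\<^esub> x2 \<in> W0" unfolding e2 using ww gsubmodule_minus[OF M sm(3)] by blast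
        qed
      qed
      finally show ?thesis .
    qed
    then have "gepi G M W1 W0 N p" unfolding gepi_def using ph pim by blast
    then show ?thesis by blast
  qed
qed

text \<open>Zassenhaus refinement: for fixed i the sums of \<open>Us ! i\<close> and the
  intersection of \<open>Us ! Suc i\<close> with \<open>Ws ! j\<close> increase with j from
  \<open>Us ! i\<close> to \<open>Us ! Suc i\<close>. As the latter covers the former there is one
  jump, and j marks it.\<close>

definition jh_match :: "'v set list \<Rightarrow> 'v set list \<Rightarrow> nat \<Rightarrow> nat \<Rightarrow> bool" where
  "jh_match Us Ws i j \<longleftrightarrow> Us ! Suc i \<inter> Ws ! j \<subseteq> Us ! i \<and> \<not> Us ! Suc i \<inter> Ws ! Suc j \<subseteq> Us ! i"

lemma composition_seriesD:
  assumes G: "monoid G" and s: "composition_series G M Us"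
  shows "is_gmodule G M" "Us ! 0 = {\<zero>\<^bsub>M\<^esub>}" "Us ! (length Us - 1) = carrier M"
    "\<And>i. i < length Us \<Longrightarrow> gsubmodule G M (Us ! i)"
    "\<And>i. Suc i < length Us \<Longrightarrow> Us ! i \<subseteq> Us ! Suc i"
    "\<And>i. Suc i < length Us \<Longrightarrow> gcover G M (Us ! i) (Us ! Suc i)"
    "\<And>i j. i \<le> j \<Longrightarrow> j < length Us \<Longrightarrow> Us ! i \<subseteq> Us ! j"
proof -
  show M: "is_gmodule G M" using s by (simp add: composition_series_def)
  show "Us ! 0 = {\<zero>\<^bsub>M\<^esub>}" "Us ! (length Us - 1) = carrier M"
    using s by (auto simp: composition_series_def hd_conv_nth last_conv_nth)
  show sub: "gsubmodule G M (Us ! i)" if "i < length Us" for i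
    using s that by (simp add: composition_series_def)
  show le: "Us ! i \<subseteq> Us ! Suc i" if "Suc i < length Us" for i
    using s that by (simp add: composition_series_def)
  show "gcover G M (Us ! i) (Us ! Suc i)" if i: "Suc i < length Us" for i
  proof -
    have "gsimple G (series_factor M Us i)" using s i by (simp add: composition_series_def)
    then show ?thesis unfolding series_factor_def
      using gsimple_factor_iff[OF G M sub sub le[OF i]] i by simp
  qed
  show "Us ! i \<subseteq> Us ! j" if "i \<le> j" "j < length Us" for i j
    using that
  proof (induction j rule: dec_induct)
    case (step k)
    then show ?case using le[of k] by simp
  qed simp
qed

text \<open>The intersection with \<open>Us ! Suc i\<close> is zero at the bottom of
  \<open>Ws\<close> and everything at the top, so there is a first index at which it is no longer
  contained in \<open>Us ! i\<close>.\<close>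

lemma jh_match_ex:
  assumes G: "monoid G" and U: "composition_series G M Us" and W: "composition_series G M Ws"
    and i: "Suc i < length Us"
  shows "\<exists>j. Suc j < length Ws \<and> jh_match Us Ws i j"
proof -
  note u = composition_seriesD[OF G U] and w = composition_seriesD[OF G W]
  define P where "P = (\<lambda>j. \<not> Us ! Suc i \<inter> Ws ! j \<subseteq> Us ! i)"
  have "Us ! i \<subset> Us ! Suc i" using u(6)[OF i] by (simp add: gcover_def)
  moreover have "Us ! Suc i \<subseteq> carrier M" using u(4)[OF i] by (simp add: gsubmodule_iff[OF u(1)])
  ultimately have "P (length Ws - 1)" unfolding P_def w(3) by blast
  moreover have "\<not> P 0"
    using u(4)[of i] i unfolding P_def w(2) by (auto simp: gsubmodule_iff[OF u(1)])
  ultimately obtain k where "k < length Ws - 1" "\<forall>j\<le>k. \<not> P j" "P (Suc k)"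
    using ex_least_nat_less[of P] by blast
  then show ?thesis unfolding jh_match_def P_def by (intro exI[of _ k]) auto
qed

text \<open>Once the intersection with \<open>Ws ! Suc a\<close> has left \<open>Us ! i\<close>, all
  later ones have left it too, which excludes a second match.\<close>

lemma jh_match_unique:
  assumes G: "monoid G" and W: "composition_series G M Ws"
    and "Suc j < length Ws" "Suc j' < length Ws" "jh_match Us Ws i j" "jh_match Us Ws i j'"
  shows "j = j'"
proof -
  note w = composition_seriesD(7)[OF G W]
  have "\<not> a < b" if "Suc b < length Ws" "jh_match Us Ws i a" "jh_match Us Ws i b" for a b
  proof
    assume "a < b"
    then have "Ws ! Suc a \<subseteq> Ws ! b" using w[of "Suc a" b] that(1) by simp
    then show False using that(2,3) unfolding jh_match_def by blast
  qed
  then show ?thesis using assms by (meson linorder_neqE_nat)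
qed

text \<open>The butterfly lemma read from both sides. The symmetry makes the matching injective, and
  the second part lets it preserve isomorphism with N.\<close>

lemma jh_match_sym:
  assumes G: "monoid G" and U: "composition_series G M Us" and W: "composition_series G M Ws"
    and i: "Suc i < length Us" and j: "Suc j < length Ws" and m: "jh_match Us Ws i j"
  shows "jh_match Ws Us j i"
    "giso G (series_factor M Us i) N \<Longrightarrow> giso G (series_factor M Ws j) N"
proof -
  note u = composition_seriesD[OF G U] and w = composition_seriesD[OF G W]
  note b = butterfly[OF u(1) u(6)[OF i] w(6)[OF j]
      m[unfolded jh_match_def, THEN conjunct1] m[unfolded jh_match_def, THEN conjunct2]]
  show "jh_match Ws Us j i" unfolding jh_match_def using b(1,2) by blast
  have fu: "giso G (series_factor M Us i) N \<longleftrightarrow> (\<exists>f. gepi G M (Us ! Suc i) (Us ! i) N f)"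
    unfolding series_factor_def by (rule giso_factor_iff[OF u(1)]) (use i u in auto)
  have fw: "giso G (series_factor M Ws j) N \<longleftrightarrow> (\<exists>f. gepi G M (Ws ! Suc j) (Ws ! j) N f)"
    unfolding series_factor_def by (rule giso_factor_iff[OF u(1)]) (use j w in auto)
  show "giso G (series_factor M Us i) N \<Longrightarrow> giso G (series_factor M Ws j) N"
    unfolding fu fw by (rule b(3))
qed

lemma jordan_hoelder_card_le:
  assumes G: "monoid G" and U: "composition_series G M Us" and W: "composition_series G M Ws"
  shows "card {i. Suc i < length Us \<and> giso G (series_factor M Us i) N}
    \<le> card {j. Suc j < length Ws \<and> giso G (series_factor M Ws j) N}"
proof -
  define p where "p = (\<lambda>i. SOME j. Suc j < length Ws \<and> jh_match Us Ws i j)"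
  have p: "Suc (p i) < length Ws" "jh_match Us Ws i (p i)" if "Suc i < length Us" for i
    using someI_ex[OF jh_match_ex[OF G U W that]] by (simp_all add: p_def)
  show ?thesis
  proof (rule card_inj_on_le[where f = p])
    show "inj_on p {i. Suc i < length Us \<and> giso G (series_factor M Us i) N}"
    proof (rule inj_onI)
      fix a b assume "a \<in> {i. Suc i < length Us \<and> giso G (series_factor M Us i) N}"
        "b \<in> {i. Suc i < length Us \<and> giso G (series_factor M Us i) N}" and e: "p a = p b"
      then have a: "Suc a < length Us" and b: "Suc b < length Us" by auto
      show "a = b"
        by (rule jh_match_unique[OF G U a b, of Ws "p a"])
          (use jh_match_sym(1)[OF G U W a p[OF a]] jh_match_sym(1)[OF G U W b p[OF b]] e in auto)
    qed
    show "p ` {i. Suc i < length Us \<and> giso G (series_factor M Us i) N}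
        \<subseteq> {j. Suc j < length Ws \<and> giso G (series_factor M Ws j) N}"
      using p(1) jh_match_sym(2)[OF G U W _ p(1) p(2)] by auto
  qed (rule finite_subset[of _ "{..<length Ws}"], auto)
qed

lemma has_multiplicityI:
  assumes "monoid G" "composition_series G M Ws"
    and "card {i. Suc i < length Ws \<and> giso G (series_factor M Ws i) S} = m"
  shows "has_multiplicity G M S m"
  unfolding has_multiplicity_def
proof (intro conjI allI impI)
  show "\<exists>Ws. composition_series G M Ws" using assms(2) by (rule exI)
  fix Us assume U: "composition_series G M Us"
  show "card {i. Suc i < length Us \<and> giso G (series_factor M Us i) S} = m"
    unfolding assms(3)[symmetric]
    by (intro antisym jordan_hoelder_card_le[OF assms(1) U assms(2)]
        jordan_hoelder_card_le[OF assms(1,2) U])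
qed

text \<open>The transfer of \<open>jh_match_sym\<close> is used from the fixed series to the one
  that contains S. A test module N carries the isomorphism, so that its type may differ from that of
  the factors.\<close>

lemma composition_factor_series:
  assumes G: "monoid G" and W: "composition_series G M Ws" and "composition_factor G M S"
  shows "\<exists>j. Suc j < length Ws \<and> (\<forall>N. giso G (series_factor M Ws j) N \<longrightarrow> giso G S N)"
proof -
  from assms obtain Us i where U: "composition_series G M Us" and i: "Suc i < length Us"
    and S: "S = series_factor M Us i"
    unfolding composition_factor_def by blast
  from jh_match_ex[OF G U W i] obtain j where j: "Suc j < length Ws" "jh_match Us Ws i j" by blast
  show ?thesis
    using j jh_match_sym(2)[OF G W U j(1) i jh_match_sym(1)[OF G U W i j]] S by blast
qed

section \<open>Symplectic matrices\<close>

text \<open>The index that the intersection form pairs with \<open>p\<close>.\<close>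

definition conjx :: "nat \<Rightarrow> nat" where
  "conjx p = (if even p then p + 1 else p - 1)"

definition Jmat :: "nat \<Rightarrow> 'r::comm_ring_1 mat" where
  "Jmat g = mat (2 * g) (2 * g) (\<lambda>(i, j). if j = conjx i then (if even i then 1 else - 1) else 0)"

lemma conjx_less: "p < 2 * g \<Longrightarrow> conjx p < 2 * g"
  by (auto simp: conjx_def elim!: evenE)

lemma conjx_conjx [simp]: "conjx (conjx p) = p"
  by (auto simp: conjx_def)

lemma conjx_neq [simp]: "conjx p \<noteq> p" "p \<noteq> conjx p"
  by (auto simp: conjx_def elim!: oddE)

lemma even_conjx [simp]: "even (conjx p) \<longleftrightarrow> odd p"
  by (auto simp: conjx_def)

lemma conjx_eq_iff: "conjx p = q \<longleftrightarrow> p = conjx q"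
  using conjx_conjx by metis

lemma Jmat_carrier [simp]: "Jmat g \<in> carrier_mat (2 * g) (2 * g)"
  by (simp add: Jmat_def)

lemma Jmat_dim [simp]: "dim_row (Jmat g) = 2 * g" "dim_col (Jmat g) = 2 * g"
  by (simp_all add: Jmat_def)

lemma Jmat_vec_carrier [simp]: "v \<in> carrier_vec (2 * g) \<Longrightarrow> Jmat g *\<^sub>v v \<in> carrier_vec (2 * g)"
  by (rule mult_mat_vec_carrier) simp_all

lemma Jmat_mult_vec:
  assumes "v \<in> carrier_vec (2 * g)" "p < 2 * g"
  shows "(Jmat g *\<^sub>v v) $ p = (if even p then v $ conjx p else - v $ conjx p)"
proof -
  have "(Jmat g *\<^sub>v v) $ p =
      (\<Sum>j\<in>{0..<2 * g}. (if j = conjx p then (if even p then 1 else - 1) else 0) * v $ j)"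
    using assms by (auto simp: Jmat_def scalar_prod_def intro!: sum.cong)
  also have "\<dots> = (\<Sum>j\<in>{0..<2 * g}. if j = conjx p then (if even p then v $ j else - v $ j) else 0)"
    by (intro sum.cong) auto
  also have "\<dots> = (if even p then v $ conjx p else - v $ conjx p)"
    using conjx_less[OF assms(2)] by simp
  finally show ?thesis .
qed

lemma sum_pairs: "(\<Sum>i\<in>{0..<2 * g}. f i) = (\<Sum>j<g. f (2 * j) + f (2 * j + 1 :: nat))"
  for f :: "nat \<Rightarrow> 'a::comm_monoid_add"
  by (induction g) (simp_all add: add.assoc)

lemma intersection_form_eq:
  assumes "v \<in> carrier_vec (2 * g)" "w \<in> carrier_vec (2 * g)"
  shows "intersection_form g v w = v \<bullet> (Jmat g *\<^sub>v w)"
proof -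
  have "v \<bullet> (Jmat g *\<^sub>v w) = (\<Sum>p\<in>{0..<2 * g}. v $ p * (Jmat g *\<^sub>v w) $ p)"
    using assms by (simp add: scalar_prod_def)
  also have "\<dots> = (\<Sum>p\<in>{0..<2 * g}. v $ p * (if even p then w $ conjx p else - w $ conjx p))"
    using assms by (intro sum.cong) (simp_all add: Jmat_mult_vec del: index_mult_mat_vec)
  also have "\<dots> = intersection_form g v w"
    unfolding sum_pairs intersection_form_def
    by (intro sum.cong) (simp_all add: conjx_def)
  finally show ?thesis by simp
qed

lemma Jmat_transpose: "transpose_mat (Jmat g) = - (Jmat g :: 'r::comm_ring_1 mat)"
  by (rule eq_matI) (auto simp: Jmat_def conjx_eq_iff)

lemma mat_eqI_vec:
  assumes "A \<in> carrier_mat m n" "B \<in> carrier_mat m n"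
    and "\<And>v. v \<in> carrier_vec n \<Longrightarrow> A *\<^sub>v v = B *\<^sub>v (v :: 'r::comm_ring_1 vec)"
  shows "A = B"
proof (rule eq_matI)
  fix i j assume "i < dim_row B" "j < dim_col B"
  then have ij: "i < m" "j < n" using assms(2) by auto
  have "(A *\<^sub>v unit_vec n j) $ i = (B *\<^sub>v unit_vec n j) $ i" using assms(3) by simp
  then show "A $$ (i, j) = B $$ (i, j)" using ij assms(1,2) by simp
qed (use assms in auto)

lemma Jmat_sq: "Jmat g * Jmat g = - (1\<^sub>m (2 * g) :: 'r::comm_ring_1 mat)"
proof (rule mat_eqI_vec[of _ "2 * g" "2 * g"])
  fix v :: "'r vec" assume v: "v \<in> carrier_vec (2 * g)"
  have "Jmat g *\<^sub>v (Jmat g *\<^sub>v v) = - v"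
    using v by (intro eq_vecI) (auto simp: Jmat_mult_vec conjx_less simp del: index_mult_mat_vec)
  then show "Jmat g * Jmat g *\<^sub>v v = - 1\<^sub>m (2 * g) *\<^sub>v v"
    using v by (simp add: assoc_mult_mat_vec[OF Jmat_carrier Jmat_carrier v])
qed (simp_all add: mult_carrier_mat[OF Jmat_carrier Jmat_carrier])

lemma Jmat_anti:
  assumes "v \<in> carrier_vec (2 * g)" "w \<in> carrier_vec (2 * g)"
  shows "(Jmat g *\<^sub>v v) \<bullet> w = - (v \<bullet> (Jmat g *\<^sub>v w))"
proof -
  have "(transpose_mat (Jmat g) *\<^sub>v v) \<bullet> w = v \<bullet> (Jmat g *\<^sub>v w)"
    by (rule transpose_vec_mult_scalar[of _ "2 * g" "2 * g"]) (use assms in simp_all)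
  moreover have "(- Jmat g *\<^sub>v v) \<bullet> w = - ((Jmat g *\<^sub>v v) \<bullet> w)" using assms by simp
  ultimately show ?thesis unfolding Jmat_transpose by (metis minus_minus)
qed

lemma scalar_prod_Jmat_self:
  assumes "v \<in> carrier_vec (2 * g)"
  shows "v \<bullet> (Jmat g *\<^sub>v v) = 0"
  unfolding intersection_form_eq[OF assms assms, symmetric] intersection_form_def
  by (simp add: mult.commute)

lemma mat_eqI_form:
  assumes A: "A \<in> carrier_mat n n" and B: "B \<in> carrier_mat n n"
    and e: "\<And>v w. v \<in> carrier_vec n \<Longrightarrow> w \<in> carrier_vec n \<Longrightarrow> v \<bullet> (A *\<^sub>v w) = v \<bullet> (B *\<^sub>v (w :: 'r::comm_ring_1 vec))"
  shows "A = B"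
proof (rule mat_eqI_vec[OF A B], rule eq_vecI)
  fix v :: "'r vec" and i assume v: "v \<in> carrier_vec n" and "i < dim_vec (B *\<^sub>v v)"
  then have i: "i < n" using B by simp
  have "A *\<^sub>v v \<in> carrier_vec n" "B *\<^sub>v v \<in> carrier_vec n" using A B v by simp_all
  then show "(A *\<^sub>v v) $ i = (B *\<^sub>v v) $ i" using e[OF unit_vec_carrier v, of i] i by simp
qed (use A B in simp)

text \<open>For an isometry A the forms with Gram matrices A^T J A and J agree, and a bilinear form
  determines its Gram matrix.\<close>

lemma Sp_iff:
  "A \<in> carrier (Sp g) \<longleftrightarrow> A \<in> carrier_mat (2 * g) (2 * g) \<and>
     transpose_mat A * (Jmat g * A) = (Jmat g :: 'r::comm_ring_1 mat)"
proof -
  have *: "intersection_form g (A *\<^sub>v v) (A *\<^sub>v w) = v \<bullet> ((transpose_mat A * (Jmat g * A)) *\<^sub>v w)"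
    if A: "A \<in> carrier_mat (2 * g) (2 * g)" and v: "v \<in> carrier_vec (2 * g)" and w: "w \<in> carrier_vec (2 * g)"
    for v w :: "'r vec"
  proof -
    have Aw: "A *\<^sub>v v \<in> carrier_vec (2 * g)" "A *\<^sub>v w \<in> carrier_vec (2 * g)" using A v w by simp_all
    have JA: "Jmat g * A \<in> carrier_mat (2 * g) (2 * g)" using mult_carrier_mat[OF Jmat_carrier A] .
    have "intersection_form g (A *\<^sub>v v) (A *\<^sub>v w) = (A *\<^sub>v v) \<bullet> (Jmat g *\<^sub>v (A *\<^sub>v w))"
      by (rule intersection_form_eq[OF Aw])
    also have "\<dots> = (transpose_mat (transpose_mat A) *\<^sub>v v) \<bullet> ((Jmat g * A) *\<^sub>v w)"
      using assoc_mult_mat_vec[OF Jmat_carrier A w] by simp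
    also have "\<dots> = v \<bullet> (transpose_mat A *\<^sub>v ((Jmat g * A) *\<^sub>v w))"
      by (rule transpose_vec_mult_scalar[of _ "2 * g" "2 * g"]) (use A v w JA in simp_all)
    also have "\<dots> = v \<bullet> ((transpose_mat A * (Jmat g * A)) *\<^sub>v w)"
      using assoc_mult_mat_vec[of "transpose_mat A" "2 * g" "2 * g" "Jmat g * A" "2 * g" w] A JA w by simp
    finally show ?thesis .
  qed
  show ?thesis
  proof
    assume A: "A \<in> carrier (Sp g)"
    then have c: "A \<in> carrier_mat (2 * g) (2 * g)" by (simp add: Sp_def)
    have "transpose_mat A * (Jmat g * A) = Jmat g"
    proof (rule mat_eqI_form[of _ "2 * g"])
      show "transpose_mat A * (Jmat g * A) \<in> carrier_mat (2 * g) (2 * g)"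
        using c mult_carrier_mat[OF Jmat_carrier c] by (intro mult_carrier_mat[of _ _ "2 * g"]) simp_all
      fix v w :: "'r vec" assume vw: "v \<in> carrier_vec (2 * g)" "w \<in> carrier_vec (2 * g)"
      show "v \<bullet> (transpose_mat A * (Jmat g * A) *\<^sub>v w) = v \<bullet> (Jmat g *\<^sub>v w)"
        using A vw *[OF c vw] intersection_form_eq[OF vw] by (simp add: Sp_def)
    qed simp
    with c show "A \<in> carrier_mat (2 * g) (2 * g) \<and> transpose_mat A * (Jmat g * A) = Jmat g" by blast
  next
    assume "A \<in> carrier_mat (2 * g) (2 * g) \<and> transpose_mat A * (Jmat g * A) = Jmat g"
    then have "A \<in> carrier_mat (2 * g) (2 * g)"
      "\<And>v w. v \<in> carrier_vec (2 * g) \<Longrightarrow> w \<in> carrier_vec (2 * g) \<Longrightarrow>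
        intersection_form g (A *\<^sub>v v) (A *\<^sub>v w) = intersection_form g v w"
      using * by (simp_all add: intersection_form_eq)
    then show "A \<in> carrier (Sp g)" by (simp add: Sp_def)
  qed
qed

text \<open>Over a commutative ring \<open>L * A = 1\<close> makes the determinant of A a unit, so
  the adjugate provides a right inverse, which must be L.\<close>

lemma mat_left_inverse_right:
  fixes A :: "'r::comm_ring_1 mat"
  assumes A: "A \<in> carrier_mat n n" and L: "L \<in> carrier_mat n n" and LA: "L * A = 1\<^sub>m n"
  shows "A * L = 1\<^sub>m n"
proof -
  have d: "det L * det A = 1" using det_mult[OF L A] LA by simp
  define R where "R = det L \<cdot>\<^sub>m adj_mat A"
  have ad: "adj_mat A \<in> carrier_mat n n" "A * adj_mat A = det A \<cdot>\<^sub>m 1\<^sub>m n" using adj_mat[OF A] by auto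
  have R: "R \<in> carrier_mat n n" using ad by (simp add: R_def)
  have AR: "A * R = 1\<^sub>m n"
    unfolding R_def mult_smult_distrib[OF A ad(1)] ad(2) using d by auto
  have "L = L * (A * R)" using AR L by simp
  also have "\<dots> = R" using assoc_mult_mat[OF L A R] LA R by simp
  finally show ?thesis using AR by simp
qed

text \<open>The inverse of a symplectic matrix, solved from A^T J A = J with J^2 = -1. The formula
  is polynomial in the entries, so an integral matrix has an integral inverse.\<close>

definition sp_inv :: "nat \<Rightarrow> 'r::comm_ring_1 mat \<Rightarrow> 'r mat" where
  "sp_inv g A = - (Jmat g * (transpose_mat A * Jmat g))"

lemma sp_inv_carrier [simp]: "A \<in> carrier_mat (2 * g) (2 * g) \<Longrightarrow> sp_inv g A \<in> carrier_mat (2 * g) (2 * g)"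
  unfolding sp_inv_def
  by (intro uminus_carrier_mat mult_carrier_mat[of _ "2 * g" "2 * g"]) simp_all

lemma sp_inv_left:
  assumes "A \<in> carrier (Sp g)"
  shows "sp_inv g A * A = 1\<^sub>m (2 * g)"
proof -
  let ?n = "2 * g" and ?J = "Jmat g"
  have A: "A \<in> carrier_mat ?n ?n" and e: "transpose_mat A * (?J * A) = ?J"
    using assms by (simp_all add: Sp_iff)
  have T: "transpose_mat A \<in> carrier_mat ?n ?n" using A by simp
  have TJ: "transpose_mat A * ?J \<in> carrier_mat ?n ?n" using T by (intro mult_carrier_mat[OF T]) simp
  have "(?J * (transpose_mat A * ?J)) * A = ?J * ((transpose_mat A * ?J) * A)"
    by (rule assoc_mult_mat[OF Jmat_carrier TJ A])
  also have "\<dots> = ?J * ?J" unfolding assoc_mult_mat[OF T Jmat_carrier A] e ..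
  finally have "(?J * (transpose_mat A * ?J)) * A = - 1\<^sub>m ?n" unfolding Jmat_sq .
  moreover have "dim_col (?J * (transpose_mat A * ?J)) = dim_row A" using A by simp
  ultimately show ?thesis unfolding sp_inv_def by (simp add: uminus_mult_left_mat)
qed

lemma sp_inv_right:
  assumes "A \<in> carrier (Sp g)"
  shows "A * sp_inv g A = 1\<^sub>m (2 * g)"
proof -
  have A: "A \<in> carrier_mat (2 * g) (2 * g)" using assms by (simp add: Sp_iff)
  show ?thesis by (rule mat_left_inverse_right[OF A _ sp_inv_left[OF assms]]) (use A in simp)
qed

text \<open>This equation turns conjugation into congruence: A C A^-1 J equals A (C J) A^T.\<close>

lemma sp_inv_J:
  assumes "A \<in> carrier_mat (2 * g) (2 * g)"
  shows "sp_inv g A * Jmat g = Jmat g * transpose_mat (A :: 'r::comm_ring_1 mat)"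
proof -
  let ?n = "2 * g" and ?J = "Jmat g :: 'r mat"
  have T: "transpose_mat A \<in> carrier_mat ?n ?n" using assms by simp
  have TJ: "transpose_mat A * ?J \<in> carrier_mat ?n ?n" by (rule mult_carrier_mat[OF T]) simp
  have 1: "dim_col (?J * (transpose_mat A * ?J)) = dim_row ?J" using assms by simp
  have "sp_inv g A * ?J = - (?J * (transpose_mat A * ?J) * ?J)"
    unfolding sp_inv_def using 1 by (rule uminus_mult_left_mat)
  also have "?J * (transpose_mat A * ?J) * ?J = ?J * (transpose_mat A * (?J * ?J))"
    unfolding assoc_mult_mat[OF Jmat_carrier TJ Jmat_carrier] assoc_mult_mat[OF T Jmat_carrier Jmat_carrier] ..
  also have "\<dots> = - (?J * transpose_mat A)"
    unfolding Jmat_sq using T by simp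
  finally show ?thesis by simp
qed

lemma Sp_mult_closed:
  assumes "A \<in> carrier (Sp g)" "B \<in> carrier (Sp g)"
  shows "A * B \<in> carrier (Sp g)"
proof -
  from assms have c: "A \<in> carrier_mat (2 * g) (2 * g)" "B \<in> carrier_mat (2 * g) (2 * g)"
    by (simp_all add: Sp_def)
  have f: "intersection_form g (C *\<^sub>v v) (C *\<^sub>v w) = intersection_form g v w"
    if "C \<in> carrier (Sp g)" "v \<in> carrier_vec (2 * g)" "w \<in> carrier_vec (2 * g)" for C v w
    using that by (simp add: Sp_def)
  show ?thesis using c f[OF assms(1)] f[OF assms(2)]
    by (simp add: Sp_def assoc_mult_mat_vec[OF c] mult_carrier_mat[OF c])
qed

lemma sp_inv_in_Sp:
  assumes A: "A \<in> carrier (Sp g)"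
  shows "sp_inv g A \<in> carrier (Sp g)"
proof -
  have c: "A \<in> carrier_mat (2 * g) (2 * g)" using A by (simp add: Sp_def)
  have L: "sp_inv g A \<in> carrier_mat (2 * g) (2 * g)" using c by simp
  have e: "A *\<^sub>v (sp_inv g A *\<^sub>v v) = v" if "v \<in> carrier_vec (2 * g)" for v
    using assoc_mult_mat_vec[OF c L that] sp_inv_right[OF A] that by simp
  have "intersection_form g (sp_inv g A *\<^sub>v v) (sp_inv g A *\<^sub>v w) = intersection_form g v w"
    if vw: "v \<in> carrier_vec (2 * g)" "w \<in> carrier_vec (2 * g)" for v w
  proof -
    have "sp_inv g A *\<^sub>v v \<in> carrier_vec (2 * g)" "sp_inv g A *\<^sub>v w \<in> carrier_vec (2 * g)"
      using L vw by simp_all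
    then have "intersection_form g (A *\<^sub>v (sp_inv g A *\<^sub>v v)) (A *\<^sub>v (sp_inv g A *\<^sub>v w)) =
        intersection_form g (sp_inv g A *\<^sub>v v) (sp_inv g A *\<^sub>v w)"
      using A by (simp add: Sp_def)
    then show ?thesis using e vw by simp
  qed
  then show ?thesis using L by (simp add: Sp_def)
qed

lemma one_in_Sp: "1\<^sub>m (2 * g) \<in> carrier (Sp g)"
  by (simp add: Sp_def)

lemma group_Sp: "group (Sp g :: 'r::comm_ring_1 mat monoid)"
proof (rule groupI)
  fix A :: "'r mat" assume A: "A \<in> carrier (Sp g)"
  show "\<exists>B\<in>carrier (Sp g). B \<otimes>\<^bsub>Sp g\<^esub> A = \<one>\<^bsub>Sp g\<^esub>"
    using sp_inv_in_Sp[OF A] sp_inv_left[OF A] by (intro bexI[of _ "sp_inv g A"]) (simp_all add: Sp_def)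
next
  fix A B C :: "'r mat" assume "A \<in> carrier (Sp g)" "B \<in> carrier (Sp g)" "C \<in> carrier (Sp g)"
  then have c: "A \<in> carrier_mat (2 * g) (2 * g)" "B \<in> carrier_mat (2 * g) (2 * g)" "C \<in> carrier_mat (2 * g) (2 * g)"
    by (simp_all add: Sp_iff)
  show "A \<otimes>\<^bsub>Sp g\<^esub> B \<otimes>\<^bsub>Sp g\<^esub> C = A \<otimes>\<^bsub>Sp g\<^esub> (B \<otimes>\<^bsub>Sp g\<^esub> C)"
    using assoc_mult_mat[OF c] by (simp add: Sp_def)
next
  show "\<one>\<^bsub>Sp g\<^esub> \<in> carrier (Sp g)" using one_in_Sp by (simp add: Sp_def)
next
  fix A B :: "'r mat" assume "A \<in> carrier (Sp g)" "B \<in> carrier (Sp g)"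
  then show "A \<otimes>\<^bsub>Sp g\<^esub> B \<in> carrier (Sp g)" using Sp_mult_closed by (simp add: Sp_def)
next
  fix A :: "'r mat" assume "A \<in> carrier (Sp g)"
  then have "A \<in> carrier_mat (2 * g) (2 * g)" by (simp add: Sp_iff)
  then show "\<one>\<^bsub>Sp g\<^esub> \<otimes>\<^bsub>Sp g\<^esub> A = A" by (simp add: Sp_def)
qed

lemma Sp_simps [simp]: "mult (Sp g) = (*)" "one (Sp g) = 1\<^sub>m (2 * g)"
  by (simp_all add: Sp_def)

lemma Sp_carrierD: "A \<in> carrier (Sp g) \<Longrightarrow> A \<in> carrier_mat (2 * g) (2 * g)"
  by (simp add: Sp_iff)

lemma inv_Sp:
  assumes "A \<in> carrier (Sp g)"
  shows "inv\<^bsub>Sp g\<^esub> A = sp_inv g A"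
  by (rule group.inv_equality[OF group_Sp]) (use sp_inv_left[OF assms] sp_inv_in_Sp[OF assms] assms in simp_all)

text \<open>When the form is expanded at (1 + SJ)v and (1 + SJ)w, the two linear terms cancel
  because S is symmetric, and the quadratic term vanishes because the image of S is isotropic. Root
  elements and transvections are both of this shape.\<close>

lemma root_in_Sp:
  fixes S :: "'r::comm_ring_1 mat"
  assumes S: "S \<in> carrier_mat (2 * g) (2 * g)" and sym: "transpose_mat S = S"
    and iso: "\<And>w. w \<in> carrier_vec (2 * g) \<Longrightarrow> S *\<^sub>v (Jmat g *\<^sub>v (S *\<^sub>v w)) = 0\<^sub>v (2 * g)"
  shows "1\<^sub>m (2 * g) + S * Jmat g \<in> carrier (Sp g)"
proof -
  let ?n = "2 * g" and ?J = "Jmat g :: 'r mat"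
  have SJ: "S * ?J \<in> carrier_mat ?n ?n" by (rule mult_carrier_mat[OF S]) simp
  have act: "(1\<^sub>m ?n + S * ?J) *\<^sub>v v = v + S *\<^sub>v (?J *\<^sub>v v)" if v: "v \<in> carrier_vec ?n" for v
    using add_mult_distrib_mat_vec[OF one_carrier_mat SJ v] assoc_mult_mat_vec[OF S Jmat_carrier v] v by simp
  have adj: "(S *\<^sub>v x) \<bullet> y = x \<bullet> (S *\<^sub>v y)" if "x \<in> carrier_vec ?n" "y \<in> carrier_vec ?n" for x y
    using transpose_vec_mult_scalar[OF S that(2,1)] unfolding sym .
  have "intersection_form g ((1\<^sub>m ?n + S * ?J) *\<^sub>v v) ((1\<^sub>m ?n + S * ?J) *\<^sub>v w) = intersection_form g v w"
    if v: "v \<in> carrier_vec ?n" and w: "w \<in> carrier_vec ?n" for v w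
  proof -
    define u z where "u = ?J *\<^sub>v v" and "z = ?J *\<^sub>v w"
    have u: "u \<in> carrier_vec ?n" and z: "z \<in> carrier_vec ?n" using v w by (simp_all add: u_def z_def)
    have Su: "S *\<^sub>v u \<in> carrier_vec ?n" and Sz: "S *\<^sub>v z \<in> carrier_vec ?n" using S u z by simp_all
    have JSz: "?J *\<^sub>v (S *\<^sub>v z) \<in> carrier_vec ?n" using Sz by simp
    have "intersection_form g (v + S *\<^sub>v u) (w + S *\<^sub>v z) = (v + S *\<^sub>v u) \<bullet> (?J *\<^sub>v (w + S *\<^sub>v z))"
      using v w Su Sz by (intro intersection_form_eq) simp_all
    also have "?J *\<^sub>v (w + S *\<^sub>v z) = z + ?J *\<^sub>v (S *\<^sub>v z)"
      unfolding z_def by (rule mult_add_distrib_mat_vec[OF Jmat_carrier w]) (use Sz z_def in simp)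
    also have "(v + S *\<^sub>v u) \<bullet> (z + ?J *\<^sub>v (S *\<^sub>v z)) =
        v \<bullet> z + v \<bullet> (?J *\<^sub>v (S *\<^sub>v z)) + ((S *\<^sub>v u) \<bullet> z + (S *\<^sub>v u) \<bullet> (?J *\<^sub>v (S *\<^sub>v z)))"
      using v z Su JSz by (simp add: add_scalar_prod_distrib[of _ ?n] scalar_prod_add_distrib[of _ ?n])
    also have "v \<bullet> (?J *\<^sub>v (S *\<^sub>v z)) = - (u \<bullet> (S *\<^sub>v z))"
      using Jmat_anti[OF v Sz] by (simp add: u_def)
    also have "(S *\<^sub>v u) \<bullet> z = u \<bullet> (S *\<^sub>v z)" by (rule adj[OF u z])
    also have "(S *\<^sub>v u) \<bullet> (?J *\<^sub>v (S *\<^sub>v z)) = 0" using adj[OF u JSz] iso[OF z] u by simp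
    finally show ?thesis unfolding act[OF v] act[OF w] u_def[symmetric] z_def[symmetric]
      using intersection_form_eq[OF v w] by (simp add: z_def)
  qed
  then show ?thesis using SJ by (simp add: Sp_def)
qed

section \<open>Generators of the level 2 congruence subgroup\<close>

text \<open>This is E_pq + E_qp for distinct p and q, but E_pp and not its double for p = q. So the
  matrices with p <= q form a basis of the symmetric matrices in characteristic 2 as well.\<close>

definition msym :: "nat \<Rightarrow> nat \<Rightarrow> nat \<Rightarrow> 'r::comm_ring_1 mat" where
  "msym n p q = mat n n (\<lambda>(i, j). if i = p \<and> j = q \<or> i = q \<and> j = p then 1 else 0)"

text \<open>A root element of the symplectic group as long as q is not \<open>conjx p\<close>: a
  short root for distinct p and q, a long root for p = q.\<close>

definition xelt :: "nat \<Rightarrow> nat \<Rightarrow> nat \<Rightarrow> 'r \<Rightarrow> 'r::comm_ring_1 mat" where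
  "xelt g p q k = 1\<^sub>m (2 * g) + (k \<cdot>\<^sub>m msym (2 * g) p q) * Jmat g"

text \<open>For q = \<open>conjx p\<close> the matrix \<open>xelt g p q k\<close> is in general not
  symplectic; minus the identity on the plane of p and \<open>conjx p\<close> provides the missing
  generator.\<close>

definition hneg :: "nat \<Rightarrow> nat \<Rightarrow> int mat" where
  "hneg g p = mat (2 * g) (2 * g) (\<lambda>(i, j). if i = j then (if i = p \<or> i = conjx p then - 1 else 1) else 0)"

definition jv :: "'r::comm_ring_1 vec \<Rightarrow> nat \<Rightarrow> 'r" where
  "jv v p = (if even p then v $ conjx p else - v $ conjx p)"

lemma msym_carrier [simp]: "msym n p q \<in> carrier_mat n n"
  by (simp add: msym_def)

lemma msym_dim [simp]: "dim_row (msym n p q) = n" "dim_col (msym n p q) = n"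
  by (simp_all add: msym_def)

lemma conjx_double [simp]: "conjx (2 * j) = Suc (2 * j)" "conjx (Suc (2 * j)) = 2 * j"
  by (simp_all add: conjx_def)

lemma Sp_form:
  assumes "A \<in> carrier (Sp g)" "v \<in> carrier_vec (2 * g)" "w \<in> carrier_vec (2 * g)"
  shows "intersection_form g (A *\<^sub>v v) (A *\<^sub>v w) = intersection_form g v w"
  using assms by (simp add: Sp_def)

lemma intersection_form_smult_left:
  assumes "v \<in> carrier_vec (2 * g)"
  shows "intersection_form g (c \<cdot>\<^sub>v v) w = c * intersection_form g v w"
  unfolding intersection_form_def sum_distrib_left
  using assms by (intro sum.cong refl) (auto simp: algebra_simps)

lemma mult_unit_vec_index:
  assumes "A \<in> carrier_mat m n" "i < m" "l < n"
  shows "(A *\<^sub>v unit_vec n l) $ i = (A $$ (i, l) :: 'r::comm_ring_1)"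
  using assms by simp

lemma mod2_mult:
  assumes "A \<in> carrier_mat n n" "B \<in> carrier_mat n n"
  shows "mod2 (A * B) = mod2 A * mod2 B"
  by (rule of_int_hom.mat_hom_mult[OF assms])

lemma msym_vec:
  assumes "w \<in> carrier_vec n" "i < n" "p < n" "q < n"
  shows "(msym n p q *\<^sub>v w) $ i = (if i = p then w $ q else 0) + (if i = q \<and> p \<noteq> q then w $ p else 0)"
proof -
  have "(msym n p q *\<^sub>v w) $ i =
      (\<Sum>j\<in>{0..<n}. (if i = p \<and> j = q \<or> i = q \<and> j = p then 1 else 0) * w $ j)"
    using assms by (simp add: msym_def scalar_prod_def)
  also have "\<dots> = (\<Sum>j\<in>{0..<n}. (if j = q then (if i = p then w $ j else 0) else 0) +
      (if j = p then (if i = q \<and> p \<noteq> q then w $ j else 0) else 0))"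
    by (intro sum.cong) auto
  also have "\<dots> = (if i = p then w $ q else 0) + (if i = q \<and> p \<noteq> q then w $ p else 0)"
    using assms by (simp add: sum.distrib)
  finally show ?thesis .
qed

lemma smult_mat_vec: "A \<in> carrier_mat m n \<Longrightarrow> w \<in> carrier_vec n \<Longrightarrow> (k \<cdot>\<^sub>m A) *\<^sub>v w = k \<cdot>\<^sub>v (A *\<^sub>v w)"
  for A :: "'r::comm_ring_1 mat"
  by (intro eq_vecI) (auto simp: scalar_prod_def sum_distrib_left mult.assoc)

lemma xelt_carrier [simp]: "xelt g p q k \<in> carrier_mat (2 * g) (2 * g)"
  unfolding xelt_def by (intro add_carrier_mat mult_carrier_mat[of _ _ "2 * g"]) simp_all

lemma xelt_vec:
  assumes v: "v \<in> carrier_vec (2 * g)" and "i < 2 * g" "p < 2 * g" "q < 2 * g"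
  shows "(xelt g p q k *\<^sub>v v) $ i =
    v $ i + (if i = p then k * jv v q else 0) + (if i = q \<and> p \<noteq> q then k * jv v p else 0)"
proof -
  let ?n = "2 * g" and ?M = "msym (2 * g) p q"
  have kM: "k \<cdot>\<^sub>m ?M \<in> carrier_mat ?n ?n" by simp
  have kMJ: "(k \<cdot>\<^sub>m ?M) * Jmat g \<in> carrier_mat ?n ?n" by (rule mult_carrier_mat[OF kM]) simp
  have Jv: "Jmat g *\<^sub>v v \<in> carrier_vec ?n" using v by simp
  have "xelt g p q k *\<^sub>v v = v + k \<cdot>\<^sub>v (?M *\<^sub>v (Jmat g *\<^sub>v v))"
    unfolding xelt_def
    using add_mult_distrib_mat_vec[OF one_carrier_mat kMJ v] assoc_mult_mat_vec[OF kM Jmat_carrier v] v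
    by (simp add: smult_mat_vec[OF msym_carrier Jv])
  moreover have "?M *\<^sub>v (Jmat g *\<^sub>v v) \<in> carrier_vec ?n" using mult_mat_vec_carrier[OF msym_carrier Jv] .
  ultimately have "(xelt g p q k *\<^sub>v v) $ i = v $ i + k * ((?M *\<^sub>v (Jmat g *\<^sub>v v)) $ i)"
    using v assms by (simp del: index_mult_mat_vec)
  then show ?thesis
    unfolding msym_vec[OF Jv assms(2-4)] Jmat_mult_vec[OF v assms(3)] Jmat_mult_vec[OF v assms(4)]
    by (simp add: jv_def distrib_left)
qed

text \<open>The image of the symmetric matrix is spanned by multiples of the basis vectors p and q,
  which are orthogonal because q is not \<open>conjx p\<close>.\<close>

lemma xelt_in_Sp:
  assumes p: "p < 2 * g" "q < 2 * g" and pq: "q \<noteq> conjx p"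
  shows "xelt g p q k \<in> carrier (Sp g)"
  unfolding xelt_def
proof (rule root_in_Sp)
  let ?n = "2 * g" and ?M = "msym (2 * g) p q"
  show kM: "k \<cdot>\<^sub>m ?M \<in> carrier_mat ?n ?n" by simp
  show "transpose_mat (k \<cdot>\<^sub>m ?M) = k \<cdot>\<^sub>m ?M" by (rule eq_matI) (auto simp: msym_def)
  fix w :: "'a vec" assume w: "w \<in> carrier_vec ?n"
  let ?u = "(k \<cdot>\<^sub>m ?M) *\<^sub>v w"
  have u: "?u \<in> carrier_vec ?n" using mult_mat_vec_carrier[OF kM w] .
  have qp: "p \<noteq> conjx q" using pq conjx_conjx by metis
  have uz: "?u $ i = 0" if "i < ?n" "i \<noteq> p" "i \<noteq> q" for i
    using that w smult_mat_vec[OF msym_carrier w, of k] msym_vec[OF w that(1) p] mult_mat_vec_carrier[OF msym_carrier w, of p q]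
    by (simp del: index_mult_mat_vec)
  have Ju: "Jmat g *\<^sub>v ?u \<in> carrier_vec ?n" using u by simp
  have z: "(Jmat g *\<^sub>v ?u) $ p = 0" "(Jmat g *\<^sub>v ?u) $ q = 0"
    using uz[of "conjx p"] uz[of "conjx q"] conjx_less p pq[symmetric] qp[symmetric]
    by (auto simp: Jmat_mult_vec[OF u p(1)] Jmat_mult_vec[OF u p(2)] simp del: index_mult_mat_vec)
  show "(k \<cdot>\<^sub>m ?M) *\<^sub>v (Jmat g *\<^sub>v ?u) = 0\<^sub>v ?n"
  proof (rule eq_vecI)
    fix i assume "i < dim_vec (0\<^sub>v ?n :: 'a vec)"
    then have i: "i < ?n" by simp
    show "((k \<cdot>\<^sub>m ?M) *\<^sub>v (Jmat g *\<^sub>v ?u)) $ i = 0\<^sub>v ?n $ i"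
      unfolding smult_mat_vec[OF msym_carrier Ju]
      using i msym_vec[OF Ju i p] z mult_mat_vec_carrier[OF msym_carrier Ju, of p q]
      by (simp del: index_mult_mat_vec)
  qed simp
qed

lemma hneg_carrier [simp]: "hneg g p \<in> carrier_mat (2 * g) (2 * g)"
  by (simp add: hneg_def)

lemma hneg_vec:
  assumes "v \<in> carrier_vec (2 * g)" "i < 2 * g"
  shows "(hneg g p *\<^sub>v v) $ i = (if i = p \<or> i = conjx p then - (v $ i) else v $ i)"
proof -
  have "(hneg g p *\<^sub>v v) $ i =
     (\<Sum>j\<in>{0..<2 * g}. (if i = j then (if i = p \<or> i = conjx p then - 1 else 1) else 0) * v $ j)"
    using assms by (simp add: hneg_def scalar_prod_def)
  also have "\<dots> = (\<Sum>j\<in>{0..<2 * g}. if j = i then (if i = p \<or> i = conjx p then - (v $ j) else v $ j) else 0)"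
    by (intro sum.cong) auto
  finally show ?thesis using assms by simp
qed

lemma hneg_in_Sp: "hneg g p \<in> carrier (Sp g)"
proof -
  have "intersection_form g (hneg g p *\<^sub>v v) (hneg g p *\<^sub>v w) = intersection_form g v w"
    if v: "v \<in> carrier_vec (2 * g)" and w: "w \<in> carrier_vec (2 * g)" for v w
    unfolding intersection_form_def
  proof (rule sum.cong[OF refl])
    fix j assume "j \<in> {..<g}"
    then have j: "2 * j < 2 * g" "2 * j + 1 < 2 * g" by auto
    have s: "2 * j = p \<or> 2 * j = conjx p \<longleftrightarrow> 2 * j + 1 = p \<or> 2 * j + 1 = conjx p"
      by (cases "even p"; simp add: conjx_def; presburger)
    show "(hneg g p *\<^sub>v v) $ (2 * j) * (hneg g p *\<^sub>v w) $ (2 * j + 1) -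
         (hneg g p *\<^sub>v v) $ (2 * j + 1) * (hneg g p *\<^sub>v w) $ (2 * j) =
         v $ (2 * j) * w $ (2 * j + 1) - v $ (2 * j + 1) * w $ (2 * j)"
      unfolding hneg_vec[OF v j(1)] hneg_vec[OF v j(2)] hneg_vec[OF w j(1)] hneg_vec[OF w j(2)] s by auto
  qed
  then show ?thesis by (simp add: Sp_def)
qed

lemma intersection_form_unit:
  assumes "v \<in> carrier_vec (2 * g)" "p < 2 * g"
  shows "intersection_form g (unit_vec (2 * g) p) v = jv v p"
  using assms Jmat_mult_vec[OF assms] intersection_form_eq[OF unit_vec_carrier assms(1), of p]
  by (simp add: jv_def del: index_mult_mat_vec)

lemma jv_unit: "p < 2 * g \<Longrightarrow> i < 2 * g \<Longrightarrow> i \<noteq> conjx p \<Longrightarrow> jv (unit_vec (2 * g) i) p = 0"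
  using conjx_less[of p g] by (simp add: jv_def)

lemma level2_iff:
  assumes "B \<in> carrier (Sp g)"
  shows "mod2 B = 1\<^sub>m (2 * g) \<longleftrightarrow> (\<forall>i<2 * g. \<forall>j<2 * g. odd (B $$ (i, j)) \<longleftrightarrow> i = j)"
proof -
  have c: "B \<in> carrier_mat (2 * g) (2 * g)" using assms by (rule Sp_carrierD)
  have o: "of_int x = (1 :: bit) \<longleftrightarrow> odd x" "of_int x = (0 :: bit) \<longleftrightarrow> even x" for x
    by (cases "even x"; auto elim!: evenE oddE)+
  have "mod2 B = 1\<^sub>m (2 * g) \<longleftrightarrow> (\<forall>i<2 * g. \<forall>j<2 * g. of_int (B $$ (i, j)) = (if i = j then 1 else 0 :: bit))"
    using c by (auto simp: mat_eq_iff)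
  then show ?thesis by (auto simp: o split: if_splits)
qed

lemma even_reduction:
  fixes a b :: int
  assumes "a \<noteq> 0"
  shows "\<exists>k. \<bar>b + 2 * k * a\<bar> \<le> \<bar>a\<bar>"
proof -
  \<comment> \<open>Shifting by the absolute value of a before reducing modulo its double centres
    the residues at 0.\<close>
  define r where "r = (b + \<bar>a\<bar>) mod (2 * \<bar>a\<bar>)"
  have r: "0 \<le> r" "r < 2 * \<bar>a\<bar>" using assms by (simp_all add: r_def)
  have "b + \<bar>a\<bar> = 2 * \<bar>a\<bar> * ((b + \<bar>a\<bar>) div (2 * \<bar>a\<bar>)) + r" by (simp add: r_def)
  moreover have "\<bar>a\<bar> = sgn a * a" by (simp add: abs_sgn mult.commute)
  ultimately have "b + 2 * (- (sgn a * ((b + \<bar>a\<bar>) div (2 * \<bar>a\<bar>)))) * a = r - \<bar>a\<bar>"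
    by (simp add: algebra_simps)
  with r show ?thesis by (intro exI[of _ "- (sgn a * ((b + \<bar>a\<bar>) div (2 * \<bar>a\<bar>)))"]) simp
qed

text \<open>Adding even multiples keeps the parity of b, which differs from that of a; so equality
  in \<open>even_reduction\<close> is impossible.\<close>

lemma even_reduction_strict:
  fixes a b :: int
  assumes "odd a \<noteq> odd b" "a \<noteq> 0"
  shows "\<exists>k. \<bar>b + 2 * k * a\<bar> < \<bar>a\<bar>"
proof -
  obtain k where k: "\<bar>b + 2 * k * a\<bar> \<le> \<bar>a\<bar>" using even_reduction[OF assms(2)] by blast
  have "odd (b + 2 * k * a) \<noteq> odd a" using assms(1) by auto
  then have "\<bar>b + 2 * k * a\<bar> \<noteq> \<bar>a\<bar>" by (metis even_abs_add_iff even_add abs_minus_cancel dvd_abs_iff)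
  with k show ?thesis by (intro exI[of _ k]) simp
qed

text \<open>Pairing with the fixed vector e_i is invariant under C, and this pairing reads off one
  coordinate of the column.\<close>

lemma Sp_fixes_jv:
  assumes C: "C \<in> carrier (Sp g)" "C *\<^sub>v unit_vec (2 * g) i = unit_vec (2 * g) i" "i < 2 * g" "l < 2 * g"
  shows "jv (C *\<^sub>v unit_vec (2 * g) l) i = jv (unit_vec (2 * g) l) (i :: nat)"
proof -
  let ?e = "unit_vec (2 * g)"
  have c: "C *\<^sub>v ?e l \<in> carrier_vec (2 * g)" using Sp_carrierD[OF C(1)] by simp
  have "jv (C *\<^sub>v ?e l) i = intersection_form g (C *\<^sub>v ?e i) (C *\<^sub>v ?e l)"
    using intersection_form_unit[OF c C(3)] C(2) by simp
  also have "\<dots> = jv (?e l) i"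
    using Sp_form[OF C(1) unit_vec_carrier unit_vec_carrier] intersection_form_unit[OF unit_vec_carrier C(3)]
    by simp
  finally show ?thesis .
qed

text \<open>The first 2j indices are closed under \<open>conjx\<close>, so each of these coordinates
  is read off by pairing with a fixed basis vector.\<close>

lemma Sp_fixes_low:
  fixes C :: "'r::comm_ring_1 mat"
  assumes C: "C \<in> carrier (Sp g)" "\<And>i. i < 2 * j \<Longrightarrow> C *\<^sub>v unit_vec (2 * g) i = unit_vec (2 * g) i"
    and i: "i < 2 * j" "2 * j \<le> l" "l < 2 * g"
  shows "(C *\<^sub>v unit_vec (2 * g) l) $ i = 0"
proof -
  have ci: "conjx i < 2 * j" using conjx_less[OF i(1)] .
  then have ci': "conjx i < 2 * g" using i by simp
  have "jv (C *\<^sub>v unit_vec (2 * g) l) (conjx i) = 0"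
    using Sp_fixes_jv[OF C(1) C(2)[OF ci] ci' i(3)] jv_unit[OF ci' i(3)] i by simp
  then show ?thesis by (simp add: jv_def split: if_splits)
qed

lemma mat_fixes_units:
  assumes "A \<in> carrier_mat n n" "\<And>i. i < n \<Longrightarrow> A *\<^sub>v unit_vec n i = unit_vec n i"
  shows "A = (1\<^sub>m n :: 'r::comm_ring_1 mat)"
proof (rule eq_matI)
  fix i l assume "i < dim_row (1\<^sub>m n :: 'r mat)" "l < dim_col (1\<^sub>m n :: 'r mat)"
  then have il: "i < n" "l < n" by auto
  show "A $$ (i, l) = 1\<^sub>m n $$ (i, l)"
    unfolding mult_unit_vec_index[OF assms(1) il, symmetric] assms(2)[OF il(2)] using il by simp
qed (use assms in auto)

text \<open>The setting shared by two reductions: over the integers for the generators of the level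
  2 group, and over two elements for the image of the reduction map. \<open>HK m\<close> fixes the
  first m basis vectors, so columns that are already finished stay so.\<close>

locale symplectic_orbits =
  fixes g :: nat and H :: "'r::comm_ring_1 mat set"
  assumes H_Sp: "H \<subseteq> carrier (Sp g)"
    and H_one: "1\<^sub>m (2 * g) \<in> H"
    and H_mult: "A \<in> H \<Longrightarrow> B \<in> H \<Longrightarrow> A * B \<in> H"
begin

definition HK :: "nat \<Rightarrow> 'r mat set" where
  "HK m = {h \<in> H. \<forall>i<m. h *\<^sub>v unit_vec (2 * g) i = unit_vec (2 * g) i}"

definition reach :: "nat \<Rightarrow> 'r vec \<Rightarrow> 'r vec \<Rightarrow> bool" where
  "reach m v w \<longleftrightarrow> (\<exists>h\<in>HK m. h *\<^sub>v v = w)"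

lemma H_carrier: "A \<in> H \<Longrightarrow> A \<in> carrier_mat (2 * g) (2 * g)"
  using H_Sp Sp_carrierD by blast

lemma reach_refl: "v \<in> carrier_vec (2 * g) \<Longrightarrow> reach m v v"
  unfolding reach_def HK_def using H_one by (intro bexI[of _ "1\<^sub>m (2 * g)"]) simp_all

lemma HK_mult:
  assumes "A \<in> HK m" "B \<in> HK m"
  shows "A * B \<in> HK m"
  using assms H_mult H_carrier unfolding HK_def by (auto simp: assoc_mult_mat_vec[of _ "2 * g" "2 * g" _ "2 * g"])

lemma reach_trans:
  assumes "reach m u v" "reach m v w" "u \<in> carrier_vec (2 * g)"
  shows "reach m u w"
proof -
  obtain A B where AB: "A \<in> HK m" "B \<in> HK m" "A *\<^sub>v u = v" "B *\<^sub>v v = w"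
    using assms unfolding reach_def by blast
  then have "A \<in> carrier_mat (2 * g) (2 * g)" "B \<in> carrier_mat (2 * g) (2 * g)"
    using H_carrier by (auto simp: HK_def)
  then have "(B * A) *\<^sub>v u = w" using AB assms(3) by (simp add: assoc_mult_mat_vec[of _ "2 * g" "2 * g" _ "2 * g"])
  then show ?thesis using HK_mult[OF AB(2,1)] unfolding reach_def by blast
qed

end

text \<open>H is any subgroup of the level 2 group that contains the generators. It is later
  instantiated with the elements whose class in H_1 is the expected one, which turns generation into
  an induction principle.\<close>

locale level2_generators = symplectic_orbits g H for g and H :: "int mat set" +
  assumes H_level2: "A \<in> H \<Longrightarrow> mod2 A = 1\<^sub>m (2 * g)"
    and H_inv: "A \<in> H \<Longrightarrow> sp_inv g A \<in> H"
    and H_x: "p < 2 * g \<Longrightarrow> q < 2 * g \<Longrightarrow> q \<noteq> conjx p \<Longrightarrow> xelt g p q (2 * k) \<in> H"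
    and H_h: "p < 2 * g \<Longrightarrow> hneg g p \<in> H"
begin

text \<open>The only basis vectors that the root element moves are those numbered
  \<open>conjx p\<close> and \<open>conjx q\<close>.\<close>

lemma reach_x:
  assumes v: "v \<in> carrier_vec (2 * g)" and p: "p < 2 * g" and q: "q < 2 * g" and pq: "q \<noteq> conjx p"
    and m: "m \<le> conjx p" "m \<le> conjx q"
  shows "reach m v (xelt g p q (2 * k) *\<^sub>v v)"
proof -
  have "xelt g p q (2 * k) *\<^sub>v unit_vec (2 * g) i = unit_vec (2 * g) i" if i: "i < m" for i
  proof (rule eq_vecI)
    have i2: "i < 2 * g" using i m conjx_less[OF p] by simp
    have ne: "i \<noteq> conjx p" "i \<noteq> conjx q" using i m by auto
    fix l assume "l < dim_vec (unit_vec (2 * g) i :: int vec)"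
    then have l: "l < 2 * g" by simp
    show "(xelt g p q (2 * k) *\<^sub>v unit_vec (2 * g) i) $ l = unit_vec (2 * g) i $ l"
      unfolding xelt_vec[OF unit_vec_carrier l p q]
        jv_unit[OF p i2 ne(1)] jv_unit[OF q i2 ne(2)] by simp
  qed (use carrier_matD[OF xelt_carrier[of g p q "2 * k"]] in simp)
  then show ?thesis unfolding reach_def HK_def using H_x[OF p q pq] by blast
qed

text \<open>The shape of column a, for even a, of a level 2 matrix that fixes all earlier basis
  vectors: zeros above an odd diagonal entry, even entries below.\<close>

definition col_good :: "nat \<Rightarrow> int vec \<Rightarrow> bool" where
  "col_good a v \<longleftrightarrow> v \<in> carrier_vec (2 * g) \<and> (\<forall>i<2 * g. (i < a \<longrightarrow> v $ i = 0) \<and> (odd (v $ i) \<longleftrightarrow> i = a))"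

lemma col_good_x:
  assumes v: "col_good (2 * j) v" and p: "p < 2 * g" "2 * j \<le> p" and q: "q < 2 * g" "2 * j \<le> q"
  shows "col_good (2 * j) (xelt g p q (2 * k) *\<^sub>v v)"
proof -
  have c: "v \<in> carrier_vec (2 * g)" using v by (simp add: col_good_def)
  have c': "xelt g p q (2 * k) *\<^sub>v v \<in> carrier_vec (2 * g)" using mult_mat_vec_carrier[OF xelt_carrier c] .
  show ?thesis unfolding col_good_def
  proof (intro conjI allI impI)
    fix i assume i: "i < 2 * g"
    note e = xelt_vec[OF c i p(1) q(1), of "2 * k"]
    show "(xelt g p q (2 * k) *\<^sub>v v) $ i = 0" if "i < 2 * j"
      unfolding e using that p q v i by (simp add: col_good_def)
    show "odd ((xelt g p q (2 * k) *\<^sub>v v) $ i) \<longleftrightarrow> i = 2 * j"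
      unfolding e using v i by (simp add: col_good_def)
  qed (rule c')
qed

lemma conjx_ge: "2 * j \<le> p \<Longrightarrow> 2 * j \<le> conjx p"
  by (auto simp: conjx_def elim!: oddE)

lemma conjx_ge2: "2 * j + 2 \<le> p \<Longrightarrow> 2 * j + 2 \<le> conjx p"
  by (cases "even p"; simp add: conjx_def; presburger)

text \<open>The root element of m and 2j + 1 adds even multiples of the odd pivot to entry m. Entry
  2j + 1 changes as well and is therefore left for later; the pivot itself stays.\<close>

lemma clear_others:
  assumes v: "col_good (2 * j) v" and "2 * j + 2 \<le> m" "m \<le> 2 * g"
  shows "\<exists>w. reach (2 * j) v w \<and> col_good (2 * j) w \<and> w $ (2 * j) = v $ (2 * j) \<and>
    (\<forall>p\<in>{2 * j + 2..<m}. \<bar>w $ p\<bar> < \<bar>v $ (2 * j)\<bar>)"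
  using assms(2,3)
proof (induction m rule: dec_induct)
  case base
  have "v \<in> carrier_vec (2 * g)" using v by (simp add: col_good_def)
  then show ?case using v reach_refl by auto
next
  case (step m)
  let ?a = "2 * j" and ?a' = "2 * j + 1"
  obtain w where w: "reach ?a v w" "col_good ?a w" "w $ ?a = v $ ?a"
    "\<forall>p\<in>{?a + 2..<m}. \<bar>w $ p\<bar> < \<bar>v $ ?a\<bar>" using step by auto
  have m: "m < 2 * g" "?a + 2 \<le> m" using step by auto
  have a: "?a < 2 * g" "?a' < 2 * g" using m by auto
  have wc: "w \<in> carrier_vec (2 * g)" and vc: "v \<in> carrier_vec (2 * g)" using w v by (simp_all add: col_good_def)
  have odda: "odd (w $ ?a)" "even (w $ m)" using w(2) a m by (auto simp: col_good_def)
  then have "w $ ?a \<noteq> 0" by auto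
  \<comment> \<open>The multiplier is minus the pivot because it is \<open>jv w (2 * j + 1)\<close>,
    and J carries the even coordinate of a plane to the odd one with a sign.\<close>
  then obtain k where k: "\<bar>w $ m + 2 * k * (- (w $ ?a))\<bar> < \<bar>- (w $ ?a)\<bar>"
    using even_reduction_strict[of "- (w $ ?a)" "w $ m"] odda by auto
  have ca: "conjx ?a' = ?a" by (simp add: conjx_def)
  define w' where "w' = xelt g m ?a' (2 * k) *\<^sub>v w"
  have e: "w' $ i = w $ i + (if i = m then 2 * k * - (w $ ?a) else 0) + (if i = ?a' \<and> m \<noteq> ?a' then 2 * k * jv w m else 0)"
    if "i < 2 * g" for i
    unfolding w'_def xelt_vec[OF wc that m(1) a(2)] by (simp add: jv_def ca)
  have cm: "?a + 2 \<le> conjx m" using conjx_ge2[OF m(2)] .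
  have "reach ?a w w'"
    unfolding w'_def by (rule reach_x[OF wc m(1) a(2)]) (use cm ca in simp_all)
  then have "reach ?a v w'" using reach_trans w(1) vc by blast
  moreover have "col_good ?a w'" unfolding w'_def by (rule col_good_x[OF w(2) m(1) _ a(2)]) (use m in simp_all)
  moreover have "w' $ ?a = v $ ?a" using e[OF a(1)] m w(3) by simp
  moreover have "\<bar>w' $ p\<bar> < \<bar>v $ ?a\<bar>" if "p \<in> {?a + 2..<Suc m}" for p
  proof (cases "p = m")
    case True
    then show ?thesis using e[OF m(1)] k m w(3) by simp
  next
    case False
    then show ?thesis using e[of p] that m w(4) by simp
  qed
  ultimately show ?case by blast
qed

text \<open>Euclid's algorithm with even multiples on a column whose only odd entry has number \<open>2 * j\<close>. It makes
  progress because an even entry never equals the odd one in absolute value.\<close>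

lemma reduce_first:
  assumes "col_good (2 * j) v" "j < g"
  shows "\<exists>w. reach (2 * j) v w \<and> w \<in> carrier_vec (2 * g) \<and> (\<forall>i<2 * g. i \<noteq> 2 * j \<longrightarrow> w $ i = 0)"
  using assms(1)
proof (induction "nat \<bar>v $ (2 * j)\<bar>" arbitrary: v rule: less_induct)
  case less
  let ?a = "2 * j" and ?a' = "2 * j + 1"
  have a: "?a < 2 * g" "?a' < 2 * g" using assms(2) by auto
  have ca: "conjx ?a' = ?a" "conjx ?a = ?a'" by (simp_all add: conjx_def)
  have vc: "v \<in> carrier_vec (2 * g)" using less(2) by (simp add: col_good_def)
  obtain w where w: "reach ?a v w" "col_good ?a w" "w $ ?a = v $ ?a"
    "\<forall>p\<in>{?a + 2..<2 * g}. \<bar>w $ p\<bar> < \<bar>v $ ?a\<bar>" using clear_others[OF less(2), of "2 * g"] a by auto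
  have wc: "w \<in> carrier_vec (2 * g)" using w by (simp add: col_good_def)
  have odda: "odd (w $ ?a)" "even (w $ ?a')" using w(2) a by (auto simp: col_good_def)
  then have "w $ ?a \<noteq> 0" by auto
  then obtain k where k: "\<bar>w $ ?a' + 2 * k * (- (w $ ?a))\<bar> < \<bar>- (w $ ?a)\<bar>"
    using even_reduction_strict[of "- (w $ ?a)" "w $ ?a'"] odda by auto
  \<comment> \<open>Entry 2j + 1 is treated after the others, by the long root element that changes
    no other entry.\<close>
  define u where "u = xelt g ?a' ?a' (2 * k) *\<^sub>v w"
  have e: "u $ i = w $ i + (if i = ?a' then 2 * k * - (w $ ?a) else 0)" if "i < 2 * g" for i
    unfolding u_def xelt_vec[OF wc that a(2) a(2)] by (simp add: jv_def ca)
  have "reach ?a w u"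
    unfolding u_def by (rule reach_x[OF wc a(2) a(2)]) (use ca in simp_all)
  then have ru: "reach ?a v u" using reach_trans w(1) vc by blast
  have gu: "col_good ?a u" unfolding u_def by (rule col_good_x[OF w(2) a(2) _ a(2)]) simp_all
  then have uc: "u \<in> carrier_vec (2 * g)" by (simp add: col_good_def)
  have ua: "u $ ?a = v $ ?a" using e[OF a(1)] w(3) by simp
  have small: "\<bar>u $ p\<bar> < \<bar>u $ ?a\<bar>" if "p < 2 * g" "p \<noteq> ?a" for p
  proof -
    consider "p < ?a" | "p = ?a'" | "p \<in> {?a + 2..<2 * g}" using \<open>p \<noteq> ?a\<close> \<open>p < 2 * g\<close> by fastforce
    then show ?thesis
    proof cases
      case 1
      moreover have "odd (u $ ?a)" using gu a by (simp add: col_good_def)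
      then have "u $ ?a \<noteq> 0" by auto
      ultimately show ?thesis using gu that by (simp add: col_good_def)
    next
      case 2
      then show ?thesis using e[OF a(2)] k ua w(3) by simp
    next
      case 3
      then show ?thesis using e[OF that(1)] w(4) ua by auto
    qed
  qed
  show ?case
  proof (cases "\<forall>i<2 * g. i \<noteq> ?a \<longrightarrow> u $ i = 0")
    case True
    then show ?thesis using ru uc by blast
  next
    case False
    then obtain p where p: "p < 2 * g" "p \<noteq> ?a" "u $ p \<noteq> 0" by blast
    have pa: "?a \<le> p" using p gu by (meson col_good_def not_le)
    \<comment> \<open>The root element of 2j and q adds an even multiple of entry
      \<open>conjx q\<close>, which is p, to the pivot. That entry is smaller than the pivot, so the
      new pivot is smaller than the old one; the other entries that change are left to the induction
      hypothesis.\<close>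
    define q where "q = conjx p"
    have q: "q < 2 * g" "?a \<le> q" "q \<noteq> conjx ?a" using p conjx_less[OF p(1)] conjx_ge[OF pa]
      by (auto simp: q_def conjx_eq_iff)
    define s where "s = (if even q then u $ p else - (u $ p))"
    have s: "s \<noteq> 0" "\<bar>s\<bar> = \<bar>u $ p\<bar>" "jv u q = s" using p by (auto simp: s_def jv_def q_def)
    obtain l where l: "\<bar>u $ ?a + 2 * l * s\<bar> \<le> \<bar>s\<bar>" using even_reduction[OF s(1)] by blast
    define z where "z = xelt g ?a q (2 * l) *\<^sub>v u"
    have za: "z $ ?a = u $ ?a + 2 * l * s"
      unfolding z_def xelt_vec[OF uc a(1) a(1) q(1)] by (simp add: s)
    have gz: "col_good ?a z" unfolding z_def by (rule col_good_x[OF gu a(1) _ q(1,2)]) simp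
    have "reach ?a u z"
      unfolding z_def by (rule reach_x[OF uc a(1) q(1)]) (use q ca conjx_ge[OF q(2)] in simp_all)
    then have rz: "reach ?a v z" using reach_trans ru vc by blast
    have "nat \<bar>z $ ?a\<bar> < nat \<bar>v $ ?a\<bar>" using za l s small[OF p(1,2)] ua by linarith
    then obtain y where "reach ?a z y" "y \<in> carrier_vec (2 * g)" "\<forall>i<2 * g. i \<noteq> ?a \<longrightarrow> y $ i = 0"
      using less(1)[OF _ gz] by blast
    then show ?thesis using reach_trans[OF rz _ vc] by blast
  qed
qed

text \<open>The pivot at 2j + 1 is now 1, so one step clears an even entry exactly. The root
  elements with second index 2j move the basis vector 2j + 1 but keep the vector 2j, to which the
  first column has already been brought.\<close>

lemma clear_second:
  assumes v: "v \<in> carrier_vec (2 * g)" "v $ (2 * j + 1) = 1" "\<And>i. i < 2 * g \<Longrightarrow> i \<noteq> 2 * j + 1 \<Longrightarrow> even (v $ i)"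
    "\<And>i. i < 2 * j \<Longrightarrow> v $ i = 0" and "2 * j + 2 \<le> m" "m \<le> 2 * g"
  shows "\<exists>w. reach (2 * j + 1) v w \<and> w \<in> carrier_vec (2 * g) \<and> w $ (2 * j + 1) = 1 \<and>
    (\<forall>i<2 * g. i \<noteq> 2 * j + 1 \<longrightarrow> even (w $ i)) \<and> (\<forall>i<2 * j. w $ i = 0) \<and> (\<forall>i\<in>{2 * j + 2..<m}. w $ i = 0)"
  using assms(5,6)
proof (induction m rule: dec_induct)
  case base
  then show ?case using v reach_refl[OF v(1)] by auto
next
  case (step m)
  let ?a = "2 * j" and ?a' = "2 * j + 1"
  obtain w where w: "reach ?a' v w" "w \<in> carrier_vec (2 * g)" "w $ ?a' = 1"
    "\<forall>i<2 * g. i \<noteq> ?a' \<longrightarrow> even (w $ i)" "\<forall>i<?a. w $ i = 0" "\<forall>i\<in>{?a + 2..<m}. w $ i = 0" using step by auto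
  have m: "m < 2 * g" "?a + 2 \<le> m" using step by auto
  have a: "?a < 2 * g" "?a' < 2 * g" using m by auto
  have ca: "conjx ?a = ?a'" by (simp add: conjx_def)
  have "even (w $ m)" using w(4) m by auto
  then obtain k where k: "w $ m = 2 * k" by (elim evenE)
  define u where "u = xelt g m ?a (2 * (- k)) *\<^sub>v w"
  have e: "u $ i = w $ i + (if i = m then 2 * (- k) else 0) + (if i = ?a \<and> m \<noteq> ?a then 2 * (- k) * jv w m else 0)"
    if "i < 2 * g" for i
    unfolding u_def xelt_vec[OF w(2) that m(1) a(1)] using w(3) by (simp add: jv_def ca)
  have cm: "?a + 2 \<le> conjx m" using conjx_ge2[OF m(2)] .
  have "reach ?a' w u"
    unfolding u_def by (rule reach_x[OF w(2) m(1) a(1)]) (use cm ca in auto)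
  then have "reach ?a' v u" using reach_trans w(1) v(1) by blast
  moreover have "u \<in> carrier_vec (2 * g)" unfolding u_def using mult_mat_vec_carrier[OF xelt_carrier w(2)] .
  moreover have "u $ ?a' = 1" using e[OF a(2)] m w(3) by simp
  moreover have "\<forall>i<2 * g. i \<noteq> ?a' \<longrightarrow> even (u $ i)" using e w(4) by simp
  moreover have "\<forall>i<?a. u $ i = 0" using e w(5) m by simp
  moreover have "\<forall>i\<in>{?a + 2..<Suc m}. u $ i = 0"
  proof
    fix i assume i: "i \<in> {?a + 2..<Suc m}"
    show "u $ i = 0"
    proof (cases "i = m")
      case True
      then show ?thesis using e[OF m(1)] k m by simp
    next
      case False
      then have "i \<in> {?a + 2..<m}" using i by auto
      then show ?thesis using e[of i] m w(6) by auto
    qed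
  qed
  ultimately show ?case by blast
qed

lemma reduce_second:
  assumes v: "v \<in> carrier_vec (2 * g)" "v $ (2 * j + 1) = 1" "\<And>i. i < 2 * g \<Longrightarrow> i \<noteq> 2 * j + 1 \<Longrightarrow> even (v $ i)"
    "\<And>i. i < 2 * j \<Longrightarrow> v $ i = 0" and j: "j < g"
  shows "reach (2 * j + 1) v (unit_vec (2 * g) (2 * j + 1))"
proof -
  let ?a = "2 * j" and ?a' = "2 * j + 1"
  have a: "?a < 2 * g" "?a' < 2 * g" using j by auto
  have ca: "conjx ?a = ?a'" by (simp add: conjx_def)
  obtain w where w: "reach ?a' v w" "w \<in> carrier_vec (2 * g)" "w $ ?a' = 1"
    "\<forall>i<2 * g. i \<noteq> ?a' \<longrightarrow> even (w $ i)" "\<forall>i<?a. w $ i = 0" "\<forall>i\<in>{?a + 2..<2 * g}. w $ i = 0"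
    using clear_second[OF v, of "2 * g"] a by auto
  have "even (w $ ?a)" using w(4) a by auto
  then obtain k where k: "w $ ?a = 2 * k" by (elim evenE)
  define u where "u = xelt g ?a ?a (2 * (- k)) *\<^sub>v w"
  have e: "u $ i = w $ i + (if i = ?a then 2 * (- k) else 0)" if "i < 2 * g" for i
    unfolding u_def xelt_vec[OF w(2) that a(1) a(1)] using w(3) by (simp add: jv_def ca)
  have "reach ?a' w u"
    unfolding u_def by (rule reach_x[OF w(2) a(1) a(1)]) (use ca in auto)
  then have r: "reach ?a' v u" using reach_trans w(1) v(1) by blast
  have uc: "u \<in> carrier_vec (2 * g)" unfolding u_def using mult_mat_vec_carrier[OF xelt_carrier w(2)] .
  have "u = unit_vec (2 * g) ?a'"
  proof (rule eq_vecI)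
    fix i assume "i < dim_vec (unit_vec (2 * g) ?a' :: int vec)"
    then have i: "i < 2 * g" by simp
    consider "i < ?a" | "i = ?a" | "i = ?a'" | "i \<in> {?a + 2..<2 * g}" using i by fastforce
    then show "u $ i = unit_vec (2 * g) ?a' $ i"
      by cases (use e[OF i] w(3,5,6) k i a in auto)
  qed (use uc in simp)
  with r show ?thesis by simp
qed

text \<open>The columns 2j and 2j + 1 are finished together: once the first is a unit vector,
  invariance of the form makes entry 2j + 1 of the second equal to 1.\<close>

lemma reduce_stage:
  assumes B: "B \<in> carrier (Sp g)" "mod2 B = 1\<^sub>m (2 * g)" and j: "j < g"
    and fx: "\<And>i. i < 2 * j \<Longrightarrow> B *\<^sub>v unit_vec (2 * g) i = unit_vec (2 * g) i"
  shows "\<exists>h\<in>H. \<forall>i<2 * j + 2. (h * B) *\<^sub>v unit_vec (2 * g) i = unit_vec (2 * g) i"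
proof -
  let ?a = "2 * j" and ?a' = "2 * j + 1" and ?n = "2 * g"
  let ?e = "unit_vec ?n :: nat \<Rightarrow> int vec"
  have a: "?a < ?n" "?a' < ?n" using j by auto
  have ca: "conjx ?a' = ?a" "conjx ?a = ?a'" by (simp_all add: conjx_def)
  have Bc: "B \<in> carrier_mat ?n ?n" using B(1) by (rule Sp_carrierD)
  have col: "(C *\<^sub>v ?e l) $ i = C $$ (i, l)" if "C \<in> carrier_mat ?n ?n" "i < ?n" "l < ?n" for C i l
    using that by simp
  have "col_good ?a (B *\<^sub>v ?e ?a)"
    unfolding col_good_def using Sp_fixes_low[OF B(1) fx] B(2)[unfolded level2_iff[OF B(1)]] a Bc col[OF Bc]
    by (simp del: index_mult_mat_vec)
  from reduce_first[OF this j] obtain w where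
    w: "reach ?a (B *\<^sub>v ?e ?a) w" "w \<in> carrier_vec ?n" "\<forall>i<?n. i \<noteq> ?a \<longrightarrow> w $ i = 0" by blast
  obtain h0 where h0: "h0 \<in> HK ?a" "h0 *\<^sub>v (B *\<^sub>v ?e ?a) = w" using w(1) unfolding reach_def by blast
  have h0H: "h0 \<in> H" "h0 \<in> carrier_mat ?n ?n" using h0 H_carrier by (auto simp: HK_def)
  have mv: "(h * C) *\<^sub>v ?e i = h *\<^sub>v (C *\<^sub>v ?e i)"
    if "h \<in> carrier_mat ?n ?n" "C \<in> carrier_mat ?n ?n" for h C i
    by (rule assoc_mult_mat_vec[OF that unit_vec_carrier])
  have hB: "h0 * B \<in> carrier (Sp g)" using Sp_mult_closed B(1) H_Sp h0H by blast
  \<comment> \<open>The column w is a multiple of a unit vector and pairs to 1 with the next column,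
    so its entry divides 1.\<close>
  have "w $ ?a = 1 \<or> w $ ?a = - 1"
  proof -
    have c: "(h0 * B) *\<^sub>v ?e ?a' \<in> carrier_vec ?n" using Sp_carrierD[OF hB] by simp
    have "w = w $ ?a \<cdot>\<^sub>v ?e ?a" using w(2,3) a by (intro eq_vecI) auto
    then have "intersection_form g w ((h0 * B) *\<^sub>v ?e ?a') = w $ ?a * jv ((h0 * B) *\<^sub>v ?e ?a') ?a"
      using intersection_form_smult_left[OF unit_vec_carrier, of g "w $ ?a" ?a] intersection_form_unit[OF c a(1)]
      by metis
    moreover have "intersection_form g w ((h0 * B) *\<^sub>v ?e ?a') = intersection_form g (?e ?a) (?e ?a')"
      using Sp_form[OF hB unit_vec_carrier unit_vec_carrier, of ?a ?a'] h0(2) mv[OF h0H(2) Bc, of ?a] by simp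
    moreover have "\<dots> = 1" using intersection_form_unit[OF unit_vec_carrier a(1), of ?a'] a by (simp add: jv_def ca)
    ultimately have "w $ ?a * jv ((h0 * B) *\<^sub>v ?e ?a') ?a = 1" by simp
    then show ?thesis using zmult_eq_1_iff by auto
  qed
  then obtain h1 where h1: "h1 \<in> HK ?a" "h1 *\<^sub>v w = ?e ?a"
  proof
    assume 1: "w $ ?a = 1"
    have "w = ?e ?a" using w(2,3) a 1 by (intro eq_vecI) auto
    then have "1\<^sub>m ?n *\<^sub>v w = ?e ?a" by simp
    moreover have "1\<^sub>m ?n \<in> HK ?a" using H_one by (simp add: HK_def)
    ultimately show ?thesis using that by blast
  next
    assume 1: "w $ ?a = - 1"
    \<comment> \<open>A sign change at 2j corrects the pivot and fixes all earlier basis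
      vectors.\<close>
    have "hneg g ?a *\<^sub>v w = ?e ?a"
    proof (rule eq_vecI)
      fix i assume "i < dim_vec (?e ?a)"
      then have i: "i < ?n" by simp
      show "(hneg g ?a *\<^sub>v w) $ i = ?e ?a $ i" unfolding hneg_vec[OF w(2) i] using w(3) i 1 a by (simp add: ca)
    qed (use carrier_matD[OF hneg_carrier[of g ?a]] in simp)
    moreover have "hneg g ?a *\<^sub>v ?e l = ?e l" if l: "l < ?a" for l
    proof (rule eq_vecI)
      fix i assume "i < dim_vec (?e l)"
      then have i: "i < ?n" by simp
      show "(hneg g ?a *\<^sub>v ?e l) $ i = ?e l $ i" unfolding hneg_vec[OF unit_vec_carrier i] using i l a by (simp add: ca)
    qed (use carrier_matD[OF hneg_carrier[of g ?a]] in simp)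
    ultimately show ?thesis using that[of "hneg g ?a"] H_h[OF a(1)] by (simp add: HK_def)
  qed
  define h2 where "h2 = h1 * h0"
  have h2: "h2 \<in> HK ?a" unfolding h2_def by (rule HK_mult[OF h1(1) h0(1)])
  then have h2H: "h2 \<in> H" "h2 \<in> carrier_mat ?n ?n" using H_carrier by (auto simp: HK_def)
  have h1c: "h1 \<in> carrier_mat ?n ?n" using h1 H_carrier by (auto simp: HK_def)
  define C where "C = h2 * B"
  have C: "C \<in> carrier (Sp g)" unfolding C_def using Sp_mult_closed B(1) H_Sp h2H by blast
  then have Cc: "C \<in> carrier_mat ?n ?n" by (rule Sp_carrierD)
  have Bv: "B *\<^sub>v ?e ?a \<in> carrier_vec ?n" using Bc by simp
  have Ca: "C *\<^sub>v ?e ?a = ?e ?a"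
    using mv[OF h2H(2) Bc, of ?a] assoc_mult_mat_vec[OF h1c h0H(2) Bv] h0(2) h1(2) by (simp add: C_def h2_def)
  have Cl: "C *\<^sub>v ?e i = ?e i" if "i < ?a" for i
    unfolding C_def mv[OF h2H(2) Bc] fx[OF that] using h2 that by (simp add: HK_def)
  have C2: "mod2 C = 1\<^sub>m ?n"
    unfolding C_def using mod2_mult[OF h2H(2) Bc] H_level2[OF h2H(1)] B(2) by simp
  let ?v = "C *\<^sub>v ?e ?a'"
  have "reach ?a' ?v (?e ?a')"
  proof (rule reduce_second[OF _ _ _ _ j])
    show "?v \<in> carrier_vec ?n" using Cc by simp
    show "?v $ ?a' = 1" using Sp_fixes_jv[OF C Ca a] a by (simp add: jv_def ca del: index_mult_mat_vec)
    show "even (?v $ i)" if "i < ?n" "i \<noteq> ?a'" for i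
      unfolding col[OF Cc that(1) a(2)] using C2[unfolded level2_iff[OF C]] that a by blast
    show "?v $ i = 0" if "i < ?a" for i by (rule Sp_fixes_low[OF C Cl that _ a(2)]) simp_all
  qed
  then obtain h3 where h3: "h3 \<in> HK ?a'" "h3 *\<^sub>v ?v = ?e ?a'" unfolding reach_def by blast
  have h3H: "h3 \<in> H" "h3 \<in> carrier_mat ?n ?n" using h3 H_carrier by (auto simp: HK_def)
  have "(h3 * C) *\<^sub>v ?e i = ?e i" if "i < 2 * j + 2" for i
  proof -
    have h3f: "h3 *\<^sub>v ?e l = ?e l" if "l < ?a'" for l using h3(1) that by (simp add: HK_def)
    have "i < ?a \<or> i = ?a \<or> i = ?a'" using that by linarith
    then show ?thesis
      unfolding mv[OF h3H(2) Cc] using Cl[of i] Ca h3(2) h3f[of i] by auto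
  qed
  moreover have "h3 * C = (h3 * h2) * B" unfolding C_def using assoc_mult_mat[OF h3H(2) h2H(2) Bc] by simp
  ultimately show ?thesis using H_mult[OF h3H(1) h2H(1)] by (intro bexI[of _ "h3 * h2"]) simp_all
qed

lemma reduce_all:
  assumes B: "B \<in> carrier (Sp g)" "mod2 B = 1\<^sub>m (2 * g)" and "j \<le> g"
  shows "\<exists>h\<in>H. \<forall>i<2 * j. (h * B) *\<^sub>v unit_vec (2 * g) i = unit_vec (2 * g) i"
  using assms(3)
proof (induction j)
  case 0
  show ?case using H_one by auto
next
  case (Suc j)
  let ?n = "2 * g"
  obtain h where h: "h \<in> H" "\<forall>i<2 * j. (h * B) *\<^sub>v unit_vec ?n i = unit_vec ?n i" using Suc by auto
  have c: "h \<in> carrier_mat ?n ?n" "B \<in> carrier_mat ?n ?n" using h H_carrier Sp_carrierD[OF B(1)] by auto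
  have "h * B \<in> carrier (Sp g)" using Sp_mult_closed B(1) H_Sp h by blast
  moreover have "mod2 (h * B) = 1\<^sub>m ?n" using mod2_mult[OF c] H_level2[OF h(1)] B(2) by simp
  ultimately obtain h' where h': "h' \<in> H" "\<forall>i<2 * j + 2. (h' * (h * B)) *\<^sub>v unit_vec ?n i = unit_vec ?n i"
    using reduce_stage[of "h * B" j] h(2) Suc(2) by auto
  have "h' * (h * B) = (h' * h) * B" using assoc_mult_mat[OF H_carrier[OF h'(1)] c] by simp
  then show ?case using h' H_mult[OF h'(1) h(1)] by (intro bexI[of _ "h' * h"]) simp_all
qed

text \<open>The reduced matrix fixes the whole basis, so B is the inverse of an element of
  H.\<close>

lemma level2_generated:
  assumes B: "B \<in> carrier (Sp g)" "mod2 B = 1\<^sub>m (2 * g)"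
  shows "B \<in> H"
proof -
  let ?n = "2 * g"
  obtain h where h: "h \<in> H" "\<forall>i<?n. (h * B) *\<^sub>v unit_vec ?n i = unit_vec ?n i" using reduce_all[OF B order_refl] by blast
  have c: "h \<in> carrier_mat ?n ?n" "B \<in> carrier_mat ?n ?n" using h H_carrier Sp_carrierD[OF B(1)] by auto
  have hB: "h * B \<in> carrier_mat ?n ?n" using mult_carrier_mat[OF c] .
  have one: "h * B = 1\<^sub>m ?n" by (rule mat_fixes_units[OF hB]) (use h(2) in blast)
  have hS: "h \<in> carrier (Sp g)" using H_Sp h by blast
  have ic: "sp_inv g h \<in> carrier_mat ?n ?n" using c by simp
  have "B = (sp_inv g h * h) * B" using sp_inv_left[OF hS] c by simp
  also have "\<dots> = sp_inv g h" unfolding assoc_mult_mat[OF ic c] one using ic by simp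
  finally show ?thesis using H_inv[OF h(1)] by simp
qed

end

section \<open>Lifting symplectic matrices from the field with two elements\<close>

text \<open>The transvection that sends v to v plus (a, v) times a, written as 1 + a a^T J so that
  \<open>root_in_Sp\<close> applies.\<close>

definition tv :: "nat \<Rightarrow> 'r::comm_ring_1 vec \<Rightarrow> 'r mat" where
  "tv g a = 1\<^sub>m (2 * g) + mat (2 * g) (2 * g) (\<lambda>(i, j). a $ i * a $ j) * Jmat g"

lemma outer_vec:
  assumes "a \<in> carrier_vec n" "w \<in> carrier_vec n"
  shows "mat n n (\<lambda>(i, j). a $ i * a $ j) *\<^sub>v w = (a \<bullet> w) \<cdot>\<^sub>v (a :: 'r::comm_ring_1 vec)"
  using assms by (intro eq_vecI) (auto simp: scalar_prod_def sum_distrib_left mult_ac)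

lemma tv_carrier [simp]: "tv g a \<in> carrier_mat (2 * g) (2 * g)"
  unfolding tv_def by (intro add_carrier_mat mult_carrier_mat[of _ _ "2 * g"]) simp_all

lemma mat_vec_smult:
  assumes "A \<in> carrier_mat m n" "v \<in> carrier_vec n"
  shows "A *\<^sub>v (c \<cdot>\<^sub>v v) = c \<cdot>\<^sub>v (A *\<^sub>v (v :: 'r::comm_ring_1 vec))"
  using assms by (intro eq_vecI) auto

lemma tv_in_Sp:
  assumes a: "a \<in> carrier_vec (2 * g)"
  shows "tv g a \<in> carrier (Sp g)"
  unfolding tv_def
proof (rule root_in_Sp)
  fix w :: "'a vec" assume w: "w \<in> carrier_vec (2 * g)"
  have "Jmat g *\<^sub>v ((a \<bullet> w) \<cdot>\<^sub>v a) = (a \<bullet> w) \<cdot>\<^sub>v (Jmat g *\<^sub>v a)"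
    by (rule mat_vec_smult[OF Jmat_carrier a])
  then show "mat (2 * g) (2 * g) (\<lambda>(i, j). a $ i * a $ j) *\<^sub>v
      (Jmat g *\<^sub>v (mat (2 * g) (2 * g) (\<lambda>(i, j). a $ i * a $ j) *\<^sub>v w)) = 0\<^sub>v (2 * g)"
    using outer_vec[OF a w] outer_vec[OF a, of "(a \<bullet> w) \<cdot>\<^sub>v (Jmat g *\<^sub>v a)"] a
      scalar_prod_Jmat_self[OF a] by auto
qed (auto simp: mult.commute intro!: eq_matI)

lemma tv_vec:
  assumes a: "a \<in> carrier_vec (2 * g)" and v: "v \<in> carrier_vec (2 * g)"
  shows "tv g a *\<^sub>v v = v + intersection_form g a v \<cdot>\<^sub>v a"
proof -
  let ?S = "mat (2 * g) (2 * g) (\<lambda>(i, j). a $ i * a $ j)"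
  have S: "?S \<in> carrier_mat (2 * g) (2 * g)" by simp
  have SJ: "?S * Jmat g \<in> carrier_mat (2 * g) (2 * g)" by (rule mult_carrier_mat[OF S]) simp
  have Jv: "Jmat g *\<^sub>v v \<in> carrier_vec (2 * g)" using v by simp
  show ?thesis
    unfolding tv_def add_mult_distrib_mat_vec[OF one_carrier_mat SJ v] assoc_mult_mat_vec[OF S Jmat_carrier v]
      outer_vec[OF a Jv] intersection_form_eq[OF a v] using v by simp
qed

lemma map_mat_Jmat: "map_mat of_int (Jmat g) = (Jmat g :: 'r::comm_ring_1 mat)"
  by (rule eq_matI) (auto simp: Jmat_def)

lemma map_mat_tv:
  assumes a: "a \<in> carrier_vec (2 * g)"
  shows "map_mat of_int (tv g a) = tv g (map_vec of_int a :: 'r::comm_ring_1 vec)"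
proof -
  let ?S = "mat (2 * g) (2 * g) (\<lambda>(i, j). a $ i * a $ j)"
  have S: "?S \<in> carrier_mat (2 * g) (2 * g)" by simp
  have SJ: "?S * Jmat g \<in> carrier_mat (2 * g) (2 * g)" by (rule mult_carrier_mat[OF S]) simp
  have 1: "map_mat of_int (?S * Jmat g) = map_mat of_int ?S * (Jmat g :: 'r mat)"
    unfolding of_int_hom.mat_hom_mult[OF S Jmat_carrier] map_mat_Jmat ..
  have 2: "map_mat of_int ?S = mat (2 * g) (2 * g) (\<lambda>(i, j). (map_vec of_int a :: 'r vec) $ i * map_vec of_int a $ j)"
    using a by (intro eq_matI) auto
  have "map_mat of_int (1\<^sub>m (2 * g) + ?S * Jmat g) = 1\<^sub>m (2 * g) + (map_mat of_int (?S * Jmat g) :: 'r mat)"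
    using SJ by (intro eq_matI) auto
  then show ?thesis unfolding tv_def 1 2 .
qed

lemma intersection_form_skew: "intersection_form g v w = - intersection_form g w v"
  by (simp add: intersection_form_def sum_negf[symmetric] mult.commute)

lemma intersection_form_add_left:
  assumes "u \<in> carrier_vec (2 * g)" "v \<in> carrier_vec (2 * g)" "w \<in> carrier_vec (2 * g)"
  shows "intersection_form g (u + v) w = intersection_form g u w + intersection_form g v w"
  using assms by (simp add: intersection_form_eq add_scalar_prod_distrib[of _ "2 * g"])

lemma intersection_form_self: "v \<in> carrier_vec (2 * g) \<Longrightarrow> intersection_form g v v = 0"
  using scalar_prod_Jmat_self[of v g] intersection_form_eq[of v g v] by simp

section \<open>The image of the reduction map, over the field with two elements\<close>

definition Sp_image :: "nat \<Rightarrow> bit mat set" where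
  "Sp_image g = {mod2 A | A. A \<in> carrier (Sp g)}"

lemma mod2_in_Sp:
  assumes A: "A \<in> carrier (Sp g)"
  shows "map_mat of_int A \<in> carrier (Sp g :: 'r::comm_ring_1 mat monoid)"
proof -
  let ?h = "map_mat of_int :: int mat \<Rightarrow> 'r mat"
  have c: "A \<in> carrier_mat (2 * g) (2 * g)" and e: "transpose_mat A * (Jmat g * A) = Jmat g"
    using A by (simp_all add: Sp_iff)
  have JA: "Jmat g * A \<in> carrier_mat (2 * g) (2 * g)" by (rule mult_carrier_mat[OF Jmat_carrier c])
  have T: "transpose_mat A \<in> carrier_mat (2 * g) (2 * g)" using c by simp
  have "?h (transpose_mat A * (Jmat g * A)) = ?h (transpose_mat A) * (Jmat g * ?h A)"
    unfolding of_int_hom.mat_hom_mult[OF T JA] of_int_hom.mat_hom_mult[OF Jmat_carrier c] map_mat_Jmat ..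
  moreover have "?h (transpose_mat A) = transpose_mat (?h A)" using c by (intro eq_matI) auto
  ultimately show ?thesis using c by (simp add: Sp_iff e map_mat_Jmat)
qed

lemma map_mat_of_int_one: "map_mat of_int (1\<^sub>m n) = (1\<^sub>m n :: 'r::comm_ring_1 mat)"
  by (rule eq_matI) auto

lemma symplectic_orbits_Sp_image: "symplectic_orbits g (Sp_image g)"
proof
  show "Sp_image g \<subseteq> carrier (Sp g)" using mod2_in_Sp by (auto simp: Sp_image_def)
  have "1\<^sub>m (2 * g) = mod2 (1\<^sub>m (2 * g))" by (simp add: map_mat_of_int_one)
  then show "1\<^sub>m (2 * g) \<in> Sp_image g" using one_in_Sp unfolding Sp_image_def by blast
  fix A B assume "A \<in> Sp_image g" "B \<in> Sp_image g"
  then obtain A' B' where "A' \<in> carrier (Sp g)" "B' \<in> carrier (Sp g)" "A = mod2 A'" "B = mod2 B'"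
    by (auto simp: Sp_image_def)
  moreover from this have "A * B = mod2 (A' * B')" using mod2_mult Sp_carrierD by metis
  ultimately show "A * B \<in> Sp_image g" using Sp_mult_closed unfolding Sp_image_def by blast
qed

text \<open>The entries of a are lifted to the integers 0 and 1; the transvection of the lift
  reduces to that of a.\<close>

lemma tv_in_Sp_image:
  assumes "a \<in> carrier_vec (2 * g)"
  shows "tv g a \<in> Sp_image g"
proof -
  let ?b = "map_vec (\<lambda>x. if x = (1 :: bit) then 1 else 0 :: int) a"
  have b: "?b \<in> carrier_vec (2 * g)" using assms by simp
  have "map_vec of_int ?b = a" using assms by (intro eq_vecI) auto
  then have "tv g a = mod2 (tv g ?b)" by (simp add: map_mat_tv[OF b])
  then show ?thesis using tv_in_Sp[OF b] unfolding Sp_image_def by blast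
qed

interpretation SpI: symplectic_orbits g "Sp_image g" for g
  by (rule symplectic_orbits_Sp_image)

lemma bit_vec_add_self:
  assumes "v \<in> carrier_vec n" "w \<in> carrier_vec n"
  shows "v + (v + w) = (w :: bit vec)"
  using assms by (intro eq_vecI) (auto simp: add.assoc[symmetric])

text \<open>The transvection along v + w takes v to w when they pair to 1. It fixes e_i if v + w
  vanishes at \<open>conjx i\<close>, which is the condition on the first m indices.\<close>

lemma tv_swap:
  assumes v: "v \<in> carrier_vec (2 * g)" and w: "w \<in> carrier_vec (2 * g)"
    and Q: "intersection_form g v w = (1 :: bit)"
    and m: "m \<le> 2 * g" "\<And>i. i < m \<Longrightarrow> v $ conjx i = w $ conjx i"
  shows "SpI.reach g m v w"
proof -
  have vw: "v + w \<in> carrier_vec (2 * g)" using v w by simp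
  have "intersection_form g (v + w) v = 1"
    unfolding intersection_form_add_left[OF v w v] intersection_form_self[OF v]
    using intersection_form_skew[of g w v] Q by simp
  then have 1: "tv g (v + w) *\<^sub>v v = w" using tv_vec[OF vw v] bit_vec_add_self[OF v w] vw by simp
  have "tv g (v + w) *\<^sub>v unit_vec (2 * g) i = unit_vec (2 * g) i" if i: "i < m" for i
  proof -
    have i2: "i < 2 * g" using i m(1) by simp
    have "intersection_form g (unit_vec (2 * g) i) (v + w) = 0"
      unfolding intersection_form_unit[OF vw i2] using m(2)[OF i] conjx_less[OF i2] v w by (simp add: jv_def)
    then have "intersection_form g (v + w) (unit_vec (2 * g) i) = 0"
      using intersection_form_skew[of g "v + w"] by simp
    then show ?thesis unfolding tv_vec[OF vw unit_vec_carrier] using v w by (intro eq_vecI) auto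
  qed
  then have "tv g (v + w) \<in> SpI.HK g m" using tv_in_Sp_image[OF vw] by (simp add: SpI.HK_def)
  with 1 show ?thesis unfolding SpI.reach_def by blast
qed

lemma bit_neq_0_iff: "x \<noteq> 0 \<longleftrightarrow> x = (1 :: bit)"
  by (cases x) auto

lemma form_unit_right:
  assumes "v \<in> carrier_vec (2 * g)" "p < 2 * g"
  shows "intersection_form g v (unit_vec (2 * g) p) = (v $ conjx p :: bit)"
  using intersection_form_unit[OF assms] intersection_form_skew[of g v] by (simp add: jv_def)

text \<open>One transvection does it if v pairs to 1 with the target; otherwise the path goes
  through a vector that pairs to 1 with both.\<close>

lemma bit_reduce_first:
  assumes v: "v \<in> carrier_vec (2 * g)" "v \<noteq> 0\<^sub>v (2 * g)" "\<And>i. i < 2 * j \<Longrightarrow> v $ i = (0 :: bit)" and j: "j < g"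
  shows "SpI.reach g (2 * j) v (unit_vec (2 * g) (2 * j))"
proof -
  let ?a = "2 * j" and ?a' = "Suc (2 * j)" and ?n = "2 * g"
  have a: "?a < ?n" "?a' < ?n" using j by auto
  have low: "conjx i < ?a" if "i < ?a" for i using conjx_less[OF that] .
  show ?thesis
  proof (cases "v $ ?a' = 1")
    case True
    show ?thesis
    proof (rule tv_swap[OF v(1) unit_vec_carrier])
      show "intersection_form g v (unit_vec ?n ?a) = 1" using form_unit_right[OF v(1) a(1)] True by simp
      fix i assume i: "i < ?a"
      then have "conjx i < ?n" "conjx i \<noteq> ?a" using low[OF i] a by auto
      then show "v $ conjx i = unit_vec ?n ?a $ conjx i" using v(3)[OF low[OF i]] a by simp
    qed (use a in simp)
  next
    case False
    then have a'0: "v $ ?a' = 0" using bit_neq_0_iff by blast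
    have "\<exists>p. p < ?n \<and> v $ p = 1"
    proof (rule ccontr)
      assume "\<not> ?thesis"
      then have "v = 0\<^sub>v ?n" using v(1) bit_neq_0_iff by (intro eq_vecI) auto
      then show False using v(2) by simp
    qed
    then obtain p where p: "p < ?n" "v $ p = 1" by blast
    have p2: "p < ?n" "v $ p = 1" "\<not> p < ?a" "p \<noteq> ?a'" using p v(3)[of p] a'0 by auto
    \<comment> \<open>The summand at \<open>?a'\<close> makes u pair to 1 with the target. If v has
      entry 0 at \<open>?a\<close>, this summand pairs to 0 with v, and the basis vector at
      \<open>conjx p\<close> corrects that without touching coordinate \<open>?a'\<close>.\<close>
    define u :: "bit vec" where
      "u = unit_vec ?n ?a' + (if v $ ?a = 1 then 0\<^sub>v ?n else unit_vec ?n (conjx p))"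
    have cp: "conjx p < ?n" using conjx_less[OF p2(1)] .
    have uc: "u \<in> carrier_vec ?n" unfolding u_def by simp
    have cl: "\<not> conjx p < ?a" using low[of "conjx p"] p2(3) by auto
    have u0: "u $ i = 0" if "i < ?a" for i
    proof -
      have "i < ?n" "i \<noteq> ?a'" "i \<noteq> conjx p" using that a cl by auto
      then show ?thesis using a cp by (simp add: u_def)
    qed
    have vu: "intersection_form g v u = 1"
    proof (cases "v $ ?a = 1")
      case True
      then show ?thesis unfolding u_def using form_unit_right[OF v(1) a(2)] by simp
    next
      case False
      then have z: "v $ ?a = 0" using bit_neq_0_iff by blast
      have "intersection_form g u v = v $ ?a + v $ p"
        unfolding u_def using False
          intersection_form_add_left[OF unit_vec_carrier unit_vec_carrier v(1)]
          intersection_form_unit[OF v(1) a(2)] intersection_form_unit[OF v(1) cp] by (simp add: jv_def)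
      then show ?thesis using z p2(2) intersection_form_skew[of g v u] by simp
    qed
    have "u $ ?a' = 1"
    proof -
      have "conjx p \<noteq> ?a'" if "v $ ?a \<noteq> 1" using p2(2) that conjx_conjx[of p] by (metis conjx_double(2))
      then show ?thesis using a cp by (cases "v $ ?a = 1") (simp_all add: u_def)
    qed
    then have ue: "intersection_form g u (unit_vec ?n ?a) = 1"
      using form_unit_right[OF uc a(1)] by simp
    have "SpI.reach g ?a v u"
      by (rule tv_swap[OF v(1) uc vu]) (use a v(3) low u0 in auto)
    moreover have "SpI.reach g ?a u (unit_vec ?n ?a)"
    proof (rule tv_swap[OF uc unit_vec_carrier ue])
      fix i assume i: "i < ?a"
      then have "conjx i < ?n" "conjx i \<noteq> ?a" using low[OF i] a by auto
      then show "u $ conjx i = unit_vec ?n ?a $ conjx i" using u0[OF low[OF i]] a by simp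
    qed (use a in simp)
    ultimately show ?thesis using SpI.reach_trans v(1) by blast
  qed
qed

text \<open>Here the basis vector 2j must stay fixed too, so an intermediate vector has to keep the
  entry 1 at 2j + 1. The sum of the two basis vectors of the plane does so, and it pairs to 1 with
  both ends when v has entry 0 at 2j.\<close>

lemma bit_reduce_second:
  assumes v: "v \<in> carrier_vec (2 * g)" "v $ (2 * j + 1) = 1" "\<And>i. i < 2 * j \<Longrightarrow> v $ i = (0 :: bit)" and j: "j < g"
  shows "SpI.reach g (2 * j + 1) v (unit_vec (2 * g) (2 * j + 1))"
proof -
  let ?a = "2 * j" and ?a' = "Suc (2 * j)" and ?n = "2 * g"
  have a: "?a < ?n" "?a' < ?n" using j by auto
  have low: "conjx i < ?a \<or> conjx i = ?a'" if "i < Suc ?a" for i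
    using that conjx_less[of i j] by (cases "i = ?a") auto
  have va: "v $ ?a' = 1" using v(2) by simp
  have "SpI.reach g (Suc ?a) v (unit_vec ?n ?a')"
  proof (cases "v $ ?a = 1")
    case True
    show ?thesis
    proof (rule tv_swap[OF v(1) unit_vec_carrier])
      show "intersection_form g v (unit_vec ?n ?a') = 1" using form_unit_right[OF v(1) a(2)] True by simp
      show "v $ conjx i = unit_vec ?n ?a' $ conjx i" if "i < Suc ?a" for i
        using low[OF that] v(3) va a by auto
    qed (use a in simp)
  next
    case False
    then have z: "v $ ?a = 0" using bit_neq_0_iff by blast
    define u where "u = unit_vec ?n ?a + (unit_vec ?n ?a' :: bit vec)"
    have uc: "u \<in> carrier_vec ?n" by (simp add: u_def)
    have ui: "u $ conjx i = unit_vec ?n ?a' $ conjx i" if "i < Suc ?a" for i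
      using low[OF that] a by (auto simp: u_def)
    have "intersection_form g u v = 1"
      unfolding u_def intersection_form_add_left[OF unit_vec_carrier unit_vec_carrier v(1)]
        intersection_form_unit[OF v(1) a(1)] intersection_form_unit[OF v(1) a(2)] using z va by (simp add: jv_def)
    then have vu: "intersection_form g v u = 1" using intersection_form_skew[of g v u] by simp
    have ue: "intersection_form g u (unit_vec ?n ?a') = 1"
      unfolding form_unit_right[OF uc a(2)] using a by (simp add: u_def)
    have "SpI.reach g (Suc ?a) v u"
    proof (rule tv_swap[OF v(1) uc vu])
      show "v $ conjx i = u $ conjx i" if "i < Suc ?a" for i
        unfolding ui[OF that] using low[OF that] v(3) va a by auto
    qed (use a in simp)
    moreover have "SpI.reach g (Suc ?a) u (unit_vec ?n ?a')"
      by (rule tv_swap[OF uc unit_vec_carrier ue]) (use a ui in simp_all)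
    ultimately show ?thesis using SpI.reach_trans v(1) by blast
  qed
  then show ?thesis by simp
qed

lemma bit_reduce_stage:
  assumes B: "B \<in> carrier (Sp g)" and j: "j < g"
    and fx: "\<And>i. i < 2 * j \<Longrightarrow> B *\<^sub>v unit_vec (2 * g) i = (unit_vec (2 * g) i :: bit vec)"
  shows "\<exists>h\<in>Sp_image g. \<forall>i<2 * j + 2. (h * B) *\<^sub>v unit_vec (2 * g) i = unit_vec (2 * g) i"
proof -
  let ?a = "2 * j" and ?a' = "2 * j + 1" and ?n = "2 * g"
  let ?e = "unit_vec ?n :: nat \<Rightarrow> bit vec"
  have a: "?a < ?n" "?a' < ?n" using j by auto
  have Bc: "B \<in> carrier_mat ?n ?n" using B by (rule Sp_carrierD)
  have mv: "(h * C) *\<^sub>v ?e i = h *\<^sub>v (C *\<^sub>v ?e i)"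
    if "h \<in> carrier_mat ?n ?n" "C \<in> carrier_mat ?n ?n" for h C i
    by (rule assoc_mult_mat_vec[OF that unit_vec_carrier])
  have Bv: "B *\<^sub>v ?e ?a \<in> carrier_vec ?n" using Bc by simp
  have "B *\<^sub>v ?e ?a \<noteq> 0\<^sub>v ?n"
  proof
    assume z: "B *\<^sub>v ?e ?a = 0\<^sub>v ?n"
    have "intersection_form g (B *\<^sub>v ?e ?a) (B *\<^sub>v ?e ?a') = 1"
      using Sp_form[OF B unit_vec_carrier unit_vec_carrier, of ?a ?a']
        intersection_form_unit[OF unit_vec_carrier a(1), of ?a'] a by (simp add: jv_def)
    moreover have "intersection_form g (0\<^sub>v ?n) (B *\<^sub>v ?e ?a') = 0"
      by (simp add: intersection_form_def)
    ultimately show False using z by simp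
  qed
  have "(B *\<^sub>v ?e ?a) $ i = 0" if "i < ?a" for i
    by (rule Sp_fixes_low[OF B fx that _ a(1)]) simp_all
  from bit_reduce_first[OF Bv \<open>B *\<^sub>v ?e ?a \<noteq> 0\<^sub>v ?n\<close> this j]
  obtain h2 where h2: "h2 \<in> SpI.HK g ?a" "h2 *\<^sub>v (B *\<^sub>v ?e ?a) = ?e ?a" unfolding SpI.reach_def by blast
  have h2H: "h2 \<in> Sp_image g" "h2 \<in> carrier_mat ?n ?n" using h2 SpI.H_carrier by (auto simp: SpI.HK_def)
  define C where "C = h2 * B"
  have C: "C \<in> carrier (Sp g)" unfolding C_def using Sp_mult_closed B SpI.H_Sp h2H by blast
  then have Cc: "C \<in> carrier_mat ?n ?n" by (rule Sp_carrierD)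
  have Ca: "C *\<^sub>v ?e ?a = ?e ?a" unfolding C_def mv[OF h2H(2) Bc] by (rule h2(2))
  have Cl: "C *\<^sub>v ?e i = ?e i" if "i < ?a" for i
    unfolding C_def mv[OF h2H(2) Bc] fx[OF that] using h2 that by (simp add: SpI.HK_def)
  let ?v = "C *\<^sub>v ?e ?a'"
  have "SpI.reach g ?a' ?v (?e ?a')"
  proof (rule bit_reduce_second[OF _ _ _ j])
    show "?v \<in> carrier_vec ?n" using Cc by simp
    show "?v $ ?a' = 1" using Sp_fixes_jv[OF C Ca a] a by (simp add: jv_def del: index_mult_mat_vec)
    show "?v $ i = 0" if "i < ?a" for i by (rule Sp_fixes_low[OF C Cl that _ a(2)]) simp_all
  qed
  then obtain h3 where h3: "h3 \<in> SpI.HK g ?a'" "h3 *\<^sub>v ?v = ?e ?a'" unfolding SpI.reach_def by blast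
  have h3H: "h3 \<in> Sp_image g" "h3 \<in> carrier_mat ?n ?n" using h3 SpI.H_carrier by (auto simp: SpI.HK_def)
  have "(h3 * C) *\<^sub>v ?e i = ?e i" if "i < 2 * j + 2" for i
  proof -
    have h3f: "h3 *\<^sub>v ?e l = ?e l" if "l < ?a'" for l using h3(1) that by (simp add: SpI.HK_def)
    have "i < ?a \<or> i = ?a \<or> i = ?a'" using that by linarith
    then show ?thesis
      unfolding mv[OF h3H(2) Cc] using Cl[of i] Ca h3(2) h3f[of i] by auto
  qed
  moreover have "h3 * C = (h3 * h2) * B" unfolding C_def using assoc_mult_mat[OF h3H(2) h2H(2) Bc] by simp
  ultimately show ?thesis using SpI.H_mult[OF h3H(1) h2H(1)] by (intro bexI[of _ "h3 * h2"]) simp_all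
qed

lemma bit_reduce_all:
  assumes B: "B \<in> carrier (Sp g)" and "j \<le> g"
  shows "\<exists>h\<in>Sp_image g. \<forall>i<2 * j. (h * B) *\<^sub>v unit_vec (2 * g) i = (unit_vec (2 * g) i :: bit vec)"
  using assms(2)
proof (induction j)
  case 0
  show ?case using SpI.H_one by auto
next
  case (Suc j)
  let ?n = "2 * g"
  obtain h where h: "h \<in> Sp_image g" "\<forall>i<2 * j. (h * B) *\<^sub>v unit_vec ?n i = unit_vec ?n i" using Suc by auto
  have c: "h \<in> carrier_mat ?n ?n" "B \<in> carrier_mat ?n ?n" using h SpI.H_carrier Sp_carrierD[OF B(1)] by auto
  have "h * B \<in> carrier (Sp g)" using Sp_mult_closed B(1) SpI.H_Sp h by blast
  then obtain h' where h': "h' \<in> Sp_image g" "\<forall>i<2 * j + 2. (h' * (h * B)) *\<^sub>v unit_vec ?n i = unit_vec ?n i"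
    using bit_reduce_stage[of "h * B" g j] h(2) Suc(2) by auto
  have "h' * (h * B) = (h' * h) * B" using assoc_mult_mat[OF SpI.H_carrier[OF h'(1)] c] by simp
  then show ?case using h' SpI.H_mult[OF h'(1) h(1)] by (intro bexI[of _ "h' * h"]) simp_all
qed

text \<open>Multiplying by an element h of the image makes B the identity, so B is the reduction of
  the inverse of an integral lift of h.\<close>

theorem mod2_surjective:
  assumes B: "B \<in> carrier (Sp g :: bit mat monoid)"
  shows "\<exists>A\<in>carrier (Sp g). mod2 A = B"
proof -
  let ?n = "2 * g"
  obtain h where h: "h \<in> Sp_image g" "\<forall>i<?n. (h * B) *\<^sub>v unit_vec ?n i = unit_vec ?n i"
    using bit_reduce_all[OF B order_refl] by blast
  have c: "h \<in> carrier_mat ?n ?n" "B \<in> carrier_mat ?n ?n" using h SpI.H_carrier Sp_carrierD[OF B] by auto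
  have one: "h * B = 1\<^sub>m ?n" by (rule mat_fixes_units[OF mult_carrier_mat[OF c]]) (use h(2) in blast)
  obtain A where A: "A \<in> carrier (Sp g)" "h = mod2 A" using h(1) by (auto simp: Sp_image_def)
  have Ac: "A \<in> carrier_mat ?n ?n" and ic: "sp_inv g A \<in> carrier_mat ?n ?n" using Sp_carrierD[OF A(1)] by simp_all
  have m: "mod2 (sp_inv g A) \<in> carrier_mat ?n ?n" using ic by simp
  have l: "mod2 (sp_inv g A) * h = 1\<^sub>m ?n"
    unfolding A(2) mod2_mult[OF ic Ac, symmetric] sp_inv_left[OF A(1)] by (rule map_mat_of_int_one)
  have "B = (mod2 (sp_inv g A) * h) * B" using l c by simp
  also have "\<dots> = mod2 (sp_inv g A)" unfolding assoc_mult_mat[OF m c] one using m by simp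
  finally show ?thesis using sp_inv_in_Sp[OF A(1)] by blast
qed

section \<open>Symmetric matrices over a field of characteristic 2\<close>

definition symm_mats :: "nat \<Rightarrow> 'f::field mat set" where
  "symm_mats n = {S \<in> carrier_mat n n. transpose_mat S = S}"

definition alt_mats :: "nat \<Rightarrow> 'f::field mat set" where
  "alt_mats n = {S \<in> symm_mats n. \<forall>i<n. S $$ (i, i) = 0}"

text \<open>For symmetric S the trace of S J is zero, as the contributions of (2j, 2j + 1) and (2j +
  1, 2j) cancel; this sum keeps one entry of each pair.\<close>

definition half_trace :: "nat \<Rightarrow> 'f::field mat \<Rightarrow> 'f" where
  "half_trace g S = (\<Sum>j<g. S $$ (2 * j, 2 * j + 1))"

definition ker_ht :: "nat \<Rightarrow> 'f::field mat set" where
  "ker_ht g = {S \<in> alt_mats (2 * g). half_trace g S = 0}"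

definition J_line :: "nat \<Rightarrow> 'f::field mat set" where
  "J_line g = range (\<lambda>c. c \<cdot>\<^sub>m Jmat g)"

definition hb :: "bit mat \<Rightarrow> 'f::field mat" where
  "hb s = map_mat of_bit s"

definition symm_module :: "'f::field itself \<Rightarrow> nat \<Rightarrow> ('f, 'f mat, bit mat) gmodule" where
  "symm_module ty g = \<lparr>carrier = symm_mats (2 * g), mult = undefined, one = undefined,
     zero = 0\<^sub>m (2 * g) (2 * g), add = (+), smult = (\<cdot>\<^sub>m),
     act = (\<lambda>s S. hb s * (S * transpose_mat (hb s)))\<rparr>"

text \<open>The matrix that corresponds to \<open>x \<and> y\<close>.\<close>

definition wd :: "nat \<Rightarrow> 'f::field vec \<Rightarrow> 'f vec \<Rightarrow> 'f mat" where
  "wd n x y = mat n n (\<lambda>(i, j). x $ i * y $ j + y $ i * x $ j)"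

text \<open>The vectors that come from the field with two elements; along each of them the acting
  group contains a transvection (\<open>bin_vec_tv\<close>).\<close>

definition bin_vecs :: "nat \<Rightarrow> 'f::field vec set" where
  "bin_vecs n = {c \<in> carrier_vec n. \<forall>i<n. c $ i = 0 \<or> c $ i = 1}"

lemma symm_module_simps [simp]:
  "carrier (symm_module ty g) = symm_mats (2 * g)" "\<zero>\<^bsub>symm_module ty g\<^esub> = 0\<^sub>m (2 * g) (2 * g)"
  "add (symm_module ty g) = (+)" "module.smult (symm_module ty g) = (\<cdot>\<^sub>m)"
  "act (symm_module ty g) s S = hb s * (S * transpose_mat (hb s))"
  by (simp_all add: symm_module_def)

lemma symm_index: "S \<in> symm_mats n \<Longrightarrow> i < n \<Longrightarrow> j < n \<Longrightarrow> S $$ (i, j) = S $$ (j, i)"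
  by (metis (mono_tags, lifting) carrier_matD index_transpose_mat(1) mem_Collect_eq symm_mats_def)

lemma symm_matsI:
  "S \<in> carrier_mat n n \<Longrightarrow> (\<And>i j. i < n \<Longrightarrow> j < n \<Longrightarrow> S $$ (i, j) = S $$ (j, i)) \<Longrightarrow> S \<in> symm_mats n"
  unfolding symm_mats_def by (auto intro!: eq_matI)

lemma symm_carrier: "S \<in> symm_mats n \<Longrightarrow> S \<in> carrier_mat n n"
  by (simp add: symm_mats_def)

lemma symm_adjoint:
  assumes S: "S \<in> symm_mats n" and "x \<in> carrier_vec n" "y \<in> carrier_vec n"
  shows "(S *\<^sub>v x) \<bullet> y = x \<bullet> (S *\<^sub>v y)"
proof -
  have "(transpose_mat S *\<^sub>v x) \<bullet> y = x \<bullet> (S *\<^sub>v y)"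
    by (rule transpose_vec_mult_scalar[of _ n n]) (use assms symm_carrier in auto)
  then show ?thesis using S by (simp add: symm_mats_def)
qed

lemma wd_carrier [simp]: "wd n x y \<in> carrier_mat n n" "dim_row (wd n x y) = n" "dim_col (wd n x y) = n"
  by (simp_all add: wd_def)

lemma wd_commute: "wd n x y = wd n y x"
  by (rule eq_matI) (auto simp: wd_def add.commute)

lemma wd_add_right:
  "y \<in> carrier_vec n \<Longrightarrow> z \<in> carrier_vec n \<Longrightarrow> wd n x (y + z) = wd n x y + wd n x z"
  by (rule eq_matI) (auto simp: wd_def algebra_simps)

lemma wd_add_left:
  "y \<in> carrier_vec n \<Longrightarrow> z \<in> carrier_vec n \<Longrightarrow> wd n (y + z) x = wd n y x + wd n z x"
  by (rule eq_matI) (auto simp: wd_def algebra_simps)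

lemma wd_smult_right: "y \<in> carrier_vec n \<Longrightarrow> wd n x (c \<cdot>\<^sub>v y) = c \<cdot>\<^sub>m wd n x y"
  by (rule eq_matI) (auto simp: wd_def algebra_simps)

lemma wd_smult_left: "y \<in> carrier_vec n \<Longrightarrow> wd n (c \<cdot>\<^sub>v y) x = c \<cdot>\<^sub>m wd n y x"
  by (rule eq_matI) (auto simp: wd_def algebra_simps)

lemma wd_vec:
  assumes "x \<in> carrier_vec n" "y \<in> carrier_vec n" "v \<in> carrier_vec n"
  shows "wd n x y *\<^sub>v v = (y \<bullet> v) \<cdot>\<^sub>v x + (x \<bullet> v) \<cdot>\<^sub>v y"
  using assms
  by (intro eq_vecI) (auto simp: wd_def scalar_prod_def sum_distrib_left sum_distrib_right sum.distrib algebra_simps)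

lemma sum_delta_pair:
  assumes "finite P"
  shows "(\<Sum>p\<in>P. if p = a then f p else (0 :: 'a::comm_monoid_add)) = (if a \<in> P then f a else 0)"
  using assms by (simp add: sum.delta)

text \<open>The size n is an argument since it fixes the value of the empty sum.\<close>

definition msum :: "nat \<Rightarrow> ('i \<Rightarrow> 'f::field mat) \<Rightarrow> 'i set \<Rightarrow> 'f mat" where
  "msum n f A = mat n n (\<lambda>ij. \<Sum>a\<in>A. f a $$ ij)"

lemma msum_closed:
  assumes "finite A" "0\<^sub>m n n \<in> W" "\<And>S T. S \<in> W \<Longrightarrow> T \<in> W \<Longrightarrow> S + T \<in> W"
    and "\<And>a. a \<in> A \<Longrightarrow> f a \<in> W" "\<And>a. a \<in> A \<Longrightarrow> f a \<in> carrier_mat n n"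
  shows "msum n f A \<in> W"
  using assms(1,4,5)
proof (induction A rule: finite_induct)
  case empty
  have "msum n f {} = 0\<^sub>m n n" by (rule eq_matI) (auto simp: msum_def)
  then show ?case using assms(2) by simp
next
  case (insert a A)
  have "msum n f (insert a A) = f a + msum n f A"
    using insert(2) insert(5)[of a] by (intro eq_matI) (auto simp: msum_def insert(1))
  then show ?case using insert assms(3) by simp
qed

definition lt_pairs :: "nat \<Rightarrow> (nat \<times> nat) set" where
  "lt_pairs n = {(i, j). i < j \<and> j < n}"

lemma finite_lt_pairs [simp]: "finite (lt_pairs n)"
  by (rule finite_subset[of _ "{..<n} \<times> {..<n}"]) (auto simp: lt_pairs_def)

lemma wd_unit_index:
  assumes "k < n" "l < n" "i < n" "j < n"
  shows "wd n (unit_vec n i) (unit_vec n j) $$ (k, l) =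
    (if (i, j) = (k, l) then 1 else 0) + (if (i, j) = (l, k) then 1 else (0 :: 'f::field))"
proof -
  have "wd n (unit_vec n i) (unit_vec n j) $$ (k, l) =
    (if k = i then 1 else 0) * (if l = j then 1 else (0 :: 'f)) + (if k = j then 1 else 0) * (if l = i then 1 else 0)"
    using assms by (simp add: wd_def)
  moreover have "(i, j) = (k, l) \<longleftrightarrow> k = i \<and> l = j" "(i, j) = (l, k) \<longleftrightarrow> k = j \<and> l = i" by auto
  ultimately show ?thesis by (cases "k = i"; cases "l = j"; cases "k = j"; cases "l = i"; simp only: if_True if_False simp_thms; simp)
qed

text \<open>The expansion of an alternating matrix in the basis e_i wedge e_j with i < j, read entry
  by entry. The vanishing diagonal enters for k = l.\<close>

lemma alt_sum_entries:
  assumes S: "S \<in> alt_mats n" and kl: "k < n" "l < n"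
  shows "(\<Sum>(i, j)\<in>lt_pairs n. S $$ (i, j) * wd n (unit_vec n i) (unit_vec n j) $$ (k, l)) = S $$ (k, l)"
proof -
  have "(\<Sum>(i, j)\<in>lt_pairs n. S $$ (i, j) * wd n (unit_vec n i) (unit_vec n j) $$ (k, l)) =
    (\<Sum>p\<in>lt_pairs n. (if p = (k, l) then S $$ p else 0) + (if p = (l, k) then S $$ p else 0))"
  proof (rule sum.cong[OF refl])
    fix p assume "p \<in> lt_pairs n"
    then obtain i j where p: "p = (i, j)" "i < n" "j < n" by (auto simp: lt_pairs_def)
    show "(case p of (i, j) \<Rightarrow> S $$ (i, j) * wd n (unit_vec n i) (unit_vec n j) $$ (k, l)) =
        (if p = (k, l) then S $$ p else 0) + (if p = (l, k) then S $$ p else 0)"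
      unfolding p(1) prod.case wd_unit_index[OF kl p(2,3)]
      by (cases "(i, j) = (k, l)"; cases "(i, j) = (l, k)";
          simp only: simp_thms if_True if_False mult_1_right mult_zero_right distrib_left)
  qed
  also have "\<dots> = (if k < l then S $$ (k, l) else 0) + (if l < k then S $$ (l, k) else 0)"
    unfolding sum.distrib sum_delta_pair[OF finite_lt_pairs] using kl by (simp add: lt_pairs_def)
  also have "\<dots> = S $$ (k, l)"
    using S kl symm_index[of S n k l] by (cases k l rule: linorder_cases) (auto simp: alt_mats_def)
  finally show ?thesis .
qed

lemma sum_even_odd_pairs:
  "(\<Sum>(i, j)\<in>lt_pairs (2 * g). if j = conjx i then f i j else 0) = (\<Sum>j<g. f (2 * j) (2 * j + 1))"
  for f :: "nat \<Rightarrow> nat \<Rightarrow> 'a::comm_monoid_add"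
proof -
  let ?P = "(\<lambda>j. (2 * j, 2 * j + 1)) ` {..<g}"
  have eq: "{p \<in> lt_pairs (2 * g). snd p = conjx (fst p)} = ?P"
  proof (rule subset_antisym; rule subsetI)
    fix p assume "p \<in> {p \<in> lt_pairs (2 * g). snd p = conjx (fst p)}"
    then obtain i j where p: "p = (i, j)" "i < j" "j < 2 * g" "j = conjx i"
      by (cases p) (auto simp: lt_pairs_def)
    then have "even i" by (auto simp: conjx_def split: if_splits)
    then have "p = (2 * (i div 2), 2 * (i div 2) + 1)" "i div 2 < g" using p by (auto simp: conjx_def)
    then show "p \<in> ?P" by blast
  qed (auto simp: lt_pairs_def)
  have "(\<Sum>(i, j)\<in>lt_pairs (2 * g). if j = conjx i then f i j else 0) =
      (\<Sum>(i, j)\<in>{p \<in> lt_pairs (2 * g). snd p = conjx (fst p)}. f i j)"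
    unfolding case_prod_unfold by (rule sum.inter_filter[symmetric]) simp
  also have "\<dots> = (\<Sum>j<g. f (2 * j) (2 * j + 1))"
    unfolding eq by (subst sum.reindex) (auto simp: inj_on_def)
  finally show ?thesis .
qed

section \<open>Arithmetic in characteristic 2 and the passage from bits to the field\<close>

locale char2 =
  fixes ty :: "'f::field itself"
  assumes char2: "CHAR('f) = 2"
begin

abbreviation hF :: "bit mat \<Rightarrow> 'f mat" where
  "hF s \<equiv> hb s"

lemma two_eq_0: "(2 :: 'f) = 0"
  using of_nat_CHAR[where 'a = 'f] char2 by simp

lemma add_self: "x + x = (0 :: 'f)"
  using two_eq_0 by (metis mult_2 mult_zero_left)

lemma minus_eq: "- x = (x :: 'f)"
  using add_self[of x] by (simp add: minus_unique)

lemma diff_eq: "x - y = x + (y :: 'f)"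
  using minus_eq[of y] by (simp add: diff_conv_add_uminus del: add_uminus_conv_diff)

lemma eq_iff_add: "x = y \<longleftrightarrow> x + y = (0 :: 'f)"
  using diff_eq[of x y] by (metis eq_iff_diff_eq_0)

lemma add_swap:
  assumes "a + b = c + (d :: 'f)"
  shows "a + c = b + d"
proof -
  have "a + c + (b + d) = (a + b) + (c + d)" by (simp add: ac_simps)
  also have "\<dots> = 0" unfolding assms by (rule add_self)
  finally show ?thesis using eq_iff_add by blast
qed

lemma of_int_eq: "of_int k = (of_bool (odd k) :: 'f)"
proof (cases "even k")
  case True
  then obtain m where "k = 2 * m" by (elim evenE)
  then show ?thesis using two_eq_0 by simp
next
  case False
  then obtain m where "k = 2 * m + 1" by (elim oddE)
  then show ?thesis using two_eq_0 by simp
qed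

lemma of_bit_of_int: "of_bit (of_int k :: bit) = (of_int k :: 'f)"
proof -
  have "odd (of_int k :: bit) \<longleftrightarrow> odd k" by (cases "even k"; auto elim!: evenE oddE)
  then show ?thesis by (simp add: of_int_eq)
qed

text \<open>\<open>of_bit\<close> respects sums because of characteristic 2. Going through an
  integral lift replaces it by the ring homomorphism \<open>of_int\<close>, and
  \<open>mod2_surjective\<close> provides a lift of every symplectic s.\<close>

lemma map_of_bit_mod2: "hF (mod2 A) = (map_mat of_int A :: 'f mat)"
proof (rule eq_matI)
  fix i j assume "i < dim_row (map_mat of_int A :: 'f mat)" "j < dim_col (map_mat of_int A :: 'f mat)"
  then show "hF (mod2 A) $$ (i, j) = (map_mat of_int A :: 'f mat) $$ (i, j)"
    using of_bit_of_int[of "A $$ (i, j)"] by (simp add: hb_def)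
qed (simp_all add: hb_def)

lemma hb_Sp: "s \<in> carrier (Sp g) \<Longrightarrow> hF s \<in> carrier (Sp g)"
  using mod2_surjective[of s g] mod2_in_Sp map_of_bit_mod2 by metis

lemma hb_mult:
  assumes "s \<in> carrier (Sp g)" "t \<in> carrier (Sp g)"
  shows "hF (s * t) = hF s * hF t"
proof -
  obtain A B where A: "A \<in> carrier (Sp g)" "mod2 A = s" and B: "B \<in> carrier (Sp g)" "mod2 B = t"
    using assms mod2_surjective by metis
  have c: "A \<in> carrier_mat (2 * g) (2 * g)" "B \<in> carrier_mat (2 * g) (2 * g)"
    using Sp_carrierD A B by blast+
  have "hF (s * t) = (map_mat of_int (A * B) :: 'f mat)"
    unfolding A(2)[symmetric] B(2)[symmetric] mod2_mult[OF c, symmetric] map_of_bit_mod2 ..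
  also have "\<dots> = hF s * hF t"
    unfolding A(2)[symmetric] B(2)[symmetric] map_of_bit_mod2 by (rule of_int_hom.mat_hom_mult[OF c])
  finally show ?thesis .
qed

lemma hb_one: "hF (1\<^sub>m n) = (1\<^sub>m n :: 'f mat)"
  by (rule eq_matI) (auto simp: hb_def)

lemma hb_carrier: "s \<in> carrier (Sp g) \<Longrightarrow> hF s \<in> carrier_mat (2 * g) (2 * g)"
  using hb_Sp Sp_carrierD by blast

lemma bin_vec_tv:
  assumes "c \<in> bin_vecs (2 * g)"
  shows "\<exists>s\<in>carrier (Sp g). hF s = (tv g c :: 'f mat)"
proof -
  let ?b = "map_vec (\<lambda>x. if x = (1 :: 'f) then 1 else 0 :: int) c"
  have c: "c \<in> carrier_vec (2 * g)" and b: "?b \<in> carrier_vec (2 * g)" using assms by (auto simp: bin_vecs_def)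
  have e: "map_vec of_int ?b = c" using assms by (intro eq_vecI) (auto simp: bin_vecs_def)
  have "hF (mod2 (tv g ?b)) = map_mat of_int (tv g ?b)" by (rule map_of_bit_mod2)
  also have "\<dots> = tv g c" unfolding map_mat_tv[OF b] e ..
  finally have "hF (mod2 (tv g ?b)) = tv g c" .
  then show ?thesis using mod2_in_Sp[OF tv_in_Sp[OF b]] by blast
qed

lemma bin_vecs_add: "c \<in> bin_vecs n \<Longrightarrow> d \<in> bin_vecs n \<Longrightarrow> c + d \<in> (bin_vecs n :: 'f vec set)"
  using add_self[of 1] by (fastforce simp: bin_vecs_def)

lemma bin_vecs_unit [simp]: "unit_vec n i \<in> bin_vecs n"
  by (auto simp: bin_vecs_def unit_vec_def)

lemma bin_vecs_carrier: "c \<in> bin_vecs n \<Longrightarrow> c \<in> carrier_vec n"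
  by (simp add: bin_vecs_def)

lemma Jmat_minus: "- Jmat g = (Jmat g :: 'f mat)"
  by (rule eq_matI) (auto simp: Jmat_def minus_eq)

lemma Jmat_symm: "(Jmat g :: 'f mat) \<in> symm_mats (2 * g)"
  unfolding symm_mats_def using Jmat_transpose[of g, where 'r = 'f] by (simp add: Jmat_minus)

lemma form_sym: "intersection_form g v w = (intersection_form g w v :: 'f)"
  using intersection_form_skew[of g v w] minus_eq by simp

text \<open>The off-diagonal terms occur in equal pairs and cancel in characteristic 2.\<close>

lemma sum_symmetric:
  fixes f :: "nat \<Rightarrow> nat \<Rightarrow> 'f"
  assumes "\<And>k l. k < n \<Longrightarrow> l < n \<Longrightarrow> f k l = f l k"
  shows "(\<Sum>k\<in>{0..<n}. \<Sum>l\<in>{0..<n}. f k l) = (\<Sum>k\<in>{0..<n}. f k k)"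
  using assms
proof (induction n)
  case (Suc n)
  have "(\<Sum>k\<in>{0..<Suc n}. \<Sum>l\<in>{0..<Suc n}. f k l) =
      (\<Sum>k\<in>{0..<n}. \<Sum>l\<in>{0..<n}. f k l) + (\<Sum>k\<in>{0..<n}. f k n) + ((\<Sum>l\<in>{0..<n}. f n l) + f n n)"
    by (simp add: sum.distrib)
  also have "(\<Sum>l\<in>{0..<n}. f n l) = (\<Sum>k\<in>{0..<n}. f k n)"
    by (intro sum.cong refl Suc(2)) auto
  also have "(\<Sum>k\<in>{0..<n}. \<Sum>l\<in>{0..<n}. f k l) = (\<Sum>k\<in>{0..<n}. f k k)"
    by (rule Suc(1)) (use Suc(2) in auto)
  also have "(\<Sum>k\<in>{0..<n}. f k k) + (\<Sum>k\<in>{0..<n}. f k n) + ((\<Sum>k\<in>{0..<n}. f k n) + f n n) =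
      (\<Sum>k\<in>{0..<Suc n}. f k k)"
    using add_self[of "\<Sum>k\<in>{0..<n}. f k n"] by (simp add: add.assoc[symmetric])
  finally show ?case .
qed simp

lemma quad_form:
  assumes S: "S \<in> symm_mats n" and u: "u \<in> carrier_vec n"
  shows "u \<bullet> (S *\<^sub>v u) = (\<Sum>k\<in>{0..<n}. S $$ (k, k) * (u $ k * u $ k) :: 'f)"
proof -
  have c: "S \<in> carrier_mat n n" using S by (rule symm_carrier)
  have "u \<bullet> (S *\<^sub>v u) = (\<Sum>k\<in>{0..<n}. \<Sum>l\<in>{0..<n}. u $ k * (S $$ (k, l) * u $ l))"
    using c u by (simp add: scalar_prod_def sum_distrib_left)
  also have "\<dots> = (\<Sum>k\<in>{0..<n}. u $ k * (S $$ (k, k) * u $ k))"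
    by (rule sum_symmetric) (use symm_index[OF S] in \<open>simp add: mult_ac\<close>)
  finally show ?thesis by (simp add: mult_ac)
qed

lemma alt_quad: "S \<in> alt_mats n \<Longrightarrow> u \<in> carrier_vec n \<Longrightarrow> u \<bullet> (S *\<^sub>v u) = (0 :: 'f)"
  by (auto simp: alt_mats_def quad_form intro!: sum.neutral)

lemma wd_alt: "wd n x y \<in> (alt_mats n :: 'f mat set)"
  unfolding alt_mats_def
  by (auto intro!: symm_matsI simp: wd_def mult.commute add.commute add_self)

lemma half_trace_wd:
  assumes "x \<in> carrier_vec (2 * g)" "y \<in> carrier_vec (2 * g)"
  shows "half_trace g (wd (2 * g) x y) = (intersection_form g x y :: 'f)"
  unfolding half_trace_def intersection_form_def
  by (intro sum.cong refl) (auto simp: wd_def diff_eq mult.commute)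

lemma symm_add: "S \<in> symm_mats n \<Longrightarrow> T \<in> symm_mats n \<Longrightarrow> S + T \<in> symm_mats n"
  by (auto simp: symm_mats_def transpose_add)

lemma symm_smult: "S \<in> symm_mats n \<Longrightarrow> c \<cdot>\<^sub>m S \<in> symm_mats n"
  using symm_index[of S n] symm_carrier[of S n] by (intro symm_matsI) auto

lemma symm_zero: "0\<^sub>m n n \<in> symm_mats n"
  by (auto intro!: symm_matsI)

lemma conj_index:
  assumes h: "h \<in> carrier_mat n n" and S: "S \<in> carrier_mat n n" and ij: "i < n" "j < n"
  shows "(h * (S * transpose_mat h)) $$ (i, j) = (\<Sum>k\<in>{0..<n}. \<Sum>l\<in>{0..<n}. S $$ (k, l) * (h $$ (i, k) * h $$ (j, l)) :: 'f)"
proof -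
  have "(h * (S * transpose_mat h)) $$ (i, j) = (\<Sum>k\<in>{0..<n}. h $$ (i, k) * (\<Sum>l\<in>{0..<n}. S $$ (k, l) * h $$ (j, l)))"
    using assms by (auto simp: scalar_prod_def intro!: sum.cong)
  then show ?thesis by (simp add: sum_distrib_left mult_ac)
qed

lemma conj_carrier: "h \<in> carrier_mat n n \<Longrightarrow> S \<in> carrier_mat n n \<Longrightarrow> h * (S * transpose_mat h) \<in> carrier_mat n n"
  by (intro mult_carrier_mat[of _ n n]) simp_all

lemma conj_symm:
  assumes h: "h \<in> carrier_mat n n" and S: "(S :: 'f mat) \<in> symm_mats n"
  shows "h * (S * transpose_mat h) \<in> symm_mats n"
proof (rule symm_matsI)
  note c = symm_carrier[OF S]
  show "h * (S * transpose_mat h) \<in> carrier_mat n n" by (rule conj_carrier[OF h c])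
  fix i j assume ij: "i < n" "j < n"
  show "(h * (S * transpose_mat h)) $$ (i, j) = (h * (S * transpose_mat h)) $$ (j, i)"
    unfolding conj_index[OF h c ij] conj_index[OF h c ij(2,1)]
    by (subst sum.swap) (use symm_index[OF S] in \<open>auto intro!: sum.cong simp: mult_ac\<close>)
qed

section \<open>The module of symmetric matrices and its submodules\<close>

lemma is_gmodule_symm: "is_gmodule (Sp g) (symm_module ty g)"
proof -
  let ?n = "2 * g" and ?M = "symm_module ty g"
  have ab: "abelian_group ?M"
  proof (rule abelian_groupI; unfold symm_module_simps)
    fix S :: "'f mat" assume S: "S \<in> symm_mats ?n"
    have "S + S = 0\<^sub>m ?n ?n" using symm_carrier[OF S] by (intro eq_matI) (auto simp: add_self)
    then show "\<exists>y\<in>symm_mats ?n. y + S = 0\<^sub>m ?n ?n" using S by blast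
  qed (auto simp: symm_add symm_zero symm_carrier intro!: comm_add_mat assoc_add_mat dest: symm_carrier)
  have "Module.module class_ring ?M"
  proof (rule moduleI; (rule ab)?; (unfold symm_module_simps)?)
    show "cring (class_ring :: 'f ring)" by unfold_locales
  qed (auto simp: symm_smult add_smult_distrib_right_mat add_smult_distrib_left_mat intro!: eq_matI
      dest!: symm_carrier simp: algebra_simps)
  moreover have "act ?M s (act ?M t S) = act ?M (s \<otimes>\<^bsub>Sp g\<^esub> t) S"
    if s: "s \<in> carrier (Sp g)" and t: "t \<in> carrier (Sp g)" and S: "S \<in> carrier ?M" for s t S
  proof -
    have c: "hF s \<in> carrier_mat ?n ?n" "hF t \<in> carrier_mat ?n ?n" "S \<in> carrier_mat ?n ?n"
      using hb_carrier s t S symm_carrier by auto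
    have T: "transpose_mat (hF s) \<in> carrier_mat ?n ?n" "transpose_mat (hF t) \<in> carrier_mat ?n ?n" using c by auto
    have St: "S * transpose_mat (hF t) \<in> carrier_mat ?n ?n" using mult_carrier_mat[OF c(3) T(2)] .
    have Ts: "transpose_mat (hF t) * transpose_mat (hF s) \<in> carrier_mat ?n ?n" using mult_carrier_mat[OF T(2,1)] .
    have STT: "S * (transpose_mat (hF t) * transpose_mat (hF s)) \<in> carrier_mat ?n ?n" using mult_carrier_mat[OF c(3) Ts] .
    have "act ?M s (act ?M t S) = hF s * ((hF t * (S * transpose_mat (hF t))) * transpose_mat (hF s))" by simp
    also have "\<dots> = hF s * (hF t * (S * (transpose_mat (hF t) * transpose_mat (hF s))))"
      unfolding assoc_mult_mat[OF c(2) St T(1)] assoc_mult_mat[OF c(3) T(2,1)] ..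
    also have "\<dots> = (hF s * hF t) * (S * transpose_mat (hF s * hF t))"
      unfolding transpose_mult[OF c(1,2)] assoc_mult_mat[OF c(1,2) STT] ..
    finally show ?thesis using hb_mult[OF s t] by simp
  qed
  moreover have "act ?M s S \<in> carrier ?M" if "s \<in> carrier (Sp g)" "S \<in> carrier ?M" for s S
    using conj_symm[OF hb_carrier] that by simp
  moreover have "act ?M s (S \<oplus>\<^bsub>?M\<^esub> T) = act ?M s S \<oplus>\<^bsub>?M\<^esub> act ?M s T"
    if s: "s \<in> carrier (Sp g)" and "S \<in> carrier ?M" "T \<in> carrier ?M" for s S T
  proof -
    have c: "hF s \<in> carrier_mat ?n ?n" "S \<in> carrier_mat ?n ?n" "T \<in> carrier_mat ?n ?n"
      using hb_carrier that symm_carrier by auto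
    have t: "transpose_mat (hF s) \<in> carrier_mat ?n ?n" using c by simp
    show ?thesis
      using add_mult_distrib_mat[OF c(2,3) t]
        mult_add_distrib_mat[OF c(1) mult_carrier_mat[OF c(2) t] mult_carrier_mat[OF c(3) t]] by simp
  qed
  moreover have "act ?M s (r \<odot>\<^bsub>?M\<^esub> S) = r \<odot>\<^bsub>?M\<^esub> act ?M s S"
    if s: "s \<in> carrier (Sp g)" and "S \<in> carrier ?M" for s S r
  proof -
    have c: "hF s \<in> carrier_mat ?n ?n" "S \<in> carrier_mat ?n ?n"
      using hb_carrier that symm_carrier by auto
    have t: "transpose_mat (hF s) \<in> carrier_mat ?n ?n" using c by simp
    show ?thesis
      using mult_smult_assoc_mat[OF c(2) t] mult_smult_distrib[OF c(1) mult_carrier_mat[OF c(2) t]] by simp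
  qed
  moreover have "act ?M \<one>\<^bsub>Sp g\<^esub> S = S" if "S \<in> carrier ?M" for S
    using symm_carrier[of S ?n] that by (simp add: hb_one)
  ultimately show ?thesis unfolding is_gmodule_def by simp
qed

lemmas symm_sub_iff = gsubmodule_iff[OF is_gmodule_symm, unfolded symm_module_simps]

lemma symm_module_minus:
  assumes "S \<in> symm_mats (2 * g)" "T \<in> symm_mats (2 * g)"
  shows "S \<ominus>\<^bsub>symm_module ty g\<^esub> T = S + T"
proof -
  interpret M: Module.module class_ring "symm_module ty g" using is_gmoduleD(1)[OF is_gmodule_symm] .
  have "T + T = 0\<^sub>m (2 * g) (2 * g)" using symm_carrier[OF assms(2)] by (intro eq_matI) (auto simp: add_self)
  then have "\<ominus>\<^bsub>symm_module ty g\<^esub> T = T" using M.minus_equality[of T T] assms by simp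
  then show ?thesis by (simp add: a_minus_def)
qed

lemma diag_act:
  assumes s: "s \<in> carrier (Sp g)" and S: "S \<in> (symm_mats (2 * g) :: 'f mat set)" and i: "i < 2 * g"
  shows "(hF s * (S * transpose_mat (hF s))) $$ (i, i) = (hF s *\<^sub>v vec (2 * g) (\<lambda>k. S $$ (k, k))) $ i"
proof -
  let ?n = "2 * g"
  have h: "hF s \<in> carrier_mat ?n ?n" using hb_carrier[OF s] .
  have idem: "hF s $$ (i, k) * hF s $$ (i, k) = hF s $$ (i, k)" if "k < ?n" for k
    using h i that unfolding hb_def by (cases "s $$ (i, k) = 1") (simp_all add: bit_neq_0_iff)
  have "(hF s * (S * transpose_mat (hF s))) $$ (i, i) =
      (\<Sum>k\<in>{0..<?n}. \<Sum>l\<in>{0..<?n}. S $$ (k, l) * (hF s $$ (i, k) * hF s $$ (i, l)))"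
    by (rule conj_index[OF h symm_carrier[OF S] i i])
  also have "\<dots> = (\<Sum>k\<in>{0..<?n}. S $$ (k, k) * (hF s $$ (i, k) * hF s $$ (i, k)))"
    by (rule sum_symmetric) (use symm_index[OF S] in \<open>simp add: mult_ac\<close>)
  also have "\<dots> = (\<Sum>k\<in>{0..<?n}. hF s $$ (i, k) * S $$ (k, k))"
    by (intro sum.cong refl) (metis idem atLeastLessThan_iff mult.commute)
  also have "\<dots> = (hF s *\<^sub>v vec ?n (\<lambda>k. S $$ (k, k))) $ i"
    using h i by (simp add: scalar_prod_def)
  finally show ?thesis .
qed

lemma alt_symm: "S \<in> alt_mats n \<Longrightarrow> S \<in> symm_mats n"
  by (simp add: alt_mats_def)

lemma gsubmodule_alt: "gsubmodule (Sp g) (symm_module ty g) (alt_mats (2 * g))"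
  unfolding symm_sub_iff
proof (intro conjI ballI allI)
  fix s :: "bit mat" and S :: "'f mat" assume s: "s \<in> carrier (Sp g)" and S: "S \<in> alt_mats (2 * g)"
  have "vec (2 * g) (\<lambda>k. S $$ (k, k)) = 0\<^sub>v (2 * g)" using S by (intro eq_vecI) (auto simp: alt_mats_def)
  then show "hF s * (S * transpose_mat (hF s)) \<in> alt_mats (2 * g)"
    using diag_act[OF s alt_symm[OF S]] conj_symm[OF hb_carrier[OF s] alt_symm[OF S]] hb_carrier[OF s]
    unfolding alt_mats_def by (simp del: index_mult_mat(1))
next
  show "alt_mats (2 * g) \<subseteq> symm_mats (2 * g)" by (auto simp: alt_mats_def)
  show "0\<^sub>m (2 * g) (2 * g) \<in> alt_mats (2 * g)" by (auto simp: alt_mats_def symm_zero)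
  fix S T :: "'f mat" assume ST: "S \<in> alt_mats (2 * g)" "T \<in> alt_mats (2 * g)"
  then show "S + T \<in> alt_mats (2 * g)" using symm_carrier[OF alt_symm[OF ST(2)]]
    by (auto simp: alt_mats_def symm_add)
next
  fix r and S :: "'f mat" assume S: "S \<in> alt_mats (2 * g)"
  then show "r \<cdot>\<^sub>m S \<in> alt_mats (2 * g)" using symm_carrier[OF alt_symm[OF S]]
    by (auto simp: alt_mats_def symm_smult)
qed

lemma half_trace_add:
  "S \<in> symm_mats (2 * g) \<Longrightarrow> T \<in> symm_mats (2 * g) \<Longrightarrow> half_trace g (S + T) = half_trace g S + half_trace g (T :: 'f mat)"
  unfolding half_trace_def sum.distrib[symmetric] by (intro sum.cong refl) (auto dest!: symm_carrier)

lemma half_trace_smult: "S \<in> symm_mats (2 * g) \<Longrightarrow> half_trace g (r \<cdot>\<^sub>m S) = r * half_trace g (S :: 'f mat)"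
  unfolding half_trace_def sum_distrib_left by (intro sum.cong refl) (auto dest!: symm_carrier)

text \<open>The half trace pairs an alternating matrix with the bilinear form \<open>c\<close> whose symmetrization
  is the intersection form, and this pairing only depends on the symmetrization.\<close>

lemma half_trace_act:
  assumes s: "s \<in> carrier (Sp g)" and S: "S \<in> alt_mats (2 * g)"
  shows "half_trace g (hF s * (S * transpose_mat (hF s))) = half_trace g S"
proof -
  let ?n = "2 * g"
  have Ss: "S \<in> symm_mats ?n" and Sc: "S \<in> carrier_mat ?n ?n" using S alt_symm symm_carrier by auto
  have pair: "half_trace g (h * (S * transpose_mat h)) =
      (\<Sum>k\<in>{0..<?n}. \<Sum>l\<in>{0..<?n}. S $$ (k, l) * (\<Sum>j<g. h $$ (2 * j, k) * h $$ (2 * j + 1, l)))"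
    if h: "h \<in> carrier_mat ?n ?n" for h
  proof -
    have "half_trace g (h * (S * transpose_mat h)) =
      (\<Sum>j<g. \<Sum>k\<in>{0..<?n}. \<Sum>l\<in>{0..<?n}. S $$ (k, l) * (h $$ (2 * j, k) * h $$ (2 * j + 1, l)))"
      unfolding half_trace_def by (intro sum.cong refl conj_index[OF h Sc]) auto
    also have "\<dots> = (\<Sum>k\<in>{0..<?n}. \<Sum>j<g. \<Sum>l\<in>{0..<?n}. S $$ (k, l) * (h $$ (2 * j, k) * h $$ (2 * j + 1, l)))"
      by (rule sum.swap)
    also have "\<dots> = (\<Sum>k\<in>{0..<?n}. \<Sum>l\<in>{0..<?n}. \<Sum>j<g. S $$ (k, l) * (h $$ (2 * j, k) * h $$ (2 * j + 1, l)))"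
      by (intro sum.cong refl sum.swap)
    finally show ?thesis by (simp add: sum_distrib_left)
  qed
  \<comment> \<open>\<open>c h\<close> is the Gram matrix of the form that pairs e_2j with e_(2j+1)
    to 1 and is zero on all other ordered pairs of basis vectors, pulled back along h. Its
    symmetrization is the intersection form for every symplectic h.\<close>
  define c where "c h k l = (\<Sum>j<g. h $$ (2 * j, k) * h $$ (2 * j + 1, l))" for h :: "'f mat" and k l
  have form: "c h k l + c h l k = intersection_form g (unit_vec ?n k) (unit_vec ?n l)"
    if h: "h \<in> carrier (Sp g)" and kl: "k < ?n" "l < ?n" for h k l
  proof -
    have hc: "h \<in> carrier_mat ?n ?n" using Sp_carrierD[OF h] .
    have "c h k l + c h l k = intersection_form g (h *\<^sub>v unit_vec ?n k) (h *\<^sub>v unit_vec ?n l)"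
      unfolding c_def intersection_form_def sum.distrib[symmetric]
      using mult_unit_vec_index[OF hc _ kl(1)] mult_unit_vec_index[OF hc _ kl(2)]
      by (intro sum.cong refl) (auto simp: diff_eq mult.commute simp del: index_mult_mat_vec)
    then show ?thesis using Sp_form[OF h unit_vec_carrier unit_vec_carrier] by simp
  qed
  note h = hb_carrier[OF s]
  have one: "(1\<^sub>m ?n :: 'f mat) \<in> carrier (Sp g)" by (rule one_in_Sp)
  have ht1: "half_trace g S = (\<Sum>k\<in>{0..<?n}. \<Sum>l\<in>{0..<?n}. S $$ (k, l) * c (1\<^sub>m ?n) k l)"
    using pair[OF one_carrier_mat] Sc unfolding c_def by simp
  \<comment> \<open>The sum of the two Gram matrices is symmetric because their symmetrizations
    agree, and a symmetric matrix pairs to zero with an alternating one in characteristic 2.\<close>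
  have "half_trace g (hF s * (S * transpose_mat (hF s))) + half_trace g S =
      (\<Sum>k\<in>{0..<?n}. \<Sum>l\<in>{0..<?n}. S $$ (k, l) * (c (hF s) k l + c (1\<^sub>m ?n) k l))"
    unfolding pair[OF h] ht1 c_def[symmetric] by (simp add: sum.distrib distrib_left)
  also have "\<dots> = (\<Sum>k\<in>{0..<?n}. S $$ (k, k) * (c (hF s) k k + c (1\<^sub>m ?n) k k))"
  proof (rule sum_symmetric)
    fix k l assume kl: "k < ?n" "l < ?n"
    have "c (hF s) k l + c (hF s) l k = c (1\<^sub>m ?n) k l + c (1\<^sub>m ?n) l k"
      unfolding form[OF hb_Sp[OF s] kl] form[OF one kl] ..
    then have "c (hF s) k l + c (1\<^sub>m ?n) k l = c (hF s) l k + c (1\<^sub>m ?n) l k"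
      by (rule add_swap)
    then show "S $$ (k, l) * (c (hF s) k l + c (1\<^sub>m ?n) k l) = S $$ (l, k) * (c (hF s) l k + c (1\<^sub>m ?n) l k)"
      using symm_index[OF Ss kl] by simp
  qed
  also have "\<dots> = 0" using S by (intro sum.neutral) (auto simp: alt_mats_def)
  finally show ?thesis using eq_iff_add by blast
qed

lemma gsubmodule_ker_ht: "gsubmodule (Sp g) (symm_module ty g) (ker_ht g)"
proof -
  note a = gsubmodule_alt[of g, unfolded symm_sub_iff]
  have z: "half_trace g (0\<^sub>m (2 * g) (2 * g) :: 'f mat) = 0" by (simp add: half_trace_def)
  show ?thesis unfolding symm_sub_iff
  proof (intro conjI ballI allI)
    fix S T :: "'f mat" assume "S \<in> ker_ht g" "T \<in> ker_ht g"
    then show "S + T \<in> ker_ht g" using a half_trace_add[OF alt_symm alt_symm, of S g T] by (simp add: ker_ht_def)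
  next
    fix r and S :: "'f mat" assume "S \<in> ker_ht g"
    then show "r \<cdot>\<^sub>m S \<in> ker_ht g" using a half_trace_smult[OF alt_symm, of S g r] by (simp add: ker_ht_def)
  next
    fix s :: "bit mat" and S :: "'f mat" assume "s \<in> carrier (Sp g)" "S \<in> ker_ht g"
    then show "hF s * (S * transpose_mat (hF s)) \<in> ker_ht g"
      using a half_trace_act[of s g S] by (simp add: ker_ht_def)
  qed (use a z in \<open>auto simp: ker_ht_def\<close>)
qed

lemma Sp_conj_J:
  assumes A: "A \<in> carrier (Sp g)"
  shows "A * (Jmat g * transpose_mat A) = (Jmat g :: 'f mat)"
proof -
  have c: "A \<in> carrier_mat (2 * g) (2 * g)" using Sp_carrierD[OF A] .
  have "A * (Jmat g * transpose_mat A) = (A * sp_inv g A) * Jmat g"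
    unfolding sp_inv_J[OF c, symmetric] assoc_mult_mat[OF c sp_inv_carrier[OF c] Jmat_carrier] ..
  then show ?thesis unfolding sp_inv_right[OF A] by simp
qed

lemma gsubmodule_J_line: "gsubmodule (Sp g) (symm_module ty g) (J_line g)"
  unfolding symm_sub_iff
proof (intro conjI ballI allI)
  show "(J_line g :: 'f mat set) \<subseteq> symm_mats (2 * g)" using symm_smult[OF Jmat_symm] by (auto simp: J_line_def)
  have "0\<^sub>m (2 * g) (2 * g) = (0 :: 'f) \<cdot>\<^sub>m Jmat g" by (intro eq_matI) auto
  then show "(0\<^sub>m (2 * g) (2 * g) :: 'f mat) \<in> J_line g" unfolding J_line_def by blast
  fix S T :: "'f mat" assume "S \<in> J_line g" "T \<in> J_line g"
  then obtain a b where "S = a \<cdot>\<^sub>m Jmat g" "T = b \<cdot>\<^sub>m Jmat g" by (auto simp: J_line_def)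
  then have "S + T = (a + b) \<cdot>\<^sub>m Jmat g" by (intro eq_matI) (auto simp: distrib_right)
  then show "S + T \<in> J_line g" unfolding J_line_def by blast
next
  fix r and S :: "'f mat" assume "S \<in> J_line g"
  then obtain a where "S = a \<cdot>\<^sub>m Jmat g" by (auto simp: J_line_def)
  then have "r \<cdot>\<^sub>m S = (r * a) \<cdot>\<^sub>m Jmat g" by (intro eq_matI) auto
  then show "r \<cdot>\<^sub>m S \<in> J_line g" unfolding J_line_def by blast
next
  fix s :: "bit mat" and S :: "'f mat" assume s: "s \<in> carrier (Sp g)" and "S \<in> J_line g"
  then obtain a where S: "S = a \<cdot>\<^sub>m Jmat g" by (auto simp: J_line_def)
  have h: "hF s \<in> carrier_mat (2 * g) (2 * g)" by (rule hb_carrier[OF s])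
  have t: "transpose_mat (hF s) \<in> carrier_mat (2 * g) (2 * g)" using h by simp
  have "hF s * (S * transpose_mat (hF s)) = a \<cdot>\<^sub>m Jmat g"
    unfolding S mult_smult_assoc_mat[OF Jmat_carrier t] mult_smult_distrib[OF h mult_carrier_mat[OF Jmat_carrier t]]
      Sp_conj_J[OF hb_Sp[OF s]] ..
  then show "hF s * (S * transpose_mat (hF s)) \<in> J_line g" unfolding J_line_def by blast
qed

end

section \<open>Submodules of the module of symmetric matrices\<close>

context char2
begin

lemma bin_vecs_index: "c \<in> bin_vecs n \<Longrightarrow> i < n \<Longrightarrow> c $ i = 0 \<or> c $ i = (1 :: 'f)"
  by (simp add: bin_vecs_def)

lemma form_unit_left:
  assumes "v \<in> carrier_vec (2 * g)" "p < 2 * g"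
  shows "intersection_form g (unit_vec (2 * g) p) v = (v $ conjx p :: 'f)"
  using intersection_form_unit[OF assms] by (simp add: jv_def minus_eq)

lemma form_unit_right':
  assumes "v \<in> carrier_vec (2 * g)" "p < 2 * g"
  shows "intersection_form g v (unit_vec (2 * g) p) = (v $ conjx p :: 'f)"
  using form_unit_left[OF assms] form_sym[of g v] by simp

lemma form_add_right:
  assumes "u \<in> carrier_vec (2 * g)" "v \<in> carrier_vec (2 * g)" "w \<in> carrier_vec (2 * g)"
  shows "intersection_form g w (u + v) = (intersection_form g w u + intersection_form g w v :: 'f)"
  using intersection_form_add_left[OF assms] form_sym[of g w] by simp

text \<open>The values stay in the prime field, which is closed under sums by 1 + 1 = 0.\<close>

lemma form_bin:
  assumes "c \<in> bin_vecs (2 * g)" "d \<in> bin_vecs (2 * g)"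
  shows "intersection_form g c d = 0 \<or> intersection_form g c d = (1 :: 'f)"
proof -
  have cl: "x + y = 0 \<or> x + y = 1" if "x = 0 \<or> x = 1" "y = 0 \<or> y = 1" for x y :: 'f
    using that add_self[of 1] by auto
  have "(\<Sum>j\<in>A. c $ (2 * j) * d $ (2 * j + 1) - c $ (2 * j + 1) * d $ (2 * j)) \<in> {0, 1 :: 'f}"
    if "finite A" "A \<subseteq> {..<g}" for A
    using that
  proof (induction A rule: finite_induct)
    case (insert j A)
    then have j: "2 * j < 2 * g" "2 * j + 1 < 2 * g" by auto
    have "c $ (2 * j) * d $ (2 * j + 1) - c $ (2 * j + 1) * d $ (2 * j) \<in> {0, 1}"
      using bin_vecs_index[OF assms(1) j(1)] bin_vecs_index[OF assms(1) j(2)]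
        bin_vecs_index[OF assms(2) j(1)] bin_vecs_index[OF assms(2) j(2)] by (auto simp: minus_eq)
    then show ?case using insert cl by simp
  qed simp
  from this[of "{..<g}"] show ?thesis by (simp add: intersection_form_def)
qed

text \<open>With t = 1 + c c^T J and u = S J c, expanding t S t^T gives S + c u^T + u c^T plus a
  multiple of c c^T. The coefficient of the last term is the value of the alternating form S at J c,
  hence zero.\<close>

lemma tv_conj:
  assumes c: "c \<in> carrier_vec (2 * g)" and S: "S \<in> alt_mats (2 * g)"
  shows "tv g c * (S * transpose_mat (tv g c)) = S + wd (2 * g) c (S *\<^sub>v (Jmat g *\<^sub>v c) :: 'f vec)"
proof (rule mat_eqI_vec[of _ "2 * g" "2 * g"])
  let ?n = "2 * g" and ?h = "tv g c" and ?J = "Jmat g :: 'f mat"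
  have Ss: "S \<in> symm_mats ?n" and Sc: "S \<in> carrier_mat ?n ?n" using S alt_symm symm_carrier by auto
  have hc: "?h \<in> carrier_mat ?n ?n" by simp
  then have tc: "transpose_mat ?h \<in> carrier_mat ?n ?n" by simp
  define u where "u = S *\<^sub>v (?J *\<^sub>v c)"
  have Jc: "?J *\<^sub>v c \<in> carrier_vec ?n" using c by simp
  have uc: "u \<in> carrier_vec ?n" unfolding u_def using mult_mat_vec_carrier[OF Sc Jc] .
  show "?h * (S * transpose_mat ?h) \<in> carrier_mat ?n ?n" by (rule conj_carrier[OF hc Sc])
  show "S + wd ?n c (S *\<^sub>v (?J *\<^sub>v c)) \<in> carrier_mat ?n ?n" using Sc by simp
  fix v :: "'f vec" assume v: "v \<in> carrier_vec ?n"
  have Sv: "S *\<^sub>v v \<in> carrier_vec ?n" using mult_mat_vec_carrier[OF Sc v] .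
  have tv: "transpose_mat ?h *\<^sub>v v = v + (c \<bullet> v) \<cdot>\<^sub>v (?J *\<^sub>v c)"
  proof (rule eq_vecI)
    fix i assume "i < dim_vec (v + (c \<bullet> v) \<cdot>\<^sub>v (?J *\<^sub>v c))"
    then have i: "i < ?n" by simp
    let ?e = "unit_vec ?n i :: 'f vec"
    have tvc: "transpose_mat ?h *\<^sub>v v \<in> carrier_vec ?n" using mult_mat_vec_carrier[OF tc v] .
    have "(transpose_mat ?h *\<^sub>v v) $ i = (transpose_mat ?h *\<^sub>v v) \<bullet> ?e" using i by simp
    also have "\<dots> = v \<bullet> (?h *\<^sub>v ?e)" by (rule transpose_vec_mult_scalar[OF hc unit_vec_carrier v])
    also have "\<dots> = v \<bullet> ?e + v \<bullet> (intersection_form g c ?e \<cdot>\<^sub>v c)"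
      unfolding tv_vec[OF c unit_vec_carrier] by (rule scalar_prod_add_distrib[OF v]) (use c in simp_all)
    also have "\<dots> = v $ i + intersection_form g c ?e * (v \<bullet> c)" using i v c by simp
    also have "intersection_form g c ?e = (?J *\<^sub>v c) $ i"
      using intersection_form_unit[OF c i] form_sym[of g c] Jmat_mult_vec[OF c i]
      by (simp add: jv_def del: index_mult_mat_vec)
    finally show "(transpose_mat ?h *\<^sub>v v) $ i = (v + (c \<bullet> v) \<cdot>\<^sub>v (?J *\<^sub>v c)) $ i"
      using i v c Jc by (simp add: comm_scalar_prod[OF v c] mult.commute carrier_vecD[OF Jc] del: index_mult_mat_vec)
  qed (use v tc in \<open>simp add: tv_def\<close>)
  have "(?h * (S * transpose_mat ?h)) *\<^sub>v v = ?h *\<^sub>v (S *\<^sub>v (transpose_mat ?h *\<^sub>v v))"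
    using assoc_mult_mat_vec[OF hc mult_carrier_mat[OF Sc tc] v] assoc_mult_mat_vec[OF Sc tc v] by simp
  also have "S *\<^sub>v (transpose_mat ?h *\<^sub>v v) = S *\<^sub>v v + (c \<bullet> v) \<cdot>\<^sub>v u"
    unfolding tv u_def
    using mult_add_distrib_mat_vec[OF Sc v, of "(c \<bullet> v) \<cdot>\<^sub>v (?J *\<^sub>v c)"] Jc mat_vec_smult[OF Sc Jc] by simp
  also have "?h *\<^sub>v (S *\<^sub>v v + (c \<bullet> v) \<cdot>\<^sub>v u) = (S *\<^sub>v v + (c \<bullet> v) \<cdot>\<^sub>v u) +
      intersection_form g c (S *\<^sub>v v + (c \<bullet> v) \<cdot>\<^sub>v u) \<cdot>\<^sub>v c"
    by (rule tv_vec[OF c]) (use Sv uc in simp)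
  also have "intersection_form g c (S *\<^sub>v v + (c \<bullet> v) \<cdot>\<^sub>v u) = u \<bullet> v"
  proof -
    have Jr: "intersection_form g c w = (?J *\<^sub>v c) \<bullet> w" if "w \<in> carrier_vec ?n" for w
      using intersection_form_eq[OF c that] Jmat_anti[OF c that] by (simp add: minus_eq)
    have "(?J *\<^sub>v c) \<bullet> (S *\<^sub>v v) = u \<bullet> v" unfolding u_def using symm_adjoint[OF Ss Jc v] by simp
    moreover have "(?J *\<^sub>v c) \<bullet> u = 0" unfolding u_def by (rule alt_quad[OF S Jc])
    ultimately show ?thesis
      using Jr[of "S *\<^sub>v v + (c \<bullet> v) \<cdot>\<^sub>v u"] Sv uc Jc by (simp add: scalar_prod_add_distrib[of _ ?n])
  qed
  also have "(S *\<^sub>v v + (c \<bullet> v) \<cdot>\<^sub>v u) + (u \<bullet> v) \<cdot>\<^sub>v c = (S + wd ?n c u) *\<^sub>v v"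
    unfolding add_mult_distrib_mat_vec[OF Sc wd_carrier(1) v] wd_vec[OF c uc v]
    using Sv uc c by (intro eq_vecI) (auto simp: ac_simps simp del: index_mult_mat_vec)
  finally show "(?h * (S * transpose_mat ?h)) *\<^sub>v v = (S + wd ?n c (S *\<^sub>v (?J *\<^sub>v c))) *\<^sub>v v"
    unfolding u_def .
qed

lemma mat_add_cancel:
  "A \<in> carrier_mat n n \<Longrightarrow> B \<in> carrier_mat n n \<Longrightarrow> A + (A + B) = (B :: 'f mat)"
  by (rule eq_matI) (auto simp: add.assoc[symmetric] add_self)

text \<open>By \<open>tv_conj\<close> this element is the difference between S and its image under
  the transvection along c.\<close>

lemma gsub_transvection:
  assumes W: "gsubmodule (Sp g) (symm_module ty g) W" and S: "S \<in> W" "S \<in> alt_mats (2 * g)"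
    and c: "c \<in> bin_vecs (2 * g)"
  shows "wd (2 * g) c (S *\<^sub>v (Jmat g *\<^sub>v c)) \<in> W"
proof -
  obtain s where s: "s \<in> carrier (Sp g)" "hF s = tv g c" using bin_vec_tv[OF c] by blast
  have "hF s * (S * transpose_mat (hF s)) \<in> W" using W S(1) s(1) unfolding symm_sub_iff by blast
  then have "S + wd (2 * g) c (S *\<^sub>v (Jmat g *\<^sub>v c)) \<in> W"
    unfolding s(2) tv_conj[OF bin_vecs_carrier[OF c] S(2)] .
  then have "S + (S + wd (2 * g) c (S *\<^sub>v (Jmat g *\<^sub>v c))) \<in> W" using W S(1) unfolding symm_sub_iff by blast
  then show ?thesis using mat_add_cancel[OF symm_carrier[OF alt_symm[OF S(2)]] wd_carrier(1)] by simp
qed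

lemma wd_J:
  assumes "x \<in> carrier_vec (2 * g)" "y \<in> carrier_vec (2 * g)" "c \<in> carrier_vec (2 * g)"
  shows "wd (2 * g) x y *\<^sub>v (Jmat g *\<^sub>v c) =
    intersection_form g y c \<cdot>\<^sub>v x + intersection_form g x c \<cdot>\<^sub>v (y :: 'f vec)"
  using wd_vec[OF assms(1,2), of "Jmat g *\<^sub>v c"] assms by (simp add: intersection_form_eq)

text \<open>For S = x wedge y the vector S J c is a combination of x and y. When c is orthogonal to
  x, only x remains, so y is exchanged for c up to a scalar.\<close>

lemma gsub_wd_transvection:
  assumes W: "gsubmodule (Sp g) (symm_module ty g) W" and xy: "x \<in> carrier_vec (2 * g)" "y \<in> carrier_vec (2 * g)"
    and "wd (2 * g) x y \<in> W" and c: "c \<in> bin_vecs (2 * g)" and "intersection_form g x c = 0"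
  shows "intersection_form g y c \<cdot>\<^sub>m wd (2 * g) c x \<in> W"
proof -
  have "wd (2 * g) x y *\<^sub>v (Jmat g *\<^sub>v c) = intersection_form g y c \<cdot>\<^sub>v x"
    unfolding wd_J[OF xy bin_vecs_carrier[OF c]] assms(6) using xy by (intro eq_vecI) auto
  then show ?thesis using gsub_transvection[OF W assms(4) wd_alt c] wd_smult_right[OF xy(1)] by simp
qed

lemma smult_cancel:
  assumes W: "gsubmodule (Sp g) (symm_module ty g) W" and "a \<cdot>\<^sub>m S \<in> W" "a \<noteq> 0"
  shows "S \<in> W"
proof -
  have "inverse a \<cdot>\<^sub>m (a \<cdot>\<^sub>m S) \<in> W" using W assms(2) unfolding symm_sub_iff by blast
  moreover have "inverse a \<cdot>\<^sub>m (a \<cdot>\<^sub>m S) = S" using assms(3) by (intro eq_matI) auto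
  ultimately show ?thesis by simp
qed

text \<open>Orthogonal to c are e_(conjx i) for each i with c_i = 0, and e_(conjx i) + e_(conjx p)
  whenever c_i and c_p are both 1. A vector u orthogonal to all of these has entries proportional to
  those of c.\<close>

lemma separating_vector:
  assumes c: "c \<in> bin_vecs (2 * g)" "c \<noteq> 0\<^sub>v (2 * g)" and u: "u \<in> carrier_vec (2 * g)"
    and ind: "\<And>l. u \<noteq> l \<cdot>\<^sub>v (c :: 'f vec)"
  shows "\<exists>b\<in>bin_vecs (2 * g). intersection_form g c b = 0 \<and> intersection_form g u b \<noteq> 0"
proof (rule ccontr)
  assume n: "\<not> ?thesis"
  let ?n = "2 * g"
  have cc: "c \<in> carrier_vec ?n" using c bin_vecs_carrier by blast
  have z: "intersection_form g u b = 0" if "b \<in> bin_vecs ?n" "intersection_form g c b = 0" for b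
    using n that by blast
  have "\<exists>p<?n. c $ p \<noteq> 0"
  proof (rule ccontr)
    assume "\<not> ?thesis"
    then have "c = 0\<^sub>v ?n" using cc by (intro eq_vecI) auto
    then show False using c(2) by simp
  qed
  then obtain p where p: "p < ?n" "c $ p = 1" using bin_vecs_index[OF c(1)] by blast
  have p': "conjx p < ?n" using conjx_less[OF p(1)] .
  have "u $ i = u $ p * c $ i" if i: "i < ?n" for i
  proof -
    have i': "conjx i < ?n" using conjx_less[OF i] .
    note fu = form_unit_right'[OF u i'] form_unit_right'[OF u p']
      and fc = form_unit_right'[OF cc i'] form_unit_right'[OF cc p']
    show ?thesis
    proof (cases "c $ i = 0")
      case True
      then show ?thesis using z[OF bin_vecs_unit, of "conjx i"] fu fc by simp
    next
      case False
      then have 1: "c $ i = 1" using bin_vecs_index[OF c(1) i] by blast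
      let ?b = "unit_vec ?n (conjx i) + unit_vec ?n (conjx p) :: 'f vec"
      have "intersection_form g c ?b = 0"
        unfolding form_add_right[OF unit_vec_carrier unit_vec_carrier cc] using fc 1 p add_self[of 1] two_eq_0 by simp
      then have "intersection_form g u ?b = 0" using z bin_vecs_add[OF bin_vecs_unit bin_vecs_unit] by blast
      then have "u $ i + u $ p = 0"
        unfolding form_add_right[OF unit_vec_carrier unit_vec_carrier u] using fu by simp
      then show ?thesis using 1 eq_iff_add by simp
    qed
  qed
  then have "u = u $ p \<cdot>\<^sub>v c" using u cc by (intro eq_vecI) auto
  then show False using ind by blast
qed

section \<open>Spreading one x wedge y in a submodule to all orthogonal pairs of binary
  vectors\<close>

definition wd_good :: "nat \<Rightarrow> 'f mat set \<Rightarrow> 'f vec \<Rightarrow> bool" where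
  "wd_good g W a \<longleftrightarrow> (\<forall>c\<in>bin_vecs (2 * g). intersection_form g a c = 0 \<longrightarrow> wd (2 * g) a c \<in> W)"

text \<open>A transvection along c orthogonal to a exchanges b for c, provided c is not orthogonal
  to b. If it is, c is split as d + (c + d) with d orthogonal to a but not to b.\<close>

lemma wd_good_start:
  assumes W: "gsubmodule (Sp g) (symm_module ty g) W"
    and a: "a \<in> bin_vecs (2 * g)" "a \<noteq> 0\<^sub>v (2 * g)" and b: "b \<in> bin_vecs (2 * g)" "b \<noteq> 0\<^sub>v (2 * g)" "a \<noteq> b"
    and Q: "intersection_form g a b = 0" and ab: "wd (2 * g) a b \<in> W"
  shows "wd_good g W a"
  unfolding wd_good_def
proof (intro ballI impI)
  let ?n = "2 * g"
  have ac: "a \<in> carrier_vec ?n" and bc: "b \<in> carrier_vec ?n" using a b bin_vecs_carrier by auto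
  have 1: "wd ?n a c \<in> W" if c: "c \<in> bin_vecs ?n" "intersection_form g a c = 0" "intersection_form g b c \<noteq> 0" for c
    using smult_cancel[OF W gsub_wd_transvection[OF W ac bc ab c(1,2)] c(3)] wd_commute by metis
  fix c assume c: "c \<in> bin_vecs ?n" "intersection_form g a c = 0"
  have cc: "c \<in> carrier_vec ?n" using c bin_vecs_carrier by blast
  show "wd ?n a c \<in> W"
  proof (cases "intersection_form g b c = 0")
    case False
    then show ?thesis using 1 c by blast
  next
    case True
    \<comment> \<open>Distinct nonzero binary vectors are never proportional: at a nonzero entry of
      b both entries are 1, which forces the factor 1.\<close>
    have "b \<noteq> l \<cdot>\<^sub>v a" for l
    proof
      assume e: "b = l \<cdot>\<^sub>v a"
      have "\<exists>p<?n. b $ p \<noteq> 0"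
      proof (rule ccontr)
        assume "\<not> ?thesis"
        then have "b = 0\<^sub>v ?n" using bc by (intro eq_vecI) auto
        then show False using b(2) by simp
      qed
      then obtain p where p: "p < ?n" "b $ p \<noteq> 0" by blast
      have bp: "b $ p = l * a $ p" using e p(1) ac by simp
      have "b $ p = 1" "a $ p = 1" using p bp bin_vecs_index[OF b(1) p(1)] bin_vecs_index[OF a(1) p(1)] by auto
      then have "l = 1" using bp by simp
      then show False using e b(3) ac by simp
    qed
    then obtain d where d: "d \<in> bin_vecs ?n" "intersection_form g a d = 0" "intersection_form g b d \<noteq> 0"
      using separating_vector[OF a bc] by blast
    have dc: "d \<in> carrier_vec ?n" using d bin_vecs_carrier by blast
    have "wd ?n a (c + d) \<in> W"
      by (rule 1) (use d c True bin_vecs_add form_add_right[OF cc dc] ac bc in auto)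
    moreover have "wd ?n a d \<in> W" using 1 d by blast
    ultimately have "wd ?n a d + wd ?n a (c + d) \<in> W" using W unfolding symm_sub_iff by blast
    moreover have "wd ?n a d + wd ?n a (c + d) = wd ?n a c"
      unfolding wd_add_right[OF cc dc] by (rule eq_matI) (auto simp: add.left_commute add_self)
    ultimately show ?thesis by simp
  qed
qed

text \<open>Pigeonhole: the pairings of e_0, e_1, e_2 with a and b take values in a set of four
  pairs. Either one of them is (0, 0), or two coincide, or all three nonzero pairs occur and add up
  to zero.\<close>

lemma orthogonal_pair:
  assumes a: "a \<in> bin_vecs (2 * g)" and b: "b \<in> bin_vecs (2 * g)" and g: "g \<ge> 3"
  shows "\<exists>c\<in>bin_vecs (2 * g). c \<noteq> (0\<^sub>v (2 * g) :: 'f vec) \<and> intersection_form g a c = 0 \<and> intersection_form g b c = 0"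
proof -
  let ?n = "2 * g" and ?e = "unit_vec (2 * g) :: nat \<Rightarrow> 'f vec"
  have n: "0 < ?n" "1 < ?n" "2 < ?n" using g by auto
  have ac: "a \<in> carrier_vec ?n" and bc: "b \<in> carrier_vec ?n" using a b bin_vecs_carrier by auto
  let ?A = "\<lambda>i. intersection_form g a (?e i)" and ?B = "\<lambda>i. intersection_form g b (?e i)"
  have v: "?A i = 0 \<or> ?A i = 1" "?B i = 0 \<or> ?B i = 1" for i using form_bin a b bin_vecs_unit by blast+
  have nz: "c \<noteq> 0\<^sub>v ?n" if "c $ i \<noteq> 0" "i < ?n" for c :: "'f vec" and i using that by auto
  have add: "intersection_form g a (x + y) = intersection_form g a x + intersection_form g a y"
    "intersection_form g b (x + y) = intersection_form g b x + intersection_form g b y"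
    if "x \<in> carrier_vec ?n" "y \<in> carrier_vec ?n" for x y
    using form_add_right[OF that ac] form_add_right[OF that bc] by auto
  have one: ?thesis if "i < ?n" "?A i = 0" "?B i = 0" for i
    using that by (intro bexI[of _ "?e i"]) auto
  have two: ?thesis if "i < ?n" "j < ?n" "i \<noteq> j" "?A i = ?A j" "?B i = ?B j" for i j
    using that nz[of "?e i + ?e j" i] by (intro bexI[of _ "?e i + ?e j"]) (auto simp: add add_self bin_vecs_add)
  have three: ?thesis if "?A 0 + ?A 1 + ?A 2 = 0" "?B 0 + ?B 1 + ?B 2 = 0"
  proof (intro bexI conjI)
    show "?e 0 + ?e 1 + ?e 2 \<in> bin_vecs ?n" by (intro bin_vecs_add bin_vecs_unit)
    show "?e 0 + ?e 1 + ?e 2 \<noteq> 0\<^sub>v ?n" by (rule nz[OF _ n(1)]) (use n in simp)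
    show "intersection_form g a (?e 0 + ?e 1 + ?e 2) = 0" "intersection_form g b (?e 0 + ?e 1 + ?e 2) = 0"
      using that by (simp_all add: add)
  qed
  have "1 + 1 = (0 :: 'f)" by (rule add_self)
  then show ?thesis
    using v(1)[of 0] v(1)[of 1] v(1)[of 2] v(2)[of 0] v(2)[of 1] v(2)[of 2]
      one[OF n(1)] one[OF n(2)] one[OF n(3)] two[OF n(1,2)] two[OF n(1,3)] two[OF n(2,3)] three
    by (elim disjE) simp_all
qed

text \<open>Goodness passes to any orthogonal vector by \<open>wd_good_start\<close>, and two
  vectors that are not orthogonal are linked by a third one orthogonal to both.\<close>

lemma wd_good_all:
  assumes W: "gsubmodule (Sp g) (symm_module ty g) W" and g: "g \<ge> 3"
    and a: "a \<in> bin_vecs (2 * g)" "a \<noteq> 0\<^sub>v (2 * g)" "wd_good g W a"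
    and b: "b \<in> bin_vecs (2 * g)" "b \<noteq> 0\<^sub>v (2 * g)"
  shows "wd_good g W b"
proof -
  have step: "wd_good g W y" if "x \<in> bin_vecs (2 * g)" "x \<noteq> 0\<^sub>v (2 * g)" "wd_good g W x"
    "y \<in> bin_vecs (2 * g)" "y \<noteq> 0\<^sub>v (2 * g)" "x \<noteq> y" "intersection_form g x y = 0" for x y
  proof -
    have "wd (2 * g) x y \<in> W" using that unfolding wd_good_def by blast
    then have "wd (2 * g) y x \<in> W" using wd_commute by metis
    then show ?thesis using wd_good_start[OF W that(4,5,1,2)] that(6,7) form_sym[of g x y] by auto
  qed
  have self: "intersection_form g x x = 0" if "x \<in> bin_vecs (2 * g)" for x
    using intersection_form_self[of x g] that bin_vecs_carrier by blast
  show ?thesis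
  proof (cases "a = b")
    case False
    show ?thesis
    proof (cases "intersection_form g a b = 0")
      case True
      then show ?thesis using step a b False by blast
    next
      case ab: False
      obtain c where c: "c \<in> bin_vecs (2 * g)" "c \<noteq> 0\<^sub>v (2 * g)" "intersection_form g a c = 0" "intersection_form g b c = 0"
        using orthogonal_pair[OF a(1) b(1) g] by blast
      have "c \<noteq> a" "c \<noteq> b" using c(3,4) ab form_sym[of g a b] by auto
      then have "wd_good g W c" using step[OF a c(1,2)] c(3) by auto
      then show ?thesis using step[OF c(1,2) _ b] c(4) \<open>c \<noteq> b\<close> form_sym[of g b c] by auto
    qed
  qed (use a in simp)
qed

text \<open>The kernel is spanned by e_i wedge e_j for orthogonal basis vectors and by the sums of
  e_i wedge e_(conjx i) and e_0 wedge e_1. For i other than 0 and 1 the latter come from (e_i + e_0)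
  wedge (e_(conjx i) + e_1), whose factors are orthogonal as 1 + 1 = 0.\<close>

lemma ker_ht_subset:
  assumes W: "gsubmodule (Sp g) (symm_module ty g) W" and g: "g \<ge> 3"
    and good: "\<And>b. b \<in> bin_vecs (2 * g) \<Longrightarrow> b \<noteq> 0\<^sub>v (2 * g) \<Longrightarrow> wd_good g W b"
  shows "ker_ht g \<subseteq> W"
proof
  let ?n = "2 * g" and ?e = "unit_vec (2 * g) :: nat \<Rightarrow> 'f vec"
  note w = W[unfolded symm_sub_iff]
  have n: "0 < ?n" "1 < ?n" using g by auto
  have in1: "wd ?n (?e i) (?e j) \<in> W" if "i < ?n" "j < ?n" "j \<noteq> conjx i" for i j
  proof -
    have ci: "conjx j < ?n" using conjx_less[OF that(2)] .
    have "i \<noteq> conjx j" using that(3) conjx_conjx by metis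
    then have "intersection_form g (?e i) (?e j) = 0"
      using form_unit_right'[OF unit_vec_carrier that(2), of i] that ci by simp
    then show ?thesis using good[of "?e i"] that unfolding wd_good_def by simp
  qed
  have in2: "wd ?n (?e i) (?e j) + wd ?n (?e 0) (?e 1) \<in> W" if ij: "i < ?n" "j = conjx i" for i j
  proof (cases "i = 0 \<or> i = 1")
    case True
    have c01: "conjx 0 = 1" "conjx 1 = 0" by (simp_all add: conjx_def)
    have "wd ?n (?e i) (?e j) = wd ?n (?e 0) (?e 1)" using True ij(2) wd_commute c01 by metis
    then have "wd ?n (?e i) (?e j) + wd ?n (?e 0) (?e 1) = 0\<^sub>m ?n ?n"
      by (intro eq_matI) (auto simp: add_self)
    then show ?thesis using w by simp
  next
    case False
    have j: "j < ?n" using ij conjx_less by simp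
    have c01: "conjx 0 = 1" "conjx 1 = 0" by (simp_all add: conjx_def)
    have jj: "j \<noteq> 0" "j \<noteq> 1" "conjx j = i" "i \<noteq> j"
      using ij(2) False c01 conjx_conjx[of i] conjx_neq(2)[of i] by metis+
    let ?x = "?e i + ?e 0" and ?y = "?e j + ?e 1"
    have xc: "?x \<in> carrier_vec ?n" by simp
    have "?x $ i \<noteq> 0" using ij False n by simp
    then have "?x \<noteq> 0\<^sub>v ?n" using ij(1) by (metis index_zero_vec(1))
    then have gx: "wd_good g W ?x" using good bin_vecs_add[OF bin_vecs_unit bin_vecs_unit] by blast
    have "intersection_form g ?x ?y = 0"
      unfolding form_add_right[OF unit_vec_carrier unit_vec_carrier xc] form_unit_right'[OF xc j] form_unit_right'[OF xc n(2)]
      using jj ij False n add_self[of 1] by (simp add: c01[unfolded One_nat_def])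
    then have "wd ?n ?x ?y \<in> W" using gx bin_vecs_add[OF bin_vecs_unit bin_vecs_unit] unfolding wd_good_def by blast
    moreover have "wd ?n (?e i) (?e 1) \<in> W" "wd ?n (?e 0) (?e j) \<in> W"
      using in1[of i 1] in1[of 0 j] ij j jj False n c01 by (auto simp: conjx_eq_iff)
    ultimately have "wd ?n ?x ?y + (wd ?n (?e i) (?e 1) + wd ?n (?e 0) (?e j)) \<in> W" using w by blast
    moreover have "wd ?n ?x ?y + (wd ?n (?e i) (?e 1) + wd ?n (?e 0) (?e j)) =
        wd ?n (?e i) (?e j) + wd ?n (?e 0) (?e 1)"
    proof -
      have cancel: "(p + r + (q + s)) + (r + q) = p + (s :: 'f)" for p q r s
      proof -
        have "(p + r + (q + s)) + (r + q) = p + s + (r + r) + (q + q)" by (simp add: ac_simps)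
        then show ?thesis by (simp add: add_self)
      qed
      have "wd ?n ?x ?y = (wd ?n (?e i) (?e j) + wd ?n (?e i) (?e 1)) + (wd ?n (?e 0) (?e j) + wd ?n (?e 0) (?e 1))"
        by (rule eq_matI) (auto simp: wd_def algebra_simps)
      then show ?thesis by (simp only:) (intro eq_matI, simp_all add: cancel)
    qed
    ultimately show ?thesis by simp
  qed
  fix S :: "'f mat" assume "S \<in> ker_ht g"
  then have S: "S \<in> alt_mats ?n" "half_trace g S = 0" by (auto simp: ker_ht_def)
  have Sc: "S \<in> carrier_mat ?n ?n" using S alt_symm symm_carrier by blast
  \<comment> \<open>Each term with j = \<open>conjx i\<close> is corrected by e_0 wedge e_1. The
    corrections add up to the half trace of S times e_0 wedge e_1, so they change nothing for S in
    the kernel.\<close>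
  define f where "f = (\<lambda>(i, j). S $$ (i, j) \<cdot>\<^sub>m (wd ?n (?e i) (?e j) +
     (if j = conjx i then wd ?n (?e 0) (?e 1) else 0\<^sub>m ?n ?n)))"
  have fc: "f p \<in> carrier_mat ?n ?n" for p unfolding f_def by (cases p) simp
  have "msum ?n f (lt_pairs ?n) \<in> W"
  proof (rule msum_closed)
    fix p assume "p \<in> lt_pairs ?n"
    then obtain i j where p: "p = (i, j)" "i < ?n" "j < ?n" by (auto simp: lt_pairs_def)
    have "wd ?n (?e i) (?e j) + (if j = conjx i then wd ?n (?e 0) (?e 1) else 0\<^sub>m ?n ?n) \<in> W"
      using in1[OF p(2,3)] in2[OF p(2)] by (cases "j = conjx i") simp_all
    then show "f p \<in> W" unfolding p(1) f_def prod.case using w by blast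
  qed (use w fc in auto)
  moreover have "msum ?n f (lt_pairs ?n) = S"
  proof (rule eq_matI)
    fix k l assume "k < dim_row S" "l < dim_col S"
    then have kl: "k < ?n" "l < ?n" using Sc by auto
    have "msum ?n f (lt_pairs ?n) $$ (k, l) = (\<Sum>p\<in>lt_pairs ?n. f p $$ (k, l))"
      using kl by (simp add: msum_def)
    also have "\<dots> = (\<Sum>p\<in>lt_pairs ?n. (case p of (i, j) \<Rightarrow> S $$ (i, j) * wd ?n (?e i) (?e j) $$ (k, l)) +
        (case p of (i, j) \<Rightarrow> if j = conjx i then S $$ (i, j) * wd ?n (?e 0) (?e 1) $$ (k, l) else 0))"
      using kl by (intro sum.cong refl) (auto simp: f_def distrib_left split: prod.splits)
    also have "\<dots> = S $$ (k, l) + (\<Sum>j<g. S $$ (2 * j, 2 * j + 1) * wd ?n (?e 0) (?e 1) $$ (k, l))"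
      unfolding sum.distrib alt_sum_entries[OF S(1) kl] sum_even_odd_pairs ..
    also have "(\<Sum>j<g. S $$ (2 * j, 2 * j + 1) * wd ?n (?e 0) (?e 1) $$ (k, l)) = 0"
      using S(2) unfolding sum_distrib_right[symmetric] half_trace_def by simp
    finally show "msum ?n f (lt_pairs ?n) $$ (k, l) = S $$ (k, l)" by simp
  qed (use Sc in \<open>auto simp: msum_def\<close>)
  ultimately show "S \<in> W" by simp
qed

text \<open>Each basis vector and each sum of two is an eigenvector of S J, so all eigenvalues agree
  and S J is scalar. As J^2 = 1 in characteristic 2, S is a multiple of J.\<close>

lemma scalar_from_eigen:
  assumes S: "S \<in> symm_mats (2 * g)"
    and e: "\<And>c. c \<in> bin_vecs (2 * g) \<Longrightarrow> \<exists>l. S *\<^sub>v (Jmat g *\<^sub>v c) = l \<cdot>\<^sub>v (c :: 'f vec)"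
  shows "S \<in> J_line g"
proof -
  let ?n = "2 * g" and ?J = "Jmat g :: 'f mat"
  let ?e = "unit_vec ?n :: nat \<Rightarrow> 'f vec"
  have Sc: "S \<in> carrier_mat ?n ?n" using S by (rule symm_carrier)
  have SJ: "S * ?J \<in> carrier_mat ?n ?n" using mult_carrier_mat[OF Sc Jmat_carrier] .
  have ev: "\<exists>l. (S * ?J) *\<^sub>v c = l \<cdot>\<^sub>v c" if "c \<in> bin_vecs ?n" for c
    using e[OF that] assoc_mult_mat_vec[OF Sc Jmat_carrier bin_vecs_carrier[OF that]] by simp
  have "\<forall>i. \<exists>l. (S * ?J) *\<^sub>v ?e i = l \<cdot>\<^sub>v ?e i" using ev[OF bin_vecs_unit] by blast
  then have "\<exists>l. \<forall>i. (S * ?J) *\<^sub>v ?e i = l i \<cdot>\<^sub>v ?e i" by (rule choice)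
  then obtain l where l: "\<And>i. (S * ?J) *\<^sub>v ?e i = l i \<cdot>\<^sub>v ?e i" by blast
  have eq: "l i = l j" if "i < ?n" "j < ?n" for i j
  proof (cases "i = j")
    case False
    obtain m where m: "(S * ?J) *\<^sub>v (?e i + ?e j) = m \<cdot>\<^sub>v (?e i + ?e j)"
      using ev bin_vecs_add[OF bin_vecs_unit bin_vecs_unit] by blast
    have "l i \<cdot>\<^sub>v ?e i + l j \<cdot>\<^sub>v ?e j = m \<cdot>\<^sub>v (?e i + ?e j)"
      using m mult_add_distrib_mat_vec[OF SJ unit_vec_carrier unit_vec_carrier, of i j] l by simp
    then have "(l i \<cdot>\<^sub>v ?e i + l j \<cdot>\<^sub>v ?e j) $ k = (m \<cdot>\<^sub>v (?e i + ?e j)) $ k" for k by simp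
    from this[of i] this[of j] show ?thesis using that False by simp
  qed simp
  have "S * ?J = l 0 \<cdot>\<^sub>m 1\<^sub>m ?n"
  proof (rule eq_matI)
    fix i j assume "i < dim_row (l 0 \<cdot>\<^sub>m 1\<^sub>m ?n)" "j < dim_col (l 0 \<cdot>\<^sub>m 1\<^sub>m ?n)"
    then have ij: "i < ?n" "j < ?n" by auto
    then have "l j = l 0" using eq[of j 0] by simp
    then show "(S * ?J) $$ (i, j) = (l 0 \<cdot>\<^sub>m 1\<^sub>m ?n) $$ (i, j)"
      unfolding mult_unit_vec_index[OF SJ ij, symmetric] l using ij by simp
  qed (use Sc in auto)
  then have "(S * ?J) * ?J = l 0 \<cdot>\<^sub>m ?J"
    using mult_smult_assoc_mat[OF one_carrier_mat Jmat_carrier, of "l 0"] by simp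
  moreover have "(S * ?J) * ?J = S"
  proof -
    have "(S * ?J) * ?J = S * (?J * ?J)" by (rule assoc_mult_mat[OF Sc Jmat_carrier Jmat_carrier])
    also have "?J * ?J = 1\<^sub>m ?n" unfolding Jmat_sq by (rule eq_matI) (auto simp: minus_eq)
    finally show ?thesis using Sc by simp
  qed
  ultimately have "S = l 0 \<cdot>\<^sub>m ?J" by metis
  then show ?thesis unfolding J_line_def by blast
qed

text \<open>Adding to an alternating matrix its image under the transvection along \<open>c\<close> gives some \<open>c \<and> u\<close>. A second
  transvection, along a binary vector \<open>b\<close>, replaces \<open>u\<close> by a multiple of \<open>b\<close>.\<close>

theorem ker_ht_minimal:
  assumes W: "gsubmodule (Sp g) (symm_module ty g) W" and g: "g \<ge> 3"
    and S: "S \<in> W" "S \<in> alt_mats (2 * g)" "S \<notin> J_line g"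
  shows "ker_ht g \<subseteq> W"
proof -
  let ?n = "2 * g" and ?J = "Jmat g :: 'f mat"
  have Sc: "S \<in> carrier_mat ?n ?n" using S alt_symm symm_carrier by blast
  obtain c where c: "c \<in> bin_vecs ?n" "\<And>l. S *\<^sub>v (?J *\<^sub>v c) \<noteq> l \<cdot>\<^sub>v c"
    using scalar_from_eigen[OF alt_symm[OF S(2)]] S(3) by blast
  define u where "u = S *\<^sub>v (?J *\<^sub>v c)"
  have cc: "c \<in> carrier_vec ?n" using c bin_vecs_carrier by blast
  have Jc: "?J *\<^sub>v c \<in> carrier_vec ?n" using cc by simp
  have uc: "u \<in> carrier_vec ?n" unfolding u_def using mult_mat_vec_carrier[OF Sc Jc] .
  have cu: "wd ?n c u \<in> W" unfolding u_def by (rule gsub_transvection[OF W S(1,2) c(1)])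
  have c0: "c \<noteq> 0\<^sub>v ?n"
  proof
    assume z: "c = 0\<^sub>v ?n"
    have "?J *\<^sub>v 0\<^sub>v ?n = 0\<^sub>v ?n" "S *\<^sub>v 0\<^sub>v ?n = 0\<^sub>v ?n" using Sc by (auto intro!: eq_vecI simp: scalar_prod_def)
    then have "S *\<^sub>v (?J *\<^sub>v c) = 0 \<cdot>\<^sub>v c" using z by (auto intro!: eq_vecI)
    then show False using c(2) by blast
  qed
  obtain b where b: "b \<in> bin_vecs ?n" "intersection_form g c b = 0" "intersection_form g u b \<noteq> 0"
    using separating_vector[OF c(1) c0 uc] c(2) unfolding u_def by blast
  have bc: "b \<in> carrier_vec ?n" using b bin_vecs_carrier by blast
  have bcW: "wd ?n b c \<in> W" using smult_cancel[OF W gsub_wd_transvection[OF W cc uc cu b(1,2)] b(3)] .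
  \<comment> \<open>Pairing u = S J c with c evaluates the alternating form S at J c. So b, whose
    pairing with u is nonzero, differs from c.\<close>
  have "intersection_form g u c = 0"
  proof -
    have "intersection_form g u c = u \<bullet> (?J *\<^sub>v c)" by (rule intersection_form_eq[OF uc cc])
    also have "\<dots> = (?J *\<^sub>v c) \<bullet> u" by (rule comm_scalar_prod[OF uc Jc])
    also have "\<dots> = 0" unfolding u_def by (rule alt_quad[OF S(2) Jc])
    finally show ?thesis .
  qed
  then have "b \<noteq> c" using b(3) by auto
  have b0: "b \<noteq> 0\<^sub>v ?n" using b(3) by (auto simp: intersection_form_def)
  have "wd_good g W b"
    using wd_good_start[OF W b(1) b0 c(1) c0 \<open>b \<noteq> c\<close> _ bcW] b(2) form_sym[of g c b] by simp
  then show ?thesis using ker_ht_subset[OF W g] wd_good_all[OF W g b(1) b0] by blast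
qed

end

section \<open>Composition factors and isomorphic modules\<close>

lemma composition_seriesI:
  assumes G: "monoid G" and M: "is_gmodule G M" and "Ws \<noteq> []" "hd Ws = {\<zero>\<^bsub>M\<^esub>}" "last Ws = carrier M"
    and c: "\<And>i. Suc i < length Ws \<Longrightarrow> gcover G M (Ws ! i) (Ws ! Suc i)"
    and sub: "\<And>W. W \<in> set Ws \<Longrightarrow> gsubmodule G M W"
  shows "composition_series G M Ws"
  unfolding composition_series_def
proof (intro conjI ballI allI impI)
  fix i assume i: "Suc i < length Ws"
  note d = gcoverD[OF c[OF i]]
  show "Ws ! i \<subseteq> Ws ! Suc i" by (rule d(3))
  show "gsimple G (series_factor M Ws i)"
    unfolding series_factor_def using gsimple_factor_iff[OF G M d(1,2,3)] c[OF i] by simp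
qed (use assms in auto)

text \<open>Triviality of the action on A / B is carried through N to A' / B'. Read
  contrapositively, this separates factors.\<close>

lemma trivial_factor_transfer:
  assumes M: "is_gmodule G M" and A: "gsubmodule G M A" "gsubmodule G M A'"
    and f: "gepi G M A B N f" and f': "gepi G M A' B' N f'"
    and t: "\<And>s x. s \<in> carrier G \<Longrightarrow> x \<in> A \<Longrightarrow> act M s x \<ominus>\<^bsub>M\<^esub> x \<in> B"
    and s: "s \<in> carrier G" and x: "x \<in> A'"
  shows "act M s x \<ominus>\<^bsub>M\<^esub> x \<in> B'"
proof -
  have fh: "ghom_on G M A N f" "ghom_on G M A' N f'" and im: "f ` A = carrier N" "f' ` A' = carrier N"
    and k: "\<And>x y. x \<in> A \<Longrightarrow> y \<in> A \<Longrightarrow> f x = f y \<longleftrightarrow> x \<ominus>\<^bsub>M\<^esub> y \<in> B"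
      "\<And>x y. x \<in> A' \<Longrightarrow> y \<in> A' \<Longrightarrow> f' x = f' y \<longleftrightarrow> x \<ominus>\<^bsub>M\<^esub> y \<in> B'"
    using f f' by (simp_all add: gepi_def)
  have cl: "act M s z \<in> A" if "z \<in> A" for z using A(1) s that unfolding gsubmodule_iff[OF M] by simp
  have cl': "act M s x \<in> A'" using A(2) s x unfolding gsubmodule_iff[OF M] by simp
  have "f' x \<in> f ` A" unfolding im(1) im(2)[symmetric] using x by (rule imageI)
  then obtain y where y: "y \<in> A" "f' x = f y" by blast
  have "f' (act M s x) = act N s (f' x)" by (rule ghom_onD(3)[OF fh(2) s x])
  also have "\<dots> = f (act M s y)" unfolding y(2) by (rule ghom_onD(3)[OF fh(1) s y(1), symmetric])
  also have "\<dots> = f y" using k(1)[OF cl[OF y(1)] y(1)] t[OF s y(1)] by simp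
  finally have "f' (act M s x) = f' x" using y(2) by simp
  then show ?thesis using k(2)[OF cl' x] by simp
qed

text \<open>The image of s - 1 on A / B has dimension at most 1 exactly if among any two elements
  some nontrivial combination is fixed by s. In this form the property is visibly preserved by
  linear equivariant maps with the given fibres.\<close>

lemma dependent_factor_transfer:
  fixes M :: "('f::field, 'v, 'g) gmodule" and N :: "('f, 'w, 'g) gmodule"
  assumes M: "is_gmodule G M" and A: "gsubmodule G M A" "gsubmodule G M A'"
    and f: "gepi G M A B N f" and f': "gepi G M A' B' N f'"
    and s: "s \<in> carrier G"
    and t: "\<And>x y. x \<in> A \<Longrightarrow> y \<in> A \<Longrightarrow> \<exists>a b. (a \<noteq> 0 \<or> b \<noteq> 0) \<and>
      (a \<odot>\<^bsub>M\<^esub> act M s x \<oplus>\<^bsub>M\<^esub> b \<odot>\<^bsub>M\<^esub> act M s y) \<ominus>\<^bsub>M\<^esub> (a \<odot>\<^bsub>M\<^esub> x \<oplus>\<^bsub>M\<^esub> b \<odot>\<^bsub>M\<^esub> y) \<in> B"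
    and x: "x \<in> A'" and y: "y \<in> A'"
  shows "\<exists>a b. (a \<noteq> 0 \<or> b \<noteq> 0) \<and>
      (a \<odot>\<^bsub>M\<^esub> act M s x \<oplus>\<^bsub>M\<^esub> b \<odot>\<^bsub>M\<^esub> act M s y) \<ominus>\<^bsub>M\<^esub> (a \<odot>\<^bsub>M\<^esub> x \<oplus>\<^bsub>M\<^esub> b \<odot>\<^bsub>M\<^esub> y) \<in> B'"
proof -
  have im: "f ` A = carrier N" "f' ` A' = carrier N"
    and fh: "ghom_on G M A N f" "ghom_on G M A' N f'"
    and k: "\<And>x y. x \<in> A \<Longrightarrow> y \<in> A \<Longrightarrow> f x = f y \<longleftrightarrow> x \<ominus>\<^bsub>M\<^esub> y \<in> B"
      "\<And>x y. x \<in> A' \<Longrightarrow> y \<in> A' \<Longrightarrow> f' x = f' y \<longleftrightarrow> x \<ominus>\<^bsub>M\<^esub> y \<in> B'"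
    using f f' by (simp_all add: gepi_def)
  have ca: "act M s z \<in> C" and cs: "r \<odot>\<^bsub>M\<^esub> z \<in> C" if "z \<in> C" "gsubmodule G M C" for z r C
    using that s unfolding gsubmodule_iff[OF M] by simp_all
  have cp: "z \<oplus>\<^bsub>M\<^esub> w \<in> C" if "z \<in> C" "w \<in> C" "gsubmodule G M C" for z w C
    using that unfolding gsubmodule_iff[OF M] by simp
  have "f' x \<in> f ` A" "f' y \<in> f ` A" unfolding im(1) im(2)[symmetric] using x y by (auto intro: imageI)
  then obtain u v where uv: "u \<in> A" "f' x = f u" "v \<in> A" "f' y = f v" by blast
  obtain a b where ab: "a \<noteq> 0 \<or> b \<noteq> 0"
    "(a \<odot>\<^bsub>M\<^esub> act M s u \<oplus>\<^bsub>M\<^esub> b \<odot>\<^bsub>M\<^esub> act M s v) \<ominus>\<^bsub>M\<^esub> (a \<odot>\<^bsub>M\<^esub> u \<oplus>\<^bsub>M\<^esub> b \<odot>\<^bsub>M\<^esub> v) \<in> B"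
    using t[OF uv(1,3)] by blast
  have lin: "h (a \<odot>\<^bsub>M\<^esub> z \<oplus>\<^bsub>M\<^esub> b \<odot>\<^bsub>M\<^esub> w) = a \<odot>\<^bsub>N\<^esub> h z \<oplus>\<^bsub>N\<^esub> b \<odot>\<^bsub>N\<^esub> h w"
    if "ghom_on G M C N h" "gsubmodule G M C" "z \<in> C" "w \<in> C" for h C z w
    using ghom_onD(1,2)[OF that(1)] cs[OF that(3,2)] cs[OF that(4,2)] that(3,4) by simp
  have "f (a \<odot>\<^bsub>M\<^esub> act M s u \<oplus>\<^bsub>M\<^esub> b \<odot>\<^bsub>M\<^esub> act M s v) = f (a \<odot>\<^bsub>M\<^esub> u \<oplus>\<^bsub>M\<^esub> b \<odot>\<^bsub>M\<^esub> v)"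
    by (rule iffD2[OF k(1) ab(2)]; intro ca cs cp A uv)
  then have "f' (a \<odot>\<^bsub>M\<^esub> act M s x \<oplus>\<^bsub>M\<^esub> b \<odot>\<^bsub>M\<^esub> act M s y) = f' (a \<odot>\<^bsub>M\<^esub> x \<oplus>\<^bsub>M\<^esub> b \<odot>\<^bsub>M\<^esub> y)"
    unfolding lin[OF fh(1) A(1) ca[OF uv(1) A(1)] ca[OF uv(3) A(1)]] lin[OF fh(1) A(1) uv(1,3)]
      lin[OF fh(2) A(2) ca[OF x A(2)] ca[OF y A(2)]] lin[OF fh(2) A(2) x y]
      ghom_onD(3)[OF fh(1) s uv(1)] ghom_onD(3)[OF fh(1) s uv(3)]
      ghom_onD(3)[OF fh(2) s x] ghom_onD(3)[OF fh(2) s y] uv(2,4) .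
  then have "(a \<odot>\<^bsub>M\<^esub> act M s x \<oplus>\<^bsub>M\<^esub> b \<odot>\<^bsub>M\<^esub> act M s y) \<ominus>\<^bsub>M\<^esub> (a \<odot>\<^bsub>M\<^esub> x \<oplus>\<^bsub>M\<^esub> b \<odot>\<^bsub>M\<^esub> y) \<in> B'"
    by (rule iffD1[OF k(2), rotated 2]; intro ca cs cp A x y)
  with ab(1) show ?thesis by blast
qed

section \<open>Transport of composition series along an isomorphism of modules\<close>

locale gmodule_iso =
  fixes G :: "'g monoid" and M :: "('f::field, 'v, 'g) gmodule" and P :: "('f, 'w, 'g) gmodule"
    and \<theta> :: "'v \<Rightarrow> 'w"
  assumes G: "monoid G" and M: "is_gmodule G M" and P: "is_gmodule G P"
    and bij: "bij_betw \<theta> (carrier M) (carrier P)" and hom: "ghom_on G M (carrier M) P \<theta>"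
begin

definition pre :: "'w set \<Rightarrow> 'v set" where
  "pre A = {x \<in> carrier M. \<theta> x \<in> A}"

lemma theta_mem: "x \<in> carrier M \<Longrightarrow> \<theta> x \<in> carrier P"
  using bij by (auto simp: bij_betw_def)

lemma theta_inj: "x \<in> carrier M \<Longrightarrow> y \<in> carrier M \<Longrightarrow> \<theta> x = \<theta> y \<longleftrightarrow> x = y"
  using bij by (auto simp: bij_betw_def inj_on_eq_iff)

lemma theta_surj: "y \<in> carrier P \<Longrightarrow> \<exists>x\<in>carrier M. y = \<theta> x"
  using bij by (auto simp: bij_betw_def)

lemma theta_zero: "\<theta> \<zero>\<^bsub>M\<^esub> = \<zero>\<^bsub>P\<^esub>"
proof -
  interpret M: Module.module class_ring M using is_gmoduleD(1)[OF M] .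
  interpret P: Module.module class_ring P using is_gmoduleD(1)[OF P] .
  have "\<theta> \<zero>\<^bsub>M\<^esub> \<oplus>\<^bsub>P\<^esub> \<theta> \<zero>\<^bsub>M\<^esub> = \<theta> \<zero>\<^bsub>M\<^esub>" using ghom_onD(1)[OF hom M.zero_closed M.zero_closed] by simp
  then show ?thesis using P.l_neg[OF theta_mem[OF M.zero_closed]] P.a_assoc theta_mem[OF M.zero_closed]
    by (metis P.a_inv_closed P.l_zero)
qed

lemma theta_minus:
  assumes "x \<in> carrier M" "y \<in> carrier M"
  shows "\<theta> (x \<ominus>\<^bsub>M\<^esub> y) = \<theta> x \<ominus>\<^bsub>P\<^esub> \<theta> y"
proof -
  interpret M: Module.module class_ring M using is_gmoduleD(1)[OF M] .
  interpret P: Module.module class_ring P using is_gmoduleD(1)[OF P] .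
  have n: "\<ominus>\<^bsub>M\<^esub> y \<in> carrier M" using assms by simp
  have "\<theta> (\<ominus>\<^bsub>M\<^esub> y) \<oplus>\<^bsub>P\<^esub> \<theta> y = \<zero>\<^bsub>P\<^esub>"
    using ghom_onD(1)[OF hom n assms(2)] theta_zero assms by (simp add: M.l_neg)
  then have "\<ominus>\<^bsub>P\<^esub> \<theta> y = \<theta> (\<ominus>\<^bsub>M\<^esub> y)"
    by (rule P.minus_equality[OF _ theta_mem[OF assms(2)] theta_mem[OF n]])
  then show ?thesis using ghom_onD(1)[OF hom assms(1) n] by (simp add: a_minus_def)
qed

lemma pre_gsubmodule:
  assumes A: "gsubmodule G P A"
  shows "gsubmodule G M (pre A)"
proof -
  interpret M: Module.module class_ring M using is_gmoduleD(1)[OF M] .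
  note a = A[unfolded gsubmodule_iff[OF P]] and h = ghom_onD[OF hom]
  show ?thesis unfolding gsubmodule_iff[OF M]
  proof (intro conjI ballI allI)
    show "\<zero>\<^bsub>M\<^esub> \<in> pre A" unfolding pre_def using a theta_zero by simp
    fix x y assume "x \<in> pre A" "y \<in> pre A"
    then show "x \<oplus>\<^bsub>M\<^esub> y \<in> pre A" unfolding pre_def using a h(1) by simp
  next
    fix r x assume "x \<in> pre A"
    then show "r \<odot>\<^bsub>M\<^esub> x \<in> pre A" unfolding pre_def using a h(2) M.smult_closed[of r x] by simp
  next
    fix s x assume "s \<in> carrier G" "x \<in> pre A"
    then show "act M s x \<in> pre A" unfolding pre_def using a h(3) is_gmoduleD(2)[OF M] by simp
  qed (auto simp: pre_def)
qed

lemma image_gsubmodule: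
  assumes A: "gsubmodule G M A"
  shows "gsubmodule G P (\<theta> ` A)"
proof -
  note a = A[unfolded gsubmodule_iff[OF M]] and h = ghom_onD[OF hom]
  have ac: "x \<in> carrier M" if "x \<in> A" for x using a that by blast
  show ?thesis unfolding gsubmodule_iff[OF P]
  proof (intro conjI ballI allI)
    show "\<theta> ` A \<subseteq> carrier P" using ac theta_mem by blast
    show "\<zero>\<^bsub>P\<^esub> \<in> \<theta> ` A" unfolding theta_zero[symmetric] using a by (intro imageI) simp
    fix x y assume "x \<in> \<theta> ` A" "y \<in> \<theta> ` A"
    then obtain u v where "u \<in> A" "v \<in> A" "x = \<theta> u" "y = \<theta> v" by blast
    then show "x \<oplus>\<^bsub>P\<^esub> y \<in> \<theta> ` A" using h(1)[OF ac ac, of u v] a by (metis imageI)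
  next
    fix r x assume "x \<in> \<theta> ` A"
    then obtain u where "u \<in> A" "x = \<theta> u" by blast
    then show "r \<odot>\<^bsub>P\<^esub> x \<in> \<theta> ` A" using h(2)[OF ac, of u r] a by (metis imageI)
  next
    fix s x assume "s \<in> carrier G" "x \<in> \<theta> ` A"
    moreover from this obtain u where "u \<in> A" "x = \<theta> u" by blast
    ultimately show "act P s x \<in> \<theta> ` A" using h(3)[OF _ ac, of s u] a by (metis imageI)
  qed
qed

lemma theta_pre: "A \<subseteq> carrier P \<Longrightarrow> \<theta> ` pre A = A"
  unfolding pre_def using theta_surj by fast

lemma pre_theta: "A \<subseteq> carrier M \<Longrightarrow> pre (\<theta> ` A) = A"
  unfolding pre_def using theta_inj by fast

lemma pre_gcover:
  assumes "gcover G P B A"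
  shows "gcover G M (pre B) (pre A)"
proof -
  note d = gcoverD[OF assms]
  have c: "A \<subseteq> carrier P" "B \<subseteq> carrier P" using d(1,2) by (simp_all add: gsubmodule_iff[OF P])
  show ?thesis unfolding gcover_def
  proof (intro conjI allI impI)
    show "gsubmodule G M (pre A)" "gsubmodule G M (pre B)" using pre_gsubmodule d(1,2) by auto
    have "pre B \<subseteq> pre A" using d(3) by (auto simp: pre_def)
    moreover have "pre B \<noteq> pre A" using d(4) theta_pre[OF c(1)] theta_pre[OF c(2)] by metis
    ultimately show "pre B \<subset> pre A" by blast
    fix U assume U: "gsubmodule G M U" "pre B \<subseteq> U" "U \<subseteq> pre A"
    have Uc: "U \<subseteq> carrier M" using U by (simp add: gsubmodule_iff[OF M])
    have "B \<subseteq> \<theta> ` U" using image_mono[OF U(2), of \<theta>] theta_pre[OF c(2)] by simp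
    moreover have "\<theta> ` U \<subseteq> A" using image_mono[OF U(3), of \<theta>] theta_pre[OF c(1)] by simp
    ultimately have "\<theta> ` U = B \<or> \<theta> ` U = A" using d(5)[OF image_gsubmodule[OF U(1)]] by simp
    then show "U = pre B \<or> U = pre A" using pre_theta[OF Uc] by metis
  qed
qed

lemma pre_gepi:
  assumes f: "gepi G P A B N f" and A: "gsubmodule G P A"
  shows "gepi G M (pre A) (pre B) N (\<lambda>x. f (\<theta> x))"
proof -
  interpret M: Module.module class_ring M using is_gmoduleD(1)[OF M] .
  have c: "A \<subseteq> carrier P" using A by (simp add: gsubmodule_iff[OF P])
  have fh: "ghom_on G P A N f" and im: "f ` A = carrier N"
    and k: "\<And>x y. x \<in> A \<Longrightarrow> y \<in> A \<Longrightarrow> f x = f y \<longleftrightarrow> x \<ominus>\<^bsub>P\<^esub> y \<in> B"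
    using f by (simp_all add: gepi_def)
  note h = ghom_onD[OF hom] and h' = ghom_onD[OF fh]
  have p: "x \<in> carrier M" "\<theta> x \<in> A" if "x \<in> pre A" for x using that by (auto simp: pre_def)
  show ?thesis unfolding gepi_def
  proof (intro conjI ballI)
    show "ghom_on G M (pre A) N (\<lambda>x. f (\<theta> x))"
      unfolding ghom_on_def by (intro conjI ballI allI) (simp_all add: h h' p)
    show "(\<lambda>x. f (\<theta> x)) ` pre A = carrier N"
      unfolding im[symmetric] using theta_pre[OF c] by (metis image_image)
    fix x y assume xy: "x \<in> pre A" "y \<in> pre A"
    show "f (\<theta> x) = f (\<theta> y) \<longleftrightarrow> x \<ominus>\<^bsub>M\<^esub> y \<in> pre B"
      using k[OF p(2)[OF xy(1)] p(2)[OF xy(2)]] theta_minus[OF p(1)[OF xy(1)] p(1)[OF xy(2)]]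
        M.minus_closed[OF p(1)[OF xy(1)] p(1)[OF xy(2)]] by (simp add: pre_def)
  qed
qed

lemma composition_series_pre:
  assumes W: "composition_series G P Ws"
  shows "composition_series G M (map pre Ws)"
proof (rule composition_seriesI[OF G M])
  interpret M: Module.module class_ring M using is_gmoduleD(1)[OF M] .
  note w = composition_seriesD[OF G W]
  have ne: "Ws \<noteq> []" and hl: "hd Ws = {\<zero>\<^bsub>P\<^esub>}" "last Ws = carrier P" using W by (auto simp: composition_series_def)
  show "map pre Ws \<noteq> []" using ne by simp
  have "pre {\<zero>\<^bsub>P\<^esub>} = {\<zero>\<^bsub>M\<^esub>}" unfolding pre_def using theta_inj[OF _ M.zero_closed] theta_zero M.zero_closed by auto
  then show "hd (map pre Ws) = {\<zero>\<^bsub>M\<^esub>}" using ne hl by (simp add: hd_map)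
  have "pre (carrier P) = carrier M" unfolding pre_def using theta_mem by auto
  then show "last (map pre Ws) = carrier M" using ne hl by (simp add: last_map)
  show "gcover G M (map pre Ws ! i) (map pre Ws ! Suc i)" if "Suc i < length (map pre Ws)" for i
    using that pre_gcover[OF w(6)] by simp
  show "gsubmodule G M X" if "X \<in> set (map pre Ws)" for X
    using that pre_gsubmodule W by (auto simp: composition_series_def)
qed

end

lemma gmodule_iso_sym:
  assumes "gmodule_iso G M P \<theta>"
  shows "gmodule_iso G P M (inv_into (carrier M) \<theta>)"
proof -
  interpret gmodule_iso G M P \<theta> by fact
  interpret M: Module.module class_ring M using is_gmoduleD(1)[OF M] .
  let ?i = "inv_into (carrier M) \<theta>"
  have i: "?i y \<in> carrier M" "\<theta> (?i y) = y" if "y \<in> carrier P" for y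
    using that bij by (auto simp: bij_betw_def inv_into_into f_inv_into_f)
  have e: "?i y = x" if "x \<in> carrier M" "\<theta> x = y" for x y
    using that bij by (auto simp: bij_betw_def)
  note h = ghom_onD[OF hom]
  show ?thesis
  proof (rule gmodule_iso.intro)
    show "monoid G" "is_gmodule G P" "is_gmodule G M" by (rule G P M)+
    show "bij_betw ?i (carrier P) (carrier M)" by (rule bij_betw_inv_into[OF bij])
    show "ghom_on G P (carrier P) M ?i" unfolding ghom_on_def
    proof (intro conjI ballI allI)
      fix x y assume "x \<in> carrier P" "y \<in> carrier P"
      then show "?i (x \<oplus>\<^bsub>P\<^esub> y) = ?i x \<oplus>\<^bsub>M\<^esub> ?i y" using i h(1) by (intro e) simp_all
    next
      fix r x assume "x \<in> carrier P"
      then show "?i (r \<odot>\<^bsub>P\<^esub> x) = r \<odot>\<^bsub>M\<^esub> ?i x" using i h(2) M.smult_closed by (intro e) simp_all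
    next
      fix s x assume "s \<in> carrier G" "x \<in> carrier P"
      then show "?i (act P s x) = act M s (?i x)" using i h(3) is_gmoduleD(2)[OF M] by (intro e) simp_all
    qed
  qed
qed

context gmodule_iso
begin

text \<open>Preimages under the isomorphism and under its inverse undo each other, so maps on
  factors can be moved both ways.\<close>

lemma giso_series_factor_pre:
  assumes W: "composition_series G P Ws" and i: "Suc i < length Ws"
  shows "giso G (series_factor M (map pre Ws) i) N \<longleftrightarrow> giso G (series_factor P Ws i) N"
proof -
  note w = composition_seriesD[OF G W] and m = composition_seriesD[OF G composition_series_pre[OF W]]
  interpret I: gmodule_iso G P M "inv_into (carrier M) \<theta>" by (rule gmodule_iso_sym) (rule gmodule_iso_axioms)
  have i': "i < length Ws" using i by simp
  have ci: "Ws ! i \<subseteq> carrier P" "Ws ! Suc i \<subseteq> carrier P"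
    using w(4)[OF i] w(4)[OF i'] by (simp_all add: gsubmodule_iff[OF P])
  have back_pre: "I.pre (pre A) = A" if "A \<subseteq> carrier P" for A
  proof -
    have "inv_into (carrier M) \<theta> y \<in> pre A \<longleftrightarrow> y \<in> A" if "y \<in> carrier P" for y
      using that bij unfolding pre_def by (auto simp: bij_betw_def inv_into_into f_inv_into_f)
    then show ?thesis unfolding I.pre_def using that by blast
  qed
  have "giso G (series_factor P Ws i) N \<longleftrightarrow> (\<exists>f. gepi G P (Ws ! Suc i) (Ws ! i) N f)"
    unfolding series_factor_def by (rule giso_factor_iff[OF P w(4)[OF i] w(4)[OF i'] w(5)[OF i]])
  moreover have "giso G (series_factor M (map pre Ws) i) N \<longleftrightarrow> (\<exists>f. gepi G M (pre (Ws ! Suc i)) (pre (Ws ! i)) N f)"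
    using giso_factor_iff[OF M m(4)[of "Suc i"] m(4)[of i] m(5)[of i]] i unfolding series_factor_def by simp
  moreover have "(\<exists>f. gepi G M (pre (Ws ! Suc i)) (pre (Ws ! i)) N f) \<longleftrightarrow> (\<exists>f. gepi G P (Ws ! Suc i) (Ws ! i) N f)"
  proof
    assume "\<exists>f. gepi G P (Ws ! Suc i) (Ws ! i) N f"
    then show "\<exists>f. gepi G M (pre (Ws ! Suc i)) (pre (Ws ! i)) N f" using pre_gepi w(4)[OF i] by blast
  next
    assume "\<exists>f. gepi G M (pre (Ws ! Suc i)) (pre (Ws ! i)) N f"
    then obtain f where "gepi G M (pre (Ws ! Suc i)) (pre (Ws ! i)) N f" by blast
    from I.pre_gepi[OF this pre_gsubmodule[OF w(4)[OF i]]]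
    show "\<exists>f. gepi G P (Ws ! Suc i) (Ws ! i) N f" unfolding back_pre[OF ci(1)] back_pre[OF ci(2)] by blast
  qed
  ultimately show ?thesis by simp
qed

lemma has_multiplicity_pre:
  assumes W: "composition_series G P Ws"
    and m: "card {i. Suc i < length Ws \<and> giso G (series_factor P Ws i) N} = m"
  shows "has_multiplicity G M N m"
proof (rule has_multiplicityI[OF G composition_series_pre[OF W]])
  show "card {i. Suc i < length (map pre Ws) \<and> giso G (series_factor M (map pre Ws) i) N} = m"
    unfolding m[symmetric] using giso_series_factor_pre[OF W] by (intro arg_cong[of _ _ card]) auto
qed

lemma composition_factor_pre:
  assumes W: "composition_series G P Ws" and S: "composition_factor G M S"
  shows "\<exists>i. Suc i < length Ws \<and> (\<forall>N. giso G (series_factor P Ws i) N \<longrightarrow> giso G S N)"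
  using composition_factor_series[OF G composition_series_pre[OF W] S] giso_series_factor_pre[OF W] by auto

end

context char2
begin

section \<open>Covering relations between consecutive members of the series\<close>

lemma monoid_Sp: "monoid (Sp g)"
  using group_Sp group.is_monoid by blast

lemma Jmat_index: "i < 2 * g \<Longrightarrow> j < 2 * g \<Longrightarrow> Jmat g $$ (i, j) = (if j = conjx i then 1 else (0 :: 'f))"
  by (simp add: Jmat_def minus_eq)

lemma Jmat_alt: "(Jmat g :: 'f mat) \<in> alt_mats (2 * g)"
  unfolding alt_mats_def using Jmat_symm by (simp add: Jmat_index)

lemma half_trace_Jmat: "half_trace g (Jmat g) = (of_nat g :: 'f)"
  by (simp add: half_trace_def Jmat_index)

lemma of_nat_parity: "of_nat k = (if odd k then 1 else 0 :: 'f)"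
  using of_int_eq[of "int k"] by simp

lemma J_line_index: "S \<in> J_line g \<Longrightarrow> i < 2 * g \<Longrightarrow> j < 2 * g \<Longrightarrow> j \<noteq> conjx i \<Longrightarrow> S $$ (i, j) = (0 :: 'f)"
  by (auto simp: J_line_def Jmat_index)

lemma wd_unit_ker:
  assumes "i < 2 * g" "j < 2 * g" "j \<noteq> conjx i"
  shows "wd (2 * g) (unit_vec (2 * g) i) (unit_vec (2 * g) j) \<in> (ker_ht g :: 'f mat set)"
proof -
  have "i \<noteq> conjx j" using assms(3) conjx_conjx by metis
  then have "intersection_form g (unit_vec (2 * g) i) (unit_vec (2 * g) j) = (0 :: 'f)"
    using form_unit_right'[OF unit_vec_carrier assms(2), of i] conjx_less[OF assms(2)] assms(1) by simp
  then show ?thesis by (simp add: ker_ht_def wd_alt half_trace_wd)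
qed

lemma ker_ht_alt: "ker_ht g \<subseteq> (alt_mats (2 * g) :: 'f mat set)"
  by (auto simp: ker_ht_def)

lemma wd_not_J_line:
  assumes "i < 2 * g" "j < 2 * g" "j \<noteq> conjx i" "i \<noteq> j"
  shows "wd (2 * g) (unit_vec (2 * g) i) (unit_vec (2 * g) j) \<notin> (J_line g :: 'f mat set)"
proof
  assume "wd (2 * g) (unit_vec (2 * g) i) (unit_vec (2 * g) j) \<in> (J_line g :: 'f mat set)"
  from J_line_index[OF this assms(1-3)] show False using assms by (simp add: wd_def)
qed

lemma gsubmodule_zero: "gsubmodule (Sp g) (symm_module ty g) {0\<^sub>m (2 * g) (2 * g)}"
proof -
  have "0\<^sub>m (2 * g) (2 * g) + 0\<^sub>m (2 * g) (2 * g) = (0\<^sub>m (2 * g) (2 * g) :: 'f mat)"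
    "r \<cdot>\<^sub>m 0\<^sub>m (2 * g) (2 * g) = (0\<^sub>m (2 * g) (2 * g) :: 'f mat)" for r
    by (intro eq_matI; simp)+
  moreover have "hF s * (0\<^sub>m (2 * g) (2 * g) * transpose_mat (hF s)) = 0\<^sub>m (2 * g) (2 * g)"
    if "s \<in> carrier (Sp g)" for s using hb_carrier[OF that] by simp
  ultimately show ?thesis unfolding symm_sub_iff by (simp add: symm_zero)
qed

lemma gsubmodule_symm: "gsubmodule (Sp g) (symm_module ty g) (symm_mats (2 * g))"
  unfolding symm_sub_iff
  using conj_symm[OF hb_carrier] by (auto simp: symm_add symm_smult symm_zero)

lemma zero_in_gsub: "gsubmodule (Sp g) (symm_module ty g) U \<Longrightarrow> 0\<^sub>m (2 * g) (2 * g) \<in> U"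
  unfolding symm_sub_iff by simp

text \<open>For odd g the half trace of J is 1, so the line through J meets the kernel only in zero;
  any other element of a submodule produces the whole kernel by
  \<open>ker_ht_minimal\<close>.\<close>

lemma gcover_zero_ker:
  assumes g: "g \<ge> 3" "odd g"
  shows "gcover (Sp g) (symm_module ty g) {0\<^sub>m (2 * g) (2 * g)} (ker_ht g)"
  unfolding gcover_def
proof (intro conjI allI impI)
  let ?n = "2 * g"
  have n: "0 < ?n" "2 < ?n" "2 \<noteq> conjx 0" using g by (auto simp: conjx_def)
  have "wd ?n (unit_vec ?n 0) (unit_vec ?n 2) \<in> (ker_ht g :: 'f mat set)" by (rule wd_unit_ker[OF n])
  moreover have "(wd ?n (unit_vec ?n 0) (unit_vec ?n 2) :: 'f mat) \<noteq> 0\<^sub>m ?n ?n"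
  proof
    assume "(wd ?n (unit_vec ?n 0) (unit_vec ?n 2) :: 'f mat) = 0\<^sub>m ?n ?n"
    from arg_cong[OF this, of "\<lambda>A. A $$ (0, 2)"] show False using n by (simp add: wd_def)
  qed
  ultimately show "{0\<^sub>m ?n ?n} \<subset> (ker_ht g :: 'f mat set)"
    using zero_in_gsub[OF gsubmodule_ker_ht, of g] by blast
  fix U assume U: "gsubmodule (Sp g) (symm_module ty g) U" "U \<subseteq> ker_ht g"
  have z: "0\<^sub>m ?n ?n \<in> U" by (rule zero_in_gsub[OF U(1)])
  show "U = {0\<^sub>m ?n ?n} \<or> U = ker_ht g"
  proof (cases "U \<subseteq> J_line g")
    case True
    have "S = 0\<^sub>m ?n ?n" if S: "S \<in> U" for S
    proof -
      obtain a where a: "S = a \<cdot>\<^sub>m Jmat g" using True S by (auto simp: J_line_def)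
      have "half_trace g S = 0" using U(2) S by (auto simp: ker_ht_def)
      then have "a = 0" unfolding a half_trace_smult[OF Jmat_symm] half_trace_Jmat of_nat_parity using g by simp
      then show ?thesis unfolding a by (intro eq_matI) auto
    qed
    then show ?thesis using z by blast
  next
    case False
    then obtain S where "S \<in> U" "S \<notin> J_line g" by blast
    then have "ker_ht g \<subseteq> U" using ker_ht_minimal[OF U(1) g(1)] U(2) ker_ht_alt by blast
    then show ?thesis using U(2) by blast
  qed
qed (rule gsubmodule_ker_ht gsubmodule_zero)+

lemma J_line_ker: "even g \<Longrightarrow> J_line g \<subseteq> (ker_ht g :: 'f mat set)"
proof
  fix S :: "'f mat" assume g: "even g" and "S \<in> J_line g"
  then obtain a where a: "S = a \<cdot>\<^sub>m Jmat g" by (auto simp: J_line_def)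
  have "S \<in> alt_mats (2 * g)" using gsubmodule_alt[of g] Jmat_alt unfolding symm_sub_iff a by blast
  moreover have "half_trace g S = 0"
    unfolding a half_trace_smult[OF Jmat_symm] half_trace_Jmat of_nat_parity using g by simp
  ultimately show "S \<in> ker_ht g" by (simp add: ker_ht_def)
qed

lemma gcover_zero_J:
  assumes g: "g \<ge> 3"
  shows "gcover (Sp g) (symm_module ty g) {0\<^sub>m (2 * g) (2 * g)} (J_line g)"
  unfolding gcover_def
proof (intro conjI allI impI)
  let ?n = "2 * g"
  have J1: "Jmat g = 1 \<cdot>\<^sub>m (Jmat g :: 'f mat)" by (rule eq_matI) auto
  then have "Jmat g \<in> (J_line g :: 'f mat set)" unfolding J_line_def by (metis rangeI)
  moreover have "(Jmat g :: 'f mat) \<noteq> 0\<^sub>m ?n ?n"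
  proof
    assume "(Jmat g :: 'f mat) = 0\<^sub>m ?n ?n"
    from arg_cong[OF this, of "\<lambda>A. A $$ (0, 1)"] show False using g by (simp add: Jmat_index conjx_def)
  qed
  ultimately show "{0\<^sub>m ?n ?n} \<subset> (J_line g :: 'f mat set)"
    using zero_in_gsub[OF gsubmodule_J_line, of g] by blast
  fix U assume U: "gsubmodule (Sp g) (symm_module ty g) U" "U \<subseteq> J_line g"
  have z: "0\<^sub>m ?n ?n \<in> U" by (rule zero_in_gsub[OF U(1)])
  show "U = {0\<^sub>m ?n ?n} \<or> U = J_line g"
  proof (cases "U \<subseteq> {0\<^sub>m ?n ?n}")
    case False
    then obtain S where S: "S \<in> U" "S \<noteq> 0\<^sub>m ?n ?n" by blast
    then obtain a where a: "S = a \<cdot>\<^sub>m Jmat g" using U(2) by (auto simp: J_line_def)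
    have "a \<noteq> 0"
    proof
      assume "a = 0"
      then have "S = 0\<^sub>m ?n ?n" unfolding a by (intro eq_matI) auto
      then show False using S(2) by simp
    qed
    have "Jmat g \<in> U" using smult_cancel[OF U(1) _ \<open>a \<noteq> 0\<close>] S(1) a by blast
    then have "J_line g \<subseteq> U" using U(1) unfolding symm_sub_iff by (auto simp: J_line_def)
    then show ?thesis using U(2) by blast
  qed (use z in blast)
qed (rule gsubmodule_J_line gsubmodule_zero)+

lemma gcover_J_ker:
  assumes g: "g \<ge> 3" "even g"
  shows "gcover (Sp g) (symm_module ty g) (J_line g) (ker_ht g)"
  unfolding gcover_def
proof (intro conjI allI impI)
  let ?n = "2 * g"
  have n: "0 < ?n" "2 < ?n" "2 \<noteq> conjx 0" using g by (auto simp: conjx_def)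
  have "wd ?n (unit_vec ?n 0) (unit_vec ?n 2) \<in> (ker_ht g :: 'f mat set)" by (rule wd_unit_ker[OF n])
  moreover have "wd ?n (unit_vec ?n 0) (unit_vec ?n 2) \<notin> (J_line g :: 'f mat set)"
    by (rule wd_not_J_line[OF n]) simp
  ultimately show "J_line g \<subset> (ker_ht g :: 'f mat set)" using J_line_ker[OF g(2)] by blast
  fix U assume U: "gsubmodule (Sp g) (symm_module ty g) U" "J_line g \<subseteq> U" "U \<subseteq> ker_ht g"
  show "U = J_line g \<or> U = ker_ht g"
  proof (cases "U \<subseteq> J_line g")
    case False
    then obtain S where "S \<in> U" "S \<notin> J_line g" by blast
    then have "ker_ht g \<subseteq> U" using ker_ht_minimal[OF U(1) g(1)] U(3) ker_ht_alt by blast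
    then show ?thesis using U(3) by blast
  qed (use U(2) in blast)
qed (rule gsubmodule_J_line gsubmodule_ker_ht)+

text \<open>The kernel of a nonzero linear functional has codimension 1: a multiple of an element
  outside it corrects the half trace of any other matrix.\<close>

lemma gcover_ker_alt:
  assumes g: "g \<ge> 3"
  shows "gcover (Sp g) (symm_module ty g) (ker_ht g) (alt_mats (2 * g))"
  unfolding gcover_def
proof (intro conjI allI impI)
  let ?n = "2 * g"
  have n: "0 < ?n" "1 < ?n" using g by auto
  have c01: "conjx 1 = 0" by (simp add: conjx_def)
  have "wd ?n (unit_vec ?n 0) (unit_vec ?n 1) \<notin> (ker_ht g :: 'f mat set)"
    using form_unit_right'[OF unit_vec_carrier n(2), of 0] n
    by (simp add: ker_ht_def half_trace_wd c01[unfolded One_nat_def])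
  then show "ker_ht g \<subset> (alt_mats ?n :: 'f mat set)" using ker_ht_alt wd_alt by blast
  fix U assume U: "gsubmodule (Sp g) (symm_module ty g) U" "ker_ht g \<subseteq> U" "U \<subseteq> alt_mats ?n"
  show "U = ker_ht g \<or> U = alt_mats ?n"
  proof (cases "U \<subseteq> ker_ht g")
    case False
    then obtain S where S: "S \<in> U" "S \<notin> ker_ht g" by blast
    then have Sa: "S \<in> alt_mats ?n" and t: "half_trace g S \<noteq> 0" using U(3) by (auto simp: ker_ht_def)
    have "T \<in> U" if T: "T \<in> alt_mats ?n" for T
    proof -
      let ?R = "(half_trace g T / half_trace g S) \<cdot>\<^sub>m S"
      have RU: "?R \<in> U" using U(1) S(1) unfolding symm_sub_iff by blast
      have Rs: "?R \<in> symm_mats ?n" using RU U(3) alt_symm by blast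
      have "half_trace g (?R + T) = 0"
        unfolding half_trace_add[OF Rs alt_symm[OF T]] half_trace_smult[OF alt_symm[OF Sa]] using t by (simp add: add_self)
      moreover have "?R + T \<in> alt_mats ?n" using gsubmodule_alt[of g] RU U(3) T unfolding symm_sub_iff by blast
      ultimately have "?R + T \<in> U" using U(2) by (auto simp: ker_ht_def)
      then have "?R + (?R + T) \<in> U" using U(1) RU unfolding symm_sub_iff by blast
      then show ?thesis using mat_add_cancel[OF symm_carrier[OF Rs] symm_carrier[OF alt_symm[OF T]]] by simp
    qed
    then show ?thesis using U(3) by blast
  qed (use U(2) in blast)
qed (rule gsubmodule_alt gsubmodule_ker_ht)+

section \<open>The diagonal map onto the natural module\<close>

definition diagv :: "nat \<Rightarrow> 'f mat \<Rightarrow> 'f vec" where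
  "diagv n S = vec n (\<lambda>k. S $$ (k, k))"

lemma diagv_carrier [simp]: "diagv n S \<in> carrier_vec n"
  by (simp add: diagv_def)

lemma diagv_act:
  assumes "s \<in> carrier (Sp g)" "S \<in> symm_mats (2 * g)"
  shows "diagv (2 * g) (hF s * (S * transpose_mat (hF s))) = hF s *\<^sub>v diagv (2 * g) S"
  using diag_act[OF assms] hb_carrier[OF assms(1)]
  by (intro eq_vecI) (auto simp: diagv_def simp del: index_mult_mat(1) index_mult_mat_vec)

lemma diagv_add:
  "S \<in> symm_mats n \<Longrightarrow> T \<in> symm_mats n \<Longrightarrow> diagv n (S + T) = diagv n S + diagv n T"
  by (intro eq_vecI) (auto simp: diagv_def dest!: symm_carrier)

lemma diagv_smult: "S \<in> symm_mats n \<Longrightarrow> diagv n (r \<cdot>\<^sub>m S) = r \<cdot>\<^sub>v diagv n S"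
  by (intro eq_vecI) (auto simp: diagv_def dest!: symm_carrier)

lemma diagv_eq_iff:
  assumes "S \<in> symm_mats n" "T \<in> symm_mats n"
  shows "diagv n S = diagv n T \<longleftrightarrow> S + T \<in> alt_mats n"
proof -
  have "diagv n S = diagv n T \<longleftrightarrow> (\<forall>i<n. S $$ (i, i) = T $$ (i, i))"
    by (auto simp: diagv_def vec_eq_iff)
  also have "\<dots> \<longleftrightarrow> S + T \<in> alt_mats n"
    using symm_add[OF assms] symm_carrier[OF assms(2)] eq_iff_add[of "S $$ (i, i)" "T $$ (i, i)" for i]
    by (simp add: alt_mats_def)
  finally show ?thesis .
qed

lemma outer_symm: "c \<in> carrier_vec n \<Longrightarrow> mat n n (\<lambda>(i, j). c $ i * c $ j) \<in> (symm_mats n :: 'f mat set)"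
  by (intro symm_matsI) (auto simp: mult.commute)

lemma outer_diagv:
  "c \<in> bin_vecs n \<Longrightarrow> diagv n (mat n n (\<lambda>(i, j). c $ i * c $ j)) = c"
  using bin_vecs_index[of c n] by (intro eq_vecI) (auto simp: diagv_def dest: bin_vecs_carrier)

text \<open>This is the simplicity of V, proved on symmetric matrices through their diagonals. The
  rank one matrix c c^T of a binary c has diagonal c, and the transvection along c adds a multiple
  of c to any diagonal.\<close>

lemma gcover_alt_symm:
  assumes g: "g \<ge> 3"
  shows "gcover (Sp g) (symm_module ty g) (alt_mats (2 * g)) (symm_mats (2 * g))"
  unfolding gcover_def
proof (intro conjI allI impI)
  let ?n = "2 * g" and ?e = "unit_vec (2 * g) :: nat \<Rightarrow> 'f vec"
  define out where "out c = mat ?n ?n (\<lambda>(i, j). c $ i * c $ j)" for c :: "'f vec"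
  have os: "out c \<in> symm_mats ?n" if "c \<in> bin_vecs ?n" for c
    unfolding out_def by (rule outer_symm[OF bin_vecs_carrier[OF that]])
  have od: "diagv ?n (out c) = c" if "c \<in> bin_vecs ?n" for c unfolding out_def by (rule outer_diagv[OF that])
  have "out (?e 0) \<notin> alt_mats ?n" using g by (auto simp: alt_mats_def out_def intro!: exI[of _ 0])
  then show "alt_mats ?n \<subset> (symm_mats ?n :: 'f mat set)" using os[OF bin_vecs_unit] alt_symm by blast
  fix U assume U: "gsubmodule (Sp g) (symm_module ty g) U" "alt_mats ?n \<subseteq> U" "U \<subseteq> symm_mats ?n"
  note u = U(1)[unfolded symm_sub_iff]
  \<comment> \<open>As U contains all alternating matrices, membership in U depends on the diagonal
    alone.\<close>
  have diag_mem: "S \<in> U" if "S \<in> symm_mats ?n" "T \<in> U" "diagv ?n S = diagv ?n T" for S T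
  proof -
    have Ts: "T \<in> symm_mats ?n" using that U(3) by blast
    have "T + S \<in> U" using diagv_eq_iff[OF Ts that(1)] that(3) U(2) by auto
    then have "T + (T + S) \<in> U" using u that(2) by blast
    then show ?thesis using mat_add_cancel[OF symm_carrier[OF Ts] symm_carrier[OF that(1)]] by simp
  qed
  have step: "out c \<in> U" if S: "S \<in> U" and c: "c \<in> bin_vecs ?n" "intersection_form g c (diagv ?n S) \<noteq> 0" for S c
  proof -
    let ?q = "intersection_form g c (diagv ?n S)"
    have Ss: "S \<in> symm_mats ?n" using S U(3) by blast
    have cc: "c \<in> carrier_vec ?n" by (rule bin_vecs_carrier[OF c(1)])
    obtain s where s: "s \<in> carrier (Sp g)" "hF s = tv g c" using bin_vec_tv[OF c(1)] by blast
    let ?T = "hF s * (S * transpose_mat (hF s))"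
    have T: "?T \<in> U" using u S s(1) by blast
    have Ts: "?T \<in> symm_mats ?n" using T U(3) by blast
    have ST: "S + ?T \<in> U" using u S T by blast
    have "diagv ?n ?T = hF s *\<^sub>v diagv ?n S" by (rule diagv_act[OF s(1) Ss])
    also have "\<dots> = diagv ?n S + ?q \<cdot>\<^sub>v c" unfolding s(2) by (rule tv_vec[OF cc diagv_carrier])
    finally have "diagv ?n (S + ?T) = diagv ?n S + (diagv ?n S + ?q \<cdot>\<^sub>v c)"
      unfolding diagv_add[OF Ss Ts] by (rule arg_cong)
    also have "\<dots> = ?q \<cdot>\<^sub>v c" using cc by (intro eq_vecI) (auto simp: add.assoc[symmetric] add_self diagv_def)
    finally have "diagv ?n (S + ?T) = diagv ?n (?q \<cdot>\<^sub>m out c)" unfolding diagv_smult[OF os[OF c(1)]] od[OF c(1)] .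
    then have "?q \<cdot>\<^sub>m out c \<in> U" using diag_mem[OF symm_smult[OF os[OF c(1)]] ST] by simp
    then show ?thesis using smult_cancel[OF U(1)] c(2) by blast
  qed
  show "U = alt_mats ?n \<or> U = symm_mats ?n"
  proof (cases "U \<subseteq> alt_mats ?n")
    case False
    then obtain S where S: "S \<in> U" "S \<notin> alt_mats ?n" by blast
    then have Ss: "S \<in> symm_mats ?n" using U(3) by blast
    then obtain p where p: "p < ?n" "S $$ (p, p) \<noteq> 0" using S(2) by (auto simp: alt_mats_def)
    have p': "conjx p < ?n" using conjx_less[OF p(1)] .
    have "intersection_form g (?e (conjx p)) (diagv ?n S) \<noteq> 0"
      using form_unit_left[OF diagv_carrier p'] p by (simp add: diagv_def)
    \<comment> \<open>A first transvection reaches the basis vector at \<open>conjx p\<close>. It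
      has nonzero pairing with every c that is nonzero at p, so a second transvection reaches all of
      those c.\<close>
    then have e1: "out (?e (conjx p)) \<in> U" using step[OF S(1) bin_vecs_unit] by blast
    have st2: "out c \<in> U" if "c \<in> bin_vecs ?n" "c $ p \<noteq> 0" for c
    proof (rule step[OF e1 that(1)])
      show "intersection_form g c (diagv ?n (out (?e (conjx p)))) \<noteq> 0"
        using form_unit_right'[OF bin_vecs_carrier[OF that(1)] p'] that(2) od[OF bin_vecs_unit] by simp
    qed
    have ej: "out (?e j) \<in> U" if j: "j < ?n" for j
    proof (cases "j = p")
      case True
      then show ?thesis using st2[OF bin_vecs_unit] j by simp
    next
      case False
      \<comment> \<open>For j other than p the vector e_j is zero at p, so it is obtained as the sum
        of e_j + e_p and e_p.\<close>
      have b: "?e j + ?e p \<in> bin_vecs ?n" by (intro bin_vecs_add bin_vecs_unit)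
      have "out (?e j + ?e p) \<in> U" using st2[OF b] False p(1) j by simp
      moreover have "out (?e p) \<in> U" using st2[OF bin_vecs_unit] p(1) by simp
      ultimately have m: "out (?e j + ?e p) + out (?e p) \<in> U" using u by blast
      have "diagv ?n (out (?e j + ?e p) + out (?e p)) = (?e j + ?e p) + ?e p"
        unfolding diagv_add[OF os[OF b] os[OF bin_vecs_unit]] od[OF b] od[OF bin_vecs_unit] ..
      also have "\<dots> = ?e j" by (intro eq_vecI) (auto simp: add.assoc add_self)
      finally have "diagv ?n (out (?e j)) = diagv ?n (out (?e j + ?e p) + out (?e p))" using od[OF bin_vecs_unit] by simp
      then show ?thesis using diag_mem[OF os[OF bin_vecs_unit] m] by blast
    qed
    have "S' \<in> U" if S': "S' \<in> symm_mats ?n" for S'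
    proof -
      let ?f = "\<lambda>j. S' $$ (j, j) \<cdot>\<^sub>m out (?e j)"
      have m: "msum ?n ?f {..<?n} \<in> U"
        by (rule msum_closed) (use u ej zero_in_gsub[OF U(1)] in \<open>auto simp: out_def\<close>)
      have "diagv ?n (msum ?n ?f {..<?n}) = diagv ?n S'"
      proof (rule eq_vecI)
        fix i assume "i < dim_vec (diagv ?n S')"
        then have i: "i < ?n" by (simp add: diagv_def)
        have "diagv ?n (msum ?n ?f {..<?n}) $ i = (\<Sum>j<?n. S' $$ (j, j) * (?e j $ i * ?e j $ i))"
          using i by (simp add: diagv_def msum_def out_def)
        also have "\<dots> = (\<Sum>j<?n. if j = i then S' $$ (j, j) else 0)"
          using i by (intro sum.cong refl) auto
        also have "\<dots> = S' $$ (i, i)" using i by simp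
        finally show "diagv ?n (msum ?n ?f {..<?n}) $ i = diagv ?n S' $ i" using i by (simp add: diagv_def)
      qed (simp add: diagv_def)
      then show ?thesis using diag_mem[OF S' m] by simp
    qed
    then show ?thesis using U(3) by blast
  qed (use U(2) in blast)
qed (rule gsubmodule_alt gsubmodule_symm)+

section \<open>Identification of factors with V and with the trivial module\<close>

lemma H1_surface_simps:
  "carrier (H1_surface ty g) = carrier_vec (2 * g)" "add (H1_surface ty g) = (+)"
  "module.smult (H1_surface ty g) = (\<cdot>\<^sub>v)" "act (H1_surface ty g) s v = hF s *\<^sub>v v"
  by (simp_all add: H1_surface_def with_act_def module_vec_def hb_def)

lemma gepi_surface:
  "gepi (Sp g) (symm_module ty g) (symm_mats (2 * g)) (alt_mats (2 * g)) (H1_surface ty g) (diagv (2 * g))"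
  unfolding gepi_def ghom_on_def H1_surface_simps symm_module_simps
proof (intro conjI ballI allI)
  show "diagv (2 * g) ` symm_mats (2 * g) = carrier_vec (2 * g)"
  proof (rule subset_antisym; rule subsetI)
    fix v :: "'f vec" assume v: "v \<in> carrier_vec (2 * g)"
    let ?D = "mat (2 * g) (2 * g) (\<lambda>(i, j). if i = j then v $ i else 0)"
    have D: "?D \<in> symm_mats (2 * g)" by (rule symm_matsI) auto
    have "diagv (2 * g) ?D = v" using v by (intro eq_vecI) (auto simp: diagv_def)
    then show "v \<in> diagv (2 * g) ` symm_mats (2 * g)" using D by (rule rev_image_eqI[OF _ sym, rotated])
  next
    fix v assume "v \<in> diagv (2 * g) ` symm_mats (2 * g)"
    then show "v \<in> carrier_vec (2 * g)" by (elim imageE) simp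
  qed
  fix S T :: "'f mat" assume S: "S \<in> symm_mats (2 * g)" and T: "T \<in> symm_mats (2 * g)"
  show "diagv (2 * g) (S + T) = diagv (2 * g) S + diagv (2 * g) T" by (rule diagv_add[OF S T])
  show "diagv (2 * g) S = diagv (2 * g) T \<longleftrightarrow> S \<ominus>\<^bsub>symm_module ty g\<^esub> T \<in> alt_mats (2 * g)"
    unfolding symm_module_minus[OF S T] by (rule diagv_eq_iff[OF S T])
next
  fix r and S :: "'f mat" assume S: "S \<in> symm_mats (2 * g)"
  show "diagv (2 * g) (r \<cdot>\<^sub>m S) = r \<cdot>\<^sub>v diagv (2 * g) S" by (rule diagv_smult[OF S])
next
  fix s :: "bit mat" and S :: "'f mat" assume s: "s \<in> carrier (Sp g)" and S: "S \<in> symm_mats (2 * g)"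
  show "diagv (2 * g) (hF s * (S * transpose_mat (hF s))) = hF s *\<^sub>v diagv (2 * g) S" by (rule diagv_act[OF s S])
qed

lemma trivial_simps:
  "carrier (trivial_gmodule ty) = UNIV" "add (trivial_gmodule ty) = (+)"
  "module.smult (trivial_gmodule ty) = (*)" "act (trivial_gmodule ty) s v = v"
  by (simp_all add: trivial_gmodule_def)

lemma gepi_alt_trivial:
  assumes g: "g \<ge> 3"
  shows "gepi (Sp g) (symm_module ty g) (alt_mats (2 * g)) (ker_ht g) (trivial_gmodule ty) (half_trace g)"
  unfolding gepi_def ghom_on_def trivial_simps symm_module_simps
proof (intro conjI ballI allI)
  let ?n = "2 * g"
  have n: "0 < ?n" "1 < ?n" using g by auto
  have c01: "conjx 1 = 0" by (simp add: conjx_def)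
  show "half_trace g ` alt_mats ?n = (UNIV :: 'f set)"
  proof
    show "(UNIV :: 'f set) \<subseteq> half_trace g ` alt_mats ?n"
    proof
      fix a :: 'f
      let ?W = "a \<cdot>\<^sub>m wd ?n (unit_vec ?n 0) (unit_vec ?n 1)"
      have "half_trace g ?W = a"
        unfolding half_trace_smult[OF alt_symm[OF wd_alt]]
        using form_unit_right'[OF unit_vec_carrier n(2), of 0] n by (simp add: half_trace_wd c01[unfolded One_nat_def])
      moreover have "?W \<in> alt_mats ?n" using gsubmodule_alt[of g] wd_alt unfolding symm_sub_iff by blast
      ultimately show "a \<in> half_trace g ` alt_mats ?n" by (metis imageI)
    qed
  qed simp
  fix S T :: "'f mat" assume S: "S \<in> alt_mats ?n" and T: "T \<in> alt_mats ?n"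
  have "S + T \<in> alt_mats ?n" using gsubmodule_alt[of g] S T unfolding symm_sub_iff by blast
  then show "half_trace g S = half_trace g T \<longleftrightarrow> S \<ominus>\<^bsub>symm_module ty g\<^esub> T \<in> ker_ht g"
    unfolding symm_module_minus[OF alt_symm[OF S] alt_symm[OF T]]
    using half_trace_add[OF alt_symm[OF S] alt_symm[OF T]] eq_iff_add[of "half_trace g S" "half_trace g T"]
    by (simp add: ker_ht_def)
qed (simp_all add: half_trace_add half_trace_smult half_trace_act alt_symm)

text \<open>The entry (0, 1) of J is 1, so it is the coordinate on the line; J is fixed because
  every symplectic A satisfies A J A^T = J.\<close>

lemma gepi_J_trivial:
  assumes g: "g \<ge> 3"
  shows "gepi (Sp g) (symm_module ty g) (J_line g) {0\<^sub>m (2 * g) (2 * g)} (trivial_gmodule ty) (\<lambda>S. S $$ (0, 1))"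
  unfolding gepi_def ghom_on_def trivial_simps symm_module_simps
proof (intro conjI ballI allI)
  let ?n = "2 * g"
  have n: "0 < ?n" "1 < ?n" using g by auto
  have J: "(a \<cdot>\<^sub>m Jmat g) $$ (0, 1) = a" for a :: 'f using n by (simp add: Jmat_index conjx_def)
  note sub = gsubmodule_J_line[of g, unfolded symm_sub_iff]
  show "(\<lambda>S. S $$ (0, 1)) ` J_line g = (UNIV :: 'f set)"
    unfolding J_line_def image_image J by simp
  fix S :: "'f mat" assume S: "S \<in> J_line g"
  then obtain a where a: "S = a \<cdot>\<^sub>m Jmat g" by (auto simp: J_line_def)
  have Ss: "S \<in> symm_mats ?n" using S sub by blast
  have Sc: "S \<in> carrier_mat ?n ?n" by (rule symm_carrier[OF Ss])
  show "(r \<cdot>\<^sub>m S) $$ (0, 1) = r * S $$ (0, 1)" for r using Sc n by simp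
  show "(hF s * (S * transpose_mat (hF s))) $$ (0, 1) = S $$ (0, 1)" if s: "s \<in> carrier (Sp g)" for s
  proof -
    have h: "hF s \<in> carrier_mat ?n ?n" by (rule hb_carrier[OF s])
    have t: "transpose_mat (hF s) \<in> carrier_mat ?n ?n" using h by simp
    show ?thesis
      unfolding a mult_smult_assoc_mat[OF Jmat_carrier t] mult_smult_distrib[OF h mult_carrier_mat[OF Jmat_carrier t]]
        Sp_conj_J[OF hb_Sp[OF s]] ..
  qed
  fix T :: "'f mat" assume T: "T \<in> J_line g"
  then obtain b where b: "T = b \<cdot>\<^sub>m Jmat g" by (auto simp: J_line_def)
  have Ts: "T \<in> symm_mats ?n" using T sub by blast
  have Tc: "T \<in> carrier_mat ?n ?n" by (rule symm_carrier[OF Ts])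
  show "(S + T) $$ (0, 1) = S $$ (0, 1) + T $$ (0, 1)" using Sc Tc n by simp
  show "S $$ (0, 1) = T $$ (0, 1) \<longleftrightarrow> S \<ominus>\<^bsub>symm_module ty g\<^esub> T \<in> {0\<^sub>m ?n ?n}"
  proof -
    have ab: "S + T = (a + b) \<cdot>\<^sub>m Jmat g" unfolding a b by (intro eq_matI) (auto simp: distrib_right)
    have "S + T = 0\<^sub>m ?n ?n \<longleftrightarrow> a + b = 0"
    proof
      assume "S + T = 0\<^sub>m ?n ?n"
      then have "((a + b) \<cdot>\<^sub>m Jmat g) $$ (0, 1) = (0 :: 'f)" unfolding ab using n by simp
      then show "a + b = 0" unfolding J .
    next
      assume "a + b = 0"
      then show "S + T = 0\<^sub>m ?n ?n" unfolding ab by (intro eq_matI) auto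
    qed
    then show ?thesis unfolding symm_module_minus[OF Ss Ts] unfolding a b J using eq_iff_add[of a b] unfolding a b by simp
  qed
qed

text \<open>The factors are told apart by the action of a transvection \<open>t\<close>: on the natural module the
  image of \<open>t - 1\<close> is a line, on the trivial module it vanishes, and on the middle factor it has
  dimension at least 2.\<close>

definition t0 :: "nat \<Rightarrow> bit mat" where
  "t0 g = (SOME s. s \<in> carrier (Sp g) \<and> hF s = tv g (unit_vec (2 * g) 0))"

lemma t0: "t0 g \<in> carrier (Sp g)" "hF (t0 g) = tv g (unit_vec (2 * g) 0)"
proof -
  have "\<exists>s. s \<in> carrier (Sp g) \<and> hF s = tv g (unit_vec (2 * g) 0)"
    using bin_vec_tv[OF bin_vecs_unit, of g 0] by blast
  from someI_ex[OF this] show "t0 g \<in> carrier (Sp g)" "hF (t0 g) = tv g (unit_vec (2 * g) 0)"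
    by (simp_all add: t0_def)
qed

text \<open>The transvection along e_0 fixes e_j for j > 1 and adds e_0 to e_1.\<close>

lemma t0_wd:
  assumes g: "g \<ge> 3" and j: "j < 2 * g" "1 < j"
  shows "act (symm_module ty g) (t0 g) (wd (2 * g) (unit_vec (2 * g) 1) (unit_vec (2 * g) j)) =
    wd (2 * g) (unit_vec (2 * g) 1) (unit_vec (2 * g) j) + wd (2 * g) (unit_vec (2 * g) 0) (unit_vec (2 * g) j)"
proof -
  let ?n = "2 * g" and ?e = "unit_vec (2 * g) :: nat \<Rightarrow> 'f vec"
  have n: "0 < ?n" "1 < ?n" using g by auto
  have c0: "conjx 0 = 1" by (simp add: conjx_def)
  have "wd ?n (?e 1) (?e j) *\<^sub>v (Jmat g *\<^sub>v ?e 0) = ?e j"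
    unfolding wd_J[OF unit_vec_carrier unit_vec_carrier unit_vec_carrier]
      form_unit_right'[OF unit_vec_carrier n(1)] c0 using n j by (intro eq_vecI) auto
  then show ?thesis
    unfolding symm_module_simps t0(2) tv_conj[OF unit_vec_carrier wd_alt] by simp
qed

lemma alt_trivial_action:
  assumes g: "g \<ge> 3" and s: "s \<in> carrier (Sp g)" and S: "S \<in> alt_mats (2 * g)"
  shows "act (symm_module ty g) s S \<ominus>\<^bsub>symm_module ty g\<^esub> S \<in> ker_ht g"
proof -
  have a: "act (symm_module ty g) s S \<in> alt_mats (2 * g)"
    using gsubmodule_alt[of g] s S unfolding gsubmodule_iff[OF is_gmodule_symm] by blast
  have "half_trace g (act (symm_module ty g) s S) = half_trace g S"
    unfolding symm_module_simps by (rule half_trace_act[OF s S])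
  then show ?thesis using gepi_alt_trivial[OF g] a S unfolding gepi_def by blast
qed

lemma J_trivial_action:
  assumes g: "g \<ge> 3" and s: "s \<in> carrier (Sp g)" and S: "S \<in> J_line g"
  shows "act (symm_module ty g) s S \<ominus>\<^bsub>symm_module ty g\<^esub> S \<in> {0\<^sub>m (2 * g) (2 * g)}"
proof -
  note e = gepi_J_trivial[OF g]
  have a: "act (symm_module ty g) s S \<in> J_line g"
    using gsubmodule_J_line[of g] s S unfolding gsubmodule_iff[OF is_gmodule_symm] by blast
  have "ghom_on (Sp g) (symm_module ty g) (J_line g) (trivial_gmodule ty) (\<lambda>S. S $$ (0, 1))" using e by (simp add: gepi_def)
  from ghom_onD(3)[OF this s S] show ?thesis using e a S unfolding gepi_def trivial_simps by blast
qed

text \<open>The transvection changes e_1 wedge e_2 by e_0 wedge e_2, whose entry (0, 2) keeps it off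
  the line through J.\<close>

lemma ker_nontrivial_action:
  assumes g: "g \<ge> 3" and B: "B \<subseteq> J_line g"
  shows "\<exists>s\<in>carrier (Sp g). \<exists>S\<in>ker_ht g. act (symm_module ty g) s S \<ominus>\<^bsub>symm_module ty g\<^esub> S \<notin> B"
proof (intro bexI)
  let ?n = "2 * g" and ?e = "unit_vec (2 * g) :: nat \<Rightarrow> 'f vec"
  let ?S = "wd ?n (?e 1) (?e 2)"
  have n: "0 < ?n" "1 < ?n" "2 < ?n" "2 \<noteq> conjx 1" "2 \<noteq> conjx 0" using g by (auto simp: conjx_def)
  show k: "?S \<in> ker_ht g" by (rule wd_unit_ker[OF n(2-4)])
  show "t0 g \<in> carrier (Sp g)" by (rule t0(1))
  have w: "wd ?n (?e 0) (?e 2) \<in> symm_mats ?n" "?S \<in> symm_mats ?n" using alt_symm[OF wd_alt] by auto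
  have e: "act (symm_module ty g) (t0 g) ?S = ?S + wd ?n (?e 0) (?e 2)" by (rule t0_wd[OF g n(3)]) simp
  have "act (symm_module ty g) (t0 g) ?S \<ominus>\<^bsub>symm_module ty g\<^esub> ?S = (?S + wd ?n (?e 0) (?e 2)) + ?S"
    unfolding e by (rule symm_module_minus[OF symm_add[OF w(2,1)] w(2)])
  also have "\<dots> = wd ?n (?e 0) (?e 2)"
    by (rule eq_matI) (auto simp: add.commute[of "_ + _"] add.assoc[symmetric] add_self)
  finally show "act (symm_module ty g) (t0 g) ?S \<ominus>\<^bsub>symm_module ty g\<^esub> ?S \<notin> B"
    using wd_not_J_line[OF n(1,3,5)] B by auto
qed

lemma surface_nontrivial_action:
  assumes g: "g \<ge> 3"
  shows "\<exists>s\<in>carrier (Sp g). \<exists>S\<in>symm_mats (2 * g). act (symm_module ty g) s S \<ominus>\<^bsub>symm_module ty g\<^esub> S \<notin> alt_mats (2 * g)"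
proof (intro bexI)
  let ?n = "2 * g" and ?e = "unit_vec (2 * g) :: nat \<Rightarrow> 'f vec"
  let ?S = "mat ?n ?n (\<lambda>(i, j). ?e 1 $ i * ?e 1 $ j)"
  have n: "0 < ?n" "1 < ?n" using g by auto
  have c0: "conjx 0 = 1" by (simp add: conjx_def)
  show S: "?S \<in> symm_mats ?n" by (rule outer_symm) simp
  show t: "t0 g \<in> carrier (Sp g)" by (rule t0(1))
  have a: "act (symm_module ty g) (t0 g) ?S \<in> symm_mats ?n"
    using gsubmodule_symm[of g] S t unfolding gsubmodule_iff[OF is_gmodule_symm] by blast
  have "diagv ?n (act (symm_module ty g) (t0 g) ?S) = hF (t0 g) *\<^sub>v ?e 1"
    unfolding symm_module_simps diagv_act[OF t S] outer_diagv[OF bin_vecs_unit] ..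
  also have "\<dots> = ?e 1 + ?e 0"
    unfolding t0(2) tv_vec[OF unit_vec_carrier unit_vec_carrier] form_unit_left[OF unit_vec_carrier n(1)] c0 using n by auto
  finally have "diagv ?n (act (symm_module ty g) (t0 g) ?S) $ 0 \<noteq> diagv ?n ?S $ 0"
    unfolding outer_diagv[OF bin_vecs_unit] using n by simp
  then show "act (symm_module ty g) (t0 g) ?S \<ominus>\<^bsub>symm_module ty g\<^esub> ?S \<notin> alt_mats ?n"
    unfolding symm_module_minus[OF a S] using diagv_eq_iff[OF a S] by metis
qed

lemma surface_dependent:
  assumes g: "g \<ge> 3" and S: "S \<in> symm_mats (2 * g)" and T: "T \<in> symm_mats (2 * g)"
  defines "M \<equiv> symm_module ty g" and "s \<equiv> t0 g"
  shows "\<exists>a b. (a \<noteq> 0 \<or> b \<noteq> 0) \<and>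
      (a \<odot>\<^bsub>M\<^esub> act M s S \<oplus>\<^bsub>M\<^esub> b \<odot>\<^bsub>M\<^esub> act M s T) \<ominus>\<^bsub>M\<^esub> (a \<odot>\<^bsub>M\<^esub> S \<oplus>\<^bsub>M\<^esub> b \<odot>\<^bsub>M\<^esub> T) \<in> alt_mats (2 * g)"
proof -
  let ?n = "2 * g" and ?e0 = "unit_vec (2 * g) 0 :: 'f vec"
  let ?q = "\<lambda>S. intersection_form g ?e0 (diagv ?n S)"
  \<comment> \<open>On diagonals t - 1 sends v to (e_0, v) e_0, so a combination is fixed as soon as
    these pairings cancel. In characteristic 2 the two pairings serve crosswise as coefficients
    without a sign.\<close>
  obtain a b where ab: "a \<noteq> 0 \<or> b \<noteq> 0" "a * ?q S + b * ?q T = 0"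
  proof (cases "?q S = 0 \<and> ?q T = 0")
    case True
    then show ?thesis using that[of 1 0] by simp
  next
    case False
    then show ?thesis using that[of "?q T" "?q S"] add_self[of "?q S * ?q T"] by (auto simp: mult.commute)
  qed
  have sc: "s \<in> carrier (Sp g)" unfolding s_def by (rule t0(1))
  have cl: "act M s X \<in> symm_mats ?n" "diagv ?n (act M s X) = diagv ?n X + ?q X \<cdot>\<^sub>v ?e0" if X: "X \<in> symm_mats ?n" for X
  proof -
    show "act M s X \<in> symm_mats ?n"
      using gsubmodule_symm[of g] X sc unfolding gsubmodule_iff[OF is_gmodule_symm] M_def by blast
    show "diagv ?n (act M s X) = diagv ?n X + ?q X \<cdot>\<^sub>v ?e0"
      unfolding M_def symm_module_simps diagv_act[OF sc X] unfolding s_def t0(2)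
      by (rule tv_vec[OF unit_vec_carrier diagv_carrier])
  qed
  note ss = symm_smult[OF cl(1)[OF S], of a] symm_smult[OF cl(1)[OF T], of b] symm_smult[OF S, of a] symm_smult[OF T, of b]
  have "diagv ?n (a \<cdot>\<^sub>m act M s S + b \<cdot>\<^sub>m act M s T) = diagv ?n (a \<cdot>\<^sub>m S + b \<cdot>\<^sub>m T)"
    unfolding diagv_add[OF ss(1,2)] diagv_add[OF ss(3,4)] diagv_smult[OF cl(1)[OF S]] diagv_smult[OF cl(1)[OF T]]
      diagv_smult[OF S] diagv_smult[OF T] cl(2)[OF S] cl(2)[OF T]
  proof (rule eq_vecI)
    fix i assume "i < dim_vec (a \<cdot>\<^sub>v diagv ?n S + b \<cdot>\<^sub>v diagv ?n T)"
    then have i: "i < ?n" by (simp add: diagv_def)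
    have "(a \<cdot>\<^sub>v (diagv ?n S + ?q S \<cdot>\<^sub>v ?e0) + b \<cdot>\<^sub>v (diagv ?n T + ?q T \<cdot>\<^sub>v ?e0)) $ i =
        (a * diagv ?n S $ i + b * diagv ?n T $ i) + (a * ?q S + b * ?q T) * ?e0 $ i"
      using i by (simp add: diagv_def algebra_simps)
    then show "(a \<cdot>\<^sub>v (diagv ?n S + ?q S \<cdot>\<^sub>v ?e0) + b \<cdot>\<^sub>v (diagv ?n T + ?q T \<cdot>\<^sub>v ?e0)) $ i =
        (a \<cdot>\<^sub>v diagv ?n S + b \<cdot>\<^sub>v diagv ?n T) $ i"
      unfolding ab(2) using i by (simp add: diagv_def)
  qed (simp add: diagv_def)
  then have "(a \<cdot>\<^sub>m act M s S + b \<cdot>\<^sub>m act M s T) \<ominus>\<^bsub>M\<^esub> (a \<cdot>\<^sub>m S + b \<cdot>\<^sub>m T) \<in> alt_mats ?n"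
    unfolding M_def
    using diagv_eq_iff[OF symm_add[OF ss(1,2)] symm_add[OF ss(3,4)]]
      symm_module_minus[OF symm_add[OF ss(1,2)] symm_add[OF ss(3,4)]] by (simp add: M_def)
  then show ?thesis using ab(1) unfolding M_def symm_module_simps by blast
qed

text \<open>The transvection changes e_1 wedge e_2 and e_1 wedge e_4 by e_0 wedge e_2 and e_0 wedge
  e_4. The entries (0, 2) and (0, 4) are zero in J and detect both coefficients; index 4 is
  available because g is at least 3.\<close>

lemma ker_independent:
  assumes g: "g \<ge> 3" and B: "B \<subseteq> J_line g"
  defines "M \<equiv> symm_module ty g" and "s \<equiv> t0 g"
  shows "\<exists>S\<in>ker_ht g. \<exists>T\<in>ker_ht g. \<forall>a b. a \<noteq> 0 \<or> b \<noteq> 0 \<longrightarrow>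
      (a \<odot>\<^bsub>M\<^esub> act M s S \<oplus>\<^bsub>M\<^esub> b \<odot>\<^bsub>M\<^esub> act M s T) \<ominus>\<^bsub>M\<^esub> (a \<odot>\<^bsub>M\<^esub> S \<oplus>\<^bsub>M\<^esub> b \<odot>\<^bsub>M\<^esub> T) \<notin> B"
proof -
  let ?n = "2 * g" and ?e = "unit_vec (2 * g) :: nat \<Rightarrow> 'f vec"
  let ?S = "wd ?n (?e 1) (?e 2)" and ?T = "wd ?n (?e 1) (?e 4)"
  have n: "0 < ?n" "1 < ?n" "2 < ?n" "4 < ?n" "2 \<noteq> conjx 1" "4 \<noteq> conjx 1" "2 \<noteq> conjx 0" "4 \<noteq> conjx 0"
    using g by (auto simp: conjx_def)
  have ST: "?S \<in> ker_ht g" "?T \<in> ker_ht g" using wd_unit_ker[OF n(2,3,5)] wd_unit_ker[OF n(2,4,6)] by auto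
  have e: "act M s ?S = ?S + wd ?n (?e 0) (?e 2)" "act M s ?T = ?T + wd ?n (?e 0) (?e 4)"
    unfolding M_def s_def by (rule t0_wd[OF g n(3)], simp) (rule t0_wd[OF g n(4)], simp)
  have w: "wd ?n x y \<in> symm_mats ?n" for x y :: "'f vec" using alt_symm[OF wd_alt] .
  show ?thesis
  proof (rule bexI[OF _ ST(1)], rule bexI[OF _ ST(2)], intro allI impI notI)
  fix a b assume ab: "a \<noteq> 0 \<or> b \<noteq> 0"
    and "(a \<odot>\<^bsub>M\<^esub> act M s ?S \<oplus>\<^bsub>M\<^esub> b \<odot>\<^bsub>M\<^esub> act M s ?T) \<ominus>\<^bsub>M\<^esub> (a \<odot>\<^bsub>M\<^esub> ?S \<oplus>\<^bsub>M\<^esub> b \<odot>\<^bsub>M\<^esub> ?T) \<in> B"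
  then have "(a \<cdot>\<^sub>m (?S + wd ?n (?e 0) (?e 2)) + b \<cdot>\<^sub>m (?T + wd ?n (?e 0) (?e 4))) \<ominus>\<^bsub>symm_module ty g\<^esub> (a \<cdot>\<^sub>m ?S + b \<cdot>\<^sub>m ?T) \<in> J_line g"
    unfolding e using B unfolding M_def symm_module_simps by blast
  then have m: "(a \<cdot>\<^sub>m (?S + wd ?n (?e 0) (?e 2)) + b \<cdot>\<^sub>m (?T + wd ?n (?e 0) (?e 4))) + (a \<cdot>\<^sub>m ?S + b \<cdot>\<^sub>m ?T) \<in> J_line g"
    by (subst (asm) symm_module_minus) (intro symm_add symm_smult w)+
  have "a = 0" using J_line_index[OF m n(1,3,7)] n by (simp add: wd_def)
  moreover have "b = 0" using J_line_index[OF m n(1,4,8)] n by (simp add: wd_def)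
  ultimately show False using ab by blast
qed
qed

end

section \<open>Quotients of free modules\<close>

lemma lookup_scale [simp]: "Poly_Mapping.lookup (scale_pm r c) b = r * Poly_Mapping.lookup c (b :: 'b) "
  for r :: "'f::field"
  by (simp add: scale_pm_def Poly_Mapping.map.rep_eq when_def)

lemma keys_scale: "Poly_Mapping.keys (scale_pm r c) \<subseteq> Poly_Mapping.keys (c :: 'b \<Rightarrow>\<^sub>0 'f::field)"
  by (auto simp: in_keys_iff)

text \<open>The linear extension of h to a functional on the free module. Matrix-valued extensions
  are treated one entry at a time through it.\<close>

definition ev :: "('b \<Rightarrow> 'f::field) \<Rightarrow> ('b \<Rightarrow>\<^sub>0 'f) \<Rightarrow> 'f" where
  "ev h c = (\<Sum>b\<in>Poly_Mapping.keys c. Poly_Mapping.lookup c b * h b)"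

lemma ev_superset:
  assumes "finite A" "Poly_Mapping.keys c \<subseteq> A"
  shows "ev h c = (\<Sum>b\<in>A. Poly_Mapping.lookup c b * h b)"
  unfolding ev_def using assms by (intro sum.mono_neutral_left) (auto simp: in_keys_iff)

lemma ev_add [simp]: "ev h (c + d) = ev h c + ev h d"
proof -
  let ?A = "Poly_Mapping.keys c \<union> Poly_Mapping.keys d"
  have "ev h (c + d) = (\<Sum>b\<in>?A. Poly_Mapping.lookup (c + d) b * h b)"
    by (rule ev_superset) (auto dest: subsetD[OF keys_add])
  also have "\<dots> = ev h c + ev h d"
    by (simp add: lookup_add distrib_right sum.distrib ev_superset[of ?A])
  finally show ?thesis .
qed

lemma ev_zero [simp]: "ev h 0 = 0"
  by (simp add: ev_def)

lemma ev_scale [simp]: "ev h (scale_pm r c) = r * ev h c"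
  using ev_superset[OF finite_keys keys_scale, of h r c]
  by (simp add: ev_def sum_distrib_left mult.assoc)

lemma ev_single [simp]: "ev h (Poly_Mapping.single b r) = r * h b"
  using ev_superset[of "{b}" "Poly_Mapping.single b r" h] by simp

lemma ev_uminus [simp]: "ev h (- c) = - ev h c"
  by (simp add: ev_def keys_minus sum_negf)

lemma ev_diff [simp]: "ev h (c - d) = ev h c - ev h d"
  using ev_add[of h c "- d"] by simp

lemma ev_sum: "ev h (\<Sum>a\<in>A. f a) = (\<Sum>a\<in>A. ev h (f a))"
  by (induction A rule: infinite_finite_induct) auto

lemma ev_lin_ext: "ev h (lin_ext f c) = ev (\<lambda>b. ev h (f b)) c"
  unfolding lin_ext_def ev_sum ev_scale ev_def[of "\<lambda>b. ev h (f b)"] ..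

lemma ev_cong: "(\<And>b. b \<in> Poly_Mapping.keys c \<Longrightarrow> h b = h' b) \<Longrightarrow> ev h c = ev h' c"
  by (simp add: ev_def)

lemma pm_sum_singles: "c = (\<Sum>b\<in>Poly_Mapping.keys c. scale_pm (Poly_Mapping.lookup c b) (gen b))"
  for c :: "'b \<Rightarrow>\<^sub>0 'f::field"
proof (rule poly_mapping_eqI)
  fix k
  have "(\<Sum>b\<in>Poly_Mapping.keys c. Poly_Mapping.lookup c b * (1 when b = k)) =
      (\<Sum>b\<in>Poly_Mapping.keys c. if b = k then Poly_Mapping.lookup c b else 0)"
    by (intro sum.cong) (auto simp: when_def)
  then show "Poly_Mapping.lookup c k =
      Poly_Mapping.lookup (\<Sum>b\<in>Poly_Mapping.keys c. scale_pm (Poly_Mapping.lookup c b) (gen b)) k"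
    by (simp add: lookup_sum lookup_single in_keys_iff)
qed

lemma scale_add: "scale_pm r (c + d) = scale_pm r c + scale_pm r (d :: 'b \<Rightarrow>\<^sub>0 'f::field)"
  by (rule poly_mapping_eqI) (simp add: lookup_add distrib_left)

lemma scale_add_left: "scale_pm (r + s) c = scale_pm r c + scale_pm s (c :: 'b \<Rightarrow>\<^sub>0 'f::field)"
  by (rule poly_mapping_eqI) (simp add: lookup_add distrib_right)

lemma scale_scale: "scale_pm r (scale_pm s c) = scale_pm (r * s) (c :: 'b \<Rightarrow>\<^sub>0 'f::field)"
  by (rule poly_mapping_eqI) (simp add: mult.assoc)

lemma scale_one [simp]: "scale_pm 1 c = (c :: 'b \<Rightarrow>\<^sub>0 'f::field)"
  by (rule poly_mapping_eqI) simp

lemma scale_zero [simp]: "scale_pm 0 c = (0 :: 'b \<Rightarrow>\<^sub>0 'f::field)" "scale_pm r 0 = (0 :: 'b \<Rightarrow>\<^sub>0 'f::field)"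
  by (rule poly_mapping_eqI; simp)+

lemma scale_diff: "scale_pm r (c - d) = scale_pm r c - scale_pm r (d :: 'b \<Rightarrow>\<^sub>0 'f::field)"
  by (rule poly_mapping_eqI) (simp add: lookup_minus right_diff_distrib)

lemma scale_minus_one: "scale_pm (- 1) c = - (c :: 'b \<Rightarrow>\<^sub>0 'f::field)"
  by (rule poly_mapping_eqI) simp

lemma scale_sum: "scale_pm r (\<Sum>a\<in>A. f a) = (\<Sum>a\<in>A. scale_pm r (f a :: 'b \<Rightarrow>\<^sub>0 'f::field))"
  by (induction A rule: infinite_finite_induct) (auto simp: scale_add)

lemma free_module_simps [simp]:
  "c \<in> carrier (free_module B) \<longleftrightarrow> Poly_Mapping.keys c \<subseteq> B" "add (free_module B) = (+)"
  "\<zero>\<^bsub>free_module B\<^esub> = 0" "module.smult (free_module B) = scale_pm"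
  by (simp_all add: free_module_def)

lemma module_free: "Module.module class_ring (free_module B :: ('f::field, 'b \<Rightarrow>\<^sub>0 'f) module)"
proof (rule moduleI)
  show "cring (class_ring :: 'f ring)" by unfold_locales
  show "abelian_group (free_module B :: ('f, 'b \<Rightarrow>\<^sub>0 'f) module)"
  proof (rule abelian_groupI)
    fix c :: "'b \<Rightarrow>\<^sub>0 'f" assume "c \<in> carrier (free_module B)"
    then show "\<exists>d\<in>carrier (free_module B). d \<oplus>\<^bsub>free_module B\<^esub> c = \<zero>\<^bsub>free_module B\<^esub>"
      by (intro bexI[of _ "- c"]) simp_all
  qed (auto simp: add.assoc add.commute dest!: subsetD[OF keys_add])
qed (use keys_scale in \<open>fastforce simp: scale_add scale_add_left scale_scale\<close>)+

lemma free_module_minus: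
  assumes "Poly_Mapping.keys c \<subseteq> B" "Poly_Mapping.keys d \<subseteq> B"
  shows "c \<ominus>\<^bsub>free_module B\<^esub> d = c - (d :: 'b \<Rightarrow>\<^sub>0 'f::field)"
proof -
  interpret M: Module.module class_ring "free_module B :: ('f, 'b \<Rightarrow>\<^sub>0 'f) module" by (rule module_free)
  have "\<ominus>\<^bsub>free_module B\<^esub> d = - d" by (rule M.minus_equality) (use assms in simp_all)
  then show ?thesis by (simp add: a_minus_def)
qed

definition mev :: "nat \<Rightarrow> ('b \<Rightarrow> 'f::field mat) \<Rightarrow> ('b \<Rightarrow>\<^sub>0 'f) \<Rightarrow> 'f mat" where
  "mev n \<theta> c = mat n n (\<lambda>ij. ev (\<lambda>b. \<theta> b $$ ij) c)"

lemma mev_carrier [simp]: "mev n \<theta> c \<in> carrier_mat n n"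
  by (simp add: mev_def)

lemma mev_simps:
  "mev n \<theta> (c + d) = mev n \<theta> c + mev n \<theta> d" "mev n \<theta> (scale_pm r c) = r \<cdot>\<^sub>m mev n \<theta> c"
  "mev n \<theta> 0 = 0\<^sub>m n n"
  by (rule eq_matI; simp add: mev_def)+

lemma mev_gen: "\<theta> b \<in> carrier_mat n n \<Longrightarrow> mev n \<theta> (gen b) = \<theta> b"
  by (rule eq_matI) (auto simp: mev_def)

lemma mev_closed:
  assumes "Poly_Mapping.keys c \<subseteq> B" "0\<^sub>m n n \<in> I" "\<And>S T. S \<in> I \<Longrightarrow> T \<in> I \<Longrightarrow> S + T \<in> I"
    "\<And>r S. S \<in> I \<Longrightarrow> r \<cdot>\<^sub>m S \<in> I" "\<And>b. b \<in> B \<Longrightarrow> \<theta> b \<in> I" "I \<subseteq> carrier_mat n n"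
  shows "mev n \<theta> c \<in> I"
proof -
  have e: "(Poly_Mapping.lookup c b \<cdot>\<^sub>m \<theta> b) $$ (i, j) = Poly_Mapping.lookup c b * \<theta> b $$ (i, j)"
    if "b \<in> Poly_Mapping.keys c" "i < n" "j < n" for b i j
  proof -
    have "\<theta> b \<in> carrier_mat n n" using that(1) assms(1,5,6) by blast
    then show ?thesis using that by simp
  qed
  have "mev n \<theta> c = msum n (\<lambda>b. Poly_Mapping.lookup c b \<cdot>\<^sub>m \<theta> b) (Poly_Mapping.keys c)"
    by (rule eq_matI) (auto simp: mev_def msum_def ev_def e)
  also have "\<dots> \<in> I"
    by (rule msum_closed) (use assms in \<open>auto simp: subset_iff\<close>)
  finally show ?thesis .
qed

text \<open>A relation module \<open>W\<close> is the kernel of a linear map once that map kills it and has a linear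
  section \<open>\<sigma>\<close> such that each generator is congruent to its image under the section.\<close>

lemma coset_eq_iff_mev:
  fixes W :: "('b \<Rightarrow>\<^sub>0 'f::field) set"
  assumes W: "Module.submodule W class_ring (free_module B)"
    and kills: "\<And>c. c \<in> W \<Longrightarrow> mev n \<theta> c = 0\<^sub>m n n"
    and \<sigma>_add: "\<And>S T. S \<in> carrier_mat n n \<Longrightarrow> T \<in> carrier_mat n n \<Longrightarrow> \<sigma> (S + T) = \<sigma> S + \<sigma> T"
    and \<sigma>_smult: "\<And>r S. S \<in> carrier_mat n n \<Longrightarrow> \<sigma> (r \<cdot>\<^sub>m S) = scale_pm r (\<sigma> S)"
    and sec: "\<And>b. b \<in> B \<Longrightarrow> gen b - \<sigma> (\<theta> b) \<in> W"
    and \<theta>: "\<And>b. b \<in> B \<Longrightarrow> \<theta> b \<in> carrier_mat n n"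
    and cd: "Poly_Mapping.keys c \<subseteq> B" "Poly_Mapping.keys d \<subseteq> B"
  shows "W +>\<^bsub>free_module B\<^esub> c = W +>\<^bsub>free_module B\<^esub> d \<longleftrightarrow> mev n \<theta> c = mev n \<theta> d"
proof -
  interpret Q: quotient_module "free_module B" W by (rule quotient_moduleI[OF module_free W])
  have W_add: "x + y \<in> W" if "x \<in> W" "y \<in> W" for x y using Q.W_add[OF that] by simp
  have W_scale: "scale_pm r x \<in> W" if "x \<in> W" for x r using Q.W_smult[OF that, of r] by simp
  have W_zero: "0 \<in> W" using Q.W_zero by simp
  have \<sigma>0: "\<sigma> (0\<^sub>m n n) = 0"
  proof -
    have "0\<^sub>m n n = (0 :: 'f) \<cdot>\<^sub>m 0\<^sub>m n n" by (intro eq_matI) auto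
    then show ?thesis using \<sigma>_smult[of "0\<^sub>m n n" 0] by simp
  qed
  have P_add: "(x + y) - \<sigma> (mev n \<theta> (x + y)) \<in> W"
    if "x - \<sigma> (mev n \<theta> x) \<in> W" "y - \<sigma> (mev n \<theta> y) \<in> W" for x y
    using W_add[OF that] unfolding mev_simps \<sigma>_add[OF mev_carrier mev_carrier] by (simp add: algebra_simps)
  have P_scale: "scale_pm r x - \<sigma> (mev n \<theta> (scale_pm r x)) \<in> W" if "x - \<sigma> (mev n \<theta> x) \<in> W" for r x
    using W_scale[OF that, of r] unfolding mev_simps \<sigma>_smult[OF mev_carrier] scale_diff .
  \<comment> \<open>The composite of the matrix map with the section is linear, so the congruence
    spreads from generators to all elements of the free module.\<close>
  have P: "x - \<sigma> (mev n \<theta> x) \<in> W" if x: "Poly_Mapping.keys x \<subseteq> B" for x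
  proof -
    have "(\<Sum>b\<in>A. scale_pm (Poly_Mapping.lookup x b) (gen b)) -
        \<sigma> (mev n \<theta> (\<Sum>b\<in>A. scale_pm (Poly_Mapping.lookup x b) (gen b))) \<in> W"
      if "finite A" "A \<subseteq> B" for A
      using that
    proof (induction A rule: finite_induct)
      case empty
      show ?case using W_zero by (simp add: mev_simps \<sigma>0)
    next
      case (insert b A)
      have "gen b - \<sigma> (mev n \<theta> (gen b)) \<in> W" using sec[of b] mev_gen[of \<theta> b n] \<theta>[of b] insert(4) by simp
      from P_add[OF P_scale[OF this] insert(3)] show ?case using insert by simp
    qed
    from this[OF finite_keys x] show ?thesis using pm_sum_singles[of x] by simp
  qed
  have "W +>\<^bsub>free_module B\<^esub> c = W +>\<^bsub>free_module B\<^esub> d \<longleftrightarrow> c - d \<in> W"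
    using Q.coset_eq_iff[of c d] cd free_module_minus[OF cd] by simp
  also have "\<dots> \<longleftrightarrow> mev n \<theta> c = mev n \<theta> d"
  proof
    assume "c - d \<in> W"
    from kills[OF this] have m: "mev n \<theta> (c - d) = 0\<^sub>m n n" .
    have "mev n \<theta> c = mev n \<theta> (c - d) + mev n \<theta> d" unfolding mev_simps(1)[symmetric] by simp
    then show "mev n \<theta> c = mev n \<theta> d" unfolding m by simp
  next
    assume e: "mev n \<theta> c = mev n \<theta> d"
    have "(c - \<sigma> (mev n \<theta> c)) + scale_pm (- 1) (d - \<sigma> (mev n \<theta> d)) \<in> W"
      by (intro W_add W_scale P cd)
    then show "c - d \<in> W" unfolding e scale_minus_one by simp
  qed
  finally show ?thesis .
qed

lemma submodule_free_iff:
  "Module.submodule W class_ring (free_module B :: ('f::field, 'b \<Rightarrow>\<^sub>0 'f) module) \<longleftrightarrow>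
    (\<forall>c\<in>W. Poly_Mapping.keys c \<subseteq> B) \<and> 0 \<in> W \<and> (\<forall>x\<in>W. \<forall>y\<in>W. x + y \<in> W) \<and> (\<forall>r. \<forall>x\<in>W. scale_pm r x \<in> W)"
  unfolding submodule_iff[OF module_free] by (auto simp: subset_iff)

lemma lin_ext_superset:
  assumes "finite A" "Poly_Mapping.keys c \<subseteq> A"
  shows "lin_ext f c = (\<Sum>b\<in>A. scale_pm (Poly_Mapping.lookup c b) (f b))"
  unfolding lin_ext_def using assms by (intro sum.mono_neutral_left) (auto simp: in_keys_iff)

lemma lin_ext_add: "lin_ext f (c + d) = lin_ext f c + lin_ext f d"
proof -
  let ?A = "Poly_Mapping.keys c \<union> Poly_Mapping.keys d"
  have "lin_ext f (c + d) = (\<Sum>b\<in>?A. scale_pm (Poly_Mapping.lookup (c + d) b) (f b))"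
    by (rule lin_ext_superset) (auto dest: subsetD[OF keys_add])
  also have "\<dots> = lin_ext f c + lin_ext f d"
    by (simp add: lookup_add scale_add_left sum.distrib lin_ext_superset[of ?A])
  finally show ?thesis .
qed

lemma lin_ext_scale: "lin_ext f (scale_pm r c) = scale_pm r (lin_ext f c)"
  using lin_ext_superset[OF finite_keys keys_scale, of f r c]
  by (simp add: lin_ext_def scale_sum scale_scale)

lemma lin_ext_zero [simp]: "lin_ext f 0 = 0"
  by (simp add: lin_ext_def)

lemma lin_ext_gen [simp]: "lin_ext f (gen b) = f b"
  by (simp add: lin_ext_def)

lemma keys_sum_subset: "(\<And>a. a \<in> A \<Longrightarrow> Poly_Mapping.keys (f a) \<subseteq> B) \<Longrightarrow> Poly_Mapping.keys (\<Sum>a\<in>A. f a) \<subseteq> B"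
proof (induction A rule: infinite_finite_induct)
  case (insert a A)
  then show ?case using keys_add[of "f a" "\<Sum>a\<in>A. f a"] by (simp add: subset_iff) blast
qed auto

lemma keys_lin_ext:
  assumes "\<And>b. b \<in> Poly_Mapping.keys c \<Longrightarrow> Poly_Mapping.keys (f b) \<subseteq> B"
  shows "Poly_Mapping.keys (lin_ext f c) \<subseteq> B"
  unfolding lin_ext_def
  by (rule keys_sum_subset, rule order_trans[OF keys_scale], rule assms)

section \<open>Group homology in degree one\<close>

definition unary :: "'a monoid \<Rightarrow> 'a list set" where
  "unary K = {xs. length xs = 1 \<and> set xs \<subseteq> carrier K}"

lemma unary_iff: "xs \<in> unary K \<longleftrightarrow> (\<exists>x\<in>carrier K. xs = [x])"
  by (auto simp: unary_def length_Suc_conv)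

lemma bar_chains_1: "bar_chains K 1 = free_module (unary K)"
  by (simp add: bar_chains_def unary_def)

text \<open>Both faces of a one-letter word are the empty word and occur with opposite signs, so
  with trivial coefficients every 1-chain is a cycle.\<close>

lemma bar_boundary_1: "Poly_Mapping.keys c \<subseteq> unary K \<Longrightarrow> bar_boundary K 1 c = 0"
  unfolding bar_boundary_def lin_ext_def
  by (auto simp: unary_iff bar_face_def single_add[symmetric] intro!: sum.neutral dest!: subsetD)

lemma bar_cycles_1: "bar_cycles K 1 = carrier (bar_chains K 1)"
  unfolding bar_cycles_def bar_chains_1 using bar_boundary_1[of _ K] by auto

definition bd2 :: "'a monoid \<Rightarrow> 'a list \<Rightarrow> ('a list \<Rightarrow>\<^sub>0 'f::field)" where
  "bd2 K xs = (\<Sum>i\<le>2. Poly_Mapping.single (bar_face K i xs) ((-1) ^ i))"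

text \<open>Modulo boundaries this reads [xy] = [x] + [y]: the first homology is the abelianization
  tensored with the field.\<close>

lemma bd2_pair: "bd2 K [x, y] = gen [y] - gen [x \<otimes>\<^bsub>K\<^esub> y] + gen [x]"
  by (simp add: bd2_def bar_face_def eval_nat_numeral single_uminus)

lemma bar_boundaries_1:
  "bar_boundaries K 1 = lin_ext (bd2 K) ` {c. Poly_Mapping.keys c \<subseteq> {xs. length xs = 2 \<and> set xs \<subseteq> carrier K}}"
  unfolding bar_boundaries_def bar_boundary_def bd2_def bar_chains_def
  by (simp add: free_module_def eval_nat_numeral)

lemma pairs_iff: "xs \<in> {xs. length xs = 2 \<and> set xs \<subseteq> carrier K} \<longleftrightarrow> (\<exists>x\<in>carrier K. \<exists>y\<in>carrier K. xs = [x, y])"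
  by (auto simp: length_Suc_conv eval_nat_numeral)

lemma boundary_mem:
  assumes "x \<in> carrier K" "y \<in> carrier K"
  shows "gen [y] - gen [x \<otimes>\<^bsub>K\<^esub> y] + gen [x] \<in> (bar_boundaries K 1 :: ('a list \<Rightarrow>\<^sub>0 'f::field) set)"
proof -
  have "lin_ext (bd2 K) (gen [x, y]) \<in> (bar_boundaries K 1 :: ('a list \<Rightarrow>\<^sub>0 'f) set)"
    unfolding bar_boundaries_1 by (rule imageI) (use assms in auto)
  then show ?thesis by (simp add: bd2_pair)
qed

lemma submodule_boundaries:
  assumes K: "monoid K"
  shows "Module.submodule (bar_boundaries K 1) class_ring (free_module (unary K) :: ('f::field, 'a list \<Rightarrow>\<^sub>0 'f) module)"
proof -
  let ?D = "{c :: 'a list \<Rightarrow>\<^sub>0 'f. Poly_Mapping.keys c \<subseteq> {xs. length xs = 2 \<and> set xs \<subseteq> carrier K}}"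
  have k: "Poly_Mapping.keys (bd2 K xs :: 'a list \<Rightarrow>\<^sub>0 'f) \<subseteq> unary K" if xs: "xs \<in> {xs. length xs = 2 \<and> set xs \<subseteq> carrier K}" for xs
  proof -
    obtain x y where xy: "x \<in> carrier K" "y \<in> carrier K" "xs = [x, y]" using xs[unfolded pairs_iff] by blast
    have m: "x \<otimes>\<^bsub>K\<^esub> y \<in> carrier K" by (rule monoid.m_closed[OF K xy(1,2)])
    have "Poly_Mapping.keys (bd2 K xs :: 'a list \<Rightarrow>\<^sub>0 'f) \<subseteq> {[y], [x \<otimes>\<^bsub>K\<^esub> y], [x]}"
      unfolding xy(3) bd2_pair
      by (rule order_trans[OF keys_add] Un_least order_trans[OF keys_diff])+ auto
    also have "\<dots> \<subseteq> unary K" using xy m by (auto simp: unary_iff)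
    finally show ?thesis .
  qed
  show ?thesis unfolding submodule_free_iff bar_boundaries_1
  proof (intro conjI ballI allI)
    fix z assume "z \<in> lin_ext (bd2 K) ` ?D"
    then obtain c where c: "c \<in> ?D" "z = lin_ext (bd2 K) c" by blast
    show "Poly_Mapping.keys z \<subseteq> unary K" unfolding c(2) by (rule keys_lin_ext) (use c(1) k in blast)
    show "scale_pm r z \<in> lin_ext (bd2 K) ` ?D" for r
      unfolding c(2) lin_ext_scale[symmetric] by (rule imageI) (use c(1) keys_scale[of r c] in blast)
    fix z' assume "z' \<in> lin_ext (bd2 K) ` ?D"
    then obtain c' where c': "c' \<in> ?D" "z' = lin_ext (bd2 K) c'" by blast
    show "z + z' \<in> lin_ext (bd2 K) ` ?D"
      unfolding c(2) c'(2) lin_ext_add[symmetric] by (rule imageI) (use c(1) c'(1) keys_add[of c c'] in blast)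
  next
    show "0 \<in> lin_ext (bd2 K) ` ?D" by (rule rev_image_eqI[of 0]) simp_all
  qed
qed

text \<open>A map to matrices that is additive on the group vanishes on [y] - [xy] + [x], and the
  boundaries are spanned by these.\<close>

lemma mev_boundary:
  assumes K: "monoid K" and c: "c \<in> (bar_boundaries K 1 :: ('a list \<Rightarrow>\<^sub>0 'f::field) set)"
    and \<theta>: "\<And>x y. x \<in> carrier K \<Longrightarrow> y \<in> carrier K \<Longrightarrow> \<theta> [x \<otimes>\<^bsub>K\<^esub> y] = \<theta> [x] + \<theta> [y]"
    and \<theta>c: "\<And>x. x \<in> carrier K \<Longrightarrow> \<theta> [x] \<in> carrier_mat n n"
  shows "mev n \<theta> c = 0\<^sub>m n n"
proof (rule eq_matI)
  fix i j assume "i < dim_row (0\<^sub>m n n :: 'f mat)" "j < dim_col (0\<^sub>m n n :: 'f mat)"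
  then have ij: "i < n" "j < n" by auto
  obtain d where d: "Poly_Mapping.keys d \<subseteq> {xs. length xs = 2 \<and> set xs \<subseteq> carrier K}" "c = lin_ext (bd2 K) d"
    using c unfolding bar_boundaries_1 by blast
  have "ev (\<lambda>b. \<theta> b $$ (i, j)) (bd2 K xs) = 0" if "xs \<in> Poly_Mapping.keys d" for xs
  proof -
    have "xs \<in> {xs. length xs = 2 \<and> set xs \<subseteq> carrier K}" using that d(1) by blast
    then obtain x y where xy: "x \<in> carrier K" "y \<in> carrier K" "xs = [x, y]" unfolding pairs_iff by blast
    show ?thesis unfolding xy(3) bd2_pair using \<theta>[OF xy(1,2)] \<theta>c[OF xy(1)] \<theta>c[OF xy(2)] ij by simp
  qed
  then have "ev (\<lambda>b. \<theta> b $$ (i, j)) c = 0"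
    unfolding d(2) ev_lin_ext by (simp add: ev_def)
  then show "mev n \<theta> c $$ (i, j) = 0\<^sub>m n n $$ (i, j)" using ij by (simp add: mev_def)
qed (simp_all add: mev_def)

section \<open>The first homology of the level 2 congruence subgroup\<close>

text \<open>The matrix C in B = 1 + 2C. The division is exact on the level 2 group.\<close>

definition halfm :: "int mat \<Rightarrow> int mat" where
  "halfm B = map_mat (\<lambda>x. x div 2) (B - 1\<^sub>m (dim_row B))"

text \<open>One element for each basis matrix \<open>msym\<close>, chosen so that
  \<open>level2_symm\<close> maps it to that matrix.\<close>

definition bgen :: "nat \<Rightarrow> nat \<Rightarrow> nat \<Rightarrow> int mat" where
  "bgen g p q = (if q = conjx p then hneg g p else xelt g p q 2)"

lemma halfm_carrier: "B \<in> carrier_mat n n \<Longrightarrow> halfm B \<in> carrier_mat n n"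
  by (auto simp: halfm_def intro!: carrier_matI)

lemma mod2_one_plus_double:
  assumes "X \<in> carrier_mat n n"
  shows "mod2 (1\<^sub>m n + 2 \<cdot>\<^sub>m X) = 1\<^sub>m n"
  using assms by (intro eq_matI) auto

lemma halfm_eq:
  assumes "D \<in> carrier_mat n n"
  shows "halfm (1\<^sub>m n + 2 \<cdot>\<^sub>m D) = D"
  using assms by (intro eq_matI) (auto simp: halfm_def)

lemma Sp_level2_simps [simp]:
  "mult (Sp_level2 g) = (*)" "\<one>\<^bsub>Sp_level2 g\<^esub> = 1\<^sub>m (2 * g)"
  "B \<in> carrier (Sp_level2 g) \<longleftrightarrow> B \<in> carrier (Sp g) \<and> mod2 B = 1\<^sub>m (2 * g)"
  by (simp_all add: Sp_level2_def Sp_def kernel_def)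

lemma monoid_level2: "monoid (Sp_level2 g)"
proof (rule monoidI)
  fix A B C assume A: "A \<in> carrier (Sp_level2 g)" and B: "B \<in> carrier (Sp_level2 g)" and C: "C \<in> carrier (Sp_level2 g)"
  then have c: "A \<in> carrier_mat (2 * g) (2 * g)" "B \<in> carrier_mat (2 * g) (2 * g)" "C \<in> carrier_mat (2 * g) (2 * g)"
    using Sp_carrierD by auto
  show "A \<otimes>\<^bsub>Sp_level2 g\<^esub> B \<otimes>\<^bsub>Sp_level2 g\<^esub> C = A \<otimes>\<^bsub>Sp_level2 g\<^esub> (B \<otimes>\<^bsub>Sp_level2 g\<^esub> C)"
    using assoc_mult_mat[OF c] by simp
next
  fix A B assume A: "A \<in> carrier (Sp_level2 g)" and B: "B \<in> carrier (Sp_level2 g)"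
  then have c: "A \<in> carrier_mat (2 * g) (2 * g)" "B \<in> carrier_mat (2 * g) (2 * g)" using Sp_carrierD by auto
  show "A \<otimes>\<^bsub>Sp_level2 g\<^esub> B \<in> carrier (Sp_level2 g)"
    using A B Sp_mult_closed[of A g B] mod2_mult[OF c] by simp
next
  show "\<one>\<^bsub>Sp_level2 g\<^esub> \<in> carrier (Sp_level2 g)" by (simp add: one_in_Sp map_mat_of_int_one)
next
  fix A assume "A \<in> carrier (Sp_level2 g)"
  then have "A \<in> carrier_mat (2 * g) (2 * g)" using Sp_carrierD by auto
  then show "\<one>\<^bsub>Sp_level2 g\<^esub> \<otimes>\<^bsub>Sp_level2 g\<^esub> A = A" "A \<otimes>\<^bsub>Sp_level2 g\<^esub> \<one>\<^bsub>Sp_level2 g\<^esub> = A" by simp_all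
qed

lemma level2_decomp:
  assumes "B \<in> carrier (Sp_level2 g)"
  shows "B = 1\<^sub>m (2 * g) + 2 \<cdot>\<^sub>m halfm B" "halfm B \<in> carrier_mat (2 * g) (2 * g)" "B \<in> carrier_mat (2 * g) (2 * g)"
proof -
  have B: "B \<in> carrier (Sp g)" "mod2 B = 1\<^sub>m (2 * g)" using assms by simp_all
  show c: "B \<in> carrier_mat (2 * g) (2 * g)" by (rule Sp_carrierD[OF B(1)])
  show "halfm B \<in> carrier_mat (2 * g) (2 * g)" by (rule halfm_carrier[OF c])
  show "B = 1\<^sub>m (2 * g) + 2 \<cdot>\<^sub>m halfm B"
  proof (rule eq_matI)
    fix i j assume "i < dim_row (1\<^sub>m (2 * g) + 2 \<cdot>\<^sub>m halfm B)" "j < dim_col (1\<^sub>m (2 * g) + 2 \<cdot>\<^sub>m halfm B)"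
    then have ij: "i < 2 * g" "j < 2 * g" using halfm_carrier[OF c] by auto
    have "even (B $$ (i, j) - (if i = j then 1 else 0))"
      using B(2)[unfolded level2_iff[OF B(1)]] ij by auto
    then have "B $$ (i, j) = (if i = j then 1 else 0) + 2 * ((B $$ (i, j) - (if i = j then 1 else 0)) div 2)" by auto
    moreover have "halfm B $$ (i, j) = (B $$ (i, j) - (if i = j then 1 else 0)) div 2"
      using ij c by (simp add: halfm_def)
    ultimately show "B $$ (i, j) = (1\<^sub>m (2 * g) + 2 \<cdot>\<^sub>m halfm B) $$ (i, j)" using ij halfm_carrier[OF c] by simp
  qed (use c halfm_carrier[OF c] in auto)
qed

text \<open>The parameter is additive because a root element leaves the coordinates
  \<open>conjx p\<close> and \<open>conjx q\<close> alone, from which its multipliers are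
  read.\<close>

lemma xelt_add:
  assumes p: "p < 2 * g" "q < 2 * g" and pq: "q \<noteq> conjx p"
  shows "xelt g p q k * xelt g p q l = xelt g p q (k + l :: int)"
proof (rule mat_eqI_vec[of _ "2 * g" "2 * g"])
  have qp: "p \<noteq> conjx q" using pq conjx_conjx by metis
  fix v :: "int vec" assume v: "v \<in> carrier_vec (2 * g)"
  have w: "xelt g p q l *\<^sub>v v \<in> carrier_vec (2 * g)" by (rule mult_mat_vec_carrier[OF xelt_carrier v])
  have jv: "jv (xelt g p q l *\<^sub>v v) p = jv v p" "jv (xelt g p q l *\<^sub>v v) q = jv v q"
    unfolding jv_def xelt_vec[OF v conjx_less[OF p(1)] p] xelt_vec[OF v conjx_less[OF p(2)] p]
    using pq[symmetric] qp[symmetric] by auto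
  show "xelt g p q k * xelt g p q l *\<^sub>v v = xelt g p q (k + l) *\<^sub>v v"
    unfolding assoc_mult_mat_vec[OF xelt_carrier xelt_carrier v]
  proof (rule eq_vecI)
    fix i assume "i < dim_vec (xelt g p q (k + l) *\<^sub>v v)"
    then have i: "i < 2 * g" using carrier_matD[OF xelt_carrier[of g p q "k + l"]] by simp
    show "(xelt g p q k *\<^sub>v (xelt g p q l *\<^sub>v v)) $ i = (xelt g p q (k + l) *\<^sub>v v) $ i"
      unfolding xelt_vec[OF w i p] xelt_vec[OF v i p] jv by (simp add: distrib_right)
  qed (use carrier_matD[OF xelt_carrier[of g p q "k + l"]] carrier_matD[OF xelt_carrier[of g p q k]] in simp)
qed (intro mult_carrier_mat[of _ _ "2 * g"] xelt_carrier)+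

lemma xelt_zero: "xelt g p q 0 = 1\<^sub>m (2 * g)"
  unfolding xelt_def by (intro eq_matI) (auto simp: scalar_prod_def)

lemma xelt_commute: "xelt g p q k = xelt g q p k"
proof -
  have "msym (2 * g) p q = (msym (2 * g) q p :: 'a mat)" by (rule eq_matI) (auto simp: msym_def)
  then show ?thesis by (simp add: xelt_def)
qed

lemma xelt_double_decomp:
  "xelt g p q (2 * k) = 1\<^sub>m (2 * g) + 2 \<cdot>\<^sub>m ((k \<cdot>\<^sub>m msym (2 * g) p q) * Jmat g :: int mat)"
proof -
  have "(2 * k) \<cdot>\<^sub>m msym (2 * g) p q = 2 \<cdot>\<^sub>m (k \<cdot>\<^sub>m (msym (2 * g) p q :: int mat))" by (rule eq_matI) auto
  then show ?thesis unfolding xelt_def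
    using mult_smult_assoc_mat[of "k \<cdot>\<^sub>m msym (2 * g) p q" "2 * g" "2 * g" "Jmat g" "2 * g" 2] by simp
qed

lemma xelt_level2:
  assumes "p < 2 * g" "q < 2 * g" "q \<noteq> conjx p"
  shows "xelt g p q (2 * k) \<in> carrier (Sp_level2 g)"
proof -
  let ?X = "(k \<cdot>\<^sub>m msym (2 * g) p q) * Jmat g :: int mat"
  have X: "?X \<in> carrier_mat (2 * g) (2 * g)" by (intro mult_carrier_mat[of _ _ "2 * g"]) simp_all
  have "mod2 (xelt g p q (2 * k)) = 1\<^sub>m (2 * g)"
    unfolding xelt_double_decomp by (rule mod2_one_plus_double[OF X])
  then show ?thesis using xelt_in_Sp[OF assms, of "2 * k"] by simp
qed

lemma hneg_level2: "hneg g p \<in> carrier (Sp_level2 g)"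
  using hneg_in_Sp by (auto simp: hneg_def intro!: eq_matI)

lemma hneg_conj: "hneg g (conjx p) = hneg g p"
  by (rule eq_matI) (auto simp: hneg_def)

lemma sp_inv_level2:
  assumes "B \<in> carrier (Sp_level2 g)"
  shows "sp_inv g B \<in> carrier (Sp_level2 g)"
proof -
  have B: "B \<in> carrier (Sp g)" "mod2 B = 1\<^sub>m (2 * g)" using assms by simp_all
  have c: "B \<in> carrier_mat (2 * g) (2 * g)" by (rule Sp_carrierD[OF B(1)])
  have i: "sp_inv g B \<in> carrier_mat (2 * g) (2 * g)" by (rule sp_inv_carrier[OF c])
  have "mod2 (sp_inv g B) * mod2 B = 1\<^sub>m (2 * g)"
    unfolding mod2_mult[OF i c, symmetric] sp_inv_left[OF B(1)] by (rule map_mat_of_int_one)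
  then have "mod2 (sp_inv g B) = 1\<^sub>m (2 * g)" unfolding B(2) using i by simp
  then show ?thesis using sp_inv_in_Sp[OF B(1)] by simp
qed

context char2
begin

text \<open>The matrix \<open>1 + 2 C\<close> is sent to \<open>C J\<close> modulo 2. This is additive because
  \<open>(1 + 2 C) (1 + 2 D) = 1 + 2 (C + D) + 4 C D\<close>.\<close>

definition level2_symm :: "nat \<Rightarrow> int mat list \<Rightarrow> 'f mat" where
  "level2_symm g xs = map_mat of_int (halfm (hd xs) * Jmat g)"

lemma of_int_double: "map_mat of_int (2 \<cdot>\<^sub>m X) = (0\<^sub>m (dim_row X) (dim_col X) :: 'f mat)"
  by (rule eq_matI) (auto simp: two_eq_0)

lemma of_int_add: "X \<in> carrier_mat n m \<Longrightarrow> Y \<in> carrier_mat n m \<Longrightarrow>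
    map_mat of_int (X + Y) = (map_mat of_int X + map_mat of_int Y :: 'f mat)"
  by (rule eq_matI) auto

lemma level2_symm_carrier: "B \<in> carrier_mat (2 * g) (2 * g) \<Longrightarrow> level2_symm g [B] \<in> carrier_mat (2 * g) (2 * g)"
  unfolding level2_symm_def using mult_carrier_mat[OF halfm_carrier Jmat_carrier] by simp

lemma halfm_mult:
  assumes A: "A \<in> carrier (Sp_level2 g)" and B: "B \<in> carrier (Sp_level2 g)"
  shows "halfm (A * B) = (halfm A + halfm B) + 2 \<cdot>\<^sub>m (halfm A * halfm B)"
proof -
  let ?n = "2 * g" and ?C = "halfm A" and ?D = "halfm B"
  note a = level2_decomp[OF A] and b = level2_decomp[OF B]
  have CD: "?C * ?D \<in> carrier_mat ?n ?n" by (rule mult_carrier_mat[OF a(2) b(2)])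
  have 2: "2 \<cdot>\<^sub>m ?C \<in> carrier_mat ?n ?n" "2 \<cdot>\<^sub>m ?D \<in> carrier_mat ?n ?n" using a(2) b(2) by simp_all
  have "A * B = (1\<^sub>m ?n + 2 \<cdot>\<^sub>m ?C) * B" using a(1) by simp
  also have "\<dots> = B + 2 \<cdot>\<^sub>m ?C * B"
    unfolding add_mult_distrib_mat[OF one_carrier_mat 2(1) b(3)] using b(3) by simp
  also have "2 \<cdot>\<^sub>m ?C * B = 2 \<cdot>\<^sub>m (?C * B)" by (rule mult_smult_assoc_mat[OF a(2) b(3)])
  also have "?C * B = ?C * (1\<^sub>m ?n + 2 \<cdot>\<^sub>m ?D)" using b(1) by simp
  also have "\<dots> = ?C + 2 \<cdot>\<^sub>m (?C * ?D)"
    unfolding mult_add_distrib_mat[OF a(2) one_carrier_mat 2(2)] mult_smult_distrib[OF a(2) b(2)] using a(2) by simp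
  finally have "A * B = B + 2 \<cdot>\<^sub>m (?C + 2 \<cdot>\<^sub>m (?C * ?D))" .
  also have "\<dots> = (1\<^sub>m ?n + 2 \<cdot>\<^sub>m ?D) + 2 \<cdot>\<^sub>m (?C + 2 \<cdot>\<^sub>m (?C * ?D))" using b(1) by simp
  also have "\<dots> = 1\<^sub>m ?n + 2 \<cdot>\<^sub>m ((?C + ?D) + 2 \<cdot>\<^sub>m (?C * ?D))"
  proof (rule eq_matI)
    fix i j assume "i < dim_row (1\<^sub>m ?n + 2 \<cdot>\<^sub>m ((?C + ?D) + 2 \<cdot>\<^sub>m (?C * ?D)))"
      "j < dim_col (1\<^sub>m ?n + 2 \<cdot>\<^sub>m ((?C + ?D) + 2 \<cdot>\<^sub>m (?C * ?D)))"
    then have ij: "i < ?n" "j < ?n" using a(2) b(2) by auto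
    show "((1\<^sub>m ?n + 2 \<cdot>\<^sub>m ?D) + 2 \<cdot>\<^sub>m (?C + 2 \<cdot>\<^sub>m (?C * ?D))) $$ (i, j) =
        (1\<^sub>m ?n + 2 \<cdot>\<^sub>m ((?C + ?D) + 2 \<cdot>\<^sub>m (?C * ?D))) $$ (i, j)"
      using ij a(2) b(2) by (simp del: index_mult_mat(1))
  qed (use a(2) b(2) in auto)
  finally show ?thesis using halfm_eq[of "(?C + ?D) + 2 \<cdot>\<^sub>m (?C * ?D)" ?n] a(2) b(2) CD by simp
qed

lemma level2_symm_mult:
  assumes A: "A \<in> carrier (Sp_level2 g)" and B: "B \<in> carrier (Sp_level2 g)"
  shows "level2_symm g [A * B] = level2_symm g [A] + level2_symm g [B]"
proof -
  let ?n = "2 * g" and ?C = "halfm A" and ?D = "halfm B" and ?J = "Jmat g :: int mat"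
  note a = level2_decomp[OF A] and b = level2_decomp[OF B]
  have CD: "?C * ?D \<in> carrier_mat ?n ?n" by (rule mult_carrier_mat[OF a(2) b(2)])
  have CJ: "?C * ?J \<in> carrier_mat ?n ?n" "?D * ?J \<in> carrier_mat ?n ?n" "(?C * ?D) * ?J \<in> carrier_mat ?n ?n"
    using mult_carrier_mat[OF _ Jmat_carrier] a(2) b(2) CD by auto
  have "halfm (A * B) * ?J = (?C * ?J + ?D * ?J) + 2 \<cdot>\<^sub>m ((?C * ?D) * ?J)"
    unfolding halfm_mult[OF A B]
    using add_mult_distrib_mat[of "?C + ?D" ?n ?n "2 \<cdot>\<^sub>m (?C * ?D)" ?J ?n] add_mult_distrib_mat[OF a(2) b(2) Jmat_carrier]
      mult_smult_assoc_mat[OF CD Jmat_carrier, of 2] a(2) b(2) CD by simp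
  then have "level2_symm g [A * B] = (level2_symm g [A] + level2_symm g [B]) + map_mat of_int (2 \<cdot>\<^sub>m ((?C * ?D) * ?J))"
    unfolding level2_symm_def list.sel
    using of_int_add[of "?C * ?J + ?D * ?J" ?n ?n "2 \<cdot>\<^sub>m ((?C * ?D) * ?J)"] of_int_add[OF CJ(1,2)] CJ by simp
  then show ?thesis unfolding of_int_double
    using level2_symm_carrier[OF a(3)] level2_symm_carrier[OF b(3)] CJ(3) a(2) by simp
qed

text \<open>A (1 + 2C) A^-1 = 1 + 2 A C A^-1, and A^-1 J = J A^T turns A C A^-1 J into A (C J) A^T.
  Only A modulo 2 is left, so the action does not depend on the lift.\<close>

lemma level2_symm_conj:
  assumes A: "A \<in> carrier (Sp g)" and B: "B \<in> carrier (Sp_level2 g)"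
  shows "A * B * sp_inv g A \<in> carrier (Sp_level2 g)"
    "level2_symm g [A * B * sp_inv g A] = hF (mod2 A) * (level2_symm g [B] * transpose_mat (hF (mod2 A)))"
proof -
  let ?n = "2 * g" and ?C = "halfm B" and ?I = "sp_inv g A" and ?J = "Jmat g :: int mat"
  note b = level2_decomp[OF B]
  have Ac: "A \<in> carrier_mat ?n ?n" by (rule Sp_carrierD[OF A])
  have Ic: "?I \<in> carrier_mat ?n ?n" by (rule sp_inv_carrier[OF Ac])
  have AC: "A * ?C \<in> carrier_mat ?n ?n" by (rule mult_carrier_mat[OF Ac b(2)])
  have ACI: "A * ?C * ?I \<in> carrier_mat ?n ?n" by (rule mult_carrier_mat[OF AC Ic])
  have "A * B = A * (1\<^sub>m ?n + 2 \<cdot>\<^sub>m ?C)" using b(1) by simp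
  also have "\<dots> = A + 2 \<cdot>\<^sub>m (A * ?C)"
    using mult_add_distrib_mat[OF Ac one_carrier_mat, of "2 \<cdot>\<^sub>m ?C"] mult_smult_distrib[OF Ac b(2)] Ac b(2) by simp
  finally have "A * B * ?I = (A + 2 \<cdot>\<^sub>m (A * ?C)) * ?I" by simp
  also have "\<dots> = 1\<^sub>m ?n + 2 \<cdot>\<^sub>m (A * ?C * ?I)"
    using add_mult_distrib_mat[OF Ac _ Ic, of "2 \<cdot>\<^sub>m (A * ?C)"] AC mult_smult_assoc_mat[OF AC Ic, of 2] sp_inv_right[OF A]
    by simp
  finally have e: "A * B * ?I = 1\<^sub>m ?n + 2 \<cdot>\<^sub>m (A * ?C * ?I)" .
  have "mod2 (A * B * ?I) = 1\<^sub>m ?n" unfolding e by (rule mod2_one_plus_double[OF ACI])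
  then show "A * B * ?I \<in> carrier (Sp_level2 g)"
    using Sp_mult_closed[OF Sp_mult_closed[OF A] sp_inv_in_Sp[OF A]] B by simp
  have CJ: "?C * ?J \<in> carrier_mat ?n ?n" by (rule mult_carrier_mat[OF b(2) Jmat_carrier])
  have T: "transpose_mat A \<in> carrier_mat ?n ?n" using Ac by simp
  have CJT: "(?C * ?J) * transpose_mat A \<in> carrier_mat ?n ?n" by (rule mult_carrier_mat[OF CJ T])
  have "A * ?C * ?I * ?J = A * (?C * (?I * ?J))"
    unfolding assoc_mult_mat[OF AC Ic Jmat_carrier] assoc_mult_mat[OF Ac b(2) mult_carrier_mat[OF Ic Jmat_carrier]] ..
  also have "\<dots> = A * ((?C * ?J) * transpose_mat A)"
    unfolding sp_inv_J[OF Ac] assoc_mult_mat[OF b(2) Jmat_carrier T] ..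
  finally have f: "halfm (A * B * ?I) * ?J = A * ((?C * ?J) * transpose_mat A)" unfolding e halfm_eq[OF ACI] .
  have t: "map_mat of_int (transpose_mat A) = transpose_mat (map_mat of_int A :: 'f mat)" using Ac by (intro eq_matI) auto
  show "level2_symm g [A * B * ?I] = hF (mod2 A) * (level2_symm g [B] * transpose_mat (hF (mod2 A)))"
    unfolding level2_symm_def list.sel f map_of_bit_mod2 of_int_hom.mat_hom_mult[OF Ac CJT] of_int_hom.mat_hom_mult[OF CJ T] t ..
qed

text \<open>Inserting B = 1 + 2C into B^T J B = J gives J C + C^T J = -2 C^T J C. Modulo 2 this
  becomes J C = C^T J, and multiplying by J on both sides makes C J symmetric.\<close>

lemma level2_symm_symm:
  assumes B: "B \<in> carrier (Sp_level2 g)"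
  shows "level2_symm g [B] \<in> symm_mats (2 * g)"
proof -
  let ?n = "2 * g" and ?C = "halfm B" and ?J = "Jmat g :: int mat"
  note b = level2_decomp[OF B]
  have BS: "B \<in> carrier (Sp g)" using B by simp
  have CT: "transpose_mat ?C \<in> carrier_mat ?n ?n" using b(2) by simp
  have JC: "?J * ?C \<in> carrier_mat ?n ?n" by (rule mult_carrier_mat[OF Jmat_carrier b(2)])
  have CTJ: "transpose_mat ?C * ?J \<in> carrier_mat ?n ?n" by (rule mult_carrier_mat[OF CT Jmat_carrier])
  have CTJC: "transpose_mat ?C * (?J * ?C) \<in> carrier_mat ?n ?n" by (rule mult_carrier_mat[OF CT JC])
  have JB: "?J * B = ?J + 2 \<cdot>\<^sub>m (?J * ?C)"
  proof -
    have "?J * B = ?J * (1\<^sub>m ?n + 2 \<cdot>\<^sub>m ?C)" using b(1) by simp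
    then show ?thesis
      using mult_add_distrib_mat[OF Jmat_carrier one_carrier_mat, of "2 \<cdot>\<^sub>m ?C"] mult_smult_distrib[OF Jmat_carrier b(2)] b(2)
      by simp
  qed
  have BT: "transpose_mat B = 1\<^sub>m ?n + 2 \<cdot>\<^sub>m transpose_mat ?C"
  proof -
    have "transpose_mat B = transpose_mat (1\<^sub>m ?n + 2 \<cdot>\<^sub>m ?C)" using b(1) by simp
    also have "\<dots> = 1\<^sub>m ?n + 2 \<cdot>\<^sub>m transpose_mat ?C" using b(2) by (intro eq_matI) auto
    finally show ?thesis .
  qed
  have JBc: "?J + 2 \<cdot>\<^sub>m (?J * ?C) \<in> carrier_mat ?n ?n" using JC by simp
  have 2: "2 \<cdot>\<^sub>m transpose_mat ?C \<in> carrier_mat ?n ?n" using CT by simp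
  have "?J = transpose_mat B * (?J * B)" using BS by (simp add: Sp_iff)
  also have "\<dots> = (?J + 2 \<cdot>\<^sub>m (?J * ?C)) + 2 \<cdot>\<^sub>m (transpose_mat ?C * (?J + 2 \<cdot>\<^sub>m (?J * ?C)))"
    unfolding JB BT add_mult_distrib_mat[OF one_carrier_mat 2 JBc] mult_smult_assoc_mat[OF CT JBc] using JBc by simp
  also have "transpose_mat ?C * (?J + 2 \<cdot>\<^sub>m (?J * ?C)) = transpose_mat ?C * ?J + 2 \<cdot>\<^sub>m (transpose_mat ?C * (?J * ?C))"
    using mult_add_distrib_mat[OF CT Jmat_carrier, of "2 \<cdot>\<^sub>m (?J * ?C)"] mult_smult_distrib[OF CT JC] JC by simp
  finally have e: "?J = (?J + 2 \<cdot>\<^sub>m (?J * ?C)) + 2 \<cdot>\<^sub>m (transpose_mat ?C * ?J + 2 \<cdot>\<^sub>m (transpose_mat ?C * (?J * ?C)))" .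
  have e2: "(?J * ?C) $$ (i, j) + (transpose_mat ?C * ?J) $$ (i, j) = - 2 * (transpose_mat ?C * (?J * ?C)) $$ (i, j)"
    if ij: "i < ?n" "j < ?n" for i j
  proof -
    have "?J $$ (i, j) = ((?J + 2 \<cdot>\<^sub>m (?J * ?C)) + 2 \<cdot>\<^sub>m (transpose_mat ?C * ?J + 2 \<cdot>\<^sub>m (transpose_mat ?C * (?J * ?C)))) $$ (i, j)"
      using e by simp
    also have "\<dots> = ?J $$ (i, j) + 2 * (?J * ?C) $$ (i, j) + 2 * ((transpose_mat ?C * ?J) $$ (i, j) + 2 * (transpose_mat ?C * (?J * ?C)) $$ (i, j))"
      using ij carrier_matD[OF JC] carrier_matD[OF CTJ] carrier_matD[OF CTJC] b(2) by (simp del: index_mult_mat(1))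
    finally show ?thesis by simp
  qed
  let ?h = "map_mat of_int :: int mat \<Rightarrow> 'f mat"
  let ?c = "?h ?C"
  have cc: "?c \<in> carrier_mat ?n ?n" and cT: "transpose_mat ?c \<in> carrier_mat ?n ?n" using b(2) by simp_all
  have hJC: "?h (?J * ?C) = Jmat g * ?c"
    unfolding of_int_hom.mat_hom_mult[OF Jmat_carrier b(2)] map_mat_Jmat ..
  have hCTJ: "?h (transpose_mat ?C * ?J) = transpose_mat ?c * Jmat g"
  proof -
    have "?h (transpose_mat ?C) = transpose_mat ?c" using b(2) by (intro eq_matI) auto
    then show ?thesis unfolding of_int_hom.mat_hom_mult[OF CT Jmat_carrier] map_mat_Jmat by simp
  qed
  have JceqCTJ: "Jmat g * ?c = transpose_mat ?c * Jmat g"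
    unfolding hJC[symmetric] hCTJ[symmetric]
  proof (rule eq_matI)
    fix i j assume "i < dim_row (?h (transpose_mat ?C * ?J))" "j < dim_col (?h (transpose_mat ?C * ?J))"
    then have ij: "i < ?n" "j < ?n" using b(2) by auto
    have "of_int ((?J * ?C) $$ (i, j) + (transpose_mat ?C * ?J) $$ (i, j)) = (0 :: 'f)"
      unfolding e2[OF ij] using two_eq_0 by simp
    then have "of_int ((?J * ?C) $$ (i, j)) = (of_int ((transpose_mat ?C * ?J) $$ (i, j)) :: 'f)"
      unfolding eq_iff_add[of "of_int ((?J * ?C) $$ (i, j))"] by simp
    then show "?h (?J * ?C) $$ (i, j) = ?h (transpose_mat ?C * ?J) $$ (i, j)"
      using ij carrier_matD[OF JC] carrier_matD[OF CTJ] by (simp del: index_mult_mat(1))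
  qed (use b(2) in auto)
  have JJ: "Jmat g * Jmat g = (1\<^sub>m ?n :: 'f mat)" unfolding Jmat_sq by (rule eq_matI) (auto simp: minus_eq)
  have cJ: "?c * Jmat g \<in> carrier_mat ?n ?n" by (rule mult_carrier_mat[OF cc Jmat_carrier])
  have "Jmat g * transpose_mat ?c = Jmat g * (transpose_mat ?c * (Jmat g * Jmat g))" unfolding JJ using cT by simp
  also have "\<dots> = Jmat g * ((transpose_mat ?c * Jmat g) * Jmat g)"
    unfolding assoc_mult_mat[OF cT Jmat_carrier Jmat_carrier] ..
  also have "\<dots> = Jmat g * (Jmat g * (?c * Jmat g))"
    unfolding JceqCTJ[symmetric] assoc_mult_mat[OF Jmat_carrier cc Jmat_carrier] ..
  also have "\<dots> = ?c * Jmat g"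
    unfolding assoc_mult_mat[OF Jmat_carrier Jmat_carrier cJ, symmetric] JJ by (rule left_mult_one_mat[OF cJ])
  finally have "transpose_mat (?c * Jmat g) = ?c * Jmat g"
    unfolding transpose_mult[OF cc Jmat_carrier] Jmat_transpose Jmat_minus .
  moreover have "level2_symm g [B] = ?c * Jmat g"
    unfolding level2_symm_def list.sel of_int_hom.mat_hom_mult[OF b(2) Jmat_carrier] map_mat_Jmat ..
  ultimately show ?thesis using cJ by (simp add: symm_mats_def)
qed

section \<open>A linear section from symmetric matrices to 1-chains\<close>

definition le_pairs :: "nat \<Rightarrow> (nat \<times> nat) set" where
  "le_pairs n = {(i, j). i \<le> j \<and> j < n}"

lemma finite_le_pairs [simp]: "finite (le_pairs n)"
  by (rule finite_subset[of _ "{..<n} \<times> {..<n}"]) (auto simp: le_pairs_def)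

definition symm_section :: "nat \<Rightarrow> 'f mat \<Rightarrow> (int mat list \<Rightarrow>\<^sub>0 'f)" where
  "symm_section g S = (\<Sum>(p, q)\<in>le_pairs (2 * g). scale_pm (S $$ (p, q)) (gen [bgen g p q]))"

lemma symm_section_add: "S \<in> carrier_mat (2 * g) (2 * g) \<Longrightarrow> T \<in> carrier_mat (2 * g) (2 * g) \<Longrightarrow> symm_section g (S + T) = symm_section g S + symm_section g T"
  unfolding symm_section_def sum.distrib[symmetric] by (intro sum.cong refl) (auto simp: le_pairs_def scale_add_left)

lemma symm_section_smult: "S \<in> carrier_mat (2 * g) (2 * g) \<Longrightarrow> symm_section g (r \<cdot>\<^sub>m S) = scale_pm r (symm_section g S)"
  unfolding symm_section_def scale_sum by (intro sum.cong refl) (auto simp: le_pairs_def scale_scale)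

lemma bgen_level2: "p < 2 * g \<Longrightarrow> q < 2 * g \<Longrightarrow> bgen g p q \<in> carrier (Sp_level2 g)"
  using hneg_level2 xelt_level2[of p g q 1] by (simp add: bgen_def)

lemma symm_section_keys: "Poly_Mapping.keys (symm_section g S) \<subseteq> unary (Sp_level2 g)"
  unfolding symm_section_def
proof (rule keys_sum_subset)
  fix a assume "a \<in> le_pairs (2 * g)"
  then obtain p q where a: "a = (p, q)" "p < 2 * g" "q < 2 * g" by (auto simp: le_pairs_def)
  have "Poly_Mapping.keys (scale_pm (S $$ (p, q)) (gen [bgen g p q])) \<subseteq> {[bgen g p q]}"
    by (rule order_trans[OF keys_scale]) simp
  then show "Poly_Mapping.keys (case a of (p, q) \<Rightarrow> scale_pm (S $$ (p, q)) (gen [bgen g p q])) \<subseteq> unary (Sp_level2 g)"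
    unfolding a(1) using bgen_level2[OF a(2,3)] unary_iff by fastforce
qed

text \<open>For a root element C is (E_pq + E_qp) J, and J^2 = -1 leaves the symmetric matrix up to
  sign. For a sign change C is minus the projection to the plane of p, and multiplying by J produces
  the two entries of the plane. Signs vanish in characteristic 2.\<close>

lemma level2_symm_bgen:
  assumes pq: "p < 2 * g" "q < 2 * g"
  shows "level2_symm g [bgen g p q] = msym (2 * g) p q"
proof (cases "q = conjx p")
  case True
  show ?thesis
  proof (rule eq_matI)
    fix i j assume "i < dim_row (msym (2 * g) p q :: 'f mat)" "j < dim_col (msym (2 * g) p q :: 'f mat)"
    then have ij: "i < 2 * g" "j < 2 * g" by auto
    have hc: "halfm (hneg g p) \<in> carrier_mat (2 * g) (2 * g)" by (rule halfm_carrier[OF hneg_carrier])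
    have hent: "halfm (hneg g p) $$ (i, k) = (if k = i then (if i = p \<or> i = conjx p then - 1 else 0) else 0)"
      if "k < 2 * g" for k
      using that ij by (auto simp: halfm_def hneg_def)
    have "(halfm (hneg g p) * Jmat g) $$ (i, j) = (\<Sum>k\<in>{0..<2 * g}. halfm (hneg g p) $$ (i, k) * Jmat g $$ (k, j))"
      using ij hc by (simp add: scalar_prod_def)
    also have "\<dots> = (\<Sum>k\<in>{0..<2 * g}. if k = i then (if i = p \<or> i = conjx p then - 1 else 0) * Jmat g $$ (k, j) else 0)"
      by (intro sum.cong refl) (auto simp: hent)
    also have "\<dots> = (if i = p \<or> i = conjx p then - 1 else 0) * Jmat g $$ (i, j)" using ij by simp
    finally have "(halfm (hneg g p) * Jmat g) $$ (i, j) = (if i = p \<or> i = conjx p then - 1 else 0) * Jmat g $$ (i, j)" .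
    then have "level2_symm g [bgen g p q] $$ (i, j) = of_int ((if i = p \<or> i = conjx p then - 1 else 0) * Jmat g $$ (i, j))"
      using ij True carrier_matD[OF halfm_carrier[OF hneg_carrier[of g p]]]
      by (simp add: level2_symm_def bgen_def del: index_mult_mat(1))
    also have "\<dots> = msym (2 * g) p q $$ (i, j)"
      using ij True by (auto simp: Jmat_def msym_def minus_eq)
    finally show "level2_symm g [bgen g p q] $$ (i, j) = msym (2 * g) p q $$ (i, j)" .
  qed (use carrier_matD[OF halfm_carrier[OF hneg_carrier[of g p]]] True in \<open>simp_all add: level2_symm_def bgen_def\<close>)
next
  case False
  let ?M = "msym (2 * g) p q :: int mat"
  have MJ: "?M * Jmat g \<in> carrier_mat (2 * g) (2 * g)" by (rule mult_carrier_mat[OF msym_carrier Jmat_carrier])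
  have "bgen g p q = 1\<^sub>m (2 * g) + 2 \<cdot>\<^sub>m (?M * Jmat g)"
  proof -
    have "1 \<cdot>\<^sub>m ?M = ?M" by (rule eq_matI) auto
    then show ?thesis using xelt_double_decomp[of g p q 1] False by (simp add: bgen_def)
  qed
  then have "halfm (bgen g p q) * Jmat g = ?M * Jmat g * Jmat g" by (simp only: halfm_eq[OF MJ])
  also have "\<dots> = ?M * (Jmat g * Jmat g)" by (rule assoc_mult_mat[OF msym_carrier Jmat_carrier Jmat_carrier])
  also have "\<dots> = - ?M" unfolding Jmat_sq by simp
  finally have e: "halfm (bgen g p q) * Jmat g = - ?M" .
  show ?thesis unfolding level2_symm_def list.sel e by (rule eq_matI) (auto simp: msym_def minus_eq)
qed

lemma symm_section_msym:
  assumes pq: "(p, q) \<in> le_pairs (2 * g)"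
  shows "symm_section g (msym (2 * g) p q) = gen [bgen g p q]"
proof -
  have "symm_section g (msym (2 * g) p q) = (\<Sum>a\<in>le_pairs (2 * g). if a = (p, q) then gen [bgen g (fst a) (snd a)] else 0)"
    unfolding symm_section_def
  proof (rule sum.cong[OF refl])
    fix a assume "a \<in> le_pairs (2 * g)"
    then obtain i j where a: "a = (i, j)" "i \<le> j" "i < 2 * g" "j < 2 * g" by (auto simp: le_pairs_def)
    have "p \<le> q" using pq by (simp add: le_pairs_def)
    then have "msym (2 * g) p q $$ (i, j) = (if a = (p, q) then 1 else (0 :: 'f))"
      using a by (auto simp: msym_def)
    then show "(case a of (i, j) \<Rightarrow> scale_pm (msym (2 * g) p q $$ (i, j)) (gen [bgen g i j])) =
        (if a = (p, q) then gen [bgen g (fst a) (snd a)] else (0 :: int mat list \<Rightarrow>\<^sub>0 'f))"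
      unfolding a(1) by simp
  qed
  then show ?thesis using pq by simp
qed

lemma level2_symm_section:
  assumes S: "S \<in> symm_mats (2 * g)"
  shows "mev (2 * g) (level2_symm g) (symm_section g S) = S"
proof (rule eq_matI)
  fix k l assume "k < dim_row S" "l < dim_col S"
  then have kl: "k < 2 * g" "l < 2 * g" using symm_carrier[OF S] by auto
  have "mev (2 * g) (level2_symm g) (symm_section g S) $$ (k, l) =
      (\<Sum>(p, q)\<in>le_pairs (2 * g). S $$ (p, q) * level2_symm g [bgen g p q] $$ (k, l))"
    using kl by (simp add: mev_def symm_section_def ev_sum case_prod_unfold)
  also have "\<dots> = (\<Sum>a\<in>le_pairs (2 * g). if a = (min k l, max k l) then S $$ a else 0)"
  proof (rule sum.cong[OF refl])
    fix a assume "a \<in> le_pairs (2 * g)"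
    then obtain i j where a: "a = (i, j)" "i \<le> j" "i < 2 * g" "j < 2 * g" by (auto simp: le_pairs_def)
    have "msym (2 * g) i j $$ (k, l) = (if a = (min k l, max k l) then 1 else (0 :: 'f))"
    proof -
      have "(k = i \<and> l = j \<or> k = j \<and> l = i) \<longleftrightarrow> i = min k l \<and> j = max k l" using a(2) by arith
      then have "(k = i \<and> l = j \<or> k = j \<and> l = i) \<longleftrightarrow> a = (min k l, max k l)" unfolding a(1) prod.inject .
      moreover have "msym (2 * g) i j $$ (k, l) = (if k = i \<and> l = j \<or> k = j \<and> l = i then 1 else (0 :: 'f))"
        using kl by (simp add: msym_def)
      ultimately show ?thesis by simp
    qed
    then show "(case a of (p, q) \<Rightarrow> S $$ (p, q) * level2_symm g [bgen g p q] $$ (k, l)) =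
        (if a = (min k l, max k l) then S $$ a else 0)"
      unfolding a(1) prod.case level2_symm_bgen[OF a(3,4)] by simp
  qed
  also have "\<dots> = S $$ (min k l, max k l)"
    unfolding sum_delta_pair[OF finite_le_pairs] using kl by (auto simp: le_pairs_def)
  also have "\<dots> = S $$ (k, l)" using symm_index[OF S kl] by (simp add: min_def max_def)
  finally show "mev (2 * g) (level2_symm g) (symm_section g S) $$ (k, l) = S $$ (k, l)" .
qed (use symm_carrier[OF S] in \<open>auto simp: mev_def\<close>)

abbreviation bnd :: "nat \<Rightarrow> (int mat list \<Rightarrow>\<^sub>0 'f) set" where
  "bnd g \<equiv> bar_boundaries (Sp_level2 g) 1"

text \<open>Modulo boundaries \<open>[B]\<close> is additive in \<open>B\<close>, so that it suffices to treat generators.\<close>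

lemma generator_mod_boundary:
  assumes B: "B \<in> carrier (Sp_level2 g)"
  shows "gen [B] - symm_section g (level2_symm g [B]) \<in> bnd g"
proof -
  let ?n = "2 * g"
  note W = submodule_boundaries[OF monoid_level2, of g, where 'f = 'f, unfolded submodule_free_iff]
  have Wadd: "x + y \<in> bnd g" if "x \<in> bnd g" "y \<in> bnd g" for x y using W that by blast
  have Wmin: "- x \<in> bnd g" if "x \<in> bnd g" for x
    using W that scale_minus_one[of x] by metis
  have W0: "0 \<in> bnd g" using W by blast
  have c: "A \<in> carrier_mat ?n ?n" if "A \<in> carrier (Sp_level2 g)" for A using level2_decomp(3)[OF that] .
  have bm: "gen [A'] - gen [A * A'] + gen [A] \<in> bnd g"
    if "A \<in> carrier (Sp_level2 g)" "A' \<in> carrier (Sp_level2 g)" for A A'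
    using boundary_mem[OF that] by simp
  \<comment> \<open>The elements for which the claim holds. Additivity of both terms modulo
    boundaries makes H a subgroup, so membership of the generators decides.\<close>
  define H where "H = {A \<in> carrier (Sp_level2 g). gen [A] - symm_section g (level2_symm g [A]) \<in> bnd g}"
  have HL: "A \<in> carrier (Sp_level2 g)" and Hb: "gen [A] - symm_section g (level2_symm g [A]) \<in> bnd g" if "A \<in> H" for A
    using that by (auto simp: H_def)
  have L1: "1\<^sub>m ?n \<in> carrier (Sp_level2 g)" using monoid.one_closed[OF monoid_level2[of g]] by simp
  have Lm: "A * A' \<in> carrier (Sp_level2 g)" if "A \<in> carrier (Sp_level2 g)" "A' \<in> carrier (Sp_level2 g)" for A A'
    using monoid.m_closed[OF monoid_level2[of g] that] by simp
  have prod: "A * A' \<in> H" if A: "A \<in> H" and A': "A' \<in> H" for A A'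
  proof -
    have "(gen [A] - symm_section g (level2_symm g [A])) + (gen [A'] - symm_section g (level2_symm g [A'])) + - (gen [A'] - gen [A * A'] + gen [A]) \<in> bnd g"
      by (intro Wadd Wmin Hb A A' bm HL)
    moreover have "symm_section g (level2_symm g [A * A']) = symm_section g (level2_symm g [A]) + symm_section g (level2_symm g [A'])"
      unfolding level2_symm_mult[OF HL[OF A] HL[OF A']] by (intro symm_section_add level2_symm_carrier c HL A A')
    ultimately show ?thesis using Lm[OF HL[OF A] HL[OF A']] by (simp add: H_def algebra_simps)
  qed
  have th1: "level2_symm g [1\<^sub>m ?n] = 0\<^sub>m ?n ?n"
  proof -
    \<comment> \<open>The image of 1 equals its own double by additivity, and doubles are zero in
      characteristic 2.\<close>
    have z: "level2_symm g [1\<^sub>m ?n] + level2_symm g [1\<^sub>m ?n] = level2_symm g [1\<^sub>m ?n]" using level2_symm_mult[OF L1 L1] by simp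
    have "level2_symm g [1\<^sub>m ?n] + level2_symm g [1\<^sub>m ?n] = 0\<^sub>m ?n ?n"
      using level2_symm_carrier[OF c[OF L1]] by (intro eq_matI) (auto simp: add_self)
    with z show ?thesis by simp
  qed
  have sg0: "symm_section g (0\<^sub>m ?n ?n) = 0" by (auto simp: symm_section_def le_pairs_def intro!: sum.neutral)
  \<comment> \<open>The boundary of [1|1] is [1], so the class of the identity is zero.\<close>
  have one: "1\<^sub>m ?n \<in> H"
    using bm[OF L1 L1] L1 unfolding H_def by (simp add: th1 sg0)
  have inv: "sp_inv g A \<in> H" if A: "A \<in> H" for A
  proof -
    let ?I = "sp_inv g A"
    have AS: "A \<in> carrier (Sp g)" using HL[OF A] by simp
    have I: "?I \<in> carrier (Sp_level2 g)" by (rule sp_inv_level2[OF HL[OF A]])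
    have "level2_symm g [A] + level2_symm g [?I] = 0\<^sub>m ?n ?n" using level2_symm_mult[OF HL[OF A] I] sp_inv_right[OF AS] th1 by simp
    then have "symm_section g (level2_symm g [A]) + symm_section g (level2_symm g [?I]) = 0"
      using symm_section_add[OF level2_symm_carrier[OF c[OF HL[OF A]]] level2_symm_carrier[OF c[OF I]]] sg0 by simp
    then have e: "symm_section g (level2_symm g [?I]) = - symm_section g (level2_symm g [A])" by (simp add: eq_neg_iff_add_eq_0 add.commute)
    have "gen [?I] - gen [1\<^sub>m ?n] + gen [A] \<in> bnd g" using bm[OF HL[OF A] I] sp_inv_right[OF AS] by simp
    moreover have "gen [1\<^sub>m ?n] \<in> bnd g" using Hb[OF one] by (simp add: th1 sg0)
    ultimately have "(gen [?I] - gen [1\<^sub>m ?n] + gen [A]) + gen [1\<^sub>m ?n] + - (gen [A] - symm_section g (level2_symm g [A])) \<in> bnd g"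
      by (intro Wadd[OF Wadd Wmin[OF Hb[OF A]]])
    then show ?thesis unfolding H_def using I by (simp add: e)
  qed
  have base: "bgen g p q \<in> H" if pq: "(p, q) \<in> le_pairs ?n" for p q
  proof -
    have l: "p < ?n" "q < ?n" using pq by (auto simp: le_pairs_def)
    show ?thesis unfolding H_def using bgen_level2[OF l] W0 by (simp add: level2_symm_bgen[OF l] symm_section_msym[OF pq])
  qed
  have x2: "xelt g p q 2 \<in> H" if "p < ?n" "q < ?n" "q \<noteq> conjx p" for p q
  proof (cases "p \<le> q")
    case True
    then show ?thesis using base[of p q] that by (simp add: bgen_def le_pairs_def)
  next
    case False
    have "p \<noteq> conjx q" using that(3) conjx_conjx by metis
    then show ?thesis using base[of q p] that False by (simp add: bgen_def le_pairs_def xelt_commute[of g p q])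
  qed
  \<comment> \<open>The set contains the root element with parameter 2 and its inverse, so induction
    over the integers in both directions reaches every even parameter.\<close>
  have x: "xelt g p q (2 * k) \<in> H" if pq: "p < ?n" "q < ?n" "q \<noteq> conjx p" for p q k
  proof (induction k rule: int_induct[of _ 0])
    case base
    then show ?case using one by (simp add: xelt_zero)
  next
    case (step1 k)
    have "xelt g p q (2 * k) * xelt g p q 2 \<in> H" by (rule prod[OF step1(2) x2[OF pq]])
    then show ?case unfolding xelt_add[OF pq] by (simp add: algebra_simps)
  next
    case (step2 k)
    have "sp_inv g (xelt g p q 2) = (xelt g p q (- 2) :: int mat)"
    proof -
      have e: "xelt g p q (- 2) * xelt g p q 2 = (1\<^sub>m ?n :: int mat)" unfolding xelt_add[OF pq] by (simp add: xelt_zero)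
      have "inv\<^bsub>Sp g\<^esub> (xelt g p q 2) = (xelt g p q (- 2) :: int mat)"
        by (rule group.inv_equality[OF group_Sp]) (use e xelt_in_Sp[OF pq] in simp_all)
      then show ?thesis unfolding inv_Sp[OF xelt_in_Sp[OF pq]] .
    qed
    then have "xelt g p q (2 * k) * xelt g p q (- 2) \<in> H" using prod[OF step2(2) inv[OF x2[OF pq]]] by simp
    then show ?case unfolding xelt_add[OF pq] by (simp add: algebra_simps)
  qed
  have h: "hneg g p \<in> H" if p: "p < ?n" for p
  proof (cases "even p")
    case True
    then have "(p, conjx p) \<in> le_pairs ?n" using conjx_less[OF p] by (simp add: le_pairs_def conjx_def)
    from base[OF this] show ?thesis by (simp add: bgen_def)
  next
    case False
    then have "(conjx p, p) \<in> le_pairs ?n" using p by (simp add: le_pairs_def conjx_def)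
    from base[OF this] show ?thesis by (simp add: bgen_def hneg_conj)
  qed
  interpret level2_generators g H
    by unfold_locales (use HL one prod inv x h in auto)
  have "B \<in> H" by (rule level2_generated) (use B in auto)
  then show ?thesis by (rule Hb)
qed

lemma H1_coset_eq:
  assumes "Poly_Mapping.keys c \<subseteq> unary (Sp_level2 g)" "Poly_Mapping.keys d \<subseteq> unary (Sp_level2 g)"
  shows "bnd g +>\<^bsub>free_module (unary (Sp_level2 g))\<^esub> c = bnd g +>\<^bsub>free_module (unary (Sp_level2 g))\<^esub> d \<longleftrightarrow>
    mev (2 * g) (level2_symm g) c = mev (2 * g) (level2_symm g) d"
proof (rule coset_eq_iff_mev[where \<sigma> = "symm_section g"])
  show "Module.submodule (bnd g) class_ring (free_module (unary (Sp_level2 g)))"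
    by (rule submodule_boundaries[OF monoid_level2])
  show "mev (2 * g) (level2_symm g) z = 0\<^sub>m (2 * g) (2 * g)" if "z \<in> bnd g" for z
    by (rule mev_boundary[OF monoid_level2 that]; (unfold Sp_level2_simps(1))?;
        (rule level2_symm_mult symm_carrier[OF level2_symm_symm]; assumption))
  show "gen b - symm_section g (level2_symm g b) \<in> bnd g" if "b \<in> unary (Sp_level2 g)" for b
    using that generator_mod_boundary unfolding unary_iff by blast
  show "level2_symm g b \<in> carrier_mat (2 * g) (2 * g)" if "b \<in> unary (Sp_level2 g)" for b
    using that level2_symm_symm symm_carrier unfolding unary_iff by blast
qed (use symm_section_add symm_section_smult assms in auto)

end

lemma ev_fsum: "finite K \<Longrightarrow> ev (\<lambda>b. \<Sum>k\<in>K. f k b) c = (\<Sum>k\<in>K. ev (f k) c)"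
proof (induction K rule: finite_induct)
  case empty
  show ?case by (simp add: ev_def)
next
  case (insert k K)
  then show ?case by (simp add: ev_def distrib_left sum.distrib)
qed

lemma ev_fmult: "ev (\<lambda>b. h b * r) c = ev h c * r"
  by (simp add: ev_def sum_distrib_right mult.assoc)

text \<open>The congruence h X h^T is linear in X, so it commutes with the extension from generators
  to chains.\<close>

lemma (in char2) mev_lin_ext_conj:
  assumes h: "h \<in> carrier_mat n n"
    and \<theta>: "\<And>b. b \<in> Poly_Mapping.keys c \<Longrightarrow> \<theta> b \<in> carrier_mat n n"
    and \<phi>: "\<And>b. b \<in> Poly_Mapping.keys c \<Longrightarrow> \<theta>' (\<phi> b) = h * (\<theta> b * transpose_mat h)"
  shows "mev n \<theta>' (lin_ext (\<lambda>b. gen (\<phi> b)) c) = (h * (mev n \<theta> c * transpose_mat h) :: 'f mat)"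
proof (rule eq_matI)
  have mc: "mev n \<theta> c \<in> carrier_mat n n" by simp
  fix i j assume "i < dim_row (h * (mev n \<theta> c * transpose_mat h))" "j < dim_col (h * (mev n \<theta> c * transpose_mat h))"
  then have ij: "i < n" "j < n" using h by auto
  have "mev n \<theta>' (lin_ext (\<lambda>b. gen (\<phi> b)) c) $$ (i, j) = ev (\<lambda>b. \<theta>' (\<phi> b) $$ (i, j)) c"
    using ij by (simp add: mev_def ev_lin_ext)
  also have "\<dots> = ev (\<lambda>b. \<Sum>k\<in>{0..<n}. \<Sum>l\<in>{0..<n}. \<theta> b $$ (k, l) * (h $$ (i, k) * h $$ (j, l))) c"
    by (rule ev_cong) (simp only: \<phi> conj_index[OF h \<theta> ij])
  also have "\<dots> = (\<Sum>k\<in>{0..<n}. \<Sum>l\<in>{0..<n}. ev (\<lambda>b. \<theta> b $$ (k, l)) c * (h $$ (i, k) * h $$ (j, l)))"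
    by (simp only: ev_fsum finite_atLeastLessThan ev_fmult)
  also have "\<dots> = (\<Sum>k\<in>{0..<n}. \<Sum>l\<in>{0..<n}. mev n \<theta> c $$ (k, l) * (h $$ (i, k) * h $$ (j, l)))"
    by (intro sum.cong refl) (simp add: mev_def)
  also have "\<dots> = (h * (mev n \<theta> c * transpose_mat h)) $$ (i, j)"
    by (rule conj_index[OF h mc ij, symmetric])
  finally show "mev n \<theta>' (lin_ext (\<lambda>b. gen (\<phi> b)) c) $$ (i, j) = (h * (mev n \<theta> c * transpose_mat h)) $$ (i, j)" .
qed (use h in \<open>auto simp: mev_def\<close>)

lemma group_homology_1:
  "group_homology K 1 = quot_module (free_module (unary K)) (bar_boundaries K 1)"
  unfolding group_homology_def bar_cycles_1 bar_chains_1 by simp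

context char2
begin

abbreviation fr :: "nat \<Rightarrow> ('f, int mat list \<Rightarrow>\<^sub>0 'f) module" where
  "fr g \<equiv> free_module (unary (Sp_level2 g))"

lemma H1_simps:
  "carrier (H1_Sp_level2 ty g) = carrier (quot_module (fr g) (bnd g))"
  "add (H1_Sp_level2 ty g) = add (quot_module (fr g) (bnd g))"
  "zero (H1_Sp_level2 ty g) = zero (quot_module (fr g) (bnd g))"
  "module.smult (H1_Sp_level2 ty g) = module.smult (quot_module (fr g) (bnd g))"
  "act (H1_Sp_level2 ty g) s X = (\<Union>A\<in>{A \<in> carrier (Sp g). mod2 A = s}.
     coset_map (fr g) (bnd g) (lin_ext (\<lambda>xs. gen (map (\<lambda>B. A * B * inv\<^bsub>Sp g\<^esub> A) xs))) X)"
  unfolding H1_Sp_level2_def with_act_def group_homology_1 homology_map_def bar_chains_1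
  by simp_all

text \<open>The section inverts the matrix map: composed one way it gives the identity by
  \<open>level2_symm_section\<close>, composed the other way it does so modulo boundaries by
  \<open>H1_coset_eq\<close>.\<close>

theorem H1_iso:
  "gmodule_iso (Sp g) (symm_module ty g) (H1_Sp_level2 ty g) (\<lambda>S. bnd g +>\<^bsub>fr g\<^esub> symm_section g S)"
proof -
  let ?n = "2 * g" and ?M = "symm_module ty g" and ?H = "H1_Sp_level2 ty g"
  let ?\<psi> = "\<lambda>S. bnd g +>\<^bsub>fr g\<^esub> symm_section g S"
  interpret Q: quotient_module "fr g" "bnd g"
    by (rule quotient_moduleI[OF module_free submodule_boundaries[OF monoid_level2]])
  have ceq: "bnd g +>\<^bsub>fr g\<^esub> c = bnd g +>\<^bsub>fr g\<^esub> d" if "mev ?n (level2_symm g) c = mev ?n (level2_symm g) d"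
    "Poly_Mapping.keys c \<subseteq> unary (Sp_level2 g)" "Poly_Mapping.keys d \<subseteq> unary (Sp_level2 g)" for c d
    using H1_coset_eq[OF that(2,3)] that(1) by simp
  have msymm: "mev ?n (level2_symm g) c \<in> symm_mats ?n" if "Poly_Mapping.keys c \<subseteq> unary (Sp_level2 g)" for c
  proof (rule mev_closed[OF that symm_zero symm_add symm_smult])
    show "level2_symm g b \<in> symm_mats ?n" if "b \<in> unary (Sp_level2 g)" for b
      using that level2_symm_symm unfolding unary_iff by blast
  qed (use symm_carrier in auto)
  have keysadd: "Poly_Mapping.keys (c + d) \<subseteq> B" if "Poly_Mapping.keys c \<subseteq> B" "Poly_Mapping.keys d \<subseteq> B"
    for c d :: "int mat list \<Rightarrow>\<^sub>0 'f" and B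
    using keys_add[of c d] that by blast
  have sgc: "symm_section g S \<in> carrier (fr g)" for S using symm_section_keys by simp
  \<comment> \<open>Every integral lift A of s acts by the same congruence of matrices, so the union
    over all lifts that defines the action is a single coset.\<close>
  have conj: "coset_map (fr g) (bnd g) (lin_ext (\<lambda>xs. gen (map (\<lambda>B. A * B * inv\<^bsub>Sp g\<^esub> A) xs))) (?\<psi> S) =
      ?\<psi> (hF s * (S * transpose_mat (hF s)))"
    if A: "A \<in> carrier (Sp g)" "mod2 A = s" and S: "S \<in> symm_mats ?n" for A s S
  proof -
    let ?\<phi> = "map (\<lambda>B. A * B * inv\<^bsub>Sp g\<^esub> A)"
    let ?f = "lin_ext (\<lambda>xs. gen (?\<phi> xs)) :: (int mat list \<Rightarrow>\<^sub>0 'f) \<Rightarrow> _"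
    have "mod2 A \<in> carrier (Sp g)" by (rule mod2_in_Sp[OF A(1)])
    then have sS: "s \<in> carrier (Sp g)" using A(2) by simp
    note h = hb_carrier[OF sS]
    have u: "?\<phi> b \<in> unary (Sp_level2 g)" "level2_symm g (?\<phi> b) = hF s * (level2_symm g b * transpose_mat (hF s))"
      "level2_symm g b \<in> carrier_mat ?n ?n" if "b \<in> unary (Sp_level2 g)" for b
    proof -
      obtain B where B: "B \<in> carrier (Sp_level2 g)" "b = [B]" using \<open>b \<in> _\<close> unfolding unary_iff by blast
      show "?\<phi> b \<in> unary (Sp_level2 g)" "level2_symm g (?\<phi> b) = hF s * (level2_symm g b * transpose_mat (hF s))"
        "level2_symm g b \<in> carrier_mat ?n ?n"
        using level2_symm_conj[OF A(1) B(1)] symm_carrier[OF level2_symm_symm[OF B(1)]] A(2)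
        unfolding B(2) unary_iff inv_Sp[OF A(1)] by auto
    qed
    have fk: "Poly_Mapping.keys (?f c) \<subseteq> unary (Sp_level2 g)" if "Poly_Mapping.keys c \<subseteq> unary (Sp_level2 g)" for c
      by (rule keys_lin_ext) (use u(1) that in auto)
    have fm: "mev ?n (level2_symm g) (?f c) = hF s * (mev ?n (level2_symm g) c * transpose_mat (hF s))"
      if "Poly_Mapping.keys c \<subseteq> unary (Sp_level2 g)" for c
      by (rule mev_lin_ext_conj[OF h]) (use u(2,3) that in blast)+
    have zero: "mev ?n (level2_symm g) c = 0\<^sub>m ?n ?n \<longleftrightarrow> c \<in> bnd g" if c: "Poly_Mapping.keys c \<subseteq> unary (Sp_level2 g)" for c
    proof -
      have "c \<in> bnd g \<longleftrightarrow> bnd g +>\<^bsub>fr g\<^esub> c = bnd g +>\<^bsub>fr g\<^esub> 0"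
        using Q.coset_eq_iff[of c 0] c free_module_minus[OF c, of 0] by simp
      then show ?thesis using H1_coset_eq[OF c, of 0] by (simp add: mev_simps)
    qed
    have img: "?f ` bnd g \<subseteq> bnd g"
    proof (rule image_subsetI)
      fix c assume c: "c \<in> bnd g"
      then have k: "Poly_Mapping.keys c \<subseteq> unary (Sp_level2 g)" using subsetD[OF Q.W_sub c] by simp
      have "mev ?n (level2_symm g) (?f c) = 0\<^sub>m ?n ?n" unfolding fm[OF k] using zero[OF k] c h by simp
      then show "?f c \<in> bnd g" using zero[OF fk[OF k]] by simp
    qed
    have "coset_map (fr g) (bnd g) ?f (?\<psi> S) = bnd g +>\<^bsub>fr g\<^esub> ?f (symm_section g S)"
      by (rule Q.coset_map_coset[OF Q.quotient_module_axioms _ _ img sgc]) (use fk in \<open>auto simp: lin_ext_add\<close>)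
    also have "\<dots> = ?\<psi> (hF s * (S * transpose_mat (hF s)))"
      by (rule ceq[OF _ fk[OF symm_section_keys] symm_section_keys]) (simp only: fm[OF symm_section_keys] level2_symm_section[OF S] level2_symm_section[OF conj_symm[OF h S]])
    finally show ?thesis .
  qed
  have hom: "ghom_on (Sp g) ?M (carrier ?M) ?H ?\<psi>"
    unfolding ghom_on_def symm_module_simps
  proof (intro conjI ballI allI)
    fix S T :: "'f mat" assume S: "S \<in> symm_mats ?n" and T: "T \<in> symm_mats ?n"
    have "?\<psi> S \<oplus>\<^bsub>?H\<^esub> ?\<psi> T = bnd g +>\<^bsub>fr g\<^esub> (symm_section g S + symm_section g T)"
      unfolding H1_simps using Q.add_quot[OF sgc sgc] by simp
    also have "\<dots> = ?\<psi> (S + T)"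
      unfolding symm_section_add[OF symm_carrier[OF S] symm_carrier[OF T]] ..
    finally show "?\<psi> (S + T) = ?\<psi> S \<oplus>\<^bsub>?H\<^esub> ?\<psi> T" by simp
  next
    fix r and S :: "'f mat" assume S: "S \<in> symm_mats ?n"
    have "r \<odot>\<^bsub>?H\<^esub> ?\<psi> S = bnd g +>\<^bsub>fr g\<^esub> scale_pm r (symm_section g S)"
      unfolding H1_simps using Q.smult_quot[OF sgc] by simp
    then show "?\<psi> (r \<cdot>\<^sub>m S) = r \<odot>\<^bsub>?H\<^esub> ?\<psi> S" unfolding symm_section_smult[OF symm_carrier[OF S]] by simp
  next
    fix s :: "bit mat" and S :: "'f mat" assume s: "s \<in> carrier (Sp g)" and S: "S \<in> symm_mats ?n"
    \<comment> \<open>Without a lift the union would be empty; here surjectivity of the reduction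
      map enters.\<close>
    have ne: "{A \<in> carrier (Sp g). mod2 A = s} \<noteq> {}" using mod2_surjective[OF s] by blast
    have "act ?H s (?\<psi> S) = (\<Union>A\<in>{A \<in> carrier (Sp g). mod2 A = s}. ?\<psi> (hF s * (S * transpose_mat (hF s))))"
      unfolding H1_simps by (rule SUP_cong[OF refl]) (use conj S in blast)
    also have "\<dots> = ?\<psi> (hF s * (S * transpose_mat (hF s)))" by (simp only: UN_constant ne if_False)
    finally show "?\<psi> (hF s * (S * transpose_mat (hF s))) = act ?H s (?\<psi> S)" by simp
  qed
  have inj: "S = T" if "S \<in> symm_mats ?n" "T \<in> symm_mats ?n" "?\<psi> S = ?\<psi> T" for S T
    using H1_coset_eq[OF symm_section_keys[of g S] symm_section_keys[of g T]] that level2_symm_section by simp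
  have im: "?\<psi> ` carrier ?M = carrier ?H"
  proof (rule subset_antisym; rule subsetI)
    fix X assume "X \<in> ?\<psi> ` carrier ?M"
    then show "X \<in> carrier ?H" unfolding H1_simps Q.carrier_quot using sgc by blast
  next
    fix X assume "X \<in> carrier ?H"
    then obtain c where c: "Poly_Mapping.keys c \<subseteq> unary (Sp_level2 g)" "X = bnd g +>\<^bsub>fr g\<^esub> c"
      unfolding H1_simps Q.carrier_quot by auto
    have "X = ?\<psi> (mev ?n (level2_symm g) c)"
      unfolding c(2) by (rule ceq[OF _ c(1) symm_section_keys]) (simp only: level2_symm_section[OF msymm[OF c(1)]])
    then show "X \<in> ?\<psi> ` carrier ?M" using msymm[OF c(1)] by simp
  qed
  show ?thesis
  proof (rule gmodule_iso.intro)
    show "monoid (Sp g :: bit mat monoid)" by (rule monoid_Sp)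
    show "is_gmodule (Sp g) ?M" by (rule is_gmodule_symm)
    show "ghom_on (Sp g) ?M (carrier ?M) ?H ?\<psi>" by (rule hom)
    have "inj_on ?\<psi> (carrier ?M)" by (rule inj_onI) (use inj in simp)
    with im show "bij_betw ?\<psi> (carrier ?M) (carrier ?H)" by (simp add: bij_betw_def)
    have "symm_section g (0\<^sub>m ?n ?n) = 0" by (auto simp: symm_section_def le_pairs_def intro!: sum.neutral)
    then have "?\<psi> \<zero>\<^bsub>?M\<^esub> = \<zero>\<^bsub>?H\<^esub>" unfolding H1_simps Q.zero_quot by simp
    then show "is_gmodule (Sp g) ?H" by (rule is_gmodule_image[OF monoid_Sp is_gmodule_symm hom im])
  qed
qed

end

section \<open>The exterior square as the module of alternating matrices\<close>

lemma (in gmodule_iso) gepi_theta: "gepi G M (carrier M) {\<zero>\<^bsub>M\<^esub>} P \<theta>"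
  unfolding gepi_def
proof (intro conjI ballI hom)
  interpret M: Module.module class_ring M using is_gmoduleD(1)[OF M] .
  show "\<theta> ` carrier M = carrier P" using bij by (simp add: bij_betw_def)
  fix x y assume xy: "x \<in> carrier M" "y \<in> carrier M"
  have "(x \<ominus>\<^bsub>M\<^esub> y) \<oplus>\<^bsub>M\<^esub> y = x" using xy by (simp add: a_minus_def M.a_assoc M.l_neg)
  moreover have "x \<ominus>\<^bsub>M\<^esub> x = \<zero>\<^bsub>M\<^esub>" using xy by (simp add: a_minus_def M.r_neg)
  ultimately show "\<theta> x = \<theta> y \<longleftrightarrow> x \<ominus>\<^bsub>M\<^esub> y \<in> {\<zero>\<^bsub>M\<^esub>}" unfolding theta_inj[OF xy] using xy by auto
qed

lemma (in gmodule_iso) restrict: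
  assumes A: "gsubmodule G M A"
  shows "gmodule_iso G (M\<lparr>carrier := A\<rparr>) (P\<lparr>carrier := \<theta> ` A\<rparr>) \<theta>"
proof (rule gmodule_iso.intro)
  have A': "A \<subseteq> carrier M" using A by (simp add: gsubmodule_iff[OF M])
  show "monoid G" by (rule G)
  show "is_gmodule G (M\<lparr>carrier := A\<rparr>)" by (rule is_gmodule_restrict[OF M A])
  show "is_gmodule G (P\<lparr>carrier := \<theta> ` A\<rparr>)" by (rule is_gmodule_restrict[OF P image_gsubmodule[OF A]])
  have "inj_on \<theta> A" using bij A' by (auto simp: bij_betw_def intro: inj_on_subset)
  then show "bij_betw \<theta> (carrier (M\<lparr>carrier := A\<rparr>)) (carrier (P\<lparr>carrier := \<theta> ` A\<rparr>))"
    by (simp add: bij_betw_def)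
  show "ghom_on G (M\<lparr>carrier := A\<rparr>) (carrier (M\<lparr>carrier := A\<rparr>)) (P\<lparr>carrier := \<theta> ` A\<rparr>) \<theta>"
    using hom A' unfolding ghom_on_def by (simp add: subset_iff)
qed

text \<open>Induction on the number of coordinates kept: each further coordinate adds a multiple of
  one unit vector.\<close>

lemma vec_induct_unit:
  fixes x :: "'a::comm_ring_1 vec"
  assumes x: "x \<in> carrier_vec n" and zero: "Q (0\<^sub>v n)"
    and step: "\<And>y r k. y \<in> carrier_vec n \<Longrightarrow> k < n \<Longrightarrow> Q y \<Longrightarrow> Q (y + r \<cdot>\<^sub>v unit_vec n k)"
  shows "Q x"
proof -
  let ?t = "\<lambda>k. vec n (\<lambda>i. if i < k then x $ i else 0)"
  have "Q (?t k)" if "k \<le> n" for k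
    using that
  proof (induction k)
    case 0
    have "?t 0 = 0\<^sub>v n" by (intro eq_vecI) auto
    then show ?case using zero by simp
  next
    case (Suc k)
    have "?t (Suc k) = ?t k + x $ k \<cdot>\<^sub>v unit_vec n k"
      using Suc.prems by (intro eq_vecI) (auto simp: less_Suc_eq)
    then show ?case using step[of "?t k" k "x $ k"] Suc by simp
  qed
  moreover have "?t n = x" using x by (intro eq_vecI) auto
  ultimately show ?thesis by (metis order_refl)
qed

lemma keys_diff_subset:
  "Poly_Mapping.keys c \<subseteq> B \<Longrightarrow> Poly_Mapping.keys d \<subseteq> B \<Longrightarrow> Poly_Mapping.keys (c - d) \<subseteq> B"
  for c d :: "'b \<Rightarrow>\<^sub>0 'f::field"
  using keys_diff[of c d] by blast

lemma mev_diff: "mev n \<theta> (c - d) = mev n \<theta> c - mev n \<theta> d"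
  by (rule eq_matI) (simp_all add: mev_def)

section \<open>Relations of the exterior square and a section from alternating matrices\<close>

context char2
begin

abbreviation vpairs :: "nat \<Rightarrow> ('f vec \<times> 'f vec) set" where
  "vpairs g \<equiv> carrier_vec (2 * g) \<times> carrier_vec (2 * g)"

abbreviation pf :: "nat \<Rightarrow> ('f, 'f vec \<times> 'f vec \<Rightarrow>\<^sub>0 'f) module" where
  "pf g \<equiv> free_module (vpairs g)"

abbreviation enull :: "nat \<Rightarrow> ('f vec \<times> 'f vec \<Rightarrow>\<^sub>0 'f) set" where
  "enull g \<equiv> ext_null (H1_surface ty g)"

abbreviation wq :: "nat \<Rightarrow> 'f vec \<times> 'f vec \<Rightarrow> 'f mat" where
  "wq g \<equiv> \<lambda>(x, y). wd (2 * g) x y"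

lemma uminus_pm: "- c = (c :: 'b \<Rightarrow>\<^sub>0 'f)"
  by (rule poly_mapping_eqI) (simp add: minus_eq)

lemma relators_keys:
  assumes "c \<in> ext_relators (H1_surface ty g)"
  shows "Poly_Mapping.keys c \<subseteq> vpairs g"
proof -
  have k: "Poly_Mapping.keys (scale_pm r (gen (x, y)) :: _ \<Rightarrow>\<^sub>0 'f) \<subseteq> vpairs g"
    if "x \<in> carrier_vec (2 * g)" "y \<in> carrier_vec (2 * g)" for r x y
    by (rule order_trans[OF keys_scale]) (use that in simp)
  from assms show ?thesis
    unfolding ext_relators_def H1_surface_simps
    by (elim UnE CollectE exE conjE) (hypsubst, (intro keys_diff_subset k)?; simp)+
qed

lemma ext_null_submodule: "Module.submodule (enull g) class_ring (pf g)"
  and relators_null: "ext_relators (H1_surface ty g) \<subseteq> enull g"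
  and ext_null_least: "Module.submodule N class_ring (pf g) \<Longrightarrow> ext_relators (H1_surface ty g) \<subseteq> N \<Longrightarrow> enull g \<subseteq> N"
proof -
  have "ext_relators (H1_surface ty g) \<subseteq> carrier (pf g)" using relators_keys by auto
  note p = span_props[OF module_free this, folded ext_null_def[of "H1_surface ty g", unfolded H1_surface_simps]]
  show "Module.submodule (enull g) class_ring (pf g)" "ext_relators (H1_surface ty g) \<subseteq> enull g"
    by (rule p(1), rule p(2))
  show "Module.submodule N class_ring (pf g) \<Longrightarrow> ext_relators (H1_surface ty g) \<subseteq> N \<Longrightarrow> enull g \<subseteq> N"
    by (rule p(3))
qed

lemma enull_closed:
  "0 \<in> enull g" "c \<in> enull g \<Longrightarrow> d \<in> enull g \<Longrightarrow> c + d \<in> enull g" "c \<in> enull g \<Longrightarrow> scale_pm r c \<in> enull g"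
  using ext_null_submodule[of g] unfolding submodule_free_iff by blast+

lemma relator_add_left:
  "x \<in> carrier_vec (2 * g) \<Longrightarrow> y \<in> carrier_vec (2 * g) \<Longrightarrow> z \<in> carrier_vec (2 * g) \<Longrightarrow>
    gen (x + y, z) - gen (x, z) - gen (y, z) \<in> enull g"
  by (rule subsetD[OF relators_null]) (unfold ext_relators_def H1_surface_simps, blast)

lemma relator_add_right:
  "x \<in> carrier_vec (2 * g) \<Longrightarrow> y \<in> carrier_vec (2 * g) \<Longrightarrow> z \<in> carrier_vec (2 * g) \<Longrightarrow>
    gen (x, y + z) - gen (x, y) - gen (x, z) \<in> enull g"
  by (rule subsetD[OF relators_null]) (unfold ext_relators_def H1_surface_simps, blast)

lemma relator_smult_left:
  "x \<in> carrier_vec (2 * g) \<Longrightarrow> y \<in> carrier_vec (2 * g) \<Longrightarrow> gen (r \<cdot>\<^sub>v x, y) - scale_pm r (gen (x, y)) \<in> enull g"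
  by (rule subsetD[OF relators_null]) (unfold ext_relators_def H1_surface_simps, blast)

lemma relator_self: "x \<in> carrier_vec (2 * g) \<Longrightarrow> gen (x, x) \<in> enull g"
  by (rule subsetD[OF relators_null]) (unfold ext_relators_def H1_surface_simps, blast)

text \<open>Expanding (x + y) wedge (x + y) = 0 by bilinearity leaves x wedge y + y wedge x, and in
  characteristic 2 the sign does not matter.\<close>

lemma gen_swap:
  assumes x: "x \<in> carrier_vec (2 * g)" and y: "y \<in> carrier_vec (2 * g)"
  shows "gen (x, y) - gen (y, x) \<in> enull g"
proof -
  have xy: "x + y \<in> carrier_vec (2 * g)" using x y by simp
  have m: "c - d \<in> enull g" if "c \<in> enull g" "d \<in> enull g" for c d
    using enull_closed(2)[OF that(1) enull_closed(3)[OF that(2), of "- 1"]] by (simp add: scale_minus_one)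
  have "gen (x + y, x + y) - (gen (x + y, x + y) - gen (x, x + y) - gen (y, x + y))
      - (gen (x, x + y) - gen (x, x) - gen (x, y)) - (gen (y, x + y) - gen (y, x) - gen (y, y))
      - gen (x, x) - gen (y, y) \<in> enull g"
    by (intro m relator_self relator_add_left relator_add_right x y xy)
  then have "gen (x, y) + gen (y, x) \<in> enull g" by (simp add: algebra_simps)
  then show ?thesis unfolding diff_conv_add_uminus uminus_pm .
qed

lemma wq_carrier: "wq g b \<in> carrier_mat (2 * g) (2 * g)"
  by (simp add: case_prod_beta)

text \<open>The kernel of the matrix map is a submodule that contains the relators, hence it
  contains their span.\<close>

lemma enull_mev:
  assumes "c \<in> enull g"
  shows "mev (2 * g) (wq g) c = 0\<^sub>m (2 * g) (2 * g)"
proof -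
  let ?N = "{c. Poly_Mapping.keys c \<subseteq> vpairs g \<and> mev (2 * g) (wq g) c = 0\<^sub>m (2 * g) (2 * g)}"
  have "Module.submodule ?N class_ring (pf g)"
    unfolding submodule_free_iff
  proof (intro conjI ballI allI)
    fix c d assume "c \<in> ?N" "d \<in> ?N"
    then show "c + d \<in> ?N" using keys_add[of c d] by (auto simp: mev_simps)
  next
    fix r c assume "c \<in> ?N"
    then show "scale_pm r c \<in> ?N" using keys_scale[of r c] by (auto simp: mev_simps)
  qed (auto simp: mev_simps)
  moreover have "ext_relators (H1_surface ty g) \<subseteq> ?N"
  proof
    fix c assume c: "c \<in> ext_relators (H1_surface ty g)"
    have "mev (2 * g) (wq g) c = 0\<^sub>m (2 * g) (2 * g)"
      using c unfolding ext_relators_def H1_surface_simps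
      by (elim UnE CollectE exE conjE)
        (hypsubst, unfold mev_diff mev_simps mev_gen[of "wq g" _ "2 * g", OF wq_carrier] split_conv,
          rule eq_matI; simp add: wd_def algebra_simps add_self)+
    then show "c \<in> ?N" using relators_keys[OF c] by simp
  qed
  ultimately show ?thesis using ext_null_least[of ?N g] assms by blast
qed

definition alt_section :: "nat \<Rightarrow> 'f mat \<Rightarrow> ('f vec \<times> 'f vec \<Rightarrow>\<^sub>0 'f)" where
  "alt_section g S = (\<Sum>(p, q)\<in>lt_pairs (2 * g). scale_pm (S $$ (p, q)) (gen (unit_vec (2 * g) p, unit_vec (2 * g) q)))"

lemma alt_section_add:
  "S \<in> carrier_mat (2 * g) (2 * g) \<Longrightarrow> T \<in> carrier_mat (2 * g) (2 * g) \<Longrightarrow> alt_section g (S + T) = alt_section g S + alt_section g T"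
  unfolding alt_section_def sum.distrib[symmetric]
  by (rule sum.cong) (auto simp: lt_pairs_def scale_add_left)

lemma alt_section_smult: "S \<in> carrier_mat (2 * g) (2 * g) \<Longrightarrow> alt_section g (r \<cdot>\<^sub>m S) = scale_pm r (alt_section g S)"
  unfolding alt_section_def scale_sum
  by (rule sum.cong) (auto simp: lt_pairs_def scale_scale)

lemma alt_section_zero: "alt_section g (0\<^sub>m (2 * g) (2 * g)) = 0"
  unfolding alt_section_def by (rule sum.neutral) (auto simp: lt_pairs_def)

lemma alt_section_keys: "Poly_Mapping.keys (alt_section g S) \<subseteq> vpairs g"
  unfolding alt_section_def by (rule keys_sum_subset) (auto dest!: subsetD[OF keys_scale])

lemma alt_section_unit:
  assumes "k < l" "l < 2 * g"
  shows "alt_section g (wd (2 * g) (unit_vec (2 * g) k) (unit_vec (2 * g) l)) = gen (unit_vec (2 * g) k, unit_vec (2 * g) l)"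
proof -
  let ?e = "unit_vec (2 * g) :: nat \<Rightarrow> 'f vec"
  have "alt_section g (wd (2 * g) (?e k) (?e l)) = (\<Sum>p\<in>lt_pairs (2 * g). if p = (k, l) then gen (?e k, ?e l) else 0)"
    unfolding alt_section_def
  proof (rule sum.cong[OF refl])
    fix p assume "p \<in> lt_pairs (2 * g)"
    then obtain a b where p: "p = (a, b)" "a < b" "b < 2 * g" by (auto simp: lt_pairs_def)
    have "wd (2 * g) (?e k) (?e l) $$ (a, b) = (if (a, b) = (k, l) then 1 else (0 :: 'f))"
      using wd_unit_index[of a "2 * g" b k l] p assms by auto
    then show "(case p of (p, q) \<Rightarrow> scale_pm (wd (2 * g) (?e k) (?e l) $$ (p, q)) (gen (?e p, ?e q))) =
        (if p = (k, l) then gen (?e k, ?e l) else 0)"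
      unfolding p(1) split_conv by (cases "(a, b) = (k, l)") auto
  qed
  also have "\<dots> = gen (?e k, ?e l)"
    using assms unfolding sum_delta_pair[OF finite_lt_pairs] by (simp add: lt_pairs_def)
  finally show ?thesis .
qed

text \<open>Bilinearity reduces the claim to basis vectors e_k and e_l, where k < l is the
  definition of the section, k = l is a relator and k > l is \<open>gen_swap\<close>. Linearity is
  used in the left slot; the right slot is reached by swapping.\<close>

lemma gen_alt_section:
  assumes "b \<in> vpairs g"
  shows "gen b - alt_section g (wq g b) \<in> enull g"
proof -
  let ?n = "2 * g" and ?V = "carrier_vec (2 * g) :: 'f vec set" and ?e = "unit_vec (2 * g) :: nat \<Rightarrow> 'f vec"
  let ?R = "\<lambda>x y. gen (x, y) - alt_section g (wd ?n x y) \<in> enull g"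
  have zero_wd: "wd ?n (0\<^sub>v ?n) y = 0\<^sub>m ?n ?n" "wd ?n y (0\<^sub>v ?n) = 0\<^sub>m ?n ?n" "wd ?n y y = 0\<^sub>m ?n ?n"
    if "y \<in> ?V" for y
    by (rule eq_matI; use that in \<open>simp add: wd_def add_self\<close>)+
  have zz: "(0 :: 'f) \<cdot>\<^sub>v 0\<^sub>v ?n = 0\<^sub>v ?n" by (intro eq_vecI) auto
  have unit: "?R (?e k) (?e l)" if "k < ?n" "l < ?n" for k l
  proof (cases k l rule: linorder_cases)
    case less
    then show ?thesis using that enull_closed(1) by (simp add: alt_section_unit)
  next
    case equal
    then show ?thesis using relator_self[of "?e k" g] by (simp add: zero_wd alt_section_zero)
  next
    case greater
    then show ?thesis using that gen_swap[of "?e k" g "?e l"] by (subst wd_commute) (simp add: alt_section_unit)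
  qed
  have left: "?R x y" if x: "x \<in> ?V" and y: "y \<in> ?V" and e: "\<And>k. k < ?n \<Longrightarrow> ?R (?e k) y" for x y
    using x
  proof (rule vec_induct_unit)
    show "?R (0\<^sub>v ?n) y" using relator_smult_left[of "0\<^sub>v ?n" g y 0] y
      by (simp add: zero_wd alt_section_zero zz)
    fix z r k assume z: "z \<in> ?V" and k: "k < ?n" and R: "?R z y"
    have w: "wd ?n (z + r \<cdot>\<^sub>v ?e k) y = wd ?n z y + r \<cdot>\<^sub>m wd ?n (?e k) y"
      using z by (simp add: wd_add_left wd_smult_left)
    have re: "r \<cdot>\<^sub>v ?e k \<in> ?V" by simp
    have "((gen (z + r \<cdot>\<^sub>v ?e k, y) - gen (z, y) - gen (r \<cdot>\<^sub>v ?e k, y)) +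
        (gen (r \<cdot>\<^sub>v ?e k, y) - scale_pm r (gen (?e k, y)))) +
        ((gen (z, y) - alt_section g (wd ?n z y)) + scale_pm r (gen (?e k, y) - alt_section g (wd ?n (?e k) y))) \<in> enull g"
      by (intro enull_closed relator_add_left relator_smult_left z y re R e k unit_vec_carrier)
    then show "?R (z + r \<cdot>\<^sub>v ?e k) y" unfolding w by (simp add: alt_section_add alt_section_smult scale_diff algebra_simps)
  qed
  have "?R x y" if x: "x \<in> ?V" and y: "y \<in> ?V" for x y
  proof (rule left[OF x y])
    fix k assume k: "k < ?n"
    have "?R y (?e k)" by (rule left[OF y unit_vec_carrier]) (use unit k in blast)
    from enull_closed(2)[OF gen_swap[OF unit_vec_carrier[of ?n k] y] this]
    show "?R (?e k) y" by (subst wd_commute) simp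
  qed
  then show ?thesis using assms by auto
qed

lemma ext_coset_eq:
  assumes "Poly_Mapping.keys c \<subseteq> vpairs g" "Poly_Mapping.keys d \<subseteq> vpairs g"
  shows "enull g +>\<^bsub>pf g\<^esub> c = enull g +>\<^bsub>pf g\<^esub> d \<longleftrightarrow> mev (2 * g) (wq g) c = mev (2 * g) (wq g) d"
  by (rule coset_eq_iff_mev[OF ext_null_submodule enull_mev alt_section_add alt_section_smult gen_alt_section wq_carrier assms])

lemma mev_alt_section:
  assumes S: "S \<in> alt_mats (2 * g)"
  shows "mev (2 * g) (wq g) (alt_section g S) = S"
proof (rule eq_matI)
  have Sc: "S \<in> carrier_mat (2 * g) (2 * g)" by (rule symm_carrier[OF alt_symm[OF S]])
  show "dim_row (mev (2 * g) (wq g) (alt_section g S)) = dim_row S" "dim_col (mev (2 * g) (wq g) (alt_section g S)) = dim_col S"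
    using Sc by (simp_all add: mev_def)
  fix k l assume "k < dim_row S" "l < dim_col S"
  then have kl: "k < 2 * g" "l < 2 * g" using Sc by auto
  have "mev (2 * g) (wq g) (alt_section g S) $$ (k, l) =
      (\<Sum>(p, q)\<in>lt_pairs (2 * g). S $$ (p, q) * wd (2 * g) (unit_vec (2 * g) p) (unit_vec (2 * g) q) $$ (k, l))"
    using kl unfolding mev_def alt_section_def by (simp add: ev_sum case_prod_beta)
  then show "mev (2 * g) (wq g) (alt_section g S) $$ (k, l) = S $$ (k, l)" unfolding alt_sum_entries[OF S kl] .
qed

text \<open>(hx)(hy)^T = h (x y^T) h^T, and the same with x and y exchanged.\<close>

lemma wd_conj:
  fixes h :: "'f mat"
  assumes h: "h \<in> carrier_mat n n" and x: "x \<in> carrier_vec n" and y: "y \<in> carrier_vec n"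
  shows "wd n (h *\<^sub>v x) (h *\<^sub>v y) = h * (wd n x y * transpose_mat h)"
proof (rule eq_matI)
  fix i j assume "i < dim_row (h * (wd n x y * transpose_mat h))" "j < dim_col (h * (wd n x y * transpose_mat h))"
  then have ij: "i < n" "j < n" using h by auto
  have m: "(h *\<^sub>v v) $ i = (\<Sum>k\<in>{0..<n}. h $$ (i, k) * v $ k)" if "v \<in> carrier_vec n" "i < n" for v i
    using that h by (auto simp: scalar_prod_def intro!: sum.cong)
  have "wd n (h *\<^sub>v x) (h *\<^sub>v y) $$ (i, j) =
      (\<Sum>k\<in>{0..<n}. \<Sum>l\<in>{0..<n}. h $$ (i, k) * x $ k * (h $$ (j, l) * y $ l)) +
      (\<Sum>k\<in>{0..<n}. \<Sum>l\<in>{0..<n}. h $$ (i, k) * y $ k * (h $$ (j, l) * x $ l))"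
    using ij unfolding wd_def by (simp add: m x y sum_product del: index_mult_mat_vec)
  also have "\<dots> = (\<Sum>k\<in>{0..<n}. \<Sum>l\<in>{0..<n}. wd n x y $$ (k, l) * (h $$ (i, k) * h $$ (j, l)))"
    unfolding sum.distrib[symmetric] by (intro sum.cong refl) (simp add: wd_def algebra_simps)
  also have "\<dots> = (h * (wd n x y * transpose_mat h)) $$ (i, j)"
    by (rule conj_index[OF h wd_carrier(1) ij, symmetric])
  finally show "wd n (h *\<^sub>v x) (h *\<^sub>v y) $$ (i, j) = (h * (wd n x y * transpose_mat h)) $$ (i, j)" .
qed (use h in auto)

end

section \<open>The exterior square, the kernel of the contraction and the line through omega\<close>

context char2
begin

lemma ext_square_simps:
  "carrier (ext_square (H1_surface ty g)) = carrier (quot_module (pf g) (enull g))"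
  "add (ext_square (H1_surface ty g)) = add (quot_module (pf g) (enull g))"
  "zero (ext_square (H1_surface ty g)) = zero (quot_module (pf g) (enull g))"
  "module.smult (ext_square (H1_surface ty g)) = module.smult (quot_module (pf g) (enull g))"
  "act (ext_square (H1_surface ty g)) s X = coset_map (pf g) (enull g)
     (lin_ext (\<lambda>b. gen (case b of (x, y) \<Rightarrow> (hF s *\<^sub>v x, hF s *\<^sub>v y)))) X"
  unfolding ext_square_def with_act_def Let_def H1_surface_simps
  by (simp_all add: split_def)

definition alt_to_ext :: "nat \<Rightarrow> 'f mat \<Rightarrow> ('f vec \<times> 'f vec \<Rightarrow>\<^sub>0 'f) set" where
  "alt_to_ext g S = enull g +>\<^bsub>pf g\<^esub> alt_section g S"

lemma quotient_ext: "quotient_module (pf g) (enull g)"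
  by (rule quotient_moduleI[OF module_free ext_null_submodule])

lemma mev_wq_alt:
  assumes "Poly_Mapping.keys c \<subseteq> vpairs g"
  shows "mev (2 * g) (wq g) c \<in> alt_mats (2 * g)"
proof -
  note a = gsubmodule_alt[of g, unfolded gsubmodule_iff[OF is_gmodule_symm] symm_module_simps]
  show ?thesis
  proof (rule mev_closed[OF assms])
    show "wq g b \<in> alt_mats (2 * g)" for b by (simp add: case_prod_beta wd_alt)
    show "(alt_mats (2 * g) :: 'f mat set) \<subseteq> carrier_mat (2 * g) (2 * g)"
      using symm_carrier alt_symm by blast
  qed (use a in blast)+
qed

lemma act_alt_to_ext:
  assumes s: "s \<in> carrier (Sp g)" and S: "S \<in> alt_mats (2 * g)"
  shows "act (ext_square (H1_surface ty g)) s (alt_to_ext g S) = alt_to_ext g (hF s * (S * transpose_mat (hF s)))"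
proof -
  interpret Q: quotient_module "pf g" "enull g" by (rule quotient_ext)
  note h = hb_carrier[OF s]
  let ?\<phi> = "\<lambda>b. case b of (x, y) \<Rightarrow> (hF s *\<^sub>v x, hF s *\<^sub>v y)"
  let ?f = "lin_ext (\<lambda>b. gen (?\<phi> b)) :: ('f vec \<times> 'f vec \<Rightarrow>\<^sub>0 'f) \<Rightarrow> _"
  have fk: "Poly_Mapping.keys (?f c) \<subseteq> vpairs g" if "Poly_Mapping.keys c \<subseteq> vpairs g" for c
    by (rule keys_lin_ext) (use that h in \<open>auto simp del: index_mult_mat_vec\<close>)
  have fm: "mev (2 * g) (wq g) (?f c) = hF s * (mev (2 * g) (wq g) c * transpose_mat (hF s))"
    if c: "Poly_Mapping.keys c \<subseteq> vpairs g" for c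
  proof (rule mev_lin_ext_conj[OF h wq_carrier])
    fix b assume "b \<in> Poly_Mapping.keys c"
    then show "wq g (?\<phi> b) = hF s * (wq g b * transpose_mat (hF s))"
      using c wd_conj[OF h] by (auto simp del: index_mult_mat_vec)
  qed
  have zero: "c \<in> enull g \<longleftrightarrow> mev (2 * g) (wq g) c = 0\<^sub>m (2 * g) (2 * g)" if c: "Poly_Mapping.keys c \<subseteq> vpairs g" for c
  proof -
    have "c \<in> enull g \<longleftrightarrow> enull g +>\<^bsub>pf g\<^esub> c = enull g +>\<^bsub>pf g\<^esub> 0"
      using Q.coset_eq_iff[of c 0] c free_module_minus[OF c, of 0] by simp
    then show ?thesis using ext_coset_eq[OF c, of 0] by (simp add: mev_simps)
  qed
  have img: "?f ` enull g \<subseteq> enull g"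
  proof (rule image_subsetI)
    fix c assume c: "c \<in> enull g"
    then have k: "Poly_Mapping.keys c \<subseteq> vpairs g" using subsetD[OF Q.W_sub c] by simp
    have "mev (2 * g) (wq g) (?f c) = 0\<^sub>m (2 * g) (2 * g)" unfolding fm[OF k] using zero[OF k] c h by simp
    then show "?f c \<in> enull g" using zero[OF fk[OF k]] by simp
  qed
  have aS: "hF s * (S * transpose_mat (hF s)) \<in> alt_mats (2 * g)"
    using gsubmodule_alt[of g, unfolded gsubmodule_iff[OF is_gmodule_symm] symm_module_simps] s S by blast
  have sgc: "alt_section g S \<in> carrier (pf g)" using alt_section_keys by simp
  have "act (ext_square (H1_surface ty g)) s (alt_to_ext g S) = enull g +>\<^bsub>pf g\<^esub> ?f (alt_section g S)"
    unfolding ext_square_simps alt_to_ext_def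
    by (rule Q.coset_map_coset[OF quotient_ext _ _ img sgc]) (use fk in \<open>auto simp: lin_ext_add\<close>)
  also have "\<dots> = alt_to_ext g (hF s * (S * transpose_mat (hF s)))"
    unfolding alt_to_ext_def ext_coset_eq[OF fk[OF alt_section_keys] alt_section_keys] fm[OF alt_section_keys] mev_alt_section[OF S] mev_alt_section[OF aS] ..
  finally show ?thesis .
qed

abbreviation (input) alt_module where
  "alt_module g \<equiv> (symm_module ty g)\<lparr>carrier := alt_mats (2 * g)\<rparr>"

theorem ext_iso: "gmodule_iso (Sp g) (alt_module g) (ext_square (H1_surface ty g)) (alt_to_ext g)"
proof (rule gmodule_iso.intro)
  let ?M = "alt_module g" and ?E = "ext_square (H1_surface ty g)"
  interpret Q: quotient_module "pf g" "enull g" by (rule quotient_ext)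
  have sgc: "alt_section g S \<in> carrier (pf g)" for S using alt_section_keys by simp
  have ac: "S \<in> carrier_mat (2 * g) (2 * g)" if "S \<in> alt_mats (2 * g)" for S :: "'f mat"
    by (rule symm_carrier[OF alt_symm[OF that]])
  show "monoid (Sp g :: bit mat monoid)" by (rule monoid_Sp)
  show M: "is_gmodule (Sp g) ?M" by (rule is_gmodule_restrict[OF is_gmodule_symm gsubmodule_alt])
  have inj: "S = T" if "S \<in> alt_mats (2 * g)" "T \<in> alt_mats (2 * g)" "alt_to_ext g S = alt_to_ext g T" for S T
    using that(3) unfolding alt_to_ext_def ext_coset_eq[OF alt_section_keys alt_section_keys] mev_alt_section[OF that(1)] mev_alt_section[OF that(2)] .
  have im: "alt_to_ext g ` carrier ?M = carrier ?E"
  proof (rule subset_antisym; rule subsetI)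
    fix X assume "X \<in> alt_to_ext g ` carrier ?M"
    then show "X \<in> carrier ?E" unfolding ext_square_simps Q.carrier_quot alt_to_ext_def using sgc by blast
  next
    fix X assume "X \<in> carrier ?E"
    then obtain c where c: "Poly_Mapping.keys c \<subseteq> vpairs g" "X = enull g +>\<^bsub>pf g\<^esub> c"
      unfolding ext_square_simps Q.carrier_quot by auto
    have "X = alt_to_ext g (mev (2 * g) (wq g) c)"
      unfolding c(2) alt_to_ext_def ext_coset_eq[OF c(1) alt_section_keys] mev_alt_section[OF mev_wq_alt[OF c(1)]] ..
    then show "X \<in> alt_to_ext g ` carrier ?M" using mev_wq_alt[OF c(1)] by simp
  qed
  have "inj_on (alt_to_ext g) (carrier ?M)" by (rule inj_onI) (use inj in simp)
  with im show "bij_betw (alt_to_ext g) (carrier ?M) (carrier ?E)" by (simp add: bij_betw_def)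
  show hom: "ghom_on (Sp g) ?M (carrier ?M) ?E (alt_to_ext g)"
    unfolding ghom_on_def
  proof (intro conjI ballI allI)
    fix S T assume S: "S \<in> carrier ?M" and T: "T \<in> carrier ?M"
    have "alt_to_ext g S \<oplus>\<^bsub>?E\<^esub> alt_to_ext g T = enull g +>\<^bsub>pf g\<^esub> (alt_section g S + alt_section g T)"
      unfolding ext_square_simps alt_to_ext_def using Q.add_quot[OF sgc sgc] by simp
    then show "alt_to_ext g (S \<oplus>\<^bsub>?M\<^esub> T) = alt_to_ext g S \<oplus>\<^bsub>?E\<^esub> alt_to_ext g T"
      using alt_section_add[OF ac[of S] ac[of T]] S T by (simp add: alt_to_ext_def)
  next
    fix r S assume S: "S \<in> carrier ?M"
    have "r \<odot>\<^bsub>?E\<^esub> alt_to_ext g S = enull g +>\<^bsub>pf g\<^esub> scale_pm r (alt_section g S)"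
      unfolding ext_square_simps alt_to_ext_def using Q.smult_quot[OF sgc] by simp
    then show "alt_to_ext g (r \<odot>\<^bsub>?M\<^esub> S) = r \<odot>\<^bsub>?E\<^esub> alt_to_ext g S"
      using alt_section_smult[OF ac[of S]] S by (simp add: alt_to_ext_def)
  next
    fix s :: "bit mat" and S :: "'f mat" assume "s \<in> carrier (Sp g)" "S \<in> carrier ?M"
    then show "alt_to_ext g (act ?M s S) = act ?E s (alt_to_ext g S)" using act_alt_to_ext by simp
  qed
  have "alt_to_ext g \<zero>\<^bsub>?M\<^esub> = \<zero>\<^bsub>?E\<^esub>" unfolding ext_square_simps Q.zero_quot by (simp add: alt_to_ext_def alt_section_zero)
  then show "is_gmodule (Sp g) ?E" by (rule is_gmodule_image[OF monoid_Sp M hom im])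
qed

text \<open>The functional that defines \<open>delta2\<close> factors through the matrix map, since
  it does so on each generator by \<open>half_trace_wd\<close>.\<close>

lemma ev_form:
  assumes "Poly_Mapping.keys c \<subseteq> vpairs g"
  shows "ev (case_prod (intersection_form g)) c = half_trace g (mev (2 * g) (wq g) c)"
proof -
  have "half_trace g (mev (2 * g) (wq g) c) = (\<Sum>j<g. ev (\<lambda>b. wq g b $$ (2 * j, 2 * j + 1)) c)"
    unfolding half_trace_def by (rule sum.cong) (auto simp: mev_def)
  also have "\<dots> = ev (\<lambda>b. half_trace g (wq g b)) c"
    unfolding half_trace_def by (simp add: ev_fsum)
  also have "\<dots> = ev (case_prod (intersection_form g)) c"
    by (rule ev_cong) (use assms half_trace_wd in auto)
  finally show ?thesis by simp
qed

text \<open>All elements of the coset have the same matrix S, so the functional is constant on it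
  and \<open>the_elem\<close> returns its value.\<close>

lemma delta2_alt_to_ext:
  assumes S: "S \<in> alt_mats (2 * g)"
  shows "delta2 g (alt_to_ext g S) = half_trace g S"
proof -
  interpret Q: quotient_module "pf g" "enull g" by (rule quotient_ext)
  have sgc: "alt_section g S \<in> carrier (pf g)" using alt_section_keys by simp
  have *: "ev (case_prod (intersection_form g)) c = half_trace g S" if c: "c \<in> alt_to_ext g S" for c
  proof -
    obtain w where w: "w \<in> enull g" "c = w \<oplus>\<^bsub>pf g\<^esub> alt_section g S"
      using c unfolding alt_to_ext_def by (rule Q.coset_memE)
    have c': "c = w + alt_section g S" using w(2) by simp
    have wk: "Poly_Mapping.keys w \<subseteq> vpairs g" using subsetD[OF Q.W_sub w(1)] by simp
    have ck: "Poly_Mapping.keys c \<subseteq> vpairs g" unfolding c' using keys_add[of w "alt_section g S"] wk alt_section_keys[of g S] by blast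
    have "mev (2 * g) (wq g) c = S"
      unfolding c' mev_simps enull_mev[OF w(1)] mev_alt_section[OF S] using symm_carrier[OF alt_symm[OF S]] by simp
    then show ?thesis unfolding ev_form[OF ck] by simp
  qed
  have "alt_section g S \<in> alt_to_ext g S" unfolding alt_to_ext_def by (rule Q.coset_self[OF sgc])
  then have "ev (case_prod (intersection_form g)) ` alt_to_ext g S = {half_trace g S}"
    by (auto simp: * intro!: rev_image_eqI[of "alt_section g S"])
  then have "the_elem (ev (case_prod (intersection_form g)) ` alt_to_ext g S) = half_trace g S" by (simp only: the_elem_eq)
  moreover have "(\<lambda>c. \<Sum>(v, w)\<in>Poly_Mapping.keys c. Poly_Mapping.lookup c (v, w) * intersection_form g v w) =
      (ev (case_prod (intersection_form g)) :: ('f vec \<times> 'f vec \<Rightarrow>\<^sub>0 'f) \<Rightarrow> 'f)"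
    by (simp add: ev_def case_prod_beta fun_eq_iff)
  ultimately show ?thesis unfolding delta2_def by (simp only:)
qed

lemma ker_iso: "gmodule_iso (Sp g) ((symm_module ty g)\<lparr>carrier := ker_ht g\<rparr>) (ker_delta2 ty g) (alt_to_ext g)"
proof -
  interpret E: gmodule_iso "Sp g" "alt_module g" "ext_square (H1_surface ty g)" "alt_to_ext g" by (rule ext_iso)
  have s: "gsubmodule (Sp g) (alt_module g) (ker_ht g)"
    unfolding gsubmodule_restrict[OF is_gmodule_symm gsubmodule_alt] using gsubmodule_ker_ht ker_ht_alt by blast
  have "alt_to_ext g ` alt_mats (2 * g) = carrier (ext_square (H1_surface ty g))"
    using E.bij by (simp add: bij_betw_def)
  note im = this[symmetric]
  have "{X \<in> carrier (ext_square (H1_surface ty g)). delta2 g X = 0} = alt_to_ext g ` ker_ht g"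
    unfolding im ker_ht_def by (auto simp: delta2_alt_to_ext)
  then show ?thesis using E.restrict[OF s] unfolding ker_delta2_def by simp
qed

lemma gepi_ker_delta2:
  "gepi (Sp g) (symm_module ty g) (ker_ht g) {0\<^sub>m (2 * g) (2 * g)} (ker_delta2 ty g) (alt_to_ext g)"
proof -
  have "gepi (Sp g) ((symm_module ty g)\<lparr>carrier := ker_ht g\<rparr>) (ker_ht g) {0\<^sub>m (2 * g) (2 * g)} (ker_delta2 ty g) (alt_to_ext g)"
    using gmodule_iso.gepi_theta[OF ker_iso[of g]] by simp
  then show ?thesis unfolding gepi_restrict[OF is_gmodule_symm gsubmodule_ker_ht] .
qed

lemma alt_to_ext_Jmat: "alt_to_ext g (Jmat g) = omega ty g"
proof -
  let ?E = "ext_square (H1_surface ty g)" and ?e = "unit_vec (2 * g) :: nat \<Rightarrow> 'f vec"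
  interpret Q: quotient_module "pf g" "enull g" by (rule quotient_ext)
  interpret E: gmodule_iso "Sp g" "alt_module g" ?E "alt_to_ext g" by (rule ext_iso)
  interpret E: Module.module class_ring ?E by (rule is_gmoduleD(1)[OF E.P])
  have gc: "gen (?e i, ?e j) \<in> carrier (pf g)" for i j by simp
  have sc: "(\<Sum>j<k. gen (?e (2 * j), ?e (2 * j + 1))) \<in> carrier (pf g)" for k
    using keys_sum_subset[of "{..<k}" "\<lambda>j. gen (?e (2 * j), ?e (2 * j + 1))" "vpairs g"] by simp
  have w: "wedge (H1_surface ty g) (?e i) (?e j) = enull g +>\<^bsub>pf g\<^esub> gen (?e i, ?e j)" for i j
    unfolding wedge_def H1_surface_simps ..
  have wc: "wedge (H1_surface ty g) (?e i) (?e j) \<in> carrier ?E" for i j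
    unfolding w ext_square_simps Q.carrier_quot using gc by blast
  have sum: "(\<Oplus>\<^bsub>?E\<^esub>j\<in>{..<k}. wedge (H1_surface ty g) (?e (2 * j)) (?e (2 * j + 1))) =
      enull g +>\<^bsub>pf g\<^esub> (\<Sum>j<k. gen (?e (2 * j), ?e (2 * j + 1)))" for k
  proof (induction k)
    case 0
    show ?case by (simp add: ext_square_simps Q.zero_quot)
  next
    case (Suc k)
    have "(\<Oplus>\<^bsub>?E\<^esub>j\<in>{..<Suc k}. wedge (H1_surface ty g) (?e (2 * j)) (?e (2 * j + 1))) =
        wedge (H1_surface ty g) (?e (2 * k)) (?e (2 * k + 1)) \<oplus>\<^bsub>?E\<^esub>
        (\<Oplus>\<^bsub>?E\<^esub>j\<in>{..<k}. wedge (H1_surface ty g) (?e (2 * j)) (?e (2 * j + 1)))"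
      unfolding lessThan_Suc by (rule E.finsum_insert) (use wc in auto)
    also have "\<dots> = enull g +>\<^bsub>pf g\<^esub> (gen (?e (2 * k), ?e (2 * k + 1)) + (\<Sum>j<k. gen (?e (2 * j), ?e (2 * j + 1))))"
      unfolding Suc.IH unfolding w ext_square_simps using Q.add_quot[OF gc sc] by simp
    finally show ?case by (simp add: add.commute)
  qed
  \<comment> \<open>Above the diagonal the nonzero entries of J are those at the pairs (2j, 2j + 1),
    so the section returns the sum that defines omega.\<close>
  have "alt_section g (Jmat g) = (\<Sum>(p, q)\<in>lt_pairs (2 * g). if q = conjx p then gen (?e p, ?e q) else 0)"
    unfolding alt_section_def by (rule sum.cong) (auto simp: lt_pairs_def Jmat_index)
  also have "\<dots> = (\<Sum>j<g. gen (?e (2 * j), ?e (2 * j + 1)))"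
    by (rule sum_even_odd_pairs)
  finally show ?thesis unfolding alt_to_ext_def omega_def sum by simp
qed

text \<open>As omega is the image of J, the image of the line through J is a submodule that contains
  omega and consists of its multiples.\<close>

lemma span_omega:
  "LinearCombinations.module.span class_ring (ext_square (H1_surface ty g)) {omega ty g} = alt_to_ext g ` J_line g"
proof -
  let ?E = "ext_square (H1_surface ty g)"
  interpret E: gmodule_iso "Sp g" "alt_module g" ?E "alt_to_ext g" by (rule ext_iso)
  have J: "J_line g \<subseteq> (alt_mats (2 * g) :: 'f mat set)"
    using Jmat_alt[of g] gsubmodule_alt[of g, unfolded gsubmodule_iff[OF is_gmodule_symm] symm_module_simps]
    unfolding J_line_def by blast
  have s: "gsubmodule (Sp g) (alt_module g) (J_line g)"
    unfolding gsubmodule_restrict[OF is_gmodule_symm gsubmodule_alt] using gsubmodule_J_line J by blast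
  have "1 \<cdot>\<^sub>m Jmat g = (Jmat g :: 'f mat)" by (intro eq_matI) auto
  then have Jm: "Jmat g \<in> (J_line g :: 'f mat set)" unfolding J_line_def by (metis rangeI)
  have om: "omega ty g \<in> carrier ?E" unfolding alt_to_ext_Jmat[symmetric] by (rule E.theta_mem) (simp add: Jmat_alt)
  note p = span_props[OF is_gmoduleD(1)[OF E.P], of "{omega ty g}"]
  show ?thesis
  proof (rule subset_antisym)
    have "Module.submodule (alt_to_ext g ` J_line g) class_ring ?E"
      using E.image_gsubmodule[OF s] by (simp add: gsubmodule_def)
    moreover have "{omega ty g} \<subseteq> alt_to_ext g ` J_line g" unfolding alt_to_ext_Jmat[symmetric] using Jm by blast
    ultimately show "LinearCombinations.module.span class_ring ?E {omega ty g} \<subseteq> alt_to_ext g ` J_line g"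
      using p(3) om by blast
    show "alt_to_ext g ` J_line g \<subseteq> LinearCombinations.module.span class_ring ?E {omega ty g}"
    proof (rule image_subsetI)
      fix S :: "'f mat" assume "S \<in> J_line g"
      then obtain r where S: "S = r \<cdot>\<^sub>m Jmat g" unfolding J_line_def by blast
      have "alt_to_ext g S = r \<odot>\<^bsub>?E\<^esub> omega ty g"
        using ghom_onD(2)[OF E.hom, of "Jmat g" r] Jmat_alt[of g] unfolding S alt_to_ext_Jmat by simp
      moreover have "r \<odot>\<^bsub>?E\<^esub> omega ty g \<in> LinearCombinations.module.span class_ring ?E {omega ty g}"
        using p(1,2) om unfolding submodule_iff[OF is_gmoduleD(1)[OF E.P]] by simp
      ultimately show "alt_to_ext g S \<in> LinearCombinations.module.span class_ring ?E {omega ty g}" by simp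
    qed
  qed
qed

text \<open>The quotient map is composed with the isomorphism of the kernels. For even g the line
  through J lies in the kernel, so it is the full preimage of the span of omega.\<close>

lemma gepi_ker_delta2_mod_omega:
  assumes "even g"
  shows "\<exists>f. gepi (Sp g) (symm_module ty g) (ker_ht g) (J_line g) (ker_delta2_mod_omega ty g) f"
proof -
  let ?K = "(symm_module ty g)\<lparr>carrier := ker_ht g\<rparr>"
  interpret K: gmodule_iso "Sp g" ?K "ker_delta2 ty g" "alt_to_ext g" by (rule ker_iso)
  have J: "J_line g \<subseteq> (ker_ht g :: 'f mat set)" by (rule J_line_ker[OF assms])
  have s: "gsubmodule (Sp g) ?K (J_line g)"
    unfolding gsubmodule_restrict[OF is_gmodule_symm gsubmodule_ker_ht] using gsubmodule_J_line J by blast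
  note L = K.image_gsubmodule[OF s]
  have c: "gsubmodule (Sp g) (ker_delta2 ty g) (carrier (ker_delta2 ty g))"
  proof -
    have "gsubmodule (Sp g) ?K (ker_ht g)"
      unfolding gsubmodule_restrict[OF is_gmodule_symm gsubmodule_ker_ht] using gsubmodule_ker_ht by blast
    from K.image_gsubmodule[OF this] show ?thesis using K.bij by (simp add: bij_betw_def)
  qed
  have "K.pre (carrier (ker_delta2 ty g)) = ker_ht g" unfolding K.pre_def using K.theta_mem by auto
  moreover have "K.pre (alt_to_ext g ` J_line g) = J_line g" by (rule K.pre_theta) (use J in simp)
  ultimately have "gepi (Sp g) ?K (ker_ht g) (J_line g) (ker_delta2_mod_omega ty g)
      (\<lambda>S. (alt_to_ext g ` J_line g) +>\<^bsub>ker_delta2 ty g\<^esub> alt_to_ext g S)"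
    using K.pre_gepi[OF gquot_epi[OF K.P L] c] unfolding ker_delta2_mod_omega_def span_omega by simp
  then show ?thesis unfolding gepi_restrict[OF is_gmodule_symm gsubmodule_ker_ht] by blast
qed

end

section \<open>Counting the composition factors\<close>

lemma giso_refl: "giso G M M"
  unfolding giso_def by (rule exI[of _ "\<lambda>x. x"]) (simp add: bij_betw_def)

lemma giso_trans:
  assumes "giso G M N" "giso G N P"
  shows "giso G M P"
proof -
  obtain f h where f: "bij_betw f (carrier M) (carrier N)" "ghom_on G M (carrier M) N f"
    and h: "bij_betw h (carrier N) (carrier P)" "ghom_on G N (carrier N) P h"
    using assms unfolding giso_iff_ghom by blast
  have fc: "f x \<in> carrier N" if "x \<in> carrier M" for x using f(1) that by (rule bij_betw_apply)
  have "ghom_on G M (carrier M) P (h \<circ> f)"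
    unfolding ghom_on_def using ghom_onD[OF f(2)] ghom_onD[OF h(2)] fc by simp
  with bij_betw_trans[OF f(1) h(1)] show ?thesis unfolding giso_iff_ghom by blast
qed

lemma card_Suc_less: "card {i. Suc i < n \<and> Q i} = (\<Sum>i<n - 1. of_bool (Q i))"
proof -
  have "{i. Suc i < n \<and> Q i} = {..<n - 1} \<inter> {i. Q i}" by auto
  then show ?thesis by simp
qed

lemma giso_series_factor_iff:
  assumes G: "monoid G" and W: "composition_series G M Ws" and i: "Suc i < length Ws"
  shows "giso G (series_factor M Ws i) N \<longleftrightarrow> (\<exists>f. gepi G M (Ws ! Suc i) (Ws ! i) N f)"
proof -
  note w = composition_seriesD[OF G W]
  have "i < length Ws" using i by simp
  then show ?thesis unfolding series_factor_def by (rule giso_factor_iff[OF w(1) w(4)[OF i] w(4) w(5)[OF i]])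
qed

lemma (in gmodule_iso) composition_factor_giso:
  assumes W: "composition_series G P Ws" and S: "composition_factor G M S"
  shows "\<exists>i. Suc i < length Ws \<and> giso G S (series_factor P Ws i)"
  using composition_factor_pre[OF W S] giso_refl by blast

context char2
begin

text \<open>Hides the map, so that a multiplicity becomes a sum of truth values over the positions
  in the series.\<close>

definition is_factor :: "nat \<Rightarrow> 'f mat set \<Rightarrow> 'f mat set \<Rightarrow> ('f, 'w, bit mat) gmodule \<Rightarrow> bool" where
  "is_factor g B A N \<longleftrightarrow> (\<exists>f. gepi (Sp g) (symm_module ty g) A B N f)"

text \<open>A trivial action on A / B would carry over through N to the quotient of symmetric by
  alternating matrices, where a transvection moves a vector.\<close>

lemma trivial_not_surface:
  assumes g: "g \<ge> 3" and A: "gsubmodule (Sp g) (symm_module ty g) A"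
    and f: "gepi (Sp g) (symm_module ty g) A B N f"
    and t: "\<And>s S. s \<in> carrier (Sp g) \<Longrightarrow> S \<in> A \<Longrightarrow> act (symm_module ty g) s S \<ominus>\<^bsub>symm_module ty g\<^esub> S \<in> B"
  shows "\<not> gepi (Sp g) (symm_module ty g) (symm_mats (2 * g)) (alt_mats (2 * g)) N f'"
  using trivial_factor_transfer[OF is_gmodule_symm A gsubmodule_symm f _ t] surface_nontrivial_action[OF g] by blast

lemma trivial_not_ker:
  assumes g: "g \<ge> 3" and A: "gsubmodule (Sp g) (symm_module ty g) A"
    and f: "gepi (Sp g) (symm_module ty g) A B N f"
    and t: "\<And>s S. s \<in> carrier (Sp g) \<Longrightarrow> S \<in> A \<Longrightarrow> act (symm_module ty g) s S \<ominus>\<^bsub>symm_module ty g\<^esub> S \<in> B"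
    and C: "C \<subseteq> J_line g"
  shows "\<not> gepi (Sp g) (symm_module ty g) (ker_ht g) C N f'"
  using trivial_factor_transfer[OF is_gmodule_symm A gsubmodule_ker_ht f _ t] ker_nontrivial_action[OF g C] by blast

text \<open>If both maps existed, \<open>t0\<close> minus the identity would have an image of
  dimension at most 1 on the middle factor, as it has on V.\<close>

lemma surface_not_ker:
  assumes g: "g \<ge> 3" and f: "gepi (Sp g) (symm_module ty g) (symm_mats (2 * g)) (alt_mats (2 * g)) N f"
    and C: "C \<subseteq> J_line g"
  shows "\<not> gepi (Sp g) (symm_module ty g) (ker_ht g) C N f'"
proof
  assume f': "gepi (Sp g) (symm_module ty g) (ker_ht g) C N f'"
  note d = dependent_factor_transfer[OF is_gmodule_symm gsubmodule_symm gsubmodule_ker_ht f f' t0(1)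
      surface_dependent[OF g]]
  show False using ker_independent[OF g C] d by blast
qed

lemma zero_J_line: "{0\<^sub>m (2 * g) (2 * g)} \<subseteq> (J_line g :: 'f mat set)"
  using zero_in_gsub[OF gsubmodule_J_line] by blast

lemma not_gepi_surface:
  assumes g: "g \<ge> 3"
  shows "\<not> gepi (Sp g) (symm_module ty g) (alt_mats (2 * g)) (ker_ht g) (H1_surface ty g) f"
    "\<not> gepi (Sp g) (symm_module ty g) (J_line g) {0\<^sub>m (2 * g) (2 * g)} (H1_surface ty g) f"
    "C \<subseteq> J_line g \<Longrightarrow> \<not> gepi (Sp g) (symm_module ty g) (ker_ht g) C (H1_surface ty g) f"
  using trivial_not_surface[OF g gsubmodule_alt _ alt_trivial_action[OF g]]
    trivial_not_surface[OF g gsubmodule_J_line _ J_trivial_action[OF g]]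
    surface_not_ker[OF g] gepi_surface by blast+

lemma not_gepi_trivial:
  assumes g: "g \<ge> 3"
  shows "\<not> gepi (Sp g) (symm_module ty g) (symm_mats (2 * g)) (alt_mats (2 * g)) (trivial_gmodule ty) f"
    "C \<subseteq> J_line g \<Longrightarrow> \<not> gepi (Sp g) (symm_module ty g) (ker_ht g) C (trivial_gmodule ty) f"
  using trivial_not_surface[OF g gsubmodule_alt gepi_alt_trivial[OF g] alt_trivial_action[OF g]]
    trivial_not_ker[OF g gsubmodule_alt gepi_alt_trivial[OF g] alt_trivial_action[OF g]] by blast+

text \<open>With N any module isomorphic to the middle factor, this covers both the kernel itself
  for odd g, where C is zero, and its quotient by the line through J for even g.\<close>

lemma not_gepi_ker:
  assumes g: "g \<ge> 3" and C: "C \<subseteq> J_line g" and h: "gepi (Sp g) (symm_module ty g) (ker_ht g) C N h"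
  shows "\<not> gepi (Sp g) (symm_module ty g) (symm_mats (2 * g)) (alt_mats (2 * g)) N f"
    "\<not> gepi (Sp g) (symm_module ty g) (alt_mats (2 * g)) (ker_ht g) N f"
    "\<not> gepi (Sp g) (symm_module ty g) (J_line g) {0\<^sub>m (2 * g) (2 * g)} N f"
  using surface_not_ker[OF g _ C] h
    trivial_not_ker[OF g gsubmodule_alt _ alt_trivial_action[OF g] C]
    trivial_not_ker[OF g gsubmodule_J_line _ J_trivial_action[OF g] C] by blast+

lemma series_odd:
  assumes g: "g \<ge> 3" "odd g"
  shows "composition_series (Sp g) (symm_module ty g)
    [{0\<^sub>m (2 * g) (2 * g)}, ker_ht g, alt_mats (2 * g), symm_mats (2 * g)]"
proof (rule composition_seriesI[OF monoid_Sp is_gmodule_symm])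
  show "gcover (Sp g) (symm_module ty g)
      ([{0\<^sub>m (2 * g) (2 * g)}, ker_ht g, alt_mats (2 * g), symm_mats (2 * g)] ! i)
      ([{0\<^sub>m (2 * g) (2 * g)}, ker_ht g, alt_mats (2 * g), symm_mats (2 * g)] ! Suc i)"
    if "Suc i < length [{0\<^sub>m (2 * g) (2 * g)}, ker_ht g, alt_mats (2 * g), symm_mats (2 * g) :: 'f mat set]" for i
  proof -
    have "i = 0 \<or> i = 1 \<or> i = 2" using that by auto
    then show ?thesis
      using gcover_zero_ker[OF g] gcover_ker_alt[OF g(1)] gcover_alt_symm[OF g(1)] by (elim disjE) simp_all
  qed
qed (use gsubmodule_zero gsubmodule_ker_ht gsubmodule_alt gsubmodule_symm in auto)

lemma series_even:
  assumes g: "g \<ge> 3" "even g"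
  shows "composition_series (Sp g) (symm_module ty g)
    [{0\<^sub>m (2 * g) (2 * g)}, J_line g, ker_ht g, alt_mats (2 * g), symm_mats (2 * g)]"
proof (rule composition_seriesI[OF monoid_Sp is_gmodule_symm])
  show "gcover (Sp g) (symm_module ty g)
      ([{0\<^sub>m (2 * g) (2 * g)}, J_line g, ker_ht g, alt_mats (2 * g), symm_mats (2 * g)] ! i)
      ([{0\<^sub>m (2 * g) (2 * g)}, J_line g, ker_ht g, alt_mats (2 * g), symm_mats (2 * g)] ! Suc i)"
    if "Suc i < length [{0\<^sub>m (2 * g) (2 * g)}, J_line g, ker_ht g, alt_mats (2 * g), symm_mats (2 * g) :: 'f mat set]" for i
  proof -
    have "i = 0 \<or> i = 1 \<or> i = 2 \<or> i = 3" using that by auto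
    then show ?thesis
      using gcover_zero_J[OF g(1)] gcover_J_ker[OF g] gcover_ker_alt[OF g(1)] gcover_alt_symm[OF g(1)]
      by (elim disjE) (simp_all add: numeral_3_eq_3 numeral_2_eq_2)
  qed
qed (use gsubmodule_zero gsubmodule_J_line gsubmodule_ker_ht gsubmodule_alt gsubmodule_symm in auto)

lemma H1_iso_symm: "\<exists>\<theta>. gmodule_iso (Sp g) (H1_Sp_level2 ty g) (symm_module ty g) \<theta>"
  using gmodule_iso_sym[OF H1_iso] by blast

lemma giso_series_factor_iff_is_factor:
  assumes "composition_series (Sp g) (symm_module ty g) Ws" "Suc i < length Ws"
  shows "giso (Sp g) (series_factor (symm_module ty g) Ws i) N \<longleftrightarrow> is_factor g (Ws ! i) (Ws ! Suc i) N"
  unfolding is_factor_def by (rule giso_series_factor_iff[OF monoid_Sp assms])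

text \<open>The count is made on an explicit series of symmetric matrices and moved to H_1 along the
  isomorphism.\<close>

lemma H1_has_multiplicity:
  assumes W: "composition_series (Sp g) (symm_module ty g) Ws"
    and m: "(\<Sum>i<length Ws - 1. of_bool (is_factor g (Ws ! i) (Ws ! Suc i) N)) = m"
  shows "has_multiplicity (Sp g) (H1_Sp_level2 ty g) N m"
proof -
  obtain \<theta> where "gmodule_iso (Sp g) (H1_Sp_level2 ty g) (symm_module ty g) \<theta>" using H1_iso_symm by blast
  then interpret I: gmodule_iso "Sp g" "H1_Sp_level2 ty g" "symm_module ty g" \<theta> .
  have "{i. Suc i < length Ws \<and> giso (Sp g) (series_factor (symm_module ty g) Ws i) N} =
      {i. Suc i < length Ws \<and> is_factor g (Ws ! i) (Ws ! Suc i) N}"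
    using giso_series_factor_iff_is_factor[OF W] by blast
  then have "card {i. Suc i < length Ws \<and> giso (Sp g) (series_factor (symm_module ty g) Ws i) N} = m"
    unfolding m[symmetric] card_Suc_less[symmetric] by (simp only:)
  then show ?thesis by (rule I.has_multiplicity_pre[OF W])
qed

lemma H1_composition_factor:
  assumes W: "composition_series (Sp g) (symm_module ty g) Ws"
    and S: "composition_factor (Sp g) (H1_Sp_level2 ty g) S"
  shows "\<exists>i. Suc i < length Ws \<and> giso (Sp g) S (series_factor (symm_module ty g) Ws i)"
proof -
  obtain \<theta> where "gmodule_iso (Sp g) (H1_Sp_level2 ty g) (symm_module ty g) \<theta>" using H1_iso_symm by blast
  then interpret I: gmodule_iso "Sp g" "H1_Sp_level2 ty g" "symm_module ty g" \<theta> .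
  show ?thesis by (rule I.composition_factor_giso[OF W S])
qed

lemma giso_of_is_factor:
  assumes W: "composition_series (Sp g) (symm_module ty g) Ws" and "Suc i < length Ws"
    and "giso (Sp g) S (series_factor (symm_module ty g) Ws i)" "is_factor g (Ws ! i) (Ws ! Suc i) N"
  shows "giso (Sp g) S N"
  using giso_trans assms(3) giso_series_factor_iff_is_factor[OF assms(1,2)] assms(4) by blast

lemma is_factor_surface:
  assumes g: "g \<ge> 3"
  shows "is_factor g (alt_mats (2 * g)) (symm_mats (2 * g)) (H1_surface ty g)"
    "\<not> is_factor g (ker_ht g) (alt_mats (2 * g)) (H1_surface ty g)"
    "\<not> is_factor g {0\<^sub>m (2 * g) (2 * g)} (J_line g) (H1_surface ty g)"
    "\<not> is_factor g {0\<^sub>m (2 * g) (2 * g)} (ker_ht g) (H1_surface ty g)"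
    "\<not> is_factor g (J_line g) (ker_ht g) (H1_surface ty g)"
  unfolding is_factor_def using gepi_surface not_gepi_surface[OF g] zero_J_line by blast+

lemma is_factor_trivial:
  assumes g: "g \<ge> 3"
  shows "\<not> is_factor g (alt_mats (2 * g)) (symm_mats (2 * g)) (trivial_gmodule ty)"
    "is_factor g (ker_ht g) (alt_mats (2 * g)) (trivial_gmodule ty)"
    "is_factor g {0\<^sub>m (2 * g) (2 * g)} (J_line g) (trivial_gmodule ty)"
    "\<not> is_factor g {0\<^sub>m (2 * g) (2 * g)} (ker_ht g) (trivial_gmodule ty)"
    "\<not> is_factor g (J_line g) (ker_ht g) (trivial_gmodule ty)"
  unfolding is_factor_def using gepi_alt_trivial[OF g] gepi_J_trivial[OF g] not_gepi_trivial[OF g] zero_J_line by blast+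

lemma is_factor_ker:
  assumes g: "g \<ge> 3" and C: "C \<subseteq> J_line g" and h: "is_factor g C (ker_ht g) N"
  shows "\<not> is_factor g (alt_mats (2 * g)) (symm_mats (2 * g)) N"
    "\<not> is_factor g (ker_ht g) (alt_mats (2 * g)) N"
    "\<not> is_factor g {0\<^sub>m (2 * g) (2 * g)} (J_line g) N"
proof -
  obtain h where "gepi (Sp g) (symm_module ty g) (ker_ht g) C N h" using h unfolding is_factor_def by blast
  from not_gepi_ker[OF g C this] show "\<not> is_factor g (alt_mats (2 * g)) (symm_mats (2 * g)) N"
    "\<not> is_factor g (ker_ht g) (alt_mats (2 * g)) N" "\<not> is_factor g {0\<^sub>m (2 * g) (2 * g)} (J_line g) N"
    unfolding is_factor_def by simp_all
qed

lemma fac_ker_delta2: "is_factor g {0\<^sub>m (2 * g) (2 * g)} (ker_ht g) (ker_delta2 ty g)"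
  unfolding is_factor_def by (rule exI) (rule gepi_ker_delta2)

lemma fac_ker_delta2_mod_omega: "even g \<Longrightarrow> is_factor g (J_line g) (ker_ht g) (ker_delta2_mod_omega ty g)"
  unfolding is_factor_def by (rule gepi_ker_delta2_mod_omega)

lemma composition_factors_odd:
  assumes g: "g \<ge> 3" "odd g"
  shows "has_multiplicity (Sp g) (H1_Sp_level2 ty g) (H1_surface ty g) 1"
    "has_multiplicity (Sp g) (H1_Sp_level2 ty g) (trivial_gmodule ty) 1"
    "has_multiplicity (Sp g) (H1_Sp_level2 ty g) (ker_delta2 ty g) 1"
    "composition_factor (Sp g) (H1_Sp_level2 ty g) S \<Longrightarrow> giso (Sp g) S (H1_surface ty g) \<or>
      giso (Sp g) S (trivial_gmodule ty) \<or> giso (Sp g) S (ker_delta2 ty g)"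
proof -
  note W = series_odd[OF g]
  note k = is_factor_ker[OF g(1) zero_J_line fac_ker_delta2]
  show "has_multiplicity (Sp g) (H1_Sp_level2 ty g) (H1_surface ty g) 1"
    by (rule H1_has_multiplicity[OF W]) (simp add: lessThan_Suc is_factor_surface[OF g(1)] del: sum_of_bool_eq)
  show "has_multiplicity (Sp g) (H1_Sp_level2 ty g) (trivial_gmodule ty) 1"
    by (rule H1_has_multiplicity[OF W]) (simp add: lessThan_Suc is_factor_trivial[OF g(1)] del: sum_of_bool_eq)
  show "has_multiplicity (Sp g) (H1_Sp_level2 ty g) (ker_delta2 ty g) 1"
    by (rule H1_has_multiplicity[OF W]) (simp add: lessThan_Suc k fac_ker_delta2 del: sum_of_bool_eq)
  assume "composition_factor (Sp g) (H1_Sp_level2 ty g) S"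
  from H1_composition_factor[OF W this] obtain i where
    i: "Suc i < length [{0\<^sub>m (2 * g) (2 * g)}, ker_ht g, alt_mats (2 * g), symm_mats (2 * g) :: 'f mat set]"
    and S: "giso (Sp g) S (series_factor (symm_module ty g)
      [{0\<^sub>m (2 * g) (2 * g)}, ker_ht g, alt_mats (2 * g), symm_mats (2 * g)] i)" by blast
  have "i = 0 \<or> i = Suc 0 \<or> i = Suc (Suc 0)" using i by auto
  then show "giso (Sp g) S (H1_surface ty g) \<or> giso (Sp g) S (trivial_gmodule ty) \<or> giso (Sp g) S (ker_delta2 ty g)"
    using giso_of_is_factor[OF W i S, of "H1_surface ty g"] giso_of_is_factor[OF W i S, of "trivial_gmodule ty"]
      giso_of_is_factor[OF W i S, of "ker_delta2 ty g"]
    by (elim disjE) (simp_all add: is_factor_surface[OF g(1)] is_factor_trivial[OF g(1)] fac_ker_delta2)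
qed

lemma composition_factors_even:
  assumes g: "g \<ge> 3" "even g"
  shows "has_multiplicity (Sp g) (H1_Sp_level2 ty g) (H1_surface ty g) 1"
    "has_multiplicity (Sp g) (H1_Sp_level2 ty g) (trivial_gmodule ty) 2"
    "has_multiplicity (Sp g) (H1_Sp_level2 ty g) (ker_delta2_mod_omega ty g) 1"
    "composition_factor (Sp g) (H1_Sp_level2 ty g) S \<Longrightarrow> giso (Sp g) S (H1_surface ty g) \<or>
      giso (Sp g) S (trivial_gmodule ty) \<or> giso (Sp g) S (ker_delta2_mod_omega ty g)"
proof -
  note W = series_even[OF g]
  note e = fac_ker_delta2_mod_omega[OF g(2)]
  note k = is_factor_ker[OF g(1) subset_refl e]
  show "has_multiplicity (Sp g) (H1_Sp_level2 ty g) (H1_surface ty g) 1"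
    by (rule H1_has_multiplicity[OF W]) (simp add: lessThan_Suc is_factor_surface[OF g(1)] del: sum_of_bool_eq)
  show "has_multiplicity (Sp g) (H1_Sp_level2 ty g) (trivial_gmodule ty) 2"
    by (rule H1_has_multiplicity[OF W]) (simp add: lessThan_Suc is_factor_trivial[OF g(1)] del: sum_of_bool_eq)
  show "has_multiplicity (Sp g) (H1_Sp_level2 ty g) (ker_delta2_mod_omega ty g) 1"
    by (rule H1_has_multiplicity[OF W]) (simp add: lessThan_Suc k e del: sum_of_bool_eq)
  assume "composition_factor (Sp g) (H1_Sp_level2 ty g) S"
  from H1_composition_factor[OF W this] obtain i where
    i: "Suc i < length [{0\<^sub>m (2 * g) (2 * g)}, J_line g, ker_ht g, alt_mats (2 * g), symm_mats (2 * g) :: 'f mat set]"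
    and S: "giso (Sp g) S (series_factor (symm_module ty g)
      [{0\<^sub>m (2 * g) (2 * g)}, J_line g, ker_ht g, alt_mats (2 * g), symm_mats (2 * g)] i)" by blast
  have "i = 0 \<or> i = Suc 0 \<or> i = Suc (Suc 0) \<or> i = Suc (Suc (Suc 0))" using i by auto
  then show "giso (Sp g) S (H1_surface ty g) \<or> giso (Sp g) S (trivial_gmodule ty) \<or>
      giso (Sp g) S (ker_delta2_mod_omega ty g)"
    using giso_of_is_factor[OF W i S, of "H1_surface ty g"] giso_of_is_factor[OF W i S, of "trivial_gmodule ty"]
      giso_of_is_factor[OF W i S, of "ker_delta2_mod_omega ty g"]
    by (elim disjE) (simp_all add: is_factor_surface[OF g(1)] is_factor_trivial[OF g(1)] e)
qed

end

theorem corollary8p3: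
  fixes g :: nat
  assumes "CHAR('f::field) = 2" and "g \<ge> 3"
  shows "(odd g \<longrightarrow>
           has_multiplicity (Sp g) (H1_Sp_level2 TYPE('f) g) (H1_surface TYPE('f) g) 1 \<and>
           has_multiplicity (Sp g) (H1_Sp_level2 TYPE('f) g) (trivial_gmodule TYPE('f)) 1 \<and>
           has_multiplicity (Sp g) (H1_Sp_level2 TYPE('f) g) (ker_delta2 TYPE('f) g) 1 \<and>
           (\<forall>S. composition_factor (Sp g) (H1_Sp_level2 TYPE('f) g) S \<longrightarrow>
              giso (Sp g) S (H1_surface TYPE('f) g) \<or>
              giso (Sp g) S (trivial_gmodule TYPE('f)) \<or>
              giso (Sp g) S (ker_delta2 TYPE('f) g))) \<and>
         (even g \<longrightarrow>
           has_multiplicity (Sp g) (H1_Sp_level2 TYPE('f) g) (H1_surface TYPE('f) g) 1 \<and>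
           has_multiplicity (Sp g) (H1_Sp_level2 TYPE('f) g) (trivial_gmodule TYPE('f)) 2 \<and>
           has_multiplicity (Sp g) (H1_Sp_level2 TYPE('f) g) (ker_delta2_mod_omega TYPE('f) g) 1 \<and>
           (\<forall>S. composition_factor (Sp g) (H1_Sp_level2 TYPE('f) g) S \<longrightarrow>
              giso (Sp g) S (H1_surface TYPE('f) g) \<or>
              giso (Sp g) S (trivial_gmodule TYPE('f)) \<or>
              giso (Sp g) S (ker_delta2_mod_omega TYPE('f) g)))"
proof -
  interpret char2 "TYPE('f)" by (rule char2.intro) (rule assms(1))
  show ?thesis
    using composition_factors_odd[OF assms(2)] composition_factors_even[OF assms(2)] by simp
qed

end
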